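(* Let $\Bbbk$ be a field, and let $A$ and $B$ be two commutative Noetherian local $\Bbbk$-algebras such that $A\otimes_\Bbbk B$ is Noetherian. Let $I$ be an ideal of $A$ and $J$ an ideal of $B$, and let $L$ and $N$ be nonzero finitely generated modules over $A$ and $B$, respectively. Then $$\operatorname{f}_{I\otimes_\Bbbk B+A\otimes_\Bbbk J}(L\otimes_\Bbbk N)=\min\{\operatorname{grade}(I,L)+\operatorname{f}_J(N),\ \operatorname{f}_I(L)+\operatorname{grade}(J,N)\}.$$
   Context: $I\otimes_\Bbbk B$ and $A\otimes_\Bbbk J$ are regarded as ideals of $A\otimes_\Bbbk B$, and $L\otimes_\Bbbk N$ as an $A\otimes_\Bbbk B$-module. For a Noetherian ring $R$, an ideal $\mathfrak a$ and a finitely generated $R$-module $M$, $H^i_{\mathfrak a}(M)$ denotes local cohomology; $\operatorname{grade}(\mathfrak a,M)=\inf\{i: H^i_{\mathfrak a}(M)\neq 0\}$; and the finiteness dimension is $\operatorname{f}_{\mathfrak a}(M)=\inf\{i\geq 0: H^i_{\mathfrak a}(M)\text{ is not finitely generated over } R\}$. Convention: $\inf\emptyset=+\infty$ (so both invariants take values in the extended non-negative integers). *)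

theory Defs
  imports "HOL-Algebra.Algebra" "HOL-Library.Extended_Nat"
begin

section \<open>Modules\<close>

text \<open>
  The \<^type>\<open>module\<close> record extends the \<^type>\<open>ring\<close> record, so a \<open>K\<close>-algebra (locale \<^locale>\<open>algebra\<close>) is
  also a ring, and it can itself serve as the ring of scalars of a further module.  For records
  that are merely modules the fields \<open>mult\<close> and \<open>one\<close> carry no information.
\<close>

definition local_ring :: "('a, 'x) ring_scheme \<Rightarrow> bool" where
  "local_ring R \<longleftrightarrow> cring R \<and> (\<exists>!\<mm>. maximalideal \<mm> R)"

definition module_hom ::
    "('a, 'x) ring_scheme \<Rightarrow> ('a, 'm, 'y) module_scheme \<Rightarrow> ('a, 'n, 'z) module_scheme \<Rightarrow> ('m \<Rightarrow> 'n) set"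
  where
  "module_hom R M N =
     {h. h \<in> carrier M \<rightarrow> carrier N \<and>
         (\<forall>x\<in>carrier M. \<forall>y\<in>carrier M. h (x \<oplus>\<^bsub>M\<^esub> y) = h x \<oplus>\<^bsub>N\<^esub> h y) \<and>
         (\<forall>r\<in>carrier R. \<forall>x\<in>carrier M. h (r \<odot>\<^bsub>M\<^esub> x) = r \<odot>\<^bsub>N\<^esub> h x)}"

definition submodule_gen ::
    "('a, 'x) ring_scheme \<Rightarrow> ('a, 'm, 'y) module_scheme \<Rightarrow> 'm set \<Rightarrow> 'm set" where
  "submodule_gen R M S = \<Inter> {H. submodule H R M \<and> S \<subseteq> H}"

definition fg_module :: "('a, 'x) ring_scheme \<Rightarrow> ('a, 'm, 'y) module_scheme \<Rightarrow> bool" where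
  "fg_module R M \<longleftrightarrow> (\<exists>S. finite S \<and> S \<subseteq> carrier M \<and> submodule_gen R M S = carrier M)"

definition nonzero_module :: "('a, 'm, 'y) module_scheme \<Rightarrow> bool" where
  "nonzero_module M \<longleftrightarrow> carrier M \<noteq> {\<zero>\<^bsub>M\<^esub>}"

text \<open>
  The ring part agrees with \<^const>\<open>FactRing\<close>; it is meaningful when \<open>M\<close> is an algebra and \<open>H\<close> an ideal.
  The union in the scalar multiplication is over representatives, all of which give the same
  coset when \<open>H\<close> is a submodule (the same device as in \<^const>\<open>rcoset_mult\<close>).
\<close>

definition quotient_module ::
    "('a, 'm, 'y) module_scheme \<Rightarrow> 'm set \<Rightarrow> ('a, 'm set) module" where
  "quotient_module M H =
     \<lparr>carrier = A_RCOSETS M H,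
      monoid.mult = rcoset_mult M H,
      one = H +>\<^bsub>M\<^esub> \<one>\<^bsub>M\<^esub>,
      ring.zero = H,
      add = set_add M,
      smult = (\<lambda>r C. \<Union>x\<in>C. H +>\<^bsub>M\<^esub> (r \<odot>\<^bsub>M\<^esub> x))\<rparr>"

definition restrict_scalars ::
    "('k, 'a, 'x) module_scheme \<Rightarrow> ('a, 'l, 'y) module_scheme \<Rightarrow> ('k, 'l) module" where
  "restrict_scalars A L =
     \<lparr>carrier = carrier L, monoid.mult = monoid.mult L, one = one L, ring.zero = ring.zero L, add = add L,
      smult = (\<lambda>c x. (c \<odot>\<^bsub>A\<^esub> \<one>\<^bsub>A\<^esub>) \<odot>\<^bsub>L\<^esub> x)\<rparr>"


section \<open>Tensor products\<close>

definition delta :: "('k, 'x) ring_scheme \<Rightarrow> 's \<Rightarrow> 's \<Rightarrow> 'k" where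
  "delta K s = (\<lambda>t. if t = s then \<one>\<^bsub>K\<^esub> else \<zero>\<^bsub>K\<^esub>)"

text \<open>
  The bilinear extension of a map \<open>\<phi>\<close> on basis elements:
  \<open>(\<Sum>\<^sub>p f\<^sub>p p, \<Sum>\<^sub>q g\<^sub>q q) \<mapsto> \<Sum>\<^sub>p\<^sub>,\<^sub>q f\<^sub>p g\<^sub>q \<phi>(p,q)\<close>.
\<close>

definition bilinear_ext ::
    "('k, 'x) ring_scheme \<Rightarrow> ('p \<Rightarrow> 'q \<Rightarrow> 's) \<Rightarrow> ('p \<Rightarrow> 'k) \<Rightarrow> ('q \<Rightarrow> 'k) \<Rightarrow> 's \<Rightarrow> 'k" where
  "bilinear_ext K \<phi> f g =
     (\<lambda>s. \<Oplus>\<^bsub>K\<^esub>z\<in>{(p, q). f p \<noteq> \<zero>\<^bsub>K\<^esub> \<and> g q \<noteq> \<zero>\<^bsub>K\<^esub> \<and> \<phi> p q = s}. f (fst z) \<otimes>\<^bsub>K\<^esub> g (snd z))"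

text \<open>
  The free \<open>K\<close>-module on the set \<open>carrier M \<times> carrier N\<close>, as finitely supported functions.  If \<open>M\<close>
  and \<open>N\<close> are \<open>K\<close>-algebras it is the monoid algebra of the multiplicative monoid \<open>M \<times> N\<close>.
\<close>

definition free_on_pairs ::
    "('k, 'x) ring_scheme \<Rightarrow> ('k, 'm, 'y) module_scheme \<Rightarrow> ('k, 'n, 'z) module_scheme
      \<Rightarrow> ('k, 'm \<times> 'n \<Rightarrow> 'k) module" where
  "free_on_pairs K M N =
     \<lparr>carrier = {f. range f \<subseteq> carrier K \<and> finite {s. f s \<noteq> \<zero>\<^bsub>K\<^esub>} \<and>
                    {s. f s \<noteq> \<zero>\<^bsub>K\<^esub>} \<subseteq> carrier M \<times> carrier N},
      monoid.mult = bilinear_ext K (\<lambda>p q. (fst p \<otimes>\<^bsub>M\<^esub> fst q, snd p \<otimes>\<^bsub>N\<^esub> snd q)),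
      one = delta K (\<one>\<^bsub>M\<^esub>, \<one>\<^bsub>N\<^esub>),
      ring.zero = (\<lambda>_. \<zero>\<^bsub>K\<^esub>),
      add = (\<lambda>f g s. f s \<oplus>\<^bsub>K\<^esub> g s),
      smult = (\<lambda>c f s. c \<otimes>\<^bsub>K\<^esub> f s)\<rparr>"

definition tensor_relations ::
    "('k, 'x) ring_scheme \<Rightarrow> ('k, 'm, 'y) module_scheme \<Rightarrow> ('k, 'n, 'z) module_scheme
      \<Rightarrow> ('m \<times> 'n \<Rightarrow> 'k) set" where
  "tensor_relations K M N =
     (let F = free_on_pairs K M N; \<delta> = (\<lambda>m n. delta K (m, n)) in
      submodule_gen K F
       ({\<delta> (m \<oplus>\<^bsub>M\<^esub> m') n \<ominus>\<^bsub>F\<^esub> (\<delta> m n \<oplus>\<^bsub>F\<^esub> \<delta> m' n) | m m' n.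
           m \<in> carrier M \<and> m' \<in> carrier M \<and> n \<in> carrier N} \<union>
        {\<delta> m (n \<oplus>\<^bsub>N\<^esub> n') \<ominus>\<^bsub>F\<^esub> (\<delta> m n \<oplus>\<^bsub>F\<^esub> \<delta> m n') | m n n'.
           m \<in> carrier M \<and> n \<in> carrier N \<and> n' \<in> carrier N} \<union>
        {\<delta> (c \<odot>\<^bsub>M\<^esub> m) n \<ominus>\<^bsub>F\<^esub> (c \<odot>\<^bsub>F\<^esub> \<delta> m n) | c m n.
           c \<in> carrier K \<and> m \<in> carrier M \<and> n \<in> carrier N} \<union>
        {\<delta> m (c \<odot>\<^bsub>N\<^esub> n) \<ominus>\<^bsub>F\<^esub> (c \<odot>\<^bsub>F\<^esub> \<delta> m n) | c m n.
           c \<in> carrier K \<and> m \<in> carrier M \<and> n \<in> carrier N}))"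

text \<open>
  For \<open>K\<close>-algebras \<open>M\<close> and \<open>N\<close> this is the algebra with \<open>(m \<otimes> n)(m' \<otimes> n') = mm' \<otimes> nn'\<close>.
\<close>

definition tensor_product ::
    "('k, 'x) ring_scheme \<Rightarrow> ('k, 'm, 'y) module_scheme \<Rightarrow> ('k, 'n, 'z) module_scheme
      \<Rightarrow> ('k, ('m \<times> 'n \<Rightarrow> 'k) set) module" where
  "tensor_product K M N = quotient_module (free_on_pairs K M N) (tensor_relations K M N)"

definition pure_tensor ::
    "('k, 'x) ring_scheme \<Rightarrow> ('k, 'm, 'y) module_scheme \<Rightarrow> ('k, 'n, 'z) module_scheme
      \<Rightarrow> 'm \<Rightarrow> 'n \<Rightarrow> ('m \<times> 'n \<Rightarrow> 'k) set" where
  "pure_tensor K M N m n = tensor_relations K M N +>\<^bsub>free_on_pairs K M N\<^esub> delta K (m, n)"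

text \<open>
  For submodules \<open>S\<close> of \<open>M\<close> and \<open>T\<close> of \<open>N\<close>: the image of \<open>S \<otimes> T\<close> in \<open>M \<otimes> N\<close>.
\<close>

definition tensor_image ::
    "('k, 'x) ring_scheme \<Rightarrow> ('k, 'm, 'y) module_scheme \<Rightarrow> ('k, 'n, 'z) module_scheme
      \<Rightarrow> 'm set \<Rightarrow> 'n set \<Rightarrow> ('m \<times> 'n \<Rightarrow> 'k) set set" where
  "tensor_image K M N S T =
     submodule_gen K (tensor_product K M N) {pure_tensor K M N s t | s t. s \<in> S \<and> t \<in> T}"

text \<open>
  For \<open>K\<close>-algebras \<open>A\<close>, \<open>B\<close>, an \<open>A\<close>-module \<open>L\<close> and a \<open>B\<close>-module \<open>N\<close>: the module \<open>L \<otimes> N\<close> over \<open>A \<otimes> B\<close>,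
  with \<open>(a \<otimes> b)(l \<otimes> n) = al \<otimes> bn\<close>.
\<close>

definition tensor_module ::
    "('k, 'x) ring_scheme \<Rightarrow> ('k, 'a, 'y) module_scheme \<Rightarrow> ('k, 'b, 'z) module_scheme
      \<Rightarrow> ('a, 'l, 'u) module_scheme \<Rightarrow> ('b, 'n, 'v) module_scheme
      \<Rightarrow> (('a \<times> 'b \<Rightarrow> 'k) set, ('l \<times> 'n \<Rightarrow> 'k) set) module" where
  "tensor_module K A B L N =
     (let L' = restrict_scalars A L; N' = restrict_scalars B N; T = tensor_product K L' N' in
      \<lparr>carrier = carrier T, monoid.mult = monoid.mult T, one = one T, ring.zero = ring.zero T, add = add T,
       smult = (\<lambda>C D. \<Union>f\<in>C. \<Union>g\<in>D. tensor_relations K L' N' +>\<^bsub>free_on_pairs K L' N'\<^esub>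
         bilinear_ext K (\<lambda>p q. (fst p \<odot>\<^bsub>L\<^esub> fst q, snd p \<odot>\<^bsub>N\<^esub> snd q)) f g)\<rparr>)"


section \<open>Injective resolutions\<close>

text \<open>
  \<open>Q\<close> is injective if homomorphisms into \<open>Q\<close> extend from submodules.  HOL cannot quantify over the
  types of the test modules \<open>Y\<close> here, but their type \<open>'a + 'q\<close> has room for a copy of every ideal
  of \<open>R\<close> and of \<open>R\<close> itself, so by Baer's criterion no larger test modules are needed.
\<close>

definition injective_module :: "('a, 'x) ring_scheme \<Rightarrow> ('a, 'q) module \<Rightarrow> bool" where
  "injective_module R Q \<longleftrightarrow> module R Q \<and>
     (\<forall>(Y :: ('a, 'a + 'q) module) S h.
        module R Y \<and> submodule S R Y \<and> h \<in> module_hom R (Y\<lparr>carrier := S\<rparr>) Q \<longrightarrow>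
        (\<exists>g\<in>module_hom R Y Q. \<forall>x\<in>S. g x = h x))"

text \<open>\<open>0 \<rightarrow> M \<rightarrow> E 0 \<rightarrow> E 1 \<rightarrow> \<dots>\<close> is exact, with maps \<open>\<epsilon>\<close>, \<open>d 0\<close>, \<open>d 1\<close>, \dots\<close>

definition injective_resolution ::
    "('a, 'x) ring_scheme \<Rightarrow> ('a, 'm, 'y) module_scheme
      \<Rightarrow> ('m \<Rightarrow> 'e) \<Rightarrow> (nat \<Rightarrow> ('a, 'e) module) \<Rightarrow> (nat \<Rightarrow> 'e \<Rightarrow> 'e) \<Rightarrow> bool" where
  "injective_resolution R M \<epsilon> E d \<longleftrightarrow>
     (\<forall>i. injective_module R (E i)) \<and>
     \<epsilon> \<in> module_hom R M (E 0) \<and> inj_on \<epsilon> (carrier M) \<and>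
     (\<forall>i. d i \<in> module_hom R (E i) (E (Suc i))) \<and>
     \<epsilon> ` carrier M = {x \<in> carrier (E 0). d 0 x = \<zero>\<^bsub>E 1\<^esub>} \<and>
     (\<forall>i. d i ` carrier (E i) = {x \<in> carrier (E (Suc i)). d (Suc i) x = \<zero>\<^bsub>E (Suc (Suc i))\<^esub>})"

text \<open>
  A type in which every module \<open>M\<close> (with carrier in \<open>'m\<close>) over a commutative ring \<open>R\<close> (with carrier
  in \<open>'a\<close>) has an injective resolution.  Let \<open>\<lambda>\<close> be its cardinality, that is \<open>2\<close> to the power
  \<open>\<bar>'a\<bar> + \<bar>'m\<bar> + \<aleph>\<^sub>0\<close>.  A module \<open>X\<close> with \<open>\<bar>X\<bar> \<le> \<lambda>\<close> lies in a divisible abelian group \<open>D\<close> with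
  \<open>\<bar>D\<bar> \<le> \<lambda>\<close>, hence in the injective module of additive maps \<open>R \<rightarrow> D\<close>, whose cardinality is again at
  most \<open>\<lambda>\<close> to the power \<open>\<bar>'a\<bar>\<close>, which is \<open>\<lambda>\<close>.
\<close>

type_synonym ('a, 'm) resolution_space = "('a + 'm + nat) set"

definition chosen_injective_resolution ::
    "('a, 'x) ring_scheme \<Rightarrow> ('a, 'm, 'y) module_scheme
      \<Rightarrow> (nat \<Rightarrow> ('a, ('a, 'm) resolution_space) module)
        \<times> (nat \<Rightarrow> ('a, 'm) resolution_space \<Rightarrow> ('a, 'm) resolution_space)" where
  "chosen_injective_resolution R M =
     (SOME (E, d). \<exists>\<epsilon>. injective_resolution R M \<epsilon> E d)"


section \<open>Local cohomology\<close>

definition torsion_part ::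
    "('a, 'x) ring_scheme \<Rightarrow> 'a set \<Rightarrow> ('a, 'm, 'y) module_scheme \<Rightarrow> 'm set" where
  "torsion_part R \<aa> M =
     {x \<in> carrier M. \<exists>n::nat. \<forall>r \<in> \<aa> [^]\<^bsub>ideals_set R\<^esub> n. r \<odot>\<^bsub>M\<^esub> x = \<zero>\<^bsub>M\<^esub>}"

text \<open>The \<open>i\<close>-th cohomology of the complex obtained by applying \<open>\<Gamma>\<^sub>\<aa>\<close> to \<open>E 0 \<rightarrow> E 1 \<rightarrow> \<dots>\<close>\<close>

definition torsion_cohomology ::
    "('a, 'x) ring_scheme \<Rightarrow> 'a set \<Rightarrow> (nat \<Rightarrow> ('a, 'e) module) \<Rightarrow> (nat \<Rightarrow> 'e \<Rightarrow> 'e)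
      \<Rightarrow> nat \<Rightarrow> ('a, 'e set) module" where
  "torsion_cohomology R \<aa> E d i =
     quotient_module
       ((E i)\<lparr>carrier := {x \<in> torsion_part R \<aa> (E i). d i x = \<zero>\<^bsub>E (Suc i)\<^esub>}\<rparr>)
       (case i of 0 \<Rightarrow> {\<zero>\<^bsub>E 0\<^esub>} | Suc j \<Rightarrow> d j ` torsion_part R \<aa> (E j))"

text \<open>
  The right derived functors of \<open>\<Gamma>\<^sub>\<aa>\<close>; up to isomorphism the value does not depend on the chosen
  resolution.
\<close>

definition local_cohomology ::
    "('a, 'x) ring_scheme \<Rightarrow> 'a set \<Rightarrow> ('a, 'm, 'y) module_scheme
      \<Rightarrow> nat \<Rightarrow> ('a, ('a, 'm) resolution_space set) module" where
  "local_cohomology R \<aa> M i =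
     (case chosen_injective_resolution R M of (E, d) \<Rightarrow> torsion_cohomology R \<aa> E d i)"

definition grade :: "('a, 'x) ring_scheme \<Rightarrow> 'a set \<Rightarrow> ('a, 'm, 'y) module_scheme \<Rightarrow> enat" where
  "grade R \<aa> M = Inf {enat i | i. nonzero_module (local_cohomology R \<aa> M i)}"

definition finiteness_dim ::
    "('a, 'x) ring_scheme \<Rightarrow> 'a set \<Rightarrow> ('a, 'm, 'y) module_scheme \<Rightarrow> enat" where
  "finiteness_dim R \<aa> M = Inf {enat i | i. \<not> fg_module R (local_cohomology R \<aa> M i)}"

end

theory Submission imports Defs begin

text \<open>
  Over the field \<open>K\<close> the total tensor product of injective resolutions of \<open>L\<close> and \<open>N\<close> is a resolution of
  \<open>L \<otimes> N\<close> over \<open>R = A \<otimes> B\<close>, but not one by injective modules.  Injective modules over a noetherian ring are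
  however flabby in the sense that \<open>S \<rightarrow> S\<^sub>x\<close> is onto, iteratedly along the generators of the ideal; this
  property passes to tensor products over \<open>K\<close>, and by a mapping cone argument local cohomology can be
  computed from any resolution by flabby modules.  The torsion part of the tensor product complex is the
  tensor product of the torsion parts, so splitting complexes over \<open>K\<close> gives a Kuenneth formula expressing
  \<open>H\<^sup>n(L \<otimes> N)\<close> as the sum of the \<open>H\<^sup>p(L) \<otimes> H\<^sup>q(N)\<close> with \<open>p + q = n\<close>.  A summand is finitely generated
  iff a factor vanishes or both are finitely generated, as a linear functional on one factor carries
  generators to generators of the other.  Hence \<open>H\<^sup>n(L \<otimes> N)\<close> is not finitely generated iff for some
  \<open>p + q = n\<close> one factor is nonzero and the other not finitely generated, and the least such \<open>n\<close> is the
  stated minimum.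
\<close>

text \<open>Local cohomology is read off from a resolution picked by choice inside the type
  \<open>resolution_space\<close>, so nothing can be said about it before resolutions are known to
  exist there; coinduction from the base field supplies them for all three modules alike. The chosen
  resolution of L \<otimes> N bears no visible relation to those of L and N. It is tied to the total
  complex by a comparison map, for which the target must be injective, and then by flabbiness of
  both sides, a condition on powers of one generator at a time that involves neither localization
  nor a Cech complex. Noetherianity makes injective modules flabby, through the ascending chain of
  annihilators of x^n m. Cohomology modules are never tensored: cycles Z and boundaries H stay
  subsets of the complexes, finite generation of Z / H is stated for the pair, and the Kuenneth
  formula is used in the form that every cycle is, up to a boundary, a sum of tensors of cycles. To
  have a single tensor product instead of a doubly indexed family, each resolution is collected into
  a direct sum, and degree n is cut out as the span of the tensors with p + q = n.\<close>

lemma module_homI: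
  assumes "\<And>x. x \<in> carrier M \<Longrightarrow> h x \<in> carrier N"
    and "\<And>x y. x \<in> carrier M \<Longrightarrow> y \<in> carrier M \<Longrightarrow> h (x \<oplus>\<^bsub>M\<^esub> y) = h x \<oplus>\<^bsub>N\<^esub> h y"
    and "\<And>r x. r \<in> carrier R \<Longrightarrow> x \<in> carrier M \<Longrightarrow> h (r \<odot>\<^bsub>M\<^esub> x) = r \<odot>\<^bsub>N\<^esub> h x"
  shows "h \<in> module_hom R M N"
  using assms by (auto simp: module_hom_def)

lemma module_hom_closed: "h \<in> module_hom R M N \<Longrightarrow> x \<in> carrier M \<Longrightarrow> h x \<in> carrier N"
  and module_hom_add: "h \<in> module_hom R M N \<Longrightarrow> x \<in> carrier M \<Longrightarrow> y \<in> carrier M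
    \<Longrightarrow> h (x \<oplus>\<^bsub>M\<^esub> y) = h x \<oplus>\<^bsub>N\<^esub> h y"
  and module_hom_smult: "h \<in> module_hom R M N \<Longrightarrow> r \<in> carrier R \<Longrightarrow> x \<in> carrier M
    \<Longrightarrow> h (r \<odot>\<^bsub>M\<^esub> x) = r \<odot>\<^bsub>N\<^esub> h x"
  by (auto simp: module_hom_def)

lemma (in abelian_group) diff_zero_imp_eq:
  assumes "x \<in> carrier G" "y \<in> carrier G" "x \<ominus> y = \<zero>"
  shows "x = y"
proof -
  have "\<ominus> (\<ominus> y) = x" using assms by (intro minus_equality) (auto simp: a_minus_def)
  then show ?thesis using assms by simp
qed

lemma (in abelian_group) diff_self: "x \<in> carrier G \<Longrightarrow> x \<ominus> x = \<zero>"
  by (simp add: a_minus_def r_neg)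

lemma module_hom_zero:
  assumes "module R M" "module R N" "h \<in> module_hom R M N"
  shows "h \<zero>\<^bsub>M\<^esub> = \<zero>\<^bsub>N\<^esub>"
proof -
  interpret M: module R M by fact
  interpret N: module R N by fact
  have "h (\<zero>\<^bsub>R\<^esub> \<odot>\<^bsub>M\<^esub> \<zero>\<^bsub>M\<^esub>) = \<zero>\<^bsub>R\<^esub> \<odot>\<^bsub>N\<^esub> h \<zero>\<^bsub>M\<^esub>"
    by (rule module_hom_smult[OF assms(3)]) auto
  then show ?thesis using module_hom_closed[OF assms(3)] by simp
qed

lemma module_hom_a_inv:
  assumes "module R M" "module R N" "h \<in> module_hom R M N" "x \<in> carrier M"
  shows "h (\<ominus>\<^bsub>M\<^esub> x) = \<ominus>\<^bsub>N\<^esub> h x"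
proof -
  interpret M: module R M by fact
  interpret N: module R N by fact
  have "h ((\<ominus>\<^bsub>R\<^esub> \<one>\<^bsub>R\<^esub>) \<odot>\<^bsub>M\<^esub> x) = (\<ominus>\<^bsub>R\<^esub> \<one>\<^bsub>R\<^esub>) \<odot>\<^bsub>N\<^esub> h x"
    by (rule module_hom_smult[OF assms(3)]) (auto simp: assms)
  then show ?thesis using module_hom_closed[OF assms(3,4)] assms(4)
    by (simp add: M.smult_l_minus N.smult_l_minus)
qed

lemma module_hom_diff:
  assumes "module R M" "module R N" "h \<in> module_hom R M N" "x \<in> carrier M" "y \<in> carrier M"
  shows "h (x \<ominus>\<^bsub>M\<^esub> y) = h x \<ominus>\<^bsub>N\<^esub> h y"
proof -
  interpret M: module R M by fact
  show ?thesis using assms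
    by (simp add: a_minus_def module_hom_add module_hom_a_inv)
qed

lemma module_hom_comp:
  assumes "h \<in> module_hom R M N" "g \<in> module_hom R N P"
  shows "(\<lambda>x. g (h x)) \<in> module_hom R M P"
  using assms by (auto simp: module_hom_def Pi_iff)

lemma module_smult_minus_one:
  assumes "module R M" "x \<in> carrier M"
  shows "(\<ominus>\<^bsub>R\<^esub> \<one>\<^bsub>R\<^esub>) \<odot>\<^bsub>M\<^esub> x = \<ominus>\<^bsub>M\<^esub> x"
proof -
  interpret M: module R M by fact
  show ?thesis using assms(2) by (simp add: M.smult_l_minus)
qed

section \<open>Submodules and their generation\<close>

lemma submodule_subset: "submodule H R M \<Longrightarrow> x \<in> H \<Longrightarrow> x \<in> carrier M"
  by (simp add: submodule_def subgroup.mem_carrier[of H "add_monoid M", simplified])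

lemma submodule_zero: "submodule H R M \<Longrightarrow> \<zero>\<^bsub>M\<^esub> \<in> H"
  using subgroup.one_closed[of H "add_monoid M"] by (simp add: submodule_def)

lemma submodule_add: "submodule H R M \<Longrightarrow> x \<in> H \<Longrightarrow> y \<in> H \<Longrightarrow> x \<oplus>\<^bsub>M\<^esub> y \<in> H"
  using subgroup.m_closed[of H "add_monoid M"] by (simp add: submodule_def)

lemma submodule_smult: "submodule H R M \<Longrightarrow> r \<in> carrier R \<Longrightarrow> x \<in> H \<Longrightarrow> r \<odot>\<^bsub>M\<^esub> x \<in> H"
  by (rule submodule.smult_closed)

lemma submodule_a_inv: "submodule H R M \<Longrightarrow> x \<in> H \<Longrightarrow> \<ominus>\<^bsub>M\<^esub> x \<in> H"
  using subgroup.m_inv_closed[of H "add_monoid M"] by (simp add: submodule_def a_inv_def)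

lemma submodule_diff: "submodule H R M \<Longrightarrow> x \<in> H \<Longrightarrow> y \<in> H \<Longrightarrow> x \<ominus>\<^bsub>M\<^esub> y \<in> H"
  by (simp add: a_minus_def submodule_add submodule_a_inv)

text \<open>Inverses are scalar multiples, -x = (-1) x, so closure under scalars takes care of
  them.\<close>

lemma submoduleI':
  assumes M: "module R M" and sub: "H \<subseteq> carrier M" and z: "\<zero>\<^bsub>M\<^esub> \<in> H"
    and a: "\<And>x y. x \<in> H \<Longrightarrow> y \<in> H \<Longrightarrow> x \<oplus>\<^bsub>M\<^esub> y \<in> H"
    and s: "\<And>r x. r \<in> carrier R \<Longrightarrow> x \<in> H \<Longrightarrow> r \<odot>\<^bsub>M\<^esub> x \<in> H"
  shows "submodule H R M"
proof -
  interpret M: module R M by fact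
  show ?thesis
  proof (rule M.submoduleI)
    fix x assume x: "x \<in> H"
    have "(\<ominus>\<^bsub>R\<^esub> \<one>\<^bsub>R\<^esub>) \<odot>\<^bsub>M\<^esub> x \<in> H" by (rule s) (auto simp: x)
    then show "\<ominus>\<^bsub>M\<^esub> x \<in> H" using x sub by (simp add: M.smult_l_minus subset_iff)
  qed (use assms in auto)
qed

lemma submodule_module: "module R M \<Longrightarrow> submodule H R M \<Longrightarrow> module R (M\<lparr>carrier := H\<rparr>)"
  by (rule submodule.submodule_is_module)

lemma submodule_Inter:
  assumes M: "module R M" and "\<H> \<noteq> {}" and "\<And>H. H \<in> \<H> \<Longrightarrow> submodule H R M"
  shows "submodule (\<Inter>\<H>) R M"
proof (rule submoduleI'[OF M])
  show "\<Inter>\<H> \<subseteq> carrier M" using assms(2) submodule_subset[OF assms(3)] by blast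
  show "\<zero>\<^bsub>M\<^esub> \<in> \<Inter>\<H>" using submodule_zero[OF assms(3)] by blast
  show "x \<oplus>\<^bsub>M\<^esub> y \<in> \<Inter>\<H>" if "x \<in> \<Inter>\<H>" "y \<in> \<Inter>\<H>" for x y
    using that submodule_add[OF assms(3)] by blast
  show "r \<odot>\<^bsub>M\<^esub> x \<in> \<Inter>\<H>" if "r \<in> carrier R" "x \<in> \<Inter>\<H>" for r x
    using that submodule_smult[OF assms(3)] by blast
qed

lemma submodule_carrier: "module R M \<Longrightarrow> submodule (carrier M) R M"
  by (rule module.carrier_is_submodule)

lemma submodule_gen_submodule:
  assumes M: "module R M" and S: "S \<subseteq> carrier M"
  shows "submodule (submodule_gen R M S) R M"
  unfolding submodule_gen_def
  by (rule submodule_Inter[OF M]) (use S submodule_carrier[OF M] in auto)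

lemma submodule_gen_incl: "S \<subseteq> submodule_gen R M S"
  by (auto simp: submodule_gen_def)

lemma submodule_gen_least: "submodule H R M \<Longrightarrow> S \<subseteq> H \<Longrightarrow> submodule_gen R M S \<subseteq> H"
  by (auto simp: submodule_gen_def)

lemma submodule_vimage:
  assumes "module R M" "module R N" "h \<in> module_hom R M N" "submodule H R N"
  shows "submodule {x \<in> carrier M. h x \<in> H} R M"
proof -
  interpret M: module R M by fact
  show ?thesis
    by (rule submoduleI'[OF assms(1)])
      (use assms in \<open>auto simp: module_hom_zero module_hom_add module_hom_smult
        intro: submodule_zero submodule_add submodule_smult\<close>)
qed

lemma submodule_singleton_zero:
  assumes "module R N"
  shows "submodule {\<zero>\<^bsub>N\<^esub>} R N"
proof -
  interpret N: module R N by fact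
  show ?thesis by (rule submoduleI'[OF assms]) auto
qed

lemma submodule_kernel:
  assumes "module R M" "module R N" "h \<in> module_hom R M N"
  shows "submodule {x \<in> carrier M. h x = \<zero>\<^bsub>N\<^esub>} R M"
  using submodule_vimage[OF assms submodule_singleton_zero[OF assms(2)]] by simp

lemma submodule_image:
  assumes "module R M" "module R N" "h \<in> module_hom R M N" "submodule H R M"
  shows "submodule (h ` H) R N"
proof (rule submoduleI'[OF assms(2)])
  show "h ` H \<subseteq> carrier N" using assms by (auto intro: module_hom_closed dest: submodule_subset)
  show "\<zero>\<^bsub>N\<^esub> \<in> h ` H" using module_hom_zero[OF assms(1-3)] submodule_zero[OF assms(4)] by force
  show "x \<oplus>\<^bsub>N\<^esub> y \<in> h ` H" if xy: "x \<in> h ` H" "y \<in> h ` H" for x y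
  proof -
    obtain a b where ab: "a \<in> H" "b \<in> H" "x = h a" "y = h b" using xy by auto
    then have "h (a \<oplus>\<^bsub>M\<^esub> b) = x \<oplus>\<^bsub>N\<^esub> y"
      using assms by (simp add: module_hom_add submodule_subset)
    then show ?thesis using ab submodule_add[OF assms(4)] by (metis imageI)
  qed
  show "r \<odot>\<^bsub>N\<^esub> x \<in> h ` H" if rx: "r \<in> carrier R" "x \<in> h ` H" for r x
  proof -
    obtain a where a: "a \<in> H" "x = h a" using rx by auto
    then have "h (r \<odot>\<^bsub>M\<^esub> a) = r \<odot>\<^bsub>N\<^esub> x"
      using assms rx by (simp add: module_hom_smult submodule_subset)
    then show ?thesis using a rx submodule_smult[OF assms(4)] by (metis imageI)
  qed
qed

lemma submodule_Int:
  assumes "module R M" "submodule H R M" "submodule H' R M"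
  shows "submodule (H \<inter> H') R M"
  by (rule submoduleI'[OF assms(1)])
    (use assms in \<open>auto intro: submodule_zero submodule_add submodule_smult dest: submodule_subset\<close>)

lemma submodule_of_submodule:
  assumes "module R M" "submodule Z R M" "submodule H R M" "H \<subseteq> Z"
  shows "submodule H R (M\<lparr>carrier := Z\<rparr>)"
proof -
  show ?thesis
    by (rule submoduleI'[OF submodule_module[OF assms(1,2)]])
     (use assms in \<open>auto intro: submodule_zero submodule_add submodule_smult\<close>)
qed

section \<open>Quotient modules\<close>

text \<open>Bridge from submodules to the coset calculus for additive subgroups, on which everything
  about \<open>quotient_module\<close> below rests.\<close>

lemma quotient_abelian_subgroup:
  assumes "module R M" "submodule H R M"
  shows "abelian_subgroup H M"
proof -
  interpret M: module R M by fact
  show ?thesis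
    by (rule abelian_subgroupI3)
      (use assms in \<open>auto simp: submodule_def additive_subgroup_def M.abelian_group_axioms\<close>)
qed

lemma quotient_carrier: "carrier (quotient_module M H) = (\<lambda>x. H +>\<^bsub>M\<^esub> x) ` carrier M"
  by (auto simp: quotient_module_def A_RCOSETS_def' )

lemma quotient_zero: "\<zero>\<^bsub>quotient_module M H\<^esub> = H"
  by (simp add: quotient_module_def)

context
  fixes R :: "('a, 'x) ring_scheme" and M :: "('a, 'm, 'y) module_scheme" and H
  assumes M: "module R M" and H: "submodule H R M"
begin

interpretation M: module R M by (fact M)
interpretation H: abelian_subgroup H M by (rule quotient_abelian_subgroup[OF M H])

lemma coset_zero: "H +>\<^bsub>M\<^esub> \<zero>\<^bsub>M\<^esub> = H"
  by (simp add: H.a_subset)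

lemma coset_eq_iff:
  assumes "x \<in> carrier M" "y \<in> carrier M"
  shows "H +>\<^bsub>M\<^esub> x = H +>\<^bsub>M\<^esub> y \<longleftrightarrow> x \<ominus>\<^bsub>M\<^esub> y \<in> H"
proof
  assume "H +>\<^bsub>M\<^esub> x = H +>\<^bsub>M\<^esub> y"
  then have "x \<in> H +>\<^bsub>M\<^esub> y" using H.a_rcos_self[OF assms(1)] by simp
  then show "x \<ominus>\<^bsub>M\<^esub> y \<in> H" using H.a_rcos_module[OF assms(2,1)] by (simp add: a_minus_def)
next
  assume "x \<ominus>\<^bsub>M\<^esub> y \<in> H"
  then have "x \<in> H +>\<^bsub>M\<^esub> y" using H.a_rcos_module[OF assms(2,1)] by (simp add: a_minus_def)
  then show "H +>\<^bsub>M\<^esub> x = H +>\<^bsub>M\<^esub> y" using H.a_repr_independence'[OF _ assms(2)] by simp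
qed

lemma coset_eq_self_iff:
  assumes "x \<in> carrier M"
  shows "H +>\<^bsub>M\<^esub> x = H \<longleftrightarrow> x \<in> H"
  using H.a_rcos_self[OF assms] H.a_rcos_const by auto

lemma mem_cosetD:
  assumes "x \<in> carrier M" "y \<in> H +>\<^bsub>M\<^esub> x"
  shows "y \<in> carrier M" "H +>\<^bsub>M\<^esub> y = H +>\<^bsub>M\<^esub> x"
  using H.a_elemrcos_carrier[OF assms] H.a_repr_independence'[OF assms(2,1)] by simp_all

lemma mem_coset_self:
  assumes "x \<in> carrier M"
  shows "x \<in> H +>\<^bsub>M\<^esub> x"
  using assms by (rule H.a_rcos_self)

lemma coset_add:
  assumes "x \<in> carrier M" "y \<in> carrier M"
  shows "(H +>\<^bsub>M\<^esub> x) \<oplus>\<^bsub>quotient_module M H\<^esub> (H +>\<^bsub>M\<^esub> y) = H +>\<^bsub>M\<^esub> (x \<oplus>\<^bsub>M\<^esub> y)"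
  using assms H.a_rcos_sum by (simp add: quotient_module_def)

lemma coset_smult:
  assumes "r \<in> carrier R" "x \<in> carrier M"
  shows "r \<odot>\<^bsub>quotient_module M H\<^esub> (H +>\<^bsub>M\<^esub> x) = H +>\<^bsub>M\<^esub> (r \<odot>\<^bsub>M\<^esub> x)"
proof -
  have "H +>\<^bsub>M\<^esub> (r \<odot>\<^bsub>M\<^esub> y) = H +>\<^bsub>M\<^esub> (r \<odot>\<^bsub>M\<^esub> x)" if "y \<in> H +>\<^bsub>M\<^esub> x" for y
  proof -
    have y: "y \<in> carrier M" "y \<ominus>\<^bsub>M\<^esub> x \<in> H"
      using mem_cosetD[OF assms(2) that] assms(2) coset_eq_iff by auto
    have "r \<odot>\<^bsub>M\<^esub> y \<ominus>\<^bsub>M\<^esub> r \<odot>\<^bsub>M\<^esub> x = r \<odot>\<^bsub>M\<^esub> (y \<ominus>\<^bsub>M\<^esub> x)"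
      using y assms by (simp add: a_minus_def M.smult_r_distr M.smult_r_minus)
    then show ?thesis using y assms submodule_smult[OF H assms(1)] by (simp add: coset_eq_iff)
  qed
  then have "(\<Union>y\<in>H +>\<^bsub>M\<^esub> x. H +>\<^bsub>M\<^esub> (r \<odot>\<^bsub>M\<^esub> y)) = H +>\<^bsub>M\<^esub> (r \<odot>\<^bsub>M\<^esub> x)"
    using mem_coset_self[OF assms(2)] by blast
  then show ?thesis by (simp add: quotient_module_def)
qed

lemma quotient_is_module: "module R (quotient_module M H)"
proof (rule moduleI)
  let ?Q = "quotient_module M H"
  show "abelian_group ?Q"
  proof (rule abelian_groupI)
    fix x assume "x \<in> carrier ?Q"
    then obtain a where a: "a \<in> carrier M" "x = H +>\<^bsub>M\<^esub> a" by (auto simp: quotient_carrier)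
    then have "H +>\<^bsub>M\<^esub> (\<ominus>\<^bsub>M\<^esub> a) \<in> carrier ?Q" "(H +>\<^bsub>M\<^esub> (\<ominus>\<^bsub>M\<^esub> a)) \<oplus>\<^bsub>?Q\<^esub> x = \<zero>\<^bsub>?Q\<^esub>"
      by (auto simp: quotient_carrier coset_add quotient_zero M.l_neg coset_zero)
    then show "\<exists>y\<in>carrier ?Q. y \<oplus>\<^bsub>?Q\<^esub> x = \<zero>\<^bsub>?Q\<^esub>" by blast
  next
    show "\<zero>\<^bsub>?Q\<^esub> \<in> carrier ?Q" unfolding quotient_zero quotient_carrier
      by (rule image_eqI[of _ _ "\<zero>\<^bsub>M\<^esub>"]) (auto simp: coset_zero)
    fix x assume "x \<in> carrier ?Q"
    then obtain a where a: "a \<in> carrier M" "x = H +>\<^bsub>M\<^esub> a" by (auto simp: quotient_carrier)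
    then show "\<zero>\<^bsub>?Q\<^esub> \<oplus>\<^bsub>?Q\<^esub> x = x"
      using coset_add[of "\<zero>\<^bsub>M\<^esub>" a] by (simp add: coset_zero quotient_zero)
  qed (auto simp: quotient_carrier coset_add M.a_ac)
qed (auto simp: quotient_carrier coset_add coset_smult M.smult_l_distr M.smult_r_distr M.smult_assoc1
      M.is_cring)

lemma coset_hom: "(\<lambda>x. H +>\<^bsub>M\<^esub> x) \<in> module_hom R M (quotient_module M H)"
  by (rule module_homI) (auto simp: quotient_carrier coset_add coset_smult)

end

section \<open>Additive spans\<close>

text \<open>Finite sums of elements of S, with neither coefficients nor signs. Pure tensors absorb
  scalars and signs, so this small span already exhausts a tensor product, and induction over it has
  only two cases.\<close>

inductive_set asum :: "('a, 'x) ring_scheme \<Rightarrow> 'a set \<Rightarrow> 'a set" for M S where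
  zero: "\<zero>\<^bsub>M\<^esub> \<in> asum M S"
| add: "s \<in> S \<Longrightarrow> x \<in> asum M S \<Longrightarrow> s \<oplus>\<^bsub>M\<^esub> x \<in> asum M S"

lemma asum_subset:
  assumes "\<zero>\<^bsub>M\<^esub> \<in> H" "\<And>x y. x \<in> H \<Longrightarrow> y \<in> H \<Longrightarrow> x \<oplus>\<^bsub>M\<^esub> y \<in> H" "S \<subseteq> H"
  shows "asum M S \<subseteq> H"
proof
  fix x assume "x \<in> asum M S" then show "x \<in> H"
    by induction (use assms in auto)
qed

lemma asum_subset_submodule: "submodule H R M \<Longrightarrow> S \<subseteq> H \<Longrightarrow> asum M S \<subseteq> H"
  by (rule asum_subset) (auto intro: submodule_zero submodule_add)

lemma asum_mono: "S \<subseteq> S' \<Longrightarrow> asum M S \<subseteq> asum M S'"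
proof
  fix x assume "S \<subseteq> S'" and "x \<in> asum M S"
  from this(2,1) show "x \<in> asum M S'"
    by induction (auto intro: asum.intros)
qed

lemma asum_carrier: "abelian_group M \<Longrightarrow> S \<subseteq> carrier M \<Longrightarrow> asum M S \<subseteq> carrier M"
  by (rule asum_subset) (auto simp: abelian_groupE)

lemma asum_incl:
  assumes "abelian_group M" "S \<subseteq> carrier M" "s \<in> S" shows "s \<in> asum M S"
proof -
  interpret abelian_group M by fact
  show ?thesis using asum.add[OF assms(3) asum.zero, of M] assms by auto
qed

lemma asum_add:
  assumes "abelian_group M" "S \<subseteq> carrier M" "x \<in> asum M S" "y \<in> asum M S"
  shows "x \<oplus>\<^bsub>M\<^esub> y \<in> asum M S"
proof -
  interpret abelian_group M by fact
  note c = asum_carrier[OF assms(1,2)]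
  from assms(3) show ?thesis
  proof induction
    case zero then show ?case using assms c by auto
  next
    case (add s x)
    then have "s \<oplus>\<^bsub>M\<^esub> x \<oplus>\<^bsub>M\<^esub> y = s \<oplus>\<^bsub>M\<^esub> (x \<oplus>\<^bsub>M\<^esub> y)"
      using c assms by (intro a_assoc) auto
    then show ?case using add by (auto intro: asum.add)
  qed
qed

text \<open>A scalar distributes over the sum, so only its effect on single generators has to be
  controlled.\<close>

lemma asum_submodule:
  assumes M: "module R M" and S: "S \<subseteq> carrier M"
    and cl: "\<And>r s. r \<in> carrier R \<Longrightarrow> s \<in> S \<Longrightarrow> r \<odot>\<^bsub>M\<^esub> s \<in> asum M S"
  shows "submodule (asum M S) R M"
proof -
  interpret M: module R M by fact
  note ag = M.abelian_group_axioms
  note c = asum_carrier[OF ag S]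
  show ?thesis
  proof (rule submoduleI'[OF M c asum.zero asum_add[OF ag S]])
    fix r x assume r: "r \<in> carrier R" and x: "x \<in> asum M S"
    from x show "r \<odot>\<^bsub>M\<^esub> x \<in> asum M S"
    proof induction
      case zero then show ?case using r by (simp add: asum.zero)
    next
      case (add s x)
      then have "r \<odot>\<^bsub>M\<^esub> (s \<oplus>\<^bsub>M\<^esub> x) = r \<odot>\<^bsub>M\<^esub> s \<oplus>\<^bsub>M\<^esub> r \<odot>\<^bsub>M\<^esub> x"
        using c S r by (intro M.smult_r_distr) auto
      then show ?case using add cl[OF r] asum_add[OF ag S] by auto
    qed
  qed
qed

text \<open>The device behind almost every identity between maps out of a tensor product: with pure
  tensors for S it reduces the identity to them.\<close>

lemma asum_hom_eq:
  assumes "module R M" "module R N" "h \<in> module_hom R M N" "g \<in> module_hom R M N"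
    and S: "S \<subseteq> carrier M" and eq: "\<And>s. s \<in> S \<Longrightarrow> h s = g s" and x: "x \<in> asum M S"
  shows "h x = g x"
proof -
  interpret M: module R M by fact
  note c = asum_carrier[OF M.abelian_group_axioms S]
  from x show ?thesis
  proof induction
    case zero then show ?case using assms by (simp add: module_hom_zero)
  next
    case (add s x)
    then show ?case using assms(3,4) S c eq by (simp add: module_hom_add subset_iff)
  qed
qed

lemma asum_hom_image:
  assumes "module R M" "module R N" "h \<in> module_hom R M N" "S \<subseteq> carrier M" "x \<in> asum M S"
  shows "h x \<in> asum N (h ` S)"
proof -
  interpret M: module R M by fact
  note c = asum_carrier[OF M.abelian_group_axioms assms(4)]
  from assms(5) show ?thesis
  proof induction
    case zero then show ?case using assms by (simp add: module_hom_zero asum.zero)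
  next
    case (add s x)
    then have "h (s \<oplus>\<^bsub>M\<^esub> x) = h s \<oplus>\<^bsub>N\<^esub> h x" using assms c by (intro module_hom_add) auto
    then show ?case using add by (auto intro: asum.add)
  qed
qed

lemma quotient_lift:
  assumes M: "module R M" and N: "module R N" and H: "submodule H R M"
    and h: "h \<in> module_hom R M N" and k: "\<And>x. x \<in> H \<Longrightarrow> h x = \<zero>\<^bsub>N\<^esub>"
  shows "\<exists>g\<in>module_hom R (quotient_module M H) N. \<forall>x\<in>carrier M. g (H +>\<^bsub>M\<^esub> x) = h x"
proof -
  interpret M: module R M by fact
  interpret N: module R N by fact
  \<comment> \<open>Evaluates h at an arbitrary representative; two representatives differ by an
    element of H, which h kills.\<close>
  define g where "g C = h (SOME x. x \<in> C)" for C
  have g: "g (H +>\<^bsub>M\<^esub> x) = h x" if x: "x \<in> carrier M" for x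
  proof -
    define y where "y = (SOME y. y \<in> H +>\<^bsub>M\<^esub> x)"
    have "y \<in> H +>\<^bsub>M\<^esub> x" unfolding y_def by (rule someI, rule mem_coset_self[OF M H x])
    then have y: "y \<in> carrier M" "y \<ominus>\<^bsub>M\<^esub> x \<in> H"
      using mem_cosetD[OF M H x] coset_eq_iff[OF M H _ x] by auto
    then have "h y \<ominus>\<^bsub>N\<^esub> h x = \<zero>\<^bsub>N\<^esub>"
      using k[OF y(2)] module_hom_diff[OF M N h y(1) x] by simp
    then have "h y = h x"
      by (rule N.diff_zero_imp_eq[OF module_hom_closed[OF h y(1)] module_hom_closed[OF h x]])
    then show ?thesis by (simp add: g_def y_def[symmetric])
  qed
  have "g \<in> module_hom R (quotient_module M H) N"
    by (rule module_homI) (use h in \<open>auto simp: quotient_carrier coset_add[OF M H]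
      coset_smult[OF M H] g module_hom_closed module_hom_add module_hom_smult\<close>)
  then show ?thesis using g by blast
qed

section \<open>Bilinear maps\<close>

text \<open>Phrased as a homomorphism in each variable separately, so that everything proved about
  homomorphisms applies with the other variable fixed.\<close>

definition bilin where
  "bilin K M N V \<beta> \<longleftrightarrow>
    (\<forall>n\<in>carrier N. (\<lambda>m. \<beta> m n) \<in> module_hom K M V) \<and> (\<forall>m\<in>carrier M. \<beta> m \<in> module_hom K N V)"

lemma bilinI:
  assumes "\<And>n. n \<in> carrier N \<Longrightarrow> (\<lambda>m. \<beta> m n) \<in> module_hom K M V"
    and "\<And>m. m \<in> carrier M \<Longrightarrow> \<beta> m \<in> module_hom K N V"
  shows "bilin K M N V \<beta>"
  using assms by (simp add: bilin_def)

lemma bilin_left: "bilin K M N V \<beta> \<Longrightarrow> n \<in> carrier N \<Longrightarrow> (\<lambda>m. \<beta> m n) \<in> module_hom K M V"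
  and bilin_right: "bilin K M N V \<beta> \<Longrightarrow> m \<in> carrier M \<Longrightarrow> \<beta> m \<in> module_hom K N V"
  by (simp_all add: bilin_def)

lemma bilin_closed: "bilin K M N V \<beta> \<Longrightarrow> m \<in> carrier M \<Longrightarrow> n \<in> carrier N \<Longrightarrow> \<beta> m n \<in> carrier V"
  using module_hom_closed[OF bilin_right] .

lemma bilin_add_left: "bilin K M N V \<beta> \<Longrightarrow> m \<in> carrier M \<Longrightarrow> m' \<in> carrier M \<Longrightarrow> n \<in> carrier N
    \<Longrightarrow> \<beta> (m \<oplus>\<^bsub>M\<^esub> m') n = \<beta> m n \<oplus>\<^bsub>V\<^esub> \<beta> m' n"
  using module_hom_add[OF bilin_left] .

lemma bilin_add_right: "bilin K M N V \<beta> \<Longrightarrow> m \<in> carrier M \<Longrightarrow> n \<in> carrier N \<Longrightarrow> n' \<in> carrier N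
    \<Longrightarrow> \<beta> m (n \<oplus>\<^bsub>N\<^esub> n') = \<beta> m n \<oplus>\<^bsub>V\<^esub> \<beta> m n'"
  using module_hom_add[OF bilin_right] .

lemma bilin_smult_left: "bilin K M N V \<beta> \<Longrightarrow> c \<in> carrier K \<Longrightarrow> m \<in> carrier M \<Longrightarrow> n \<in> carrier N
    \<Longrightarrow> \<beta> (c \<odot>\<^bsub>M\<^esub> m) n = c \<odot>\<^bsub>V\<^esub> \<beta> m n"
  using module_hom_smult[OF bilin_left] .

lemma bilin_smult_right: "bilin K M N V \<beta> \<Longrightarrow> c \<in> carrier K \<Longrightarrow> m \<in> carrier M \<Longrightarrow> n \<in> carrier N
    \<Longrightarrow> \<beta> m (c \<odot>\<^bsub>N\<^esub> n) = c \<odot>\<^bsub>V\<^esub> \<beta> m n"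
  using module_hom_smult[OF bilin_right] .

section \<open>Free modules\<close>

declare split_paired_All [simp del]

lemma free_sel [simp]:
  "\<zero>\<^bsub>free_on_pairs K M N\<^esub> = (\<lambda>_. \<zero>\<^bsub>K\<^esub>)"
  "add (free_on_pairs K M N) = (\<lambda>f g s. f s \<oplus>\<^bsub>K\<^esub> g s)"
  "smult (free_on_pairs K M N) = (\<lambda>c f s. c \<otimes>\<^bsub>K\<^esub> f s)"
  by (simp_all add: free_on_pairs_def)

lemma free_carrier_iff: "f \<in> carrier (free_on_pairs K M N) \<longleftrightarrow> (\<forall>s. f s \<in> carrier K) \<and>
    finite {s. f s \<noteq> \<zero>\<^bsub>K\<^esub>} \<and> {s. f s \<noteq> \<zero>\<^bsub>K\<^esub>} \<subseteq> carrier M \<times> carrier N"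
  by (auto simp: free_on_pairs_def)

text \<open>Any finite set containing the support will do. Such sets can be united when elements are
  added, whereas the support itself may shrink.\<close>

lemma free_carrierI:
  assumes "\<And>s. f s \<in> carrier K" "finite P" "P \<subseteq> carrier M \<times> carrier N" "\<And>s. s \<notin> P \<Longrightarrow> f s = \<zero>\<^bsub>K\<^esub>"
  shows "f \<in> carrier (free_on_pairs K M N)"
proof -
  have "{s. f s \<noteq> \<zero>\<^bsub>K\<^esub>} \<subseteq> P" using assms(4) by blast
  then show ?thesis using assms finite_subset[of _ P] by (auto simp: free_carrier_iff)
qed

lemma free_carrierE:
  assumes "f \<in> carrier (free_on_pairs K M N)"
  obtains P where "\<forall>s. f s \<in> carrier K" "finite P" "P \<subseteq> carrier M \<times> carrier N"
    "\<forall>s. s \<notin> P \<longrightarrow> f s = \<zero>\<^bsub>K\<^esub>"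
  using assms by (intro that[of "{s. f s \<noteq> \<zero>\<^bsub>K\<^esub>}"]) (auto simp: free_carrier_iff)

lemma free_module:
  assumes K: "cring K"
  shows "module K (free_on_pairs K M N)"
proof -
  interpret K: cring K by fact
  let ?F = "free_on_pairs K M N"
  have add: "(\<lambda>s. f s \<oplus>\<^bsub>K\<^esub> g s) \<in> carrier ?F" if f: "f \<in> carrier ?F" and g: "g \<in> carrier ?F" for f g
  proof -
    from f obtain P where P: "\<forall>s. f s \<in> carrier K" "finite P" "P \<subseteq> carrier M \<times> carrier N"
      "\<forall>s. s \<notin> P \<longrightarrow> f s = \<zero>\<^bsub>K\<^esub>" by (rule free_carrierE)
    from g obtain Q where Q: "\<forall>s. g s \<in> carrier K" "finite Q" "Q \<subseteq> carrier M \<times> carrier N"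
      "\<forall>s. s \<notin> Q \<longrightarrow> g s = \<zero>\<^bsub>K\<^esub>" by (rule free_carrierE)
    show ?thesis by (rule free_carrierI[of _ _ "P \<union> Q"]) (use P Q in auto)
  qed
  have map: "(\<lambda>s. u (f s)) \<in> carrier ?F" if f: "f \<in> carrier ?F"
    and u: "\<And>x. x \<in> carrier K \<Longrightarrow> u x \<in> carrier K" "u \<zero>\<^bsub>K\<^esub> = \<zero>\<^bsub>K\<^esub>" for f u
  proof -
    from f obtain P where P: "\<forall>s. f s \<in> carrier K" "finite P" "P \<subseteq> carrier M \<times> carrier N"
      "\<forall>s. s \<notin> P \<longrightarrow> f s = \<zero>\<^bsub>K\<^esub>" by (rule free_carrierE)
    show ?thesis by (rule free_carrierI[of _ _ P]) (use P u in auto)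
  qed
  have c: "f s \<in> carrier K" if "f \<in> carrier ?F" for f s
    using that unfolding free_carrier_iff by blast
  show ?thesis
  proof (rule moduleI)
    show "abelian_group ?F"
    proof (rule abelian_groupI)
      show "\<zero>\<^bsub>?F\<^esub> \<in> carrier ?F" by (simp add: free_carrier_iff)
      fix f assume f: "f \<in> carrier ?F"
      have "(\<lambda>s. \<ominus>\<^bsub>K\<^esub> f s) \<in> carrier ?F" by (rule map[OF f]) auto
      moreover have "(\<lambda>s. \<ominus>\<^bsub>K\<^esub> f s) \<oplus>\<^bsub>?F\<^esub> f = \<zero>\<^bsub>?F\<^esub>" using c[OF f] by (simp add: K.l_neg)
      ultimately show "\<exists>g\<in>carrier ?F. g \<oplus>\<^bsub>?F\<^esub> f = \<zero>\<^bsub>?F\<^esub>" by blast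
    qed (auto simp: add c K.a_ac fun_eq_iff)
    show "x \<odot>\<^bsub>?F\<^esub> f \<in> carrier ?F" if "x \<in> carrier K" "f \<in> carrier ?F" for x f
      using map[OF that(2), of "\<lambda>y. x \<otimes>\<^bsub>K\<^esub> y"] that by simp
  qed (auto simp: c K fun_eq_iff K.l_distr K.r_distr K.m_assoc)
qed

lemma delta_carrier:
  assumes "cring K" "p \<in> carrier M \<times> carrier N"
  shows "delta K p \<in> carrier (free_on_pairs K M N)"
proof -
  interpret K: cring K by fact
  show ?thesis by (rule free_carrierI[of _ _ "{p}"]) (use assms in \<open>auto simp: delta_def\<close>)
qed

text \<open>Induction on a finite set containing the support: the value at one point is split off as
  a multiple of \<open>delta\<close> and overwritten by zero.\<close>

lemma free_asum:
  assumes K: "cring K" and f: "f \<in> carrier (free_on_pairs K M N)"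
  shows "f \<in> asum (free_on_pairs K M N)
    {c \<odot>\<^bsub>free_on_pairs K M N\<^esub> delta K p | c p. c \<in> carrier K \<and> p \<in> carrier M \<times> carrier N}"
    (is "_ \<in> asum ?F ?S")
proof -
  interpret K: cring K by fact
  have "f \<in> asum ?F ?S" if "finite P" "P \<subseteq> carrier M \<times> carrier N" "\<forall>s. f s \<in> carrier K"
    "\<forall>s. s \<notin> P \<longrightarrow> f s = \<zero>\<^bsub>K\<^esub>" for P f
    using that
  proof (induction P arbitrary: f rule: finite_induct)
    case empty
    then have "f = \<zero>\<^bsub>?F\<^esub>" by auto
    then show ?case by (simp only: asum.zero)
  next
    case (insert p P)
    let ?g = "f(p := \<zero>\<^bsub>K\<^esub>)"
    have "?g \<in> asum ?F ?S" by (rule insert.IH) (use insert.prems in auto)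
    moreover have "f p \<odot>\<^bsub>?F\<^esub> delta K p \<in> ?S" using insert.prems by blast
    ultimately have "f p \<odot>\<^bsub>?F\<^esub> delta K p \<oplus>\<^bsub>?F\<^esub> ?g \<in> asum ?F ?S" by (rule asum.add[rotated])
    moreover have "f p \<odot>\<^bsub>?F\<^esub> delta K p \<oplus>\<^bsub>?F\<^esub> ?g = f"
    proof
      fix s show "(f p \<odot>\<^bsub>?F\<^esub> delta K p \<oplus>\<^bsub>?F\<^esub> ?g) s = f s"
        using insert.prems(2) by (cases "s = p") (simp_all add: delta_def)
    qed
    ultimately show ?case by (simp only:)
  qed
  note * = this
  from f obtain P where P: "\<forall>s. f s \<in> carrier K" "finite P" "P \<subseteq> carrier M \<times> carrier N"
    "\<forall>s. s \<notin> P \<longrightarrow> f s = \<zero>\<^bsub>K\<^esub>" by (rule free_carrierE)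
  show ?thesis by (rule *[OF P(2,3,1,4)])
qed

lemma free_subset_submodule:
  assumes K: "cring K" and H: "submodule H K (free_on_pairs K M N)"
    and d: "\<And>p. p \<in> carrier M \<times> carrier N \<Longrightarrow> delta K p \<in> H"
  shows "carrier (free_on_pairs K M N) \<subseteq> H"
proof
  fix f assume "f \<in> carrier (free_on_pairs K M N)"
  moreover have "{c \<odot>\<^bsub>free_on_pairs K M N\<^esub> delta K p | c p. c \<in> carrier K \<and> p \<in> carrier M \<times> carrier N} \<subseteq> H"
    using submodule_smult[OF H] d by blast
  ultimately show "f \<in> H" using free_asum[OF K] asum_subset_submodule[OF H] by blast
qed

text \<open>Universal property of the free module. The sum defining h runs over the support; to
  compare h at f, g and f + g it is first enlarged to one finite set containing all the
  supports.\<close>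

lemma free_lift:
  fixes V (structure)
  assumes K: "cring K" and V: "module K V"
    and b: "\<And>p. p \<in> carrier M \<times> carrier N \<Longrightarrow> b p \<in> carrier V"
  shows "\<exists>h\<in>module_hom K (free_on_pairs K M N) V. \<forall>p\<in>carrier M \<times> carrier N. h (delta K p) = b p"
proof -
  interpret K: cring K by fact
  interpret V: module K V by fact
  let ?F = "free_on_pairs K M N"
  interpret F: module K ?F by (rule free_module[OF K])
  define h where "h f = (\<Oplus>p\<in>{s. f s \<noteq> \<zero>\<^bsub>K\<^esub>}. f p \<odot> b p)" for f
  have h: "h f = (\<Oplus>p\<in>P. f p \<odot> b p)" if "\<forall>s. f s \<in> carrier K" "finite P"
    "P \<subseteq> carrier M \<times> carrier N" "\<forall>s. s \<notin> P \<longrightarrow> f s = \<zero>\<^bsub>K\<^esub>" for f P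
    unfolding h_def
    by (rule V.add.finprod_mono_neutral_cong_left) (use that b in auto)
  have "h \<in> module_hom K ?F V"
  proof (rule module_homI)
    fix f assume "f \<in> carrier ?F"
    then obtain P where P: "\<forall>s. f s \<in> carrier K" "finite P" "P \<subseteq> carrier M \<times> carrier N"
      "\<forall>s. s \<notin> P \<longrightarrow> f s = \<zero>\<^bsub>K\<^esub>" by (rule free_carrierE)
    then show "h f \<in> carrier V" using b unfolding h[OF P] by (intro V.finsum_closed) auto
    show "h (r \<odot>\<^bsub>?F\<^esub> f) = r \<odot> h f" if r: "r \<in> carrier K" for r
    proof -
      have "h (r \<odot>\<^bsub>?F\<^esub> f) = (\<Oplus>p\<in>P. (r \<otimes>\<^bsub>K\<^esub> f p) \<odot> b p)"
        using h[of "r \<odot>\<^bsub>?F\<^esub> f" P] P r by simp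
      also have "\<dots> = (\<Oplus>p\<in>P. r \<odot> (f p \<odot> b p))"
        by (rule V.finsum_cong') (use P r b in \<open>auto simp: V.smult_assoc1 subset_iff\<close>)
      finally show ?thesis unfolding h[OF P] using P r b
        by (subst V.finsum_smult_ldistr) (auto simp: subset_iff)
    qed
    fix g assume "g \<in> carrier ?F"
    then obtain Q where Q: "\<forall>s. g s \<in> carrier K" "finite Q" "Q \<subseteq> carrier M \<times> carrier N"
      "\<forall>s. s \<notin> Q \<longrightarrow> g s = \<zero>\<^bsub>K\<^esub>" by (rule free_carrierE)
    have U: "finite (P \<union> Q)" "P \<union> Q \<subseteq> carrier M \<times> carrier N" using P Q by auto
    have "h f = (\<Oplus>p\<in>P\<union>Q. f p \<odot> b p)" "h g = (\<Oplus>p\<in>P\<union>Q. g p \<odot> b p)"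
      using h[OF P(1) U] h[OF Q(1) U] P(4) Q(4) by auto
    moreover have "h (f \<oplus>\<^bsub>?F\<^esub> g) = (\<Oplus>p\<in>P\<union>Q. (f p \<oplus>\<^bsub>K\<^esub> g p) \<odot> b p)"
      using h[of "f \<oplus>\<^bsub>?F\<^esub> g" "P \<union> Q"] P Q by auto
    moreover have "\<dots> = (\<Oplus>p\<in>P\<union>Q. f p \<odot> b p \<oplus> g p \<odot> b p)"
      by (rule V.finsum_cong') (use P Q U b in \<open>auto simp: V.smult_l_distr subset_iff\<close>)
    moreover have "\<dots> = (\<Oplus>p\<in>P\<union>Q. f p \<odot> b p) \<oplus> (\<Oplus>p\<in>P\<union>Q. g p \<odot> b p)"
      by (rule V.finsum_addf) (use P Q U b in \<open>auto simp: subset_iff\<close>)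
    ultimately show "h (f \<oplus>\<^bsub>?F\<^esub> g) = h f \<oplus> h g" by simp
  qed
  moreover have "h (delta K p) = b p" if p: "p \<in> carrier M \<times> carrier N" for p
  proof -
    have "h (delta K p) = (\<Oplus>q\<in>{p}. delta K p q \<odot> b q)"
      by (rule h) (use p in \<open>auto simp: delta_def\<close>)
    then show ?thesis using b[OF p] by (simp add: delta_def)
  qed
  ultimately show ?thesis by blast
qed

section \<open>The bilinear extension\<close>

text \<open>Trades the condition on \<phi> in the index set for a factor 0 or 1. The sum then runs
  over the same rectangle for every s, and bilinearity becomes a termwise identity.\<close>

lemma bilinear_ext_eq:
  assumes K: "cring K" and f: "\<forall>s. f s \<in> carrier K" "finite P" "\<forall>s. s \<notin> P \<longrightarrow> f s = \<zero>\<^bsub>K\<^esub>"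
    and g: "\<forall>s. g s \<in> carrier K" "finite Q" "\<forall>s. s \<notin> Q \<longrightarrow> g s = \<zero>\<^bsub>K\<^esub>"
  shows "bilinear_ext K \<phi> f g s =
    (\<Oplus>\<^bsub>K\<^esub>z\<in>P \<times> Q. (if \<phi> (fst z) (snd z) = s then \<one>\<^bsub>K\<^esub> else \<zero>\<^bsub>K\<^esub>) \<otimes>\<^bsub>K\<^esub> (f (fst z) \<otimes>\<^bsub>K\<^esub> g (snd z)))"
proof -
  interpret K: cring K by fact
  show ?thesis unfolding bilinear_ext_def
    by (rule K.add.finprod_mono_neutral_cong_left) (use f g in \<open>auto\<close>)
qed

context
  fixes K :: "('k, 'x) ring_scheme" (structure)
    and M1 :: "('k, 'm1, 'x1) module_scheme" and N1 :: "('k, 'n1, 'y1) module_scheme"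
    and M2 :: "('k, 'm2, 'x2) module_scheme" and N2 :: "('k, 'n2, 'y2) module_scheme"
    and M3 :: "('k, 'm3, 'x3) module_scheme" and N3 :: "('k, 'n3, 'y3) module_scheme"
    and \<phi>
  assumes K: "cring K"
    and \<phi>: "\<And>p q. p \<in> carrier M1 \<times> carrier N1 \<Longrightarrow> q \<in> carrier M2 \<times> carrier N2
      \<Longrightarrow> \<phi> p q \<in> carrier M3 \<times> carrier N3"
begin

interpretation K: cring K by (fact K)

lemma bilinear_ext_carrier:
  assumes f: "f \<in> carrier (free_on_pairs K M1 N1)" and g: "g \<in> carrier (free_on_pairs K M2 N2)"
  shows "bilinear_ext K \<phi> f g \<in> carrier (free_on_pairs K M3 N3)"
proof -
  from f obtain P where P: "\<forall>s. f s \<in> carrier K" "finite P" "P \<subseteq> carrier M1 \<times> carrier N1"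
    "\<forall>s. s \<notin> P \<longrightarrow> f s = \<zero>" by (rule free_carrierE)
  from g obtain Q where Q: "\<forall>s. g s \<in> carrier K" "finite Q" "Q \<subseteq> carrier M2 \<times> carrier N2"
    "\<forall>s. s \<notin> Q \<longrightarrow> g s = \<zero>" by (rule free_carrierE)
  note e = bilinear_ext_eq[OF K P(1,2,4) Q(1,2,4), where \<phi> = \<phi>]
  show ?thesis
  proof (rule free_carrierI[of _ _ "(\<lambda>z. \<phi> (fst z) (snd z)) ` (P \<times> Q)"])
    show "bilinear_ext K \<phi> f g s \<in> carrier K" for s unfolding e
      by (rule K.finsum_closed) (use P Q in auto)
    show "(\<lambda>z. \<phi> (fst z) (snd z)) ` (P \<times> Q) \<subseteq> carrier M3 \<times> carrier N3"
    proof
      fix y assume "y \<in> (\<lambda>z. \<phi> (fst z) (snd z)) ` (P \<times> Q)"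
      then obtain p q where "p \<in> P" "q \<in> Q" "y = \<phi> p q" by auto
      then show "y \<in> carrier M3 \<times> carrier N3" using \<phi>[of p q] P Q by blast
    qed
    show "bilinear_ext K \<phi> f g s = \<zero>" if "s \<notin> (\<lambda>z. \<phi> (fst z) (snd z)) ` (P \<times> Q)" for s
    proof -
      have "bilinear_ext K \<phi> f g s = (\<Oplus>z\<in>P \<times> Q. \<zero>)" unfolding e
        by (rule K.finsum_cong') (use that P Q in auto)
      then show ?thesis by simp
    qed
  qed (use P Q in auto)
qed

lemma bilinear_ext_delta:
  assumes "p \<in> carrier M1 \<times> carrier N1" "q \<in> carrier M2 \<times> carrier N2"
  shows "bilinear_ext K \<phi> (delta K p) (delta K q) = delta K (\<phi> p q)"
proof
  fix s
  have "bilinear_ext K \<phi> (delta K p) (delta K q) s = (\<Oplus>z\<in>{p} \<times> {q}. (if \<phi> (fst z) (snd z) = s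
      then \<one> else \<zero>) \<otimes> (delta K p (fst z) \<otimes> delta K q (snd z)))"
    by (rule bilinear_ext_eq[OF K]) (auto simp: delta_def)
  then show "bilinear_ext K \<phi> (delta K p) (delta K q) s = delta K (\<phi> p q) s"
    by (auto simp: delta_def)
qed

lemma bilinear_ext_bilin:
  "bilin K (free_on_pairs K M1 N1) (free_on_pairs K M2 N2) (free_on_pairs K M3 N3) (bilinear_ext K \<phi>)"
proof (rule bilinI; rule module_homI)
  let ?F1 = "free_on_pairs K M1 N1" and ?F2 = "free_on_pairs K M2 N2" and ?F3 = "free_on_pairs K M3 N3"
  have c: "(if b then \<one> else \<zero>) \<in> carrier K" for b by simp
  { fix f g assume f: "f \<in> carrier ?F1" and g: "g \<in> carrier ?F2"
    show "bilinear_ext K \<phi> f g \<in> carrier ?F3" "bilinear_ext K \<phi> f g \<in> carrier ?F3"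
      by (rule bilinear_ext_carrier[OF f g])+
    from f obtain P where P: "\<forall>s. f s \<in> carrier K" "finite P" "\<forall>s. s \<notin> P \<longrightarrow> f s = \<zero>"
      by (rule free_carrierE)
    from g obtain Q where Q: "\<forall>s. g s \<in> carrier K" "finite Q" "\<forall>s. s \<notin> Q \<longrightarrow> g s = \<zero>"
      by (rule free_carrierE)
    note e = bilinear_ext_eq[OF K P Q, where \<phi> = \<phi>]
    fix r assume r: "r \<in> carrier K"
    have rr: "r \<otimes> bilinear_ext K \<phi> f g s = (\<Oplus>z\<in>P \<times> Q. r \<otimes>
      ((if \<phi> (fst z) (snd z) = s then \<one> else \<zero>) \<otimes> (f (fst z) \<otimes> g (snd z))))" for s
      unfolding e by (rule K.finsum_rdistr) (use P Q r in auto)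
    show "bilinear_ext K \<phi> (r \<odot>\<^bsub>?F1\<^esub> f) g = r \<odot>\<^bsub>?F3\<^esub> bilinear_ext K \<phi> f g"
    proof
      fix s
      have "bilinear_ext K \<phi> (r \<odot>\<^bsub>?F1\<^esub> f) g s = (\<Oplus>z\<in>P \<times> Q.
        (if \<phi> (fst z) (snd z) = s then \<one> else \<zero>) \<otimes> ((r \<otimes> f (fst z)) \<otimes> g (snd z)))"
        using bilinear_ext_eq[OF K _ P(2) _ Q, where f = "r \<odot>\<^bsub>?F1\<^esub> f" and \<phi> = \<phi>] P r by simp
      also have "\<dots> = r \<otimes> bilinear_ext K \<phi> f g s" unfolding rr
        by (rule K.finsum_cong') (use P Q r in \<open>auto simp: K.m_ac c\<close>)
      finally show "bilinear_ext K \<phi> (r \<odot>\<^bsub>?F1\<^esub> f) g s = (r \<odot>\<^bsub>?F3\<^esub> bilinear_ext K \<phi> f g) s" by simp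
    qed
    show "bilinear_ext K \<phi> f (r \<odot>\<^bsub>?F2\<^esub> g) = r \<odot>\<^bsub>?F3\<^esub> bilinear_ext K \<phi> f g"
    proof
      fix s
      have "bilinear_ext K \<phi> f (r \<odot>\<^bsub>?F2\<^esub> g) s = (\<Oplus>z\<in>P \<times> Q.
        (if \<phi> (fst z) (snd z) = s then \<one> else \<zero>) \<otimes> (f (fst z) \<otimes> (r \<otimes> g (snd z))))"
        using bilinear_ext_eq[OF K P _ Q(2), where g = "r \<odot>\<^bsub>?F2\<^esub> g" and \<phi> = \<phi>] Q r by simp
      also have "\<dots> = r \<otimes> bilinear_ext K \<phi> f g s" unfolding rr
        by (rule K.finsum_cong') (use P Q r in \<open>auto simp: K.m_ac c\<close>)
      finally show "bilinear_ext K \<phi> f (r \<odot>\<^bsub>?F2\<^esub> g) s = (r \<odot>\<^bsub>?F3\<^esub> bilinear_ext K \<phi> f g) s" by simp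
    qed
  }
  fix f f' g assume f: "f \<in> carrier ?F1" and f': "f' \<in> carrier ?F1" and g: "g \<in> carrier ?F2"
  from f obtain P where P: "\<forall>s. f s \<in> carrier K" "finite P" "\<forall>s. s \<notin> P \<longrightarrow> f s = \<zero>"
    by (rule free_carrierE)
  from f' obtain P' where P': "\<forall>s. f' s \<in> carrier K" "finite P'" "\<forall>s. s \<notin> P' \<longrightarrow> f' s = \<zero>"
    by (rule free_carrierE)
  from g obtain Q where Q: "\<forall>s. g s \<in> carrier K" "finite Q" "\<forall>s. s \<notin> Q \<longrightarrow> g s = \<zero>"
    by (rule free_carrierE)
  let ?P = "P \<union> P'"
  have U: "finite ?P" using P P' by auto
  show "bilinear_ext K \<phi> (f \<oplus>\<^bsub>?F1\<^esub> f') g = bilinear_ext K \<phi> f g \<oplus>\<^bsub>?F3\<^esub> bilinear_ext K \<phi> f' g"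
  proof
    fix s
    let ?u = "\<lambda>f z. (if \<phi> (fst z) (snd z) = s then \<one> else \<zero>) \<otimes> (f (fst z) \<otimes> g (snd z))"
    have "bilinear_ext K \<phi> (f \<oplus>\<^bsub>?F1\<^esub> f') g s = (\<Oplus>z\<in>?P \<times> Q. ?u (f \<oplus>\<^bsub>?F1\<^esub> f') z)"
      by (rule bilinear_ext_eq[OF K _ U _ Q]) (use P P' in auto)
    also have "\<dots> = (\<Oplus>z\<in>?P \<times> Q. ?u f z \<oplus> ?u f' z)"
      by (rule K.finsum_cong') (use P P' Q in \<open>auto simp: K.l_distr K.r_distr c\<close>)
    also have "\<dots> = (\<Oplus>z\<in>?P \<times> Q. ?u f z) \<oplus> (\<Oplus>z\<in>?P \<times> Q. ?u f' z)"
      by (rule K.finsum_addf) (use P P' Q in auto)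
    also have "(\<Oplus>z\<in>?P \<times> Q. ?u f z) = bilinear_ext K \<phi> f g s"
      by (rule bilinear_ext_eq[OF K _ U _ Q, symmetric]) (use P in auto)
    also have "(\<Oplus>z\<in>?P \<times> Q. ?u f' z) = bilinear_ext K \<phi> f' g s"
      by (rule bilinear_ext_eq[OF K _ U _ Q, symmetric]) (use P' in auto)
    finally show "bilinear_ext K \<phi> (f \<oplus>\<^bsub>?F1\<^esub> f') g s =
      (bilinear_ext K \<phi> f g \<oplus>\<^bsub>?F3\<^esub> bilinear_ext K \<phi> f' g) s" by simp
  qed
next
  let ?F1 = "free_on_pairs K M1 N1" and ?F2 = "free_on_pairs K M2 N2" and ?F3 = "free_on_pairs K M3 N3"
  have c: "(if b then \<one> else \<zero>) \<in> carrier K" for b by simp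
  fix f g g' assume f: "f \<in> carrier ?F1" and g: "g \<in> carrier ?F2" and g': "g' \<in> carrier ?F2"
  from f obtain P where P: "\<forall>s. f s \<in> carrier K" "finite P" "\<forall>s. s \<notin> P \<longrightarrow> f s = \<zero>"
    by (rule free_carrierE)
  from g obtain Q where Q: "\<forall>s. g s \<in> carrier K" "finite Q" "\<forall>s. s \<notin> Q \<longrightarrow> g s = \<zero>"
    by (rule free_carrierE)
  from g' obtain Q' where Q': "\<forall>s. g' s \<in> carrier K" "finite Q'" "\<forall>s. s \<notin> Q' \<longrightarrow> g' s = \<zero>"
    by (rule free_carrierE)
  let ?Q = "Q \<union> Q'"
  have U: "finite ?Q" using Q Q' by auto
  show "bilinear_ext K \<phi> f (g \<oplus>\<^bsub>?F2\<^esub> g') = bilinear_ext K \<phi> f g \<oplus>\<^bsub>?F3\<^esub> bilinear_ext K \<phi> f g'"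
  proof
    fix s
    let ?u = "\<lambda>g z. (if \<phi> (fst z) (snd z) = s then \<one> else \<zero>) \<otimes> (f (fst z) \<otimes> g (snd z))"
    have "bilinear_ext K \<phi> f (g \<oplus>\<^bsub>?F2\<^esub> g') s = (\<Oplus>z\<in>P \<times> ?Q. ?u (g \<oplus>\<^bsub>?F2\<^esub> g') z)"
      by (rule bilinear_ext_eq[OF K P _ U]) (use Q Q' in auto)
    also have "\<dots> = (\<Oplus>z\<in>P \<times> ?Q. ?u g z \<oplus> ?u g' z)"
      by (rule K.finsum_cong') (use P Q Q' in \<open>auto simp: K.l_distr K.r_distr c\<close>)
    also have "\<dots> = (\<Oplus>z\<in>P \<times> ?Q. ?u g z) \<oplus> (\<Oplus>z\<in>P \<times> ?Q. ?u g' z)"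
      by (rule K.finsum_addf) (use P Q Q' in auto)
    also have "(\<Oplus>z\<in>P \<times> ?Q. ?u g z) = bilinear_ext K \<phi> f g s"
      by (rule bilinear_ext_eq[OF K P _ U, symmetric]) (use Q in auto)
    also have "(\<Oplus>z\<in>P \<times> ?Q. ?u g' z) = bilinear_ext K \<phi> f g' s"
      by (rule bilinear_ext_eq[OF K P _ U, symmetric]) (use Q' in auto)
    finally show "bilinear_ext K \<phi> f (g \<oplus>\<^bsub>?F2\<^esub> g') s =
      (bilinear_ext K \<phi> f g \<oplus>\<^bsub>?F3\<^esub> bilinear_ext K \<phi> f g') s" by simp
  qed
qed

end

declare split_paired_All [simp] free_sel [simp del]

section \<open>Tensor products\<close>

context
  fixes K :: "('k, 'x) ring_scheme"
    and M :: "('k, 'm, 'y) module_scheme" and N :: "('k, 'n, 'z) module_scheme"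
  assumes K: "cring K" and M: "module K M" and N: "module K N"
begin

private abbreviation (input) "FF \<equiv> free_on_pairs K M N"
private abbreviation (input) "HH \<equiv> tensor_relations K M N"
private abbreviation (input) "TT \<equiv> tensor_product K M N"
private abbreviation (input) "pt \<equiv> pure_tensor K M N"

interpretation M: module K M by (fact M)
interpretation N: module K N by (fact N)
interpretation F: module K "free_on_pairs K M N" by (rule free_module[OF K])

lemma delta_free: "m \<in> carrier M \<Longrightarrow> n \<in> carrier N \<Longrightarrow> delta K (m, n) \<in> carrier FF"
  by (rule delta_carrier[OF K]) simp

lemma tensor_relations_submodule: "submodule HH K FF"
  unfolding tensor_relations_def Let_def
  by (rule submodule_gen_submodule[OF free_module[OF K]])
    (auto intro!: F.minus_closed F.a_closed F.smult_closed delta_free)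

lemma tensor_rel_add_left: "m \<in> carrier M \<Longrightarrow> m' \<in> carrier M \<Longrightarrow> n \<in> carrier N \<Longrightarrow>
    delta K (m \<oplus>\<^bsub>M\<^esub> m', n) \<ominus>\<^bsub>FF\<^esub> (delta K (m, n) \<oplus>\<^bsub>FF\<^esub> delta K (m', n)) \<in> HH"
  unfolding tensor_relations_def Let_def by (rule subsetD[OF submodule_gen_incl]) blast

lemma tensor_rel_add_right: "m \<in> carrier M \<Longrightarrow> n \<in> carrier N \<Longrightarrow> n' \<in> carrier N \<Longrightarrow>
    delta K (m, n \<oplus>\<^bsub>N\<^esub> n') \<ominus>\<^bsub>FF\<^esub> (delta K (m, n) \<oplus>\<^bsub>FF\<^esub> delta K (m, n')) \<in> HH"
  unfolding tensor_relations_def Let_def by (rule subsetD[OF submodule_gen_incl]) blast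

lemma tensor_rel_smult_left: "c \<in> carrier K \<Longrightarrow> m \<in> carrier M \<Longrightarrow> n \<in> carrier N \<Longrightarrow>
    delta K (c \<odot>\<^bsub>M\<^esub> m, n) \<ominus>\<^bsub>FF\<^esub> (c \<odot>\<^bsub>FF\<^esub> delta K (m, n)) \<in> HH"
  unfolding tensor_relations_def Let_def by (rule subsetD[OF submodule_gen_incl]) blast

lemma tensor_rel_smult_right: "c \<in> carrier K \<Longrightarrow> m \<in> carrier M \<Longrightarrow> n \<in> carrier N \<Longrightarrow>
    delta K (m, c \<odot>\<^bsub>N\<^esub> n) \<ominus>\<^bsub>FF\<^esub> (c \<odot>\<^bsub>FF\<^esub> delta K (m, n)) \<in> HH"
  unfolding tensor_relations_def Let_def by (rule subsetD[OF submodule_gen_incl]) blast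

lemma tensor_relations_least:
  assumes "submodule G K FF"
    and "\<And>m m' n. m \<in> carrier M \<Longrightarrow> m' \<in> carrier M \<Longrightarrow> n \<in> carrier N \<Longrightarrow>
      delta K (m \<oplus>\<^bsub>M\<^esub> m', n) \<ominus>\<^bsub>FF\<^esub> (delta K (m, n) \<oplus>\<^bsub>FF\<^esub> delta K (m', n)) \<in> G"
    and "\<And>m n n'. m \<in> carrier M \<Longrightarrow> n \<in> carrier N \<Longrightarrow> n' \<in> carrier N \<Longrightarrow>
      delta K (m, n \<oplus>\<^bsub>N\<^esub> n') \<ominus>\<^bsub>FF\<^esub> (delta K (m, n) \<oplus>\<^bsub>FF\<^esub> delta K (m, n')) \<in> G"
    and "\<And>c m n. c \<in> carrier K \<Longrightarrow> m \<in> carrier M \<Longrightarrow> n \<in> carrier N \<Longrightarrow>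
      delta K (c \<odot>\<^bsub>M\<^esub> m, n) \<ominus>\<^bsub>FF\<^esub> (c \<odot>\<^bsub>FF\<^esub> delta K (m, n)) \<in> G"
    and "\<And>c m n. c \<in> carrier K \<Longrightarrow> m \<in> carrier M \<Longrightarrow> n \<in> carrier N \<Longrightarrow>
      delta K (m, c \<odot>\<^bsub>N\<^esub> n) \<ominus>\<^bsub>FF\<^esub> (c \<odot>\<^bsub>FF\<^esub> delta K (m, n)) \<in> G"
  shows "HH \<subseteq> G"
  unfolding tensor_relations_def Let_def
  by (rule submodule_gen_least[OF assms(1)]) (intro Un_least subsetI; elim CollectE exE conjE; simp only: assms(2-))

lemma tensor_is_module: "module K TT"
  unfolding tensor_product_def by (rule quotient_is_module[OF free_module[OF K] tensor_relations_submodule])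

lemma tensor_carrier: "carrier TT = (\<lambda>f. HH +>\<^bsub>FF\<^esub> f) ` carrier FF"
  by (simp add: tensor_product_def quotient_carrier)

lemma tensor_coset_hom: "(\<lambda>f. HH +>\<^bsub>FF\<^esub> f) \<in> module_hom K FF TT"
  unfolding tensor_product_def by (rule coset_hom[OF free_module[OF K] tensor_relations_submodule])

lemma tensor_coset_eq_iff: "f \<in> carrier FF \<Longrightarrow> g \<in> carrier FF \<Longrightarrow>
    HH +>\<^bsub>FF\<^esub> f = HH +>\<^bsub>FF\<^esub> g \<longleftrightarrow> f \<ominus>\<^bsub>FF\<^esub> g \<in> HH"
  by (rule coset_eq_iff[OF free_module[OF K] tensor_relations_submodule])

text \<open>The four families in \<open>tensor_relations\<close> are the four laws of bilinearity,
  one each.\<close>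

lemma pure_bilin: "bilin K M N TT pt"
proof (rule bilinI; rule module_homI)
  note hom = tensor_coset_hom
  fix m n assume mn: "m \<in> carrier M" "n \<in> carrier N"
  show "pt m n \<in> carrier TT" "pt m n \<in> carrier TT"
    using mn by (auto simp: pure_tensor_def tensor_carrier delta_free)
  fix c assume c: "c \<in> carrier K"
  have *: "c \<odot>\<^bsub>TT\<^esub> pt m n = HH +>\<^bsub>FF\<^esub> (c \<odot>\<^bsub>FF\<^esub> delta K (m, n))"
    using module_hom_smult[OF hom c delta_free[OF mn]] by (simp add: pure_tensor_def)
  show "pt (c \<odot>\<^bsub>M\<^esub> m) n = c \<odot>\<^bsub>TT\<^esub> pt m n" unfolding * unfolding pure_tensor_def
    by (subst tensor_coset_eq_iff) (use mn c in \<open>auto intro: delta_free tensor_rel_smult_left\<close>)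
  show "pt m (c \<odot>\<^bsub>N\<^esub> n) = c \<odot>\<^bsub>TT\<^esub> pt m n" unfolding * unfolding pure_tensor_def
    by (subst tensor_coset_eq_iff) (use mn c in \<open>auto intro: delta_free tensor_rel_smult_right\<close>)
next
  note hom = tensor_coset_hom
  fix m m' n assume mn: "m \<in> carrier M" "m' \<in> carrier M" "n \<in> carrier N"
  have *: "pt m n \<oplus>\<^bsub>TT\<^esub> pt m' n = HH +>\<^bsub>FF\<^esub> (delta K (m, n) \<oplus>\<^bsub>FF\<^esub> delta K (m', n))"
    using module_hom_add[OF hom delta_free delta_free] mn by (simp add: pure_tensor_def)
  show "pt (m \<oplus>\<^bsub>M\<^esub> m') n = pt m n \<oplus>\<^bsub>TT\<^esub> pt m' n" unfolding * unfolding pure_tensor_def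
    by (subst tensor_coset_eq_iff) (use mn in \<open>auto intro: delta_free tensor_rel_add_left\<close>)
next
  note hom = tensor_coset_hom
  fix m n n' assume mn: "m \<in> carrier M" "n \<in> carrier N" "n' \<in> carrier N"
  have *: "pt m n \<oplus>\<^bsub>TT\<^esub> pt m n' = HH +>\<^bsub>FF\<^esub> (delta K (m, n) \<oplus>\<^bsub>FF\<^esub> delta K (m, n'))"
    using module_hom_add[OF hom delta_free delta_free] mn by (simp add: pure_tensor_def)
  show "pt m (n \<oplus>\<^bsub>N\<^esub> n') = pt m n \<oplus>\<^bsub>TT\<^esub> pt m n'" unfolding * unfolding pure_tensor_def
    by (subst tensor_coset_eq_iff) (use mn in \<open>auto intro: delta_free tensor_rel_add_right\<close>)
qed

lemma pure_closed: "m \<in> carrier M \<Longrightarrow> n \<in> carrier N \<Longrightarrow> pt m n \<in> carrier TT"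
  by (rule bilin_closed[OF pure_bilin])

text \<open>The coefficient of each basis element is moved into the left factor, so pure tensors
  suffice without coefficients.\<close>

lemma tensor_asum:
  assumes "t \<in> carrier TT"
  shows "t \<in> asum TT {pt m n | m n. m \<in> carrier M \<and> n \<in> carrier N}"
proof -
  obtain f where f: "f \<in> carrier FF" "t = HH +>\<^bsub>FF\<^esub> f" using assms by (auto simp: tensor_carrier)
  let ?S = "{c \<odot>\<^bsub>FF\<^esub> delta K p | c p. c \<in> carrier K \<and> p \<in> carrier M \<times> carrier N}"
  have S: "?S \<subseteq> carrier FF" by (auto intro: delta_free)
  have "t \<in> asum TT ((\<lambda>f. HH +>\<^bsub>FF\<^esub> f) ` ?S)" unfolding f(2)
    by (rule asum_hom_image[OF free_module[OF K] tensor_is_module tensor_coset_hom S free_asum[OF K f(1)]])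
  moreover have "(\<lambda>f. HH +>\<^bsub>FF\<^esub> f) ` ?S \<subseteq> {pt m n | m n. m \<in> carrier M \<and> n \<in> carrier N}"
  proof clarify
    fix c m n assume c: "c \<in> carrier K" "m \<in> carrier M" "n \<in> carrier N"
    have "HH +>\<^bsub>FF\<^esub> (c \<odot>\<^bsub>FF\<^esub> delta K (m, n)) = pt (c \<odot>\<^bsub>M\<^esub> m) n"
      using module_hom_smult[OF tensor_coset_hom c(1) delta_free[OF c(2,3)]] bilin_smult_left[OF pure_bilin c]
      by (simp add: pure_tensor_def)
    then show "\<exists>m' n'. HH +>\<^bsub>FF\<^esub> (c \<odot>\<^bsub>FF\<^esub> delta K (m, n)) = pt m' n' \<and> m' \<in> carrier M \<and> n' \<in> carrier N"
      using c by blast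
  qed
  ultimately show ?thesis using asum_mono by blast
qed

lemma tensor_hom_eq:
  assumes V: "module K V" and h: "h \<in> module_hom K TT V" and g: "g \<in> module_hom K TT V"
    and eq: "\<And>m n. m \<in> carrier M \<Longrightarrow> n \<in> carrier N \<Longrightarrow> h (pt m n) = g (pt m n)"
    and t: "t \<in> carrier TT"
  shows "h t = g t"
  by (rule asum_hom_eq[OF tensor_is_module V h g _ _ tensor_asum[OF t]]) (use pure_closed eq in auto)

text \<open>The linear extension of \<beta> to the free module kills the relations because \<beta>
  is bilinear, hence it descends to the quotient.\<close>

lemma tensor_lift:
  assumes V: "module K V" and b: "bilin K M N V \<beta>"
  shows "\<exists>h\<in>module_hom K TT V. \<forall>m\<in>carrier M. \<forall>n\<in>carrier N. h (pt m n) = \<beta> m n"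
proof -
  interpret V: module K V by (fact V)
  obtain h where h: "h \<in> module_hom K FF V"
    and hd: "\<And>m n. m \<in> carrier M \<Longrightarrow> n \<in> carrier N \<Longrightarrow> h (delta K (m, n)) = \<beta> m n"
    using free_lift[OF K V, of M N "\<lambda>p. \<beta> (fst p) (snd p)"] bilin_closed[OF b] by auto
  note Fm = free_module[OF K, of M N]
  note d = module_hom_diff[OF Fm V h] module_hom_add[OF h] module_hom_smult[OF h]
  have "HH \<subseteq> {x \<in> carrier FF. h x = \<zero>\<^bsub>V\<^esub>}"
    by (rule tensor_relations_least[OF submodule_kernel[OF Fm V h]])
      (auto simp: delta_free d hd bilin_add_left[OF b] bilin_add_right[OF b] bilin_smult_left[OF b]
        bilin_smult_right[OF b] bilin_closed[OF b] V.diff_self)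
  then have k: "h x = \<zero>\<^bsub>V\<^esub>" if "x \<in> HH" for x using that by blast
  obtain g where "g \<in> module_hom K TT V" "\<And>x. x \<in> carrier FF \<Longrightarrow> g (HH +>\<^bsub>FF\<^esub> x) = h x"
    using quotient_lift[OF Fm V tensor_relations_submodule h k] by (auto simp: tensor_product_def)
  then show ?thesis using hd by (intro bexI[of _ g]) (auto simp: pure_tensor_def delta_free)
qed

end

text \<open>A map that is u \<times> v on basis elements sends each defining relation to a relation
  of the same kind. This is the tool for showing that operations on representatives are well
  defined.\<close>

lemma tensor_relations_hom:
  assumes K: "cring K" and M1: "module K M1" and N1: "module K N1" and M3: "module K M3" and N3: "module K N3"
    and h: "h \<in> module_hom K (free_on_pairs K M1 N1) (free_on_pairs K M3 N3)"
    and u: "u \<in> module_hom K M1 M3" and v: "v \<in> module_hom K N1 N3"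
    and hd: "\<And>m n. m \<in> carrier M1 \<Longrightarrow> n \<in> carrier N1 \<Longrightarrow> h (delta K (m, n)) = delta K (u m, v n)"
    and r: "r \<in> tensor_relations K M1 N1"
  shows "h r \<in> tensor_relations K M3 N3"
proof -
  let ?F1 = "free_on_pairs K M1 N1" and ?F3 = "free_on_pairs K M3 N3"
  note F1 = free_module[OF K, of M1 N1] and F3 = free_module[OF K, of M3 N3]
  interpret F1: module K ?F1 by (rule F1)
  interpret M1: module K M1 by (rule M1)
  interpret N1: module K N1 by (rule N1)
  note d = module_hom_diff[OF F1 F3 h] module_hom_add[OF h] module_hom_smult[OF h]
  note uv = module_hom_closed[OF u] module_hom_closed[OF v]
  have "tensor_relations K M1 N1 \<subseteq> {x \<in> carrier ?F1. h x \<in> tensor_relations K M3 N3}"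
    by (rule tensor_relations_least[OF K M1 N1 submodule_vimage[OF F1 F3 h tensor_relations_submodule[OF K M3 N3]]])
      (auto simp: delta_free[OF K M1 N1] d hd uv module_hom_add[OF u] module_hom_add[OF v]
        module_hom_smult[OF u] module_hom_smult[OF v]
        intro: tensor_rel_add_left[OF K M3 N3] tensor_rel_add_right[OF K M3 N3]
        tensor_rel_smult_left[OF K M3 N3] tensor_rel_smult_right[OF K M3 N3])
  then show ?thesis using r by blast
qed

text \<open>Common form of the multiplication of A \<otimes> B and of its action on L \<otimes> N: a
  componentwise operation, extended bilinearly and taken over all representatives.\<close>

definition tensor_act where
  "tensor_act K M3 N3 \<phi> C D = (\<Union>f\<in>C. \<Union>g\<in>D.
    tensor_relations K M3 N3 +>\<^bsub>free_on_pairs K M3 N3\<^esub> bilinear_ext K \<phi> f g)"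

context
  fixes K :: "('k, 'x) ring_scheme"
    and M1 :: "('k, 'm1, 'x1) module_scheme" and N1 :: "('k, 'n1, 'y1) module_scheme"
    and M2 :: "('k, 'm2, 'x2) module_scheme" and N2 :: "('k, 'n2, 'y2) module_scheme"
    and M3 :: "('k, 'm3, 'x3) module_scheme" and N3 :: "('k, 'n3, 'y3) module_scheme"
    and \<mu> \<nu> \<phi>
  defines phi: "\<phi> \<equiv> \<lambda>p q. (\<mu> (fst p) (fst q), \<nu> (snd p) (snd q))"
  assumes K: "cring K" and M1: "module K M1" and N1: "module K N1" and M2: "module K M2" and N2: "module K N2"
    and M3: "module K M3" and N3: "module K N3"
    and \<mu>: "bilin K M1 M2 M3 \<mu>" and \<nu>: "bilin K N1 N2 N3 \<nu>"
begin

private abbreviation (input) "F1 \<equiv> free_on_pairs K M1 N1"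
private abbreviation (input) "F2 \<equiv> free_on_pairs K M2 N2"
private abbreviation (input) "F3 \<equiv> free_on_pairs K M3 N3"
private abbreviation (input) "H1 \<equiv> tensor_relations K M1 N1"
private abbreviation (input) "H2 \<equiv> tensor_relations K M2 N2"
private abbreviation (input) "H3 \<equiv> tensor_relations K M3 N3"

interpretation F1: module K "free_on_pairs K M1 N1" by (rule free_module[OF K])
interpretation F2: module K "free_on_pairs K M2 N2" by (rule free_module[OF K])
interpretation F3: module K "free_on_pairs K M3 N3" by (rule free_module[OF K])

private lemma phi_mem: "p \<in> carrier M1 \<times> carrier N1 \<Longrightarrow> q \<in> carrier M2 \<times> carrier N2 \<Longrightarrow>
    \<phi> p q \<in> carrier M3 \<times> carrier N3"
  using bilin_closed[OF \<mu>] bilin_closed[OF \<nu>] by (auto simp: phi)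

private lemma B: "bilin K F1 F2 F3 (bilinear_ext K \<phi>)"
  by (rule bilinear_ext_bilin[OF K]) (rule phi_mem)

private lemma Bd:
  assumes "m \<in> carrier M1" "n \<in> carrier N1" "m' \<in> carrier M2" "n' \<in> carrier N2"
  shows "bilinear_ext K \<phi> (delta K (m, n)) (delta K (m', n')) = delta K (\<mu> m m', \<nu> n n')"
proof -
  have "bilinear_ext K \<phi> (delta K (m, n)) (delta K (m', n')) = delta K (\<phi> (m, n) (m', n'))"
    by (rule bilinear_ext_delta[OF K, of M1 N1 M2 N2 \<phi> M3 N3]; (rule phi_mem)?) (use assms in auto)
  then show ?thesis by (simp add: phi)
qed

text \<open>For a basis element in place of g the map is u \<times> v on basis elements, where u and
  v come from \<mu> and \<nu> by fixing the second argument. The g that work form a submodule, which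
  is therefore everything.\<close>

private lemma B_left:
  assumes r: "r \<in> H1" and g: "g \<in> carrier F2"
  shows "bilinear_ext K \<phi> r g \<in> H3"
proof -
  have rc: "r \<in> carrier F1" using r submodule_subset[OF tensor_relations_submodule[OF K M1 N1]] by blast
  let ?G = "{g \<in> carrier F2. bilinear_ext K \<phi> r g \<in> H3}"
  have "submodule ?G K F2"
    by (rule submodule_vimage[OF F2.module_axioms F3.module_axioms bilin_right[OF B rc]
          tensor_relations_submodule[OF K M3 N3]])
  moreover have "delta K q \<in> ?G" if q: "q \<in> carrier M2 \<times> carrier N2" for q
  proof -
    have qc: "delta K q \<in> carrier F2" using q by (rule delta_carrier[OF K])
    have q': "fst q \<in> carrier M2" "snd q \<in> carrier N2" using q by auto
    have "bilinear_ext K \<phi> r (delta K q) \<in> H3"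
      by (rule tensor_relations_hom[OF K M1 N1 M3 N3 bilin_left[OF B qc] bilin_left[OF \<mu> q'(1)]
            bilin_left[OF \<nu> q'(2)] _ r]) (use q in \<open>auto simp: Bd\<close>)
    then show ?thesis using qc by simp
  qed
  ultimately show ?thesis using free_subset_submodule[OF K, of ?G M2 N2] g by blast
qed

private lemma B_right:
  assumes r: "r \<in> H2" and g: "g \<in> carrier F1"
  shows "bilinear_ext K \<phi> g r \<in> H3"
proof -
  have rc: "r \<in> carrier F2" using r submodule_subset[OF tensor_relations_submodule[OF K M2 N2]] by blast
  let ?G = "{g \<in> carrier F1. bilinear_ext K \<phi> g r \<in> H3}"
  have "submodule ?G K F1"
    by (rule submodule_vimage[OF F1.module_axioms F3.module_axioms bilin_left[OF B rc]
          tensor_relations_submodule[OF K M3 N3]])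
  moreover have "delta K q \<in> ?G" if q: "q \<in> carrier M1 \<times> carrier N1" for q
  proof -
    have qc: "delta K q \<in> carrier F1" using q by (rule delta_carrier[OF K])
    have q': "fst q \<in> carrier M1" "snd q \<in> carrier N1" using q by auto
    have "bilinear_ext K \<phi> (delta K q) r \<in> H3"
      by (rule tensor_relations_hom[OF K M2 N2 M3 N3 bilin_right[OF B qc] bilin_right[OF \<mu> q'(1)]
            bilin_right[OF \<nu> q'(2)] _ r]) (use q in \<open>auto simp: Bd\<close>)
    then show ?thesis using qc by simp
  qed
  ultimately show ?thesis using free_subset_submodule[OF K, of ?G M1 N1] g by blast
qed

text \<open>The two representatives are changed one after the other; each change alters the result
  by a relation.\<close>

private lemma tensor_act_coset:
  assumes f: "f \<in> carrier F1" and g: "g \<in> carrier F2"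
  shows "tensor_act K M3 N3 \<phi> (H1 +>\<^bsub>F1\<^esub> f) (H2 +>\<^bsub>F2\<^esub> g) = H3 +>\<^bsub>F3\<^esub> bilinear_ext K \<phi> f g"
proof -
  note S1 = tensor_relations_submodule[OF K M1 N1] and S2 = tensor_relations_submodule[OF K M2 N2]
    and S3 = tensor_relations_submodule[OF K M3 N3]
  have "H3 +>\<^bsub>F3\<^esub> bilinear_ext K \<phi> f' g' = H3 +>\<^bsub>F3\<^esub> bilinear_ext K \<phi> f g"
    if f': "f' \<in> H1 +>\<^bsub>F1\<^esub> f" and g': "g' \<in> H2 +>\<^bsub>F2\<^esub> g" for f' g'
  proof -
    have f'c: "f' \<in> carrier F1" and g'c: "g' \<in> carrier F2"
      using mem_cosetD(1)[OF F1.module_axioms S1 f f'] mem_cosetD(1)[OF F2.module_axioms S2 g g'] .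
    have fd: "f' \<ominus>\<^bsub>F1\<^esub> f \<in> H1" using mem_cosetD(2)[OF F1.module_axioms S1 f f'] tensor_coset_eq_iff[OF K M1 N1 f'c f] by simp
    have gd: "g' \<ominus>\<^bsub>F2\<^esub> g \<in> H2" using mem_cosetD(2)[OF F2.module_axioms S2 g g'] tensor_coset_eq_iff[OF K M2 N2 g'c g] by simp
    note c = bilin_closed[OF B]
    have "bilinear_ext K \<phi> f' g' \<ominus>\<^bsub>F3\<^esub> bilinear_ext K \<phi> f g' \<in> H3"
      using B_left[OF fd g'c] module_hom_diff[OF F1.module_axioms F3.module_axioms bilin_left[OF B g'c] f'c f] by simp
    then have 1: "H3 +>\<^bsub>F3\<^esub> bilinear_ext K \<phi> f' g' = H3 +>\<^bsub>F3\<^esub> bilinear_ext K \<phi> f g'"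
      using tensor_coset_eq_iff[OF K M3 N3 c[OF f'c g'c] c[OF f g'c]] by simp
    have "bilinear_ext K \<phi> f g' \<ominus>\<^bsub>F3\<^esub> bilinear_ext K \<phi> f g \<in> H3"
      using B_right[OF gd f] module_hom_diff[OF F2.module_axioms F3.module_axioms bilin_right[OF B f] g'c g] by simp
    then have 2: "H3 +>\<^bsub>F3\<^esub> bilinear_ext K \<phi> f g' = H3 +>\<^bsub>F3\<^esub> bilinear_ext K \<phi> f g"
      using tensor_coset_eq_iff[OF K M3 N3 c[OF f g'c] c[OF f g]] by simp
    show ?thesis using 1 2 by simp
  qed
  moreover have "f \<in> H1 +>\<^bsub>F1\<^esub> f" "g \<in> H2 +>\<^bsub>F2\<^esub> g"
    using mem_coset_self[OF F1.module_axioms S1 f] mem_coset_self[OF F2.module_axioms S2 g] .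
  ultimately show ?thesis unfolding tensor_act_def by blast
qed

lemma tensor_act_bilin:
  "bilin K (tensor_product K M1 N1) (tensor_product K M2 N2) (tensor_product K M3 N3) (tensor_act K M3 N3 \<phi>)"
proof -
  note h1 = tensor_coset_hom[OF K M1 N1] and h2 = tensor_coset_hom[OF K M2 N2] and h3 = tensor_coset_hom[OF K M3 N3]
  note c = tensor_carrier[OF K M1 N1] tensor_carrier[OF K M2 N2] tensor_carrier[OF K M3 N3]
  show ?thesis
    by (rule bilinI; rule module_homI)
      (auto simp: c tensor_act_coset bilin_closed[OF B] module_hom_add[OF h1, symmetric]
        module_hom_add[OF h2, symmetric] module_hom_add[OF h3, symmetric] module_hom_smult[OF h1, symmetric]
        module_hom_smult[OF h2, symmetric] module_hom_smult[OF h3, symmetric]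
        bilin_add_left[OF B] bilin_add_right[OF B] bilin_smult_left[OF B] bilin_smult_right[OF B])
qed

lemma tensor_act_pure:
  assumes "m1 \<in> carrier M1" "n1 \<in> carrier N1" "m2 \<in> carrier M2" "n2 \<in> carrier N2"
  shows "tensor_act K M3 N3 \<phi> (pure_tensor K M1 N1 m1 n1) (pure_tensor K M2 N2 m2 n2)
    = pure_tensor K M3 N3 (\<mu> m1 m2) (\<nu> n1 n2)"
proof -
  have "delta K (m1, n1) \<in> carrier F1" "delta K (m2, n2) \<in> carrier F2"
    using assms by (auto intro: delta_carrier[OF K])
  then show ?thesis using assms by (simp add: pure_tensor_def tensor_act_coset Bd)
qed

end

section \<open>Restriction of scalars\<close>

lemma abelian_group_cong:
  assumes "abelian_group G" "carrier H = carrier G" "add H = add G" "\<zero>\<^bsub>H\<^esub> = \<zero>\<^bsub>G\<^esub>"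
  shows "abelian_group H"
proof -
  interpret G: abelian_group G by fact
  show ?thesis
    by (rule abelian_groupI) (use assms(2-) G.l_neg in \<open>auto simp: G.a_ac\<close>)
qed

lemma a_minus_cong:
  assumes "carrier H = carrier G" "add H = add G" "\<zero>\<^bsub>H\<^esub> = \<zero>\<^bsub>G\<^esub>"
  shows "a_inv H = a_inv G" "a_minus H = a_minus G"
proof -
  show "a_inv H = a_inv G" using assms by (simp add: a_inv_def m_inv_def fun_eq_iff)
  then show "a_minus H = a_minus G" using assms by (simp add: a_minus_def fun_eq_iff)
qed

lemma restrict_scalars_sel [simp]:
  "carrier (restrict_scalars A L) = carrier L"
  "add (restrict_scalars A L) = add L"
  "\<zero>\<^bsub>restrict_scalars A L\<^esub> = \<zero>\<^bsub>L\<^esub>"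
  by (simp_all add: restrict_scalars_def)

lemma restrict_scalars_minus [simp]:
  "a_inv (restrict_scalars A L) = a_inv L"
  "a_minus (restrict_scalars A L) = a_minus L"
  by (simp_all add: a_minus_cong[of "restrict_scalars A L" L])

lemma restrict_scalars_smult: "smult (restrict_scalars A L) = (\<lambda>c x. (c \<odot>\<^bsub>A\<^esub> \<one>\<^bsub>A\<^esub>) \<odot>\<^bsub>L\<^esub> x)"
  by (simp add: restrict_scalars_def)

text \<open>The scalars act through the ring homomorphism that sends c to c 1.\<close>

lemma restrict_scalars_module:
  assumes A: "algebra K A" and L: "module A L"
  shows "module K (restrict_scalars A L)"
proof -
  interpret A: algebra K A by fact
  interpret L: module A L by fact
  have "(a \<otimes>\<^bsub>K\<^esub> b) \<odot>\<^bsub>A\<^esub> \<one>\<^bsub>A\<^esub> = (a \<odot>\<^bsub>A\<^esub> \<one>\<^bsub>A\<^esub>) \<otimes>\<^bsub>A\<^esub> (b \<odot>\<^bsub>A\<^esub> \<one>\<^bsub>A\<^esub>)"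
    if "a \<in> carrier K" "b \<in> carrier K" for a b
    using that by (simp add: A.smult_assoc1 A.smult_assoc2)
  then show ?thesis
    by (intro moduleI)
      (auto simp: A.R_cring restrict_scalars_smult A.smult_l_distr L.smult_l_distr L.smult_r_distr
        L.smult_assoc1[symmetric] intro: abelian_group_cong[OF L.abelian_group_axioms])
qed

lemma module_hom_restrict_scalars:
  assumes A: "algebra K A" and h: "h \<in> module_hom A L M"
  shows "h \<in> module_hom K (restrict_scalars A L) (restrict_scalars A M)"
proof -
  interpret A: algebra K A by fact
  show ?thesis by (rule module_homI)
    (use h in \<open>auto simp: restrict_scalars_smult module_hom_closed module_hom_add module_hom_smult\<close>)
qed

lemma algebra_smult_smult:
  assumes A: "algebra K A" and L: "module A L" and "c \<in> carrier K" "a \<in> carrier A" "x \<in> carrier L"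
  shows "(c \<odot>\<^bsub>A\<^esub> a) \<odot>\<^bsub>L\<^esub> x = c \<odot>\<^bsub>restrict_scalars A L\<^esub> (a \<odot>\<^bsub>L\<^esub> x)"
    "a \<odot>\<^bsub>L\<^esub> (c \<odot>\<^bsub>restrict_scalars A L\<^esub> x) = c \<odot>\<^bsub>restrict_scalars A L\<^esub> (a \<odot>\<^bsub>L\<^esub> x)"
proof -
  interpret A: algebra K A by fact
  interpret L: module A L by fact
  have "c \<odot>\<^bsub>A\<^esub> a = (c \<odot>\<^bsub>A\<^esub> \<one>\<^bsub>A\<^esub>) \<otimes>\<^bsub>A\<^esub> a" using assms(3,4) by (simp add: A.smult_assoc2)
  then show *: "(c \<odot>\<^bsub>A\<^esub> a) \<odot>\<^bsub>L\<^esub> x = c \<odot>\<^bsub>restrict_scalars A L\<^esub> (a \<odot>\<^bsub>L\<^esub> x)"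
    using assms(3-5) by (simp add: restrict_scalars_smult L.smult_assoc1)
  have "(c \<odot>\<^bsub>A\<^esub> \<one>\<^bsub>A\<^esub>) \<otimes>\<^bsub>A\<^esub> a = a \<otimes>\<^bsub>A\<^esub> (c \<odot>\<^bsub>A\<^esub> \<one>\<^bsub>A\<^esub>)"
    using assms(3,4) by (intro A.m_comm) auto
  then show "a \<odot>\<^bsub>L\<^esub> (c \<odot>\<^bsub>restrict_scalars A L\<^esub> x) = c \<odot>\<^bsub>restrict_scalars A L\<^esub> (a \<odot>\<^bsub>L\<^esub> x)"
    using assms(3-5) by (simp add: restrict_scalars_smult L.smult_assoc1[symmetric])
qed

lemma smult_bilin:
  assumes A: "algebra K A" and L: "module A L"
  shows "bilin K A (restrict_scalars A L) (restrict_scalars A L) (smult L)"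
proof -
  interpret A: algebra K A by fact
  interpret L: module A L by fact
  show ?thesis
    by (rule bilinI; rule module_homI)
      (simp_all add: L.smult_l_distr L.smult_r_distr algebra_smult_smult[OF A L])
qed

lemma mult_bilin:
  assumes A: "algebra K A"
  shows "bilin K A A A (monoid.mult A)"
proof -
  interpret A: algebra K A by fact
  have "x \<otimes>\<^bsub>A\<^esub> (c \<odot>\<^bsub>A\<^esub> y) = c \<odot>\<^bsub>A\<^esub> (x \<otimes>\<^bsub>A\<^esub> y)"
    if "c \<in> carrier K" "x \<in> carrier A" "y \<in> carrier A" for c x y
    using that A.smult_assoc2[of c y x] by (simp add: A.m_comm)
  then show ?thesis
    by (intro bilinI; intro module_homI) (simp_all add: A.smult_assoc2 A.l_distr A.r_distr)
qed

text \<open>Serves the associativity laws, which thereby become identities between pure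
  tensors.\<close>

lemma trilinear_eq:
  assumes V: "module K V" and M: "module K M1" "module K M2" "module K M3"
    and S: "S1 \<subseteq> carrier M1" "S2 \<subseteq> carrier M2" "S3 \<subseteq> carrier M3"
    and sp: "carrier M1 \<subseteq> asum M1 S1" "carrier M2 \<subseteq> asum M2 S2" "carrier M3 \<subseteq> asum M3 S3"
    and u: "\<And>y z. y \<in> carrier M2 \<Longrightarrow> z \<in> carrier M3 \<Longrightarrow> (\<lambda>x. u x y z) \<in> module_hom K M1 V"
      "\<And>x z. x \<in> carrier M1 \<Longrightarrow> z \<in> carrier M3 \<Longrightarrow> (\<lambda>y. u x y z) \<in> module_hom K M2 V"
      "\<And>x y. x \<in> carrier M1 \<Longrightarrow> y \<in> carrier M2 \<Longrightarrow> u x y \<in> module_hom K M3 V"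
    and v: "\<And>y z. y \<in> carrier M2 \<Longrightarrow> z \<in> carrier M3 \<Longrightarrow> (\<lambda>x. v x y z) \<in> module_hom K M1 V"
      "\<And>x z. x \<in> carrier M1 \<Longrightarrow> z \<in> carrier M3 \<Longrightarrow> (\<lambda>y. v x y z) \<in> module_hom K M2 V"
      "\<And>x y. x \<in> carrier M1 \<Longrightarrow> y \<in> carrier M2 \<Longrightarrow> v x y \<in> module_hom K M3 V"
    and eq: "\<And>x y z. x \<in> S1 \<Longrightarrow> y \<in> S2 \<Longrightarrow> z \<in> S3 \<Longrightarrow> u x y z = v x y z"
    and xyz: "x \<in> carrier M1" "y \<in> carrier M2" "z \<in> carrier M3"
  shows "u x y z = v x y z"
proof (rule asum_hom_eq[OF M(1) V u(1) v(1) S(1), OF xyz(2,3) xyz(2,3)])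
  show "x \<in> asum M1 S1" using xyz sp by blast
  fix x assume x: "x \<in> S1"
  then have xc: "x \<in> carrier M1" using S by blast
  show "u x y z = v x y z"
  proof (rule asum_hom_eq[OF M(2) V u(2) v(2) S(2), OF xc xyz(3) xc xyz(3)])
    show "y \<in> asum M2 S2" using xyz sp by blast
    fix y assume y: "y \<in> S2"
    then have yc: "y \<in> carrier M2" using S by blast
    show "u x y z = v x y z"
      by (rule asum_hom_eq[OF M(3) V u(3) v(3) S(3), OF xc yc xc yc]) (use eq x y xyz sp in auto)
  qed
qed

lemma bilinear_eq:
  assumes V: "module K V" and M: "module K M1" "module K M2"
    and S: "S1 \<subseteq> carrier M1" "S2 \<subseteq> carrier M2"
    and sp: "carrier M1 \<subseteq> asum M1 S1" "carrier M2 \<subseteq> asum M2 S2"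
    and u: "bilin K M1 M2 V u" and v: "bilin K M1 M2 V v"
    and eq: "\<And>x y. x \<in> S1 \<Longrightarrow> y \<in> S2 \<Longrightarrow> u x y = v x y"
    and xy: "x \<in> carrier M1" "y \<in> carrier M2"
  shows "u x y = v x y"
proof (rule asum_hom_eq[OF M(1) V bilin_left[OF u xy(2)] bilin_left[OF v xy(2)] S(1)])
  show "x \<in> asum M1 S1" using xy sp by blast
  fix x assume x: "x \<in> S1"
  then have xc: "x \<in> carrier M1" using S by blast
  show "u x y = v x y"
    by (rule asum_hom_eq[OF M(2) V bilin_right[OF u xc] bilin_right[OF v xc] S(2)])
      (use eq x xy sp in auto)
qed

section \<open>Tensor products of algebras and of modules over them\<close>

locale tensor_algebra =
  fixes K :: "('k, 'x) ring_scheme" and A :: "('k, 'a, 'y) module_scheme" and B :: "('k, 'b, 'z) module_scheme"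
  assumes algA: "algebra K A" and algB: "algebra K B"
begin

abbreviation "R \<equiv> tensor_product K A B"

lemma cringK: "cring K" using algA by (simp add: algebra_def module_def)
lemma modA: "module K A" using algA by (simp add: algebra_def)
lemma modB: "module K B" using algB by (simp add: algebra_def)
lemma modR: "module K R" by (rule tensor_is_module[OF cringK modA modB])

lemma cringA: "cring A" using algA by (simp add: algebra_def)
lemma cringB: "cring B" using algB by (simp add: algebra_def)

sublocale K: cring K by (rule cringK)
sublocale A: algebra K A by (rule algA)
sublocale B: algebra K B by (rule algB)

abbreviation "pR \<equiv> pure_tensor K A B"

definition "puresR = {pR a b | a b. a \<in> carrier A \<and> b \<in> carrier B}"

lemma pR_closed: "a \<in> carrier A \<Longrightarrow> b \<in> carrier B \<Longrightarrow> pR a b \<in> carrier R"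
  by (rule pure_closed[OF cringK modA modB])

lemma puresR_carrier: "puresR \<subseteq> carrier R" by (auto simp: puresR_def pR_closed)

lemma carrier_R_asum: "carrier R \<subseteq> asum R puresR"
  unfolding puresR_def using tensor_asum[OF cringK modA modB] by blast

text \<open>The multiplication of \<open>tensor_product\<close> is \<open>rcoset_mult\<close> on the
  free module; unfolded, it is an instance of \<open>tensor_act\<close> and inherits its
  bilinearity.\<close>

lemma multR_act: "monoid.mult R = tensor_act K A B (\<lambda>p q. (fst p \<otimes>\<^bsub>A\<^esub> fst q, snd p \<otimes>\<^bsub>B\<^esub> snd q))"
  by (simp add: fun_eq_iff tensor_product_def quotient_module_def rcoset_mult_def tensor_act_def)
    (simp add: free_on_pairs_def)

lemma oneR: "\<one>\<^bsub>R\<^esub> = pR \<one>\<^bsub>A\<^esub> \<one>\<^bsub>B\<^esub>"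
  by (simp add: tensor_product_def quotient_module_def pure_tensor_def) (simp add: free_on_pairs_def)

lemma multR_bilin: "bilin K R R R (monoid.mult R)"
  unfolding multR_act
  by (rule tensor_act_bilin[OF cringK modA modB modA modB modA modB mult_bilin[OF algA] mult_bilin[OF algB]])

lemma multR_pure: "a \<in> carrier A \<Longrightarrow> b \<in> carrier B \<Longrightarrow> a' \<in> carrier A \<Longrightarrow> b' \<in> carrier B \<Longrightarrow>
    pR a b \<otimes>\<^bsub>R\<^esub> pR a' b' = pR (a \<otimes>\<^bsub>A\<^esub> a') (b \<otimes>\<^bsub>B\<^esub> b')"
  unfolding multR_act
  by (rule tensor_act_pure[OF cringK modA modB modA modB modA modB mult_bilin[OF algA] mult_bilin[OF algB]])

text \<open>Distributivity is bilinearity. The other ring axioms are identities between multilinear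
  maps and reduce to pure tensors, that is, to the same axioms in A and in B.\<close>

lemma R_alg: "algebra K R"
proof -
  interpret R: module K R by (rule modR)
  note cl = bilin_closed[OF multR_bilin]
  note hl = bilin_left[OF multR_bilin] and hr = bilin_right[OF multR_bilin]
  have one: "\<one>\<^bsub>R\<^esub> \<in> carrier R" by (simp add: oneR pR_closed)
  have comm: "x \<otimes>\<^bsub>R\<^esub> y = y \<otimes>\<^bsub>R\<^esub> x" if "x \<in> carrier R" "y \<in> carrier R" for x y
    by (rule bilinear_eq[OF modR modR modR puresR_carrier puresR_carrier carrier_R_asum carrier_R_asum
          multR_bilin, where v = "\<lambda>x y. y \<otimes>\<^bsub>R\<^esub> x"])
      (use that hl hr in \<open>auto intro!: bilinI simp: puresR_def multR_pure A.m_comm B.m_comm\<close>)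
  have assoc: "x \<otimes>\<^bsub>R\<^esub> y \<otimes>\<^bsub>R\<^esub> z = x \<otimes>\<^bsub>R\<^esub> (y \<otimes>\<^bsub>R\<^esub> z)" if "x \<in> carrier R" "y \<in> carrier R" "z \<in> carrier R" for x y z
  proof (rule trilinear_eq[OF modR modR modR modR puresR_carrier puresR_carrier puresR_carrier carrier_R_asum
        carrier_R_asum carrier_R_asum, where u = "\<lambda>x y z. x \<otimes>\<^bsub>R\<^esub> y \<otimes>\<^bsub>R\<^esub> z" and v = "\<lambda>x y z. x \<otimes>\<^bsub>R\<^esub> (y \<otimes>\<^bsub>R\<^esub> z)"])
    show "x \<otimes>\<^bsub>R\<^esub> y \<otimes>\<^bsub>R\<^esub> z = x \<otimes>\<^bsub>R\<^esub> (y \<otimes>\<^bsub>R\<^esub> z)" if "x \<in> puresR" "y \<in> puresR" "z \<in> puresR" for x y z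
      using that by (auto simp: puresR_def multR_pure A.m_assoc B.m_assoc)
  qed (use that in \<open>auto intro: cl hl hr module_hom_comp[OF hl hl] module_hom_comp[OF hr hl]
      module_hom_comp[OF hl hr] module_hom_comp[OF hr hr]\<close>)
  have onel: "\<one>\<^bsub>R\<^esub> \<otimes>\<^bsub>R\<^esub> x = x" if "x \<in> carrier R" for x
    by (rule asum_hom_eq[OF modR modR hr[OF one], where g = "\<lambda>x. x", OF _ puresR_carrier])
      (use that carrier_R_asum in \<open>auto intro: module_homI simp: oneR puresR_def multR_pure\<close>)
  have "comm_monoid R"
    by (rule comm_monoidI) (use cl one assoc onel comm in auto)
  then have "cring R"
    by (intro cringI) (auto simp: R.abelian_group_axioms module_hom_add[OF hl])
  then show ?thesis
    by (intro algebraI) (auto simp: cringK R.smult_l_distr R.smult_r_distr R.smult_assoc1 module_hom_smult[OF hl])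
qed

end

locale tensor_mod = tensor_algebra K A B for K :: "('k, 'x) ring_scheme"
    and A :: "('k, 'a, 'y) module_scheme" and B :: "('k, 'b, 'z) module_scheme" +
  fixes E :: "('a, 'e, 'u) module_scheme" and F :: "('b, 'f, 'v) module_scheme"
  assumes modE: "module A E" and modF: "module B F"
begin

sublocale E: module A E by (rule modE)
sublocale F: module B F by (rule modF)

abbreviation "E' \<equiv> restrict_scalars A E"
abbreviation "F' \<equiv> restrict_scalars B F"
abbreviation "T \<equiv> tensor_product K E' F'"
abbreviation "Xm \<equiv> tensor_module K A B E F"
abbreviation pX (infixl "\<star>" 70) where "pX \<equiv> pure_tensor K E' F'"
abbreviation actX (infixl "\<cdot>" 70) where "actX \<equiv> smult Xm"

definition "puresX = {e \<star> f | e f. e \<in> carrier E \<and> f \<in> carrier F}"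

lemma modE': "module K E'" by (rule restrict_scalars_module[OF algA modE])
lemma modF': "module K F'" by (rule restrict_scalars_module[OF algB modF])
lemma modT: "module K T" by (rule tensor_is_module[OF cringK modE' modF'])

sublocale E': module K E' by (rule modE')
sublocale F': module K F' by (rule modF')
sublocale T: module K T by (rule modT)

lemma X_sel [simp]: "carrier Xm = carrier T" "add Xm = add T" "\<zero>\<^bsub>Xm\<^esub> = \<zero>\<^bsub>T\<^esub>"
  by (simp_all add: tensor_module_def Let_def)

lemma X_minus [simp]: "a_inv Xm = a_inv T" "a_minus Xm = a_minus T"
  by (simp_all add: a_minus_cong[of Xm T])

lemma X_asum [simp]: "asum Xm S = asum T S"
proof -
  have "x \<in> asum T S" if "x \<in> asum Xm S" for x
    using that by induction (auto intro: asum.intros)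
  moreover have "x \<in> asum Xm S" if "x \<in> asum T S" for x
    using that by induction (use asum.zero[of Xm S] asum.add[of _ S _ Xm] in auto)
  ultimately show ?thesis by blast
qed

lemma smultX_act: "smult Xm = tensor_act K E' F' (\<lambda>p q. (fst p \<odot>\<^bsub>E\<^esub> fst q, snd p \<odot>\<^bsub>F\<^esub> snd q))"
  by (simp add: fun_eq_iff tensor_module_def Let_def tensor_act_def)

lemma smultX_bilin: "bilin K R T T (smult Xm)"
  unfolding smultX_act
  by (rule tensor_act_bilin[OF cringK modA modB modE' modF' modE' modF' smult_bilin[OF algA modE] smult_bilin[OF algB modF]])

lemma smultX_pure: "a \<in> carrier A \<Longrightarrow> b \<in> carrier B \<Longrightarrow> e \<in> carrier E \<Longrightarrow> f \<in> carrier F \<Longrightarrow>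
    pR a b \<cdot> (e \<star> f) = (a \<odot>\<^bsub>E\<^esub> e) \<star> (b \<odot>\<^bsub>F\<^esub> f)"
  unfolding smultX_act
  by (rule tensor_act_pure[OF cringK modA modB modE' modF' modE' modF' smult_bilin[OF algA modE] smult_bilin[OF algB modF]])
    simp_all

lemma pX_bilin: "bilin K E' F' T pX" by (rule pure_bilin[OF cringK modE' modF'])

lemma pX_closed [simp]: "e \<in> carrier E \<Longrightarrow> f \<in> carrier F \<Longrightarrow> e \<star> f \<in> carrier T"
  using bilin_closed[OF pX_bilin] by simp

lemma puresX_carrier: "puresX \<subseteq> carrier T" by (auto simp: puresX_def)

lemma carrier_T_asum: "carrier T \<subseteq> asum T puresX"
  unfolding puresX_def using tensor_asum[OF cringK modE' modF'] by auto

lemma modX: "module R Xm"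
proof -
  interpret R: algebra K R by (rule R_alg)
  note cl = bilin_closed[OF smultX_bilin]
  note hl = bilin_left[OF smultX_bilin] and hr = bilin_right[OF smultX_bilin]
  note ml = bilin_left[OF multR_bilin] and mr = bilin_right[OF multR_bilin]
  have assoc: "(x \<otimes>\<^bsub>R\<^esub> y) \<cdot> z = x \<cdot> (y \<cdot> z)" if "x \<in> carrier R" "y \<in> carrier R" "z \<in> carrier T" for x y z
  proof (rule trilinear_eq[OF modT modR modR modT puresR_carrier puresR_carrier puresX_carrier carrier_R_asum
        carrier_R_asum carrier_T_asum, where u = "\<lambda>x y z. (x \<otimes>\<^bsub>R\<^esub> y) \<cdot> z" and v = "\<lambda>x y z. x \<cdot> (y \<cdot> z)"])
    show "(x \<otimes>\<^bsub>R\<^esub> y) \<cdot> z = x \<cdot> (y \<cdot> z)" if "x \<in> puresR" "y \<in> puresR" "z \<in> puresX" for x y z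
      using that by (auto simp: puresR_def puresX_def multR_pure smultX_pure E.smult_assoc1 F.smult_assoc1)
  qed (use that in \<open>auto intro: cl hl hr bilin_closed[OF multR_bilin] module_hom_comp[OF ml hl] module_hom_comp[OF mr hl]
      module_hom_comp[OF hl hr] module_hom_comp[OF hr hr]\<close>)
  have one: "\<one>\<^bsub>R\<^esub> \<cdot> x = x" if "x \<in> carrier T" for x
    by (rule asum_hom_eq[OF modT modT hr[OF R.one_closed], where g = "\<lambda>x. x", OF _ puresX_carrier])
      (use that carrier_T_asum in \<open>auto intro: module_homI simp: oneR puresX_def smultX_pure\<close>)
  show ?thesis
    by (rule moduleI) (auto simp: R.cring_axioms cl one assoc module_hom_add[OF hl] module_hom_add[OF hr]
        intro: abelian_group_cong[OF T.abelian_group_axioms])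
qed

sublocale R: algebra K R by (rule R_alg)
sublocale Xm: module R Xm by (rule modX)

text \<open>The K-structure of T as a tensor product agrees with the one induced from R, so that
  R-submodules are also K-submodules.\<close>

lemma smult_one_act:
  assumes c: "c \<in> carrier K" and t: "t \<in> carrier T"
  shows "(c \<odot>\<^bsub>R\<^esub> \<one>\<^bsub>R\<^esub>) \<cdot> t = c \<odot>\<^bsub>T\<^esub> t"
  using bilin_smult_left[OF smultX_bilin c R.one_closed t] Xm.smult_one t by simp

lemma submodule_X_imp_T:
  assumes "submodule H R Xm" shows "submodule H K T"
proof (rule submoduleI'[OF modT])
  show "H \<subseteq> carrier T" using submodule_subset[OF assms] by auto
  show "\<zero>\<^bsub>T\<^esub> \<in> H" using submodule_zero[OF assms] by simp
  show "x \<oplus>\<^bsub>T\<^esub> y \<in> H" if "x \<in> H" "y \<in> H" for x y using submodule_add[OF assms that] by simp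
  show "c \<odot>\<^bsub>T\<^esub> x \<in> H" if "c \<in> carrier K" "x \<in> H" for c x
    using submodule_smult[OF assms, of "c \<odot>\<^bsub>R\<^esub> \<one>\<^bsub>R\<^esub>" x] smult_one_act[OF that(1)] that submodule_subset[OF assms that(2)]
    by simp
qed

end

section \<open>Baer's criterion\<close>

lemma module_cring: "module R M \<Longrightarrow> cring R"
  by (simp add: module_def)

text \<open>As with \<open>submoduleI'\<close>, negatives are multiples by -1.\<close>

lemma cring_idealI:
  assumes R: "cring R" and sub: "I \<subseteq> carrier R" and z: "\<zero>\<^bsub>R\<^esub> \<in> I"
    and a: "\<And>x y. x \<in> I \<Longrightarrow> y \<in> I \<Longrightarrow> x \<oplus>\<^bsub>R\<^esub> y \<in> I"
    and m: "\<And>r x. r \<in> carrier R \<Longrightarrow> x \<in> I \<Longrightarrow> r \<otimes>\<^bsub>R\<^esub> x \<in> I"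
  shows "ideal I R"
proof -
  interpret R: cring R by fact
  have n: "\<ominus>\<^bsub>R\<^esub> x \<in> I" if "x \<in> I" for x
    using m[of "\<ominus>\<^bsub>R\<^esub> \<one>\<^bsub>R\<^esub>" x] that sub by (auto simp: R.l_minus)
  show ?thesis
  proof (rule idealI[OF R.ring_axioms])
    show "subgroup I (add_monoid R)"
      by (rule subgroup.intro) (use sub z a n in \<open>auto simp: a_inv_def\<close>)
    show "x \<otimes>\<^bsub>R\<^esub> b \<in> I" "b \<otimes>\<^bsub>R\<^esub> x \<in> I" if "b \<in> I" "x \<in> carrier R" for b x
      using m[OF that(2,1)] that sub by (auto simp: R.m_comm)
  qed
qed

text \<open>Injectivity tested on ideals only: every homomorphism from an ideal is multiplication by
  some e. In contrast to \<open>injective_module\<close> no type of test modules occurs, so it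
  serves for extension problems in modules of any type.\<close>

definition baer_module :: "('a, 'x) ring_scheme \<Rightarrow> ('a, 'q, 'y) module_scheme \<Rightarrow> bool" where
  "baer_module R Q \<longleftrightarrow> module R Q \<and> (\<forall>I h. ideal I R \<longrightarrow> h \<in> I \<rightarrow> carrier Q \<longrightarrow>
     (\<forall>x\<in>I. \<forall>y\<in>I. h (x \<oplus>\<^bsub>R\<^esub> y) = h x \<oplus>\<^bsub>Q\<^esub> h y) \<longrightarrow>
     (\<forall>r\<in>carrier R. \<forall>x\<in>I. h (r \<otimes>\<^bsub>R\<^esub> x) = r \<odot>\<^bsub>Q\<^esub> h x) \<longrightarrow>
     (\<exists>e\<in>carrier Q. \<forall>x\<in>I. h x = x \<odot>\<^bsub>Q\<^esub> e))"

text \<open>Baer's criterion. Zorn's lemma is applied to graphs of partial homomorphisms containing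
  that of h, where an upper bound of a chain is just its union; a maximal graph is total.\<close>

lemma baer_extend:
  fixes R :: "('a, 'x) ring_scheme" and Y :: "('a, 'y, 'u) module_scheme" and Q :: "('a, 'q, 'v) module_scheme" (structure)
  assumes Q: "baer_module R Q" and Y: "module R Y" and S: "submodule S R Y"
    and h: "h \<in> module_hom R (Y\<lparr>carrier := S\<rparr>) Q"
  shows "\<exists>g\<in>module_hom R Y Q. \<forall>x\<in>S. g x = h x"
proof -
  have mQ: "module R Q" using Q by (simp add: baer_module_def)
  interpret Q: module R Q by (rule mQ)
  interpret Y: module R Y by (rule Y)
  note Sc = submodule_subset[OF S]
  have hS: "h x \<in> carrier Q" if "x \<in> S" for x using module_hom_closed[OF h] that by simp
  have h_add: "h (x \<oplus>\<^bsub>Y\<^esub> y) = h x \<oplus> h y" if "x \<in> S" "y \<in> S" for x y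
    using module_hom_add[OF h] that by simp
  have h_smult: "h (r \<odot>\<^bsub>Y\<^esub> x) = r \<odot> h x" if "r \<in> carrier R" "x \<in> S" for r x
    using module_hom_smult[OF h] that by simp
  have h0: "h \<zero>\<^bsub>Y\<^esub> = \<zero>"
    using module_hom_zero[OF submodule_module[OF Y S] mQ h] by simp
  define gr where "gr = {(x, h x) | x. x \<in> S}"
  \<comment> \<open>For a relation closed under addition and scalars, being single-valued reduces to
    the value at zero.\<close>
  define good where "good G \<longleftrightarrow> G \<subseteq> carrier Y \<times> carrier Q \<and>
    (\<forall>y q y' q'. (y, q) \<in> G \<longrightarrow> (y', q') \<in> G \<longrightarrow> (y \<oplus>\<^bsub>Y\<^esub> y', q \<oplus> q') \<in> G) \<and>
    (\<forall>r y q. r \<in> carrier R \<longrightarrow> (y, q) \<in> G \<longrightarrow> (r \<odot>\<^bsub>Y\<^esub> y, r \<odot> q) \<in> G) \<and>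
    (\<forall>q. (\<zero>\<^bsub>Y\<^esub>, q) \<in> G \<longrightarrow> q = \<zero>)" for G
  have goodD: "\<And>y q. good G \<Longrightarrow> (y, q) \<in> G \<Longrightarrow> y \<in> carrier Y \<and> q \<in> carrier Q"
    "\<And>y q y' q'. good G \<Longrightarrow> (y, q) \<in> G \<Longrightarrow> (y', q') \<in> G \<Longrightarrow> (y \<oplus>\<^bsub>Y\<^esub> y', q \<oplus> q') \<in> G"
    "\<And>r y q. good G \<Longrightarrow> r \<in> carrier R \<Longrightarrow> (y, q) \<in> G \<Longrightarrow> (r \<odot>\<^bsub>Y\<^esub> y, r \<odot> q) \<in> G"
    "\<And>q. good G \<Longrightarrow> (\<zero>\<^bsub>Y\<^esub>, q) \<in> G \<Longrightarrow> q = \<zero>" for G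
    by (auto simp: good_def)
  have "good gr" unfolding good_def
  proof (intro conjI allI impI)
    show "gr \<subseteq> carrier Y \<times> carrier Q" using Sc hS by (auto simp: gr_def)
    show "(y \<oplus>\<^bsub>Y\<^esub> y', q \<oplus> q') \<in> gr" if "(y, q) \<in> gr" "(y', q') \<in> gr" for y q y' q'
      using that h_add submodule_add[OF S] by (auto simp: gr_def)
    show "(r \<odot>\<^bsub>Y\<^esub> y, r \<odot> q) \<in> gr" if "r \<in> carrier R" "(y, q) \<in> gr" for r y q
      using that h_smult submodule_smult[OF S] by (auto simp: gr_def)
    show "q = \<zero>" if "(\<zero>\<^bsub>Y\<^esub>, q) \<in> gr" for q using that h0 by (auto simp: gr_def)
  qed
  define \<G> where "\<G> = {G. good G \<and> gr \<subseteq> G}"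
  have "\<exists>G\<in>\<G>. \<forall>G'\<in>\<G>. G \<subseteq> G' \<longrightarrow> G' = G"
  proof (rule subset_Zorn_nonempty)
    show "\<G> \<noteq> {}" using \<open>good gr\<close> by (auto simp: \<G>_def)
    fix C assume C: "C \<noteq> {}" "subset.chain \<G> C"
    have good: "good G" if "G \<in> C" for G using C that by (auto simp: subset.chain_def \<G>_def)
    have "good (\<Union>C)" unfolding good_def
    proof (intro conjI allI impI)
      show "\<Union>C \<subseteq> carrier Y \<times> carrier Q" using goodD(1)[OF good] by auto
      show "(y \<oplus>\<^bsub>Y\<^esub> y', q \<oplus> q') \<in> \<Union>C" if yq: "(y, q) \<in> \<Union>C" "(y', q') \<in> \<Union>C" for y q y' q'
      proof -
        obtain G G' where G: "G \<in> C" "G' \<in> C" "(y, q) \<in> G" "(y', q') \<in> G'" using yq by blast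
        then have "G \<subseteq> G' \<or> G' \<subseteq> G" using C by (auto simp: subset.chain_def)
        then show ?thesis using G goodD(2)[OF good] by blast
      qed
      show "(r \<odot>\<^bsub>Y\<^esub> y, r \<odot> q) \<in> \<Union>C" if "r \<in> carrier R" "(y, q) \<in> \<Union>C" for r y q
        using that goodD(3)[OF good] by blast
      show "q = \<zero>" if "(\<zero>\<^bsub>Y\<^esub>, q) \<in> \<Union>C" for q using that goodD(4)[OF good] by blast
    qed
    moreover have "gr \<subseteq> \<Union>C"
    proof -
      obtain G where "G \<in> C" using C(1) by blast
      moreover have "gr \<subseteq> G" using C(2) \<open>G \<in> C\<close> by (auto simp: subset.chain_def \<G>_def)
      ultimately show ?thesis using Union_upper subset_trans by metis
    qed
    ultimately show "\<Union>C \<in> \<G>" by (simp add: \<G>_def)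
  qed
  then obtain G where G_mem: "G \<in> \<G>" and G_max: "\<forall>G'\<in>\<G>. G \<subseteq> G' \<longrightarrow> G' = G" by blast
  have G: "good G" "gr \<subseteq> G" using G_mem by (simp_all add: \<G>_def)
  have max: "G' = G" if "good G'" "gr \<subseteq> G'" "G \<subseteq> G'" for G'
    using G_max that by (simp add: \<G>_def)
  note GD = goodD[OF G(1)]
  have G0: "(\<zero>\<^bsub>Y\<^esub>, \<zero>) \<in> G" using G(2) h0 submodule_zero[OF S] by (force simp: gr_def)
  have Gneg: "(\<ominus>\<^bsub>Y\<^esub> y, \<ominus> q) \<in> G" if "(y, q) \<in> G" for y q
    using GD(3)[OF _ that, of "\<ominus>\<^bsub>R\<^esub> \<one>\<^bsub>R\<^esub>"] GD(1)[OF that] module_smult_minus_one[OF Y]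
      module_smult_minus_one[OF mQ] by simp
  have single: "q = q'" if "(y, q) \<in> G" "(y, q') \<in> G" for y q q'
  proof -
    have "(y \<oplus>\<^bsub>Y\<^esub> \<ominus>\<^bsub>Y\<^esub> y, q \<oplus> \<ominus> q') \<in> G" by (rule GD(2)[OF that(1) Gneg[OF that(2)]])
    then have "q \<ominus> q' = \<zero>" using GD(1)[OF that(1)] GD(4) by (simp add: Y.r_neg a_minus_def)
    then show ?thesis using GD(1) that Q.diff_zero_imp_eq by blast
  qed
  \<comment> \<open>The r that move y into the domain of G form an ideal, on which G induces a
    homomorphism f. The Baer property turns f into multiplication by e, and e can serve as a value
    at y.\<close>
  have total: "\<exists>q. (y, q) \<in> G" if y: "y \<in> carrier Y" for y
  proof -
    define I where "I = {r \<in> carrier R. \<exists>q. (r \<odot>\<^bsub>Y\<^esub> y, q) \<in> G}"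
    define f where "f r = (THE q. (r \<odot>\<^bsub>Y\<^esub> y, q) \<in> G)" for r
    have f: "(r \<odot>\<^bsub>Y\<^esub> y, f r) \<in> G" if "r \<in> I" for r
      unfolding f_def by (rule theI') (use that single in \<open>auto simp: I_def\<close>)
    have fI: "r \<in> I" "f r = q" if rq: "r \<in> carrier R" "(r \<odot>\<^bsub>Y\<^esub> y, q) \<in> G" for r q
    proof -
      show r: "r \<in> I" using rq by (auto simp: I_def)
      show "f r = q" by (rule single[OF f[OF r] rq(2)])
    qed
    have Ic: "r \<in> carrier R" if "r \<in> I" for r using that by (simp add: I_def)
    have add: "r \<oplus>\<^bsub>R\<^esub> s \<in> I" "f (r \<oplus>\<^bsub>R\<^esub> s) = f r \<oplus> f s" if "r \<in> I" "s \<in> I" for r s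
      using fI[of "r \<oplus>\<^bsub>R\<^esub> s"] GD(2)[OF f[OF that(1)] f[OF that(2)]] Ic that y
      by (auto simp: Y.smult_l_distr)
    have mult: "r \<otimes>\<^bsub>R\<^esub> s \<in> I" "f (r \<otimes>\<^bsub>R\<^esub> s) = r \<odot> f s" if "r \<in> carrier R" "s \<in> I" for r s
      using fI[of "r \<otimes>\<^bsub>R\<^esub> s"] GD(3)[OF that(1) f[OF that(2)]] Ic that y
      by (auto simp: Y.smult_assoc1)
    have "ideal I R"
      by (rule cring_idealI[OF module_cring[OF Y.module_axioms]])
       (use G0 y add mult in \<open>auto simp: I_def intro!: exI[of _ "\<zero>"]\<close>)
    moreover have "f \<in> I \<rightarrow> carrier Q" using GD(1) f by blast
    ultimately obtain e where e: "e \<in> carrier Q" "\<And>r. r \<in> I \<Longrightarrow> f r = r \<odot> e"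
      using Q add(2) mult(2) unfolding baer_module_def by metis
    define G' where "G' = {(s \<oplus>\<^bsub>Y\<^esub> r \<odot>\<^bsub>Y\<^esub> y, q \<oplus> r \<odot> e) | s q r. (s, q) \<in> G \<and> r \<in> carrier R}"
    have "good G'" unfolding good_def
    proof (intro conjI allI impI)
      show "G' \<subseteq> carrier Y \<times> carrier Q" using GD(1) y e by (auto simp: G'_def)
    next
      fix a b a' b' assume "(a, b) \<in> G'" "(a', b') \<in> G'"
      then obtain s q r s' q' r' where *: "(s, q) \<in> G" "(s', q') \<in> G" "r \<in> carrier R" "r' \<in> carrier R"
        "a = s \<oplus>\<^bsub>Y\<^esub> r \<odot>\<^bsub>Y\<^esub> y" "b = q \<oplus> r \<odot> e" "a' = s' \<oplus>\<^bsub>Y\<^esub> r' \<odot>\<^bsub>Y\<^esub> y" "b' = q' \<oplus> r' \<odot> e"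
        unfolding G'_def by blast
      have "a \<oplus>\<^bsub>Y\<^esub> a' = (s \<oplus>\<^bsub>Y\<^esub> s') \<oplus>\<^bsub>Y\<^esub> (r \<oplus>\<^bsub>R\<^esub> r') \<odot>\<^bsub>Y\<^esub> y"
        "b \<oplus> b' = (q \<oplus> q') \<oplus> (r \<oplus>\<^bsub>R\<^esub> r') \<odot> e"
        using * GD(1)[OF *(1)] GD(1)[OF *(2)] y e(1)
        by (simp_all add: Y.smult_l_distr Q.smult_l_distr Y.a_ac Q.a_ac)
      then show "(a \<oplus>\<^bsub>Y\<^esub> a', b \<oplus> b') \<in> G'"
        unfolding G'_def using GD(2)[OF *(1,2)] *(3,4) by blast
    next
      fix t a b assume t: "t \<in> carrier R" and "(a, b) \<in> G'"
      then obtain s q r where *: "(s, q) \<in> G" "r \<in> carrier R"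
        "a = s \<oplus>\<^bsub>Y\<^esub> r \<odot>\<^bsub>Y\<^esub> y" "b = q \<oplus> r \<odot> e" unfolding G'_def by blast
      have "t \<odot>\<^bsub>Y\<^esub> a = t \<odot>\<^bsub>Y\<^esub> s \<oplus>\<^bsub>Y\<^esub> (t \<otimes>\<^bsub>R\<^esub> r) \<odot>\<^bsub>Y\<^esub> y" "t \<odot> b = t \<odot> q \<oplus> (t \<otimes>\<^bsub>R\<^esub> r) \<odot> e"
        using * GD(1)[OF *(1)] y e(1) t
        by (simp_all add: Y.smult_r_distr Q.smult_r_distr Y.smult_assoc1 Q.smult_assoc1)
      moreover have "t \<otimes>\<^bsub>R\<^esub> r \<in> carrier R" using t * by simp
      ultimately show "(t \<odot>\<^bsub>Y\<^esub> a, t \<odot> b) \<in> G'"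
        unfolding G'_def using GD(3)[OF t *(1)] by blast
    next
      fix b assume "(\<zero>\<^bsub>Y\<^esub>, b) \<in> G'"
      then obtain s q r where *: "(s, q) \<in> G" "r \<in> carrier R"
        "\<zero>\<^bsub>Y\<^esub> = s \<oplus>\<^bsub>Y\<^esub> r \<odot>\<^bsub>Y\<^esub> y" "b = q \<oplus> r \<odot> e" unfolding G'_def by blast
      have sq: "s \<in> carrier Y" "q \<in> carrier Q" using GD(1)[OF *(1)] by auto
      have "\<ominus>\<^bsub>Y\<^esub> s = r \<odot>\<^bsub>Y\<^esub> y"
        by (rule Y.minus_equality) (use * sq y in \<open>auto simp: Y.a_comm\<close>)
      then have "(r \<odot>\<^bsub>Y\<^esub> y, \<ominus> q) \<in> G" using Gneg[OF *(1)] by simp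
      \<comment> \<open>Consistency of the extension: r y = -s lies in the domain of G with value
        -q, and e reproduces that value.\<close>
      then have "r \<odot> e = \<ominus> q" using fI[OF *(2)] e(2) by metis
      then show "b = \<zero>" using * sq by (simp add: Q.r_neg)
    qed
    moreover have sub: "G \<subseteq> G'"
    proof
      fix z assume z: "z \<in> G"
      obtain s q where sq: "z = (s, q)" by (cases z)
      have "s = s \<oplus>\<^bsub>Y\<^esub> \<zero>\<^bsub>R\<^esub> \<odot>\<^bsub>Y\<^esub> y" "q = q \<oplus> \<zero>\<^bsub>R\<^esub> \<odot> e" using GD(1) z sq y e by auto
      then show "z \<in> G'" unfolding G'_def using z sq Q.R.zero_closed by blast
    qed
    ultimately have "G' = G" using max G(2) by blast
    moreover have "(\<zero>\<^bsub>Y\<^esub> \<oplus>\<^bsub>Y\<^esub> \<one>\<^bsub>R\<^esub> \<odot>\<^bsub>Y\<^esub> y, \<zero> \<oplus> \<one>\<^bsub>R\<^esub> \<odot> e) \<in> G'"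
      unfolding G'_def using G0 by blast
    ultimately show ?thesis using y e(1) by auto
  qed
  define g where "g y = (THE q. (y, q) \<in> G)" for y
  have g: "(y, g y) \<in> G" if "y \<in> carrier Y" for y
    unfolding g_def by (rule theI') (use total[OF that] single in auto)
  have gI: "g y = q" if "(y, q) \<in> G" for y q
    by (rule single[OF g that]) (use GD(1)[OF that] in simp)
  have "g \<in> module_hom R Y Q"
  proof (rule module_homI)
    show "g x \<in> carrier Q" if "x \<in> carrier Y" for x using GD(1)[OF g[OF that]] by simp
    show "g (x \<oplus>\<^bsub>Y\<^esub> y) = g x \<oplus> g y" if "x \<in> carrier Y" "y \<in> carrier Y" for x y
      by (rule gI[OF GD(2)[OF g[OF that(1)] g[OF that(2)]]])
    show "g (r \<odot>\<^bsub>Y\<^esub> x) = r \<odot> g x" if "r \<in> carrier R" "x \<in> carrier Y" for r x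
      by (rule gI[OF GD(3)[OF that(1) g[OF that(2)]]])
  qed
  moreover have "g x = h x" if "x \<in> S" for x
    by (rule gI) (use G(2) that in \<open>auto simp: gr_def\<close>)
  ultimately show ?thesis by blast
qed

text \<open>A field has only two ideals: on the zero ideal e = 0 works, on K the value of h at 1.
  Consequently every linear map on a subspace extends.\<close>

lemma field_baer:
  assumes K: "field K" and V: "module K V"
  shows "baer_module K V"
  unfolding baer_module_def
proof (intro conjI V allI impI)
  interpret K: field K by fact
  interpret V: module K V by fact
  fix I h assume I: "ideal I K" and h: "h \<in> I \<rightarrow> carrier V"
    and "\<forall>x\<in>I. \<forall>y\<in>I. h (x \<oplus>\<^bsub>K\<^esub> y) = h x \<oplus>\<^bsub>V\<^esub> h y"
    and hs: "\<forall>r\<in>carrier K. \<forall>x\<in>I. h (r \<otimes>\<^bsub>K\<^esub> x) = r \<odot>\<^bsub>V\<^esub> h x"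
  consider "I = {\<zero>\<^bsub>K\<^esub>}" | "I = carrier K" using I K.all_ideals by blast
  then show "\<exists>e\<in>carrier V. \<forall>x\<in>I. h x = x \<odot>\<^bsub>V\<^esub> e"
  proof cases
    case 1
    then have "h (\<zero>\<^bsub>K\<^esub> \<otimes>\<^bsub>K\<^esub> \<zero>\<^bsub>K\<^esub>) = \<zero>\<^bsub>K\<^esub> \<odot>\<^bsub>V\<^esub> h \<zero>\<^bsub>K\<^esub>" using hs by blast
    then show ?thesis using 1 h by (intro bexI[of _ "\<zero>\<^bsub>V\<^esub>"]) auto
  next
    case 2
    have "h x = x \<odot>\<^bsub>V\<^esub> h \<one>\<^bsub>K\<^esub>" if "x \<in> carrier K" for x
      using hs 2 that by (metis K.one_closed K.r_one)
    moreover have "h \<one>\<^bsub>K\<^esub> \<in> carrier V" using 2 h by blast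
    ultimately show ?thesis unfolding 2 by blast
  qed
qed

lemmas linear_extend = baer_extend[OF field_baer]

section \<open>Transport of structure\<close>

text \<open>Carries a module along an injection j of its carrier, in order to place modules built
  elsewhere into a prescribed type. The ring fields of the result are dummies.\<close>

definition transport :: "('q \<Rightarrow> 'w) \<Rightarrow> ('a, 'q, 'y) module_scheme \<Rightarrow> ('a, 'w) module" where
  "transport j Q = (let i = inv_into (carrier Q) j in
    \<lparr>carrier = j ` carrier Q, monoid.mult = (\<lambda>x y. x), one = j \<zero>\<^bsub>Q\<^esub>, ring.zero = j \<zero>\<^bsub>Q\<^esub>,
     add = (\<lambda>x y. j (i x \<oplus>\<^bsub>Q\<^esub> i y)), smult = (\<lambda>r x. j (r \<odot>\<^bsub>Q\<^esub> i x))\<rparr>)"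

context
  fixes R :: "('a, 'x) ring_scheme" and Q :: "('a, 'q, 'y) module_scheme" and j :: "'q \<Rightarrow> 'w"
  assumes Q: "module R Q" and j: "inj_on j (carrier Q)"
begin

interpretation Q: module R Q by (fact Q)

lemma transport_sel:
  "carrier (transport j Q) = j ` carrier Q"
  "\<zero>\<^bsub>transport j Q\<^esub> = j \<zero>\<^bsub>Q\<^esub>"
  "x \<in> carrier Q \<Longrightarrow> y \<in> carrier Q \<Longrightarrow> j x \<oplus>\<^bsub>transport j Q\<^esub> j y = j (x \<oplus>\<^bsub>Q\<^esub> y)"
  "x \<in> carrier Q \<Longrightarrow> r \<odot>\<^bsub>transport j Q\<^esub> j x = j (r \<odot>\<^bsub>Q\<^esub> x)"
  using j by (simp_all add: transport_def Let_def)

lemma transport_module: "module R (transport j Q)"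
proof (rule moduleI[OF module_cring[OF Q.module_axioms]])
  show "abelian_group (transport j Q)"
  proof (rule abelian_groupI)
    fix x assume "x \<in> carrier (transport j Q)"
    then obtain q where q: "q \<in> carrier Q" "x = j q" by (auto simp: transport_sel)
    then have "j (\<ominus>\<^bsub>Q\<^esub> q) \<oplus>\<^bsub>transport j Q\<^esub> x = \<zero>\<^bsub>transport j Q\<^esub>" by (simp add: transport_sel Q.l_neg)
    then show "\<exists>y\<in>carrier (transport j Q). y \<oplus>\<^bsub>transport j Q\<^esub> x = \<zero>\<^bsub>transport j Q\<^esub>"
      using q by (auto simp: transport_sel(1))
  qed (auto simp: transport_sel Q.a_ac)
qed (auto simp: transport_sel Q.smult_l_distr Q.smult_r_distr Q.smult_assoc1)

lemma transport_hom: "j \<in> module_hom R Q (transport j Q)"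
  by (rule module_homI) (auto simp: transport_sel)

lemma transport_hom_inv: "inv_into (carrier Q) j \<in> module_hom R (transport j Q) Q"
  by (rule module_homI) (use j in \<open>auto simp: transport_sel\<close>)

lemma transport_baer:
  assumes "baer_module R Q"
  shows "baer_module R (transport j Q)"
  unfolding baer_module_def
proof (intro conjI transport_module allI impI)
  let ?i = "inv_into (carrier Q) j"
  fix I h assume I: "ideal I R" and h: "h \<in> I \<rightarrow> carrier (transport j Q)"
    and ha: "\<forall>x\<in>I. \<forall>y\<in>I. h (x \<oplus>\<^bsub>R\<^esub> y) = h x \<oplus>\<^bsub>transport j Q\<^esub> h y"
    and hs: "\<forall>r\<in>carrier R. \<forall>x\<in>I. h (r \<otimes>\<^bsub>R\<^esub> x) = r \<odot>\<^bsub>transport j Q\<^esub> h x"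
  note hi = transport_hom_inv
  have hc: "h x \<in> carrier (transport j Q)" if "x \<in> I" for x using h that by blast
  have "\<exists>e\<in>carrier Q. \<forall>x\<in>I. ?i (h x) = x \<odot>\<^bsub>Q\<^esub> e"
    using assms[unfolded baer_module_def, THEN conjunct2, rule_format, OF I, of "\<lambda>x. ?i (h x)"]
    by (auto simp: ha hs hc module_hom_closed[OF hi] module_hom_add[OF hi] module_hom_smult[OF hi])
  then obtain e where e: "e \<in> carrier Q" "\<And>x. x \<in> I \<Longrightarrow> ?i (h x) = x \<odot>\<^bsub>Q\<^esub> e" by blast
  have "h x = x \<odot>\<^bsub>transport j Q\<^esub> j e" if "x \<in> I" for x
  proof -
    have "h x = j (?i (h x))" using hc[OF that] j by (auto simp: transport_sel f_inv_into_f)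
    then show ?thesis using e that by (simp add: transport_sel)
  qed
  then show "\<exists>e\<in>carrier (transport j Q). \<forall>x\<in>I. h x = x \<odot>\<^bsub>transport j Q\<^esub> e"
    using e(1) by (auto simp: transport_sel(1))
qed

end

definition regular_module :: "('a, 'x) ring_scheme \<Rightarrow> ('a, 'a) module" where
  "regular_module R = \<lparr>carrier = carrier R, monoid.mult = monoid.mult R, one = one R, ring.zero = ring.zero R,
     add = add R, smult = monoid.mult R\<rparr>"

lemma regular_sel [simp]: "carrier (regular_module R) = carrier R" "add (regular_module R) = add R"
  "\<zero>\<^bsub>regular_module R\<^esub> = \<zero>\<^bsub>R\<^esub>" "smult (regular_module R) = monoid.mult R"
  by (simp_all add: regular_module_def)

lemma regular_is_module:
  assumes "cring R" shows "module R (regular_module R)"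
proof -
  interpret R: cring R by fact
  show ?thesis
    by (rule moduleI) (auto simp: assms R.l_distr R.r_distr R.m_assoc
        intro: abelian_group_cong[OF R.abelian_group_axioms])
qed

lemma ideal_submodule_regular:
  assumes "cring R" "ideal I R" shows "submodule I R (regular_module R)"
proof -
  interpret R: cring R by fact
  interpret I: ideal I R by fact
  show ?thesis
    by (rule submoduleI'[OF regular_is_module[OF assms(1)]])
     (auto simp: I.Icarr I.I_l_closed)
qed

text \<open>A copy of R in the test type, embedded by \<open>Inl\<close>, serves as test module; the
  image of 1 under the extended map is e.\<close>

lemma injective_imp_baer:
  fixes R :: "('a, 'x) ring_scheme" and Q :: "('a, 'q) module"
  assumes "injective_module R Q"
  shows "baer_module R Q"
  unfolding baer_module_def
proof (intro conjI allI impI)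
  show mQ: "module R Q" using assms by (simp add: injective_module_def)
  interpret Q: module R Q by (rule mQ)
  fix I h assume I: "ideal I R" and h: "h \<in> I \<rightarrow> carrier Q"
    and ha: "\<forall>x\<in>I. \<forall>y\<in>I. h (x \<oplus>\<^bsub>R\<^esub> y) = h x \<oplus>\<^bsub>Q\<^esub> h y"
    and hs: "\<forall>r\<in>carrier R. \<forall>x\<in>I. h (r \<otimes>\<^bsub>R\<^esub> x) = r \<odot>\<^bsub>Q\<^esub> h x"
  let ?j = "Inl :: 'a \<Rightarrow> 'a + 'q"
  let ?Rm = "regular_module R"
  let ?Y = "transport ?j ?Rm"
  have Rm: "module R ?Rm" by (rule regular_is_module[OF module_cring[OF Q.module_axioms]])
  have j: "inj_on ?j (carrier ?Rm)" by simp
  note sel = transport_sel[OF Rm j]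
  have Y: "module R ?Y" by (rule transport_module[OF Rm j])
  have S: "submodule (?j ` I) R ?Y"
    by (rule submodule_image[OF Rm Y transport_hom[OF Rm j] ideal_submodule_regular[OF module_cring[OF Q.module_axioms] I]])
  have Ic: "x \<in> carrier R" if "x \<in> I" for x using ideal.Icarr[OF I that] .
  have hj: "(\<lambda>y. h (projl y)) \<in> module_hom R (?Y\<lparr>carrier := ?j ` I\<rparr>) Q"
    by (rule module_homI) (use h ha hs Ic sel in auto)
  then obtain g where g: "g \<in> module_hom R ?Y Q" "\<And>x. x \<in> ?j ` I \<Longrightarrow> g x = h (projl x)"
    using assms[unfolded injective_module_def, THEN conjunct2, rule_format, OF conjI[OF Y conjI[OF S hj]]]
    by blast
  let ?e = "g (?j \<one>\<^bsub>R\<^esub>)"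
  have oc: "?j \<one>\<^bsub>R\<^esub> \<in> carrier ?Y" by (simp add: sel)
  have "h x = x \<odot>\<^bsub>Q\<^esub> ?e" if "x \<in> I" for x
  proof -
    have "x \<odot>\<^bsub>?Y\<^esub> ?j \<one>\<^bsub>R\<^esub> = ?j x" using sel(4)[of "\<one>\<^bsub>R\<^esub>" x] Ic[OF that] by simp
    then show ?thesis using module_hom_smult[OF g(1) Ic[OF that] oc] g(2)[of "?j x"] that by simp
  qed
  then show "\<exists>e\<in>carrier Q. \<forall>x\<in>I. h x = x \<odot>\<^bsub>Q\<^esub> e" using module_hom_closed[OF g(1) oc] by blast
qed

lemma baer_imp_injective: "baer_module R Q \<Longrightarrow> injective_module R Q"
  unfolding injective_module_def by (auto simp: baer_extend) (simp add: baer_module_def)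

section \<open>Existence of injective resolutions\<close>

text \<open>
  \<open>Hom\<^sub>K(A, V)\<close> is injective over \<open>A\<close> because every \<open>K\<close>-linear functional extends, and it contains \<open>V\<close>.
  Functions are normalised to \<open>0\<close> outside \<open>carrier A\<close>, so that equality of functions is equality of maps.
\<close>

definition coinduced :: "('k, 'x) ring_scheme \<Rightarrow> ('k, 'a, 'y) module_scheme \<Rightarrow> ('a, 'v, 'z) module_scheme
    \<Rightarrow> ('a, 'a \<Rightarrow> 'v) module" where
  "coinduced K A V =
    \<lparr>carrier = {f \<in> module_hom K A (restrict_scalars A V). \<forall>x. x \<notin> carrier A \<longrightarrow> f x = \<zero>\<^bsub>V\<^esub>},
     monoid.mult = (\<lambda>f g. f), one = (\<lambda>_. \<zero>\<^bsub>V\<^esub>), ring.zero = (\<lambda>_. \<zero>\<^bsub>V\<^esub>), add = (\<lambda>f g x. f x \<oplus>\<^bsub>V\<^esub> g x),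
     smult = (\<lambda>a f x. if x \<in> carrier A then f (x \<otimes>\<^bsub>A\<^esub> a) else \<zero>\<^bsub>V\<^esub>)\<rparr>"

context
  fixes K :: "('k, 'x) ring_scheme" and A :: "('k, 'a, 'y) module_scheme" and V :: "('a, 'v, 'z) module_scheme"
  assumes K: "field K" and A: "algebra K A" and V: "module A V"
begin

interpretation K: field K by (fact K)
interpretation A: algebra K A by (fact A)
interpretation V: module A V by (fact V)

private abbreviation "V' \<equiv> restrict_scalars A V"
private abbreviation "C \<equiv> coinduced K A V"

interpretation V': module K "restrict_scalars A V" by (rule restrict_scalars_module[OF A V])

private lemma cc: "f \<in> carrier C \<longleftrightarrow> f \<in> module_hom K A V' \<and> (\<forall>x. x \<notin> carrier A \<longrightarrow> f x = \<zero>\<^bsub>V\<^esub>)"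
  by (simp add: coinduced_def)

private lemma csel: "\<zero>\<^bsub>C\<^esub> = (\<lambda>_. \<zero>\<^bsub>V\<^esub>)" "add C = (\<lambda>f g x. f x \<oplus>\<^bsub>V\<^esub> g x)"
  "smult C = (\<lambda>a f x. if x \<in> carrier A then f (x \<otimes>\<^bsub>A\<^esub> a) else \<zero>\<^bsub>V\<^esub>)"
  by (simp_all add: coinduced_def)

private lemma f_closed: "f \<in> carrier C \<Longrightarrow> f x \<in> carrier V"
  by (cases "x \<in> carrier A") (auto simp: cc dest: module_hom_closed)

private lemma mult_smult: "c \<in> carrier K \<Longrightarrow> x \<in> carrier A \<Longrightarrow> a \<in> carrier A \<Longrightarrow>
    (c \<odot>\<^bsub>A\<^esub> x) \<otimes>\<^bsub>A\<^esub> a = c \<odot>\<^bsub>A\<^esub> (x \<otimes>\<^bsub>A\<^esub> a)"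
  by (rule A.smult_assoc2)

lemma coinduced_module: "module A (coinduced K A V)"
proof (rule moduleI)
  show "cring A" by (rule A.M_cring)
  have add: "(\<lambda>x. f x \<oplus>\<^bsub>V\<^esub> g x) \<in> carrier C" if f: "f \<in> carrier C" and g: "g \<in> carrier C" for f g
  proof -
    have "(\<lambda>x. f x \<oplus>\<^bsub>V\<^esub> g x) \<in> module_hom K A V'"
    proof (rule module_homI)
      fix x y assume xy: "x \<in> carrier A" "y \<in> carrier A"
      have "f (x \<oplus>\<^bsub>A\<^esub> y) = f x \<oplus>\<^bsub>V\<^esub> f y" "g (x \<oplus>\<^bsub>A\<^esub> y) = g x \<oplus>\<^bsub>V\<^esub> g y"
        using f g xy by (auto simp: cc module_hom_add)
      then show "f (x \<oplus>\<^bsub>A\<^esub> y) \<oplus>\<^bsub>V\<^esub> g (x \<oplus>\<^bsub>A\<^esub> y) = f x \<oplus>\<^bsub>V\<^esub> g x \<oplus>\<^bsub>V'\<^esub> (f y \<oplus>\<^bsub>V\<^esub> g y)"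
        using f_closed[OF f] f_closed[OF g] by (simp add: V.a_ac)
    next
      fix c x assume cx: "c \<in> carrier K" "x \<in> carrier A"
      have "f (c \<odot>\<^bsub>A\<^esub> x) = c \<odot>\<^bsub>V'\<^esub> f x" "g (c \<odot>\<^bsub>A\<^esub> x) = c \<odot>\<^bsub>V'\<^esub> g x"
        using f g cx by (auto simp: cc module_hom_smult)
      then show "f (c \<odot>\<^bsub>A\<^esub> x) \<oplus>\<^bsub>V\<^esub> g (c \<odot>\<^bsub>A\<^esub> x) = c \<odot>\<^bsub>V'\<^esub> (f x \<oplus>\<^bsub>V\<^esub> g x)"
        using f_closed[OF f] f_closed[OF g] cx V'.smult_r_distr[of c "f x" "g x"] by simp
    qed (use f_closed[OF f] f_closed[OF g] in auto)
    then show ?thesis using f g by (auto simp: cc)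
  qed
  have zero: "(\<lambda>x. \<zero>\<^bsub>V\<^esub>) \<in> carrier C" using V'.smult_r_null by (auto simp: cc intro!: module_homI)
  have neg: "(\<lambda>x. \<ominus>\<^bsub>V\<^esub> f x) \<in> carrier C" if f: "f \<in> carrier C" for f
  proof -
    have "(\<lambda>x. \<ominus>\<^bsub>V\<^esub> f x) \<in> module_hom K A V'"
    proof (rule module_homI)
      fix x y assume xy: "x \<in> carrier A" "y \<in> carrier A"
      have "f (x \<oplus>\<^bsub>A\<^esub> y) = f x \<oplus>\<^bsub>V\<^esub> f y" using f xy by (auto simp: cc module_hom_add)
      then show "\<ominus>\<^bsub>V\<^esub> f (x \<oplus>\<^bsub>A\<^esub> y) = \<ominus>\<^bsub>V\<^esub> f x \<oplus>\<^bsub>V'\<^esub> \<ominus>\<^bsub>V\<^esub> f y"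
        using f_closed[OF f] by (simp add: V.minus_add)
    next
      fix c x assume cx: "c \<in> carrier K" "x \<in> carrier A"
      have "f (c \<odot>\<^bsub>A\<^esub> x) = c \<odot>\<^bsub>V'\<^esub> f x" using f cx by (auto simp: cc module_hom_smult)
      then show "\<ominus>\<^bsub>V\<^esub> f (c \<odot>\<^bsub>A\<^esub> x) = c \<odot>\<^bsub>V'\<^esub> (\<ominus>\<^bsub>V\<^esub> f x)"
        using f_closed[OF f] cx V'.smult_r_minus[of c "f x"] by simp
    qed (use f_closed[OF f] in auto)
    then show ?thesis using f by (auto simp: cc)
  qed
  show "abelian_group C"
  proof (rule abelian_groupI)
    fix f assume f: "f \<in> carrier C"
    show "\<exists>g\<in>carrier C. g \<oplus>\<^bsub>C\<^esub> f = \<zero>\<^bsub>C\<^esub>"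
      by (rule bexI[OF _ neg[OF f]]) (use f_closed[OF f] in \<open>auto simp: csel V.l_neg\<close>)
  qed (auto simp: csel add zero f_closed V.a_ac)
  show "a \<odot>\<^bsub>C\<^esub> f \<in> carrier C" if a: "a \<in> carrier A" and f: "f \<in> carrier C" for a f
  proof -
    have h: "f \<in> module_hom K A V'" using f by (simp add: cc)
    have "a \<odot>\<^bsub>C\<^esub> f \<in> module_hom K A V'"
      by (rule module_homI) (use a module_hom_closed[OF h] module_hom_add[OF h] module_hom_smult[OF h] in
          \<open>auto simp: csel A.l_distr mult_smult\<close>)
    then show ?thesis by (auto simp: cc csel)
  qed
  show "(a \<oplus>\<^bsub>A\<^esub> b) \<odot>\<^bsub>C\<^esub> f = a \<odot>\<^bsub>C\<^esub> f \<oplus>\<^bsub>C\<^esub> b \<odot>\<^bsub>C\<^esub> f"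
    if "a \<in> carrier A" "b \<in> carrier A" "f \<in> carrier C" for a b f
    using that module_hom_add[of f K A V'] by (auto simp: csel cc A.r_distr fun_eq_iff)
  show "(a \<otimes>\<^bsub>A\<^esub> b) \<odot>\<^bsub>C\<^esub> f = a \<odot>\<^bsub>C\<^esub> (b \<odot>\<^bsub>C\<^esub> f)"
    if "a \<in> carrier A" "b \<in> carrier A" "f \<in> carrier C" for a b f
    using that by (auto simp: csel fun_eq_iff A.m_assoc)
qed (auto simp: csel cc fun_eq_iff)

lemma coinduced_baer: "baer_module A (coinduced K A V)"
  unfolding baer_module_def
proof (intro conjI coinduced_module allI impI)
  fix I h assume I: "ideal I A" and h: "h \<in> I \<rightarrow> carrier C"
    and ha: "\<forall>x\<in>I. \<forall>y\<in>I. h (x \<oplus>\<^bsub>A\<^esub> y) = h x \<oplus>\<^bsub>C\<^esub> h y"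
    and hs: "\<forall>r\<in>carrier A. \<forall>x\<in>I. h (r \<otimes>\<^bsub>A\<^esub> x) = r \<odot>\<^bsub>C\<^esub> h x"
  interpret I: ideal I A by fact
  have hc: "h x \<in> carrier C" if "x \<in> I" for x using h that by blast
  have ks: "c \<odot>\<^bsub>A\<^esub> x = (c \<odot>\<^bsub>A\<^esub> \<one>\<^bsub>A\<^esub>) \<otimes>\<^bsub>A\<^esub> x" if "c \<in> carrier K" "x \<in> carrier A" for c x
    using that by (simp add: A.smult_assoc2)
  have cI: "c \<odot>\<^bsub>A\<^esub> x \<in> I" if "c \<in> carrier K" "x \<in> I" for c x
    unfolding ks[OF that(1) I.Icarr[OF that(2)]] using that I.I_l_closed by simp
  have S: "submodule I K A"
    by (rule submoduleI') (auto simp: A.module I.Icarr cI)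
  have "(\<lambda>x. h x \<one>\<^bsub>A\<^esub>) \<in> module_hom K (A\<lparr>carrier := I\<rparr>) V'"
  proof (rule module_homI)
    fix c x assume cx: "c \<in> carrier K" "x \<in> carrier (A\<lparr>carrier := I\<rparr>)"
    have x: "x \<in> I" using cx by simp
    have "h (c \<odot>\<^bsub>A\<^esub> x) = (c \<odot>\<^bsub>A\<^esub> \<one>\<^bsub>A\<^esub>) \<odot>\<^bsub>C\<^esub> h x"
      unfolding ks[OF cx(1) I.Icarr[OF x]] using hs x cx by simp
    then have "h (c \<odot>\<^bsub>A\<^esub> x) \<one>\<^bsub>A\<^esub> = h x (c \<odot>\<^bsub>A\<^esub> \<one>\<^bsub>A\<^esub>)" using cx by (simp add: csel)
    also have "\<dots> = c \<odot>\<^bsub>V'\<^esub> h x \<one>\<^bsub>A\<^esub>"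
      using hc[of x] cx by (intro module_hom_smult) (auto simp: cc)
    finally show "h (c \<odot>\<^bsub>A\<lparr>carrier := I\<rparr>\<^esub> x) \<one>\<^bsub>A\<^esub> = c \<odot>\<^bsub>V'\<^esub> h x \<one>\<^bsub>A\<^esub>" by simp
  qed (use hc f_closed ha in \<open>auto simp: csel\<close>)
  \<comment> \<open>The functional x \<mapsto> (h x)(1) on I extends K-linearly to G on A. As an
    element of the coinduced module G represents h, because (h x)(y) = (y h x)(1) = h(y x)(1) = G(y
    x) for x in I.\<close>
  then obtain G where G: "G \<in> module_hom K A V'" "\<And>x. x \<in> I \<Longrightarrow> G x = h x \<one>\<^bsub>A\<^esub>"
    using linear_extend[OF K V'.module_axioms A.module S] by blast
  define e where "e x = (if x \<in> carrier A then G x else \<zero>\<^bsub>V\<^esub>)" for x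
  have "e \<in> carrier C"
    using G(1) unfolding cc module_hom_def e_def by auto
  moreover have "h x = x \<odot>\<^bsub>C\<^esub> e" if x: "x \<in> I" for x
  proof
    fix y show "h x y = (x \<odot>\<^bsub>C\<^esub> e) y"
    proof (cases "y \<in> carrier A")
      case True
      have "h (y \<otimes>\<^bsub>A\<^esub> x) = y \<odot>\<^bsub>C\<^esub> h x" using hs True x by blast
      then have "h (y \<otimes>\<^bsub>A\<^esub> x) \<one>\<^bsub>A\<^esub> = h x y" using True by (simp add: csel)
      moreover have "y \<otimes>\<^bsub>A\<^esub> x \<in> I" using I.I_l_closed[OF x True] .
      ultimately show ?thesis using True G(2) I.Icarr x by (simp add: csel e_def)
    next
      case False then show ?thesis using hc[OF x] by (simp add: csel cc)
    qed
  qed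
  ultimately show "\<exists>e\<in>carrier C. \<forall>x\<in>I. h x = x \<odot>\<^bsub>C\<^esub> e" by blast
qed

text \<open>The element v is sent to the map x \<mapsto> x v, and evaluation at 1 recovers
  v.\<close>

lemma coinduced_embedding:
  "\<exists>\<epsilon>\<in>module_hom A V (coinduced K A V). inj_on \<epsilon> (carrier V)"
proof -
  define \<epsilon> where "\<epsilon> v = (\<lambda>x. if x \<in> carrier A then x \<odot>\<^bsub>V\<^esub> v else \<zero>\<^bsub>V\<^esub>)" for v
  have "\<epsilon> \<in> module_hom A V C"
  proof (rule module_homI)
    fix v assume v: "v \<in> carrier V"
    have "\<epsilon> v \<in> module_hom K A V'"
      by (rule module_homI) (use v algebra_smult_smult(1)[OF A V] in \<open>auto simp: \<epsilon>_def V.smult_l_distr\<close>)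
    then show "\<epsilon> v \<in> carrier C" by (simp add: cc \<epsilon>_def)
  qed (auto simp: \<epsilon>_def csel V.smult_r_distr V.smult_assoc1)
  moreover have "inj_on \<epsilon> (carrier V)"
  proof (rule inj_onI)
    fix v w assume vw: "v \<in> carrier V" "w \<in> carrier V" "\<epsilon> v = \<epsilon> w"
    then have "\<epsilon> v \<one>\<^bsub>A\<^esub> = \<epsilon> w \<one>\<^bsub>A\<^esub>" by simp
    then show "v = w" using vw by (simp add: \<epsilon>_def)
  qed
  ultimately show ?thesis by blast
qed

end

text \<open>Write U for \<open>'a + 'm + nat\<close>. A map from \<open>'a\<close> to subsets of U
  amounts to a subset of \<open>'a\<close> \<times> U, and since U is infinite and contains a copy
  of \<open>'a\<close>, this product is in bijection with U.\<close>

lemma resolution_space_code: "\<exists>p :: ('a \<Rightarrow> ('a, 'm) resolution_space) \<Rightarrow> ('a, 'm) resolution_space. inj p"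
proof -
  have inf: "\<not> finite (UNIV :: ('a + 'm + nat) set)"
    by (simp add: UNIV_Plus_UNIV[symmetric] del: UNIV_Plus_UNIV)
  have "inj (Inl :: 'a \<Rightarrow> 'a + 'm + nat)" by simp
  then have "|UNIV :: 'a set| \<le>o |UNIV :: ('a + 'm + nat) set|"
    using card_of_ordLeq[of "UNIV :: 'a set" "UNIV :: ('a + 'm + nat) set"] by blast
  then have "|(UNIV :: 'a set) \<times> (UNIV :: ('a + 'm + nat) set)| =o |UNIV :: ('a + 'm + nat) set|"
    using card_of_Times_infinite[OF inf] by blast
  then obtain u where u: "bij_betw u ((UNIV :: 'a set) \<times> (UNIV :: ('a + 'm + nat) set)) (UNIV :: ('a + 'm + nat) set)"
    using card_of_ordIso by blast
  then have inj: "inj (u :: 'a \<times> ('a + 'm + nat) \<Rightarrow> 'a + 'm + nat)" by (simp add: bij_betw_def)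
  define p :: "('a \<Rightarrow> ('a, 'm) resolution_space) \<Rightarrow> ('a, 'm) resolution_space"
    where "p f = u ` (SIGMA x:UNIV. f x)" for f
  have "inj p"
  proof (rule injI)
    fix f g :: "'a \<Rightarrow> ('a, 'm) resolution_space" assume "p f = p g"
    then have "(SIGMA x:UNIV. f x) = (SIGMA x:UNIV. g x)"
      unfolding p_def using inj by (simp add: inj_image_eq_iff)
    then show "f = g" by (auto simp: fun_eq_iff set_eq_iff)
  qed
  then show ?thesis by blast
qed

text \<open>The coinduced module lives on functions from A to V. After i is applied to their values,
  such functions are coded back into the same type, so the construction can be iterated.\<close>

lemma injective_embedding:
  fixes K :: "('k, 'x) ring_scheme" and A :: "('k, 'a, 'y) module_scheme" and V :: "('a, 'v, 'z) module_scheme"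
    and i :: "'v \<Rightarrow> ('a, 'm) resolution_space"
  assumes K: "field K" and A: "algebra K A" and V: "module A V" and i: "inj_on i (carrier V)"
  shows "\<exists>(Q :: ('a, ('a, 'm) resolution_space) module). \<exists>\<epsilon>\<in>module_hom A V Q.
    injective_module A Q \<and> inj_on \<epsilon> (carrier V)"
proof -
  let ?C = "coinduced K A V"
  interpret V: module A V by fact
  obtain p :: "('a \<Rightarrow> ('a, 'm) resolution_space) \<Rightarrow> ('a, 'm) resolution_space" where p: "inj p"
    using resolution_space_code by blast
  define j where "j f = p (\<lambda>x. i (f x))" for f
  have cl: "f x \<in> carrier V" if "f \<in> carrier ?C" for f x
    using that by (cases "x \<in> carrier A") (auto simp: coinduced_def dest: module_hom_closed)
  have j: "inj_on j (carrier ?C)"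
  proof (rule inj_onI, rule ext)
    fix f g x assume fg: "f \<in> carrier ?C" "g \<in> carrier ?C" "j f = j g"
    then have "i (f x) = i (g x)" using p by (simp add: j_def inj_eq fun_eq_iff)
    then show "f x = g x" using inj_onD[OF i] cl fg by blast
  qed
  note C = coinduced_module[OF K A V]
  obtain \<epsilon> where e: "\<epsilon> \<in> module_hom A V ?C" "inj_on \<epsilon> (carrier V)"
    using coinduced_embedding[OF K A V] by blast
  have "(\<lambda>v. j (\<epsilon> v)) \<in> module_hom A V (transport j ?C)"
    by (rule module_hom_comp[OF e(1) transport_hom[OF C j]])
  moreover have "inj_on (\<lambda>v. j (\<epsilon> v)) (carrier V)"
  proof (rule inj_onI)
    fix v w assume vw: "v \<in> carrier V" "w \<in> carrier V" "j (\<epsilon> v) = j (\<epsilon> w)"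
    have "\<epsilon> v = \<epsilon> w"
      by (rule inj_onD[OF j vw(3) module_hom_closed[OF e(1) vw(1)] module_hom_closed[OF e(1) vw(2)]])
    then show "v = w" by (rule inj_onD[OF e(2) _ vw(1,2)])
  qed
  moreover have "injective_module A (transport j ?C)"
    by (rule baer_imp_injective[OF transport_baer[OF C j coinduced_baer[OF K A V]]])
  ultimately show ?thesis by blast
qed

text \<open>Each stage of the recursion holds an injective module Q together with the submodule H
  that has to become the next kernel. The differential is the projection onto Q / H followed by an
  embedding of Q / H into an injective module.\<close>

lemma injective_resolution_exists:
  fixes K :: "('k, 'x) ring_scheme" and A :: "('k, 'a, 'y) module_scheme" and L :: "('a, 'm, 'z) module_scheme"
  assumes K: "field K" and A: "algebra K A" and L: "module A L"
  shows "\<exists>\<epsilon> (E :: nat \<Rightarrow> ('a, ('a, 'm) resolution_space) module) d. injective_resolution A L \<epsilon> E d"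
proof -
  \<comment> \<open>Singletons place the carrier of L into the resolution type.\<close>
  have "inj_on (\<lambda>x :: 'm. {Inr (Inl x) :: 'a + 'm + nat}) (carrier L)" by (auto simp: inj_on_def)
  then obtain Q0 :: "('a, ('a, 'm) resolution_space) module" and \<epsilon> where
    e: "\<epsilon> \<in> module_hom A L Q0" "injective_module A Q0" "inj_on \<epsilon> (carrier L)"
    using injective_embedding[OF K A L] by blast
  have mod: "module A Q" if "injective_module A Q" for Q :: "('a, ('a, 'm) resolution_space) module"
    using that by (simp add: injective_module_def)
  define P where "P n s \<longleftrightarrow> injective_module A (fst s) \<and> submodule (snd s) A (fst s) \<and>
    (n = 0 \<longrightarrow> s = (Q0, \<epsilon> ` carrier L))"
    for n :: nat and s :: "('a, ('a, 'm) resolution_space) module \<times> ('a, 'm) resolution_space set"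
  define D where "D s t d \<longleftrightarrow> d \<in> module_hom A (fst s) (fst t) \<and>
    {x \<in> carrier (fst s). d x = \<zero>\<^bsub>fst t\<^esub>} = snd s \<and> d ` carrier (fst s) = snd t"
    for s t :: "('a, ('a, 'm) resolution_space) module \<times> ('a, 'm) resolution_space set" and d
  have "\<exists>f. \<forall>n. P n (f n) \<and> (\<exists>d. D (f n) (f (Suc n)) d)"
  proof (rule dependent_nat_choice)
    show "\<exists>s. P 0 s" using e submodule_image[OF L mod[OF e(2)] e(1) submodule_carrier[OF L]]
      by (auto simp: P_def)
    fix s n assume "P n s"
    then obtain Q H where s: "s = (Q, H)" and Q: "injective_module A Q" and H: "submodule H A Q"
      by (cases s) (auto simp: P_def)
    note mQ = mod[OF Q]
    interpret Q: module A Q by (rule mQ)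
    let ?V = "quotient_module Q H"
    have V: "module A ?V" by (rule quotient_is_module[OF mQ H])
    note ch = coset_hom[OF mQ H]
    \<comment> \<open>A coset is coded by one of its elements, so Q / H embeds into the type of Q
      again.\<close>
    have "inj_on (\<lambda>C. SOME x. x \<in> C) (carrier ?V)"
    proof (rule inj_onI)
      fix C C' assume C: "C \<in> carrier ?V" "C' \<in> carrier ?V" "(SOME x. x \<in> C) = (SOME x. x \<in> C')"
      have *: "H +>\<^bsub>Q\<^esub> (SOME x. x \<in> C) = C" if "C \<in> carrier ?V" for C
      proof -
        from that obtain x where x: "x \<in> carrier Q" "C = H +>\<^bsub>Q\<^esub> x" by (auto simp: quotient_carrier)
        have "(SOME x. x \<in> C) \<in> C" by (rule someI[of _ x]) (use mem_coset_self[OF mQ H x(1)] x in simp)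
        then show ?thesis using mem_cosetD(2)[OF mQ H x(1)] x(2) by simp
      qed
      have "H +>\<^bsub>Q\<^esub> (SOME x. x \<in> C) = H +>\<^bsub>Q\<^esub> (SOME x. x \<in> C')" by (simp only: C(3))
      then show "C = C'" unfolding *[OF C(1)] *[OF C(2)] .
    qed
    from injective_embedding[OF K A V this]
    obtain Q' :: "('a, ('a, 'm) resolution_space) module" and \<delta> where
      d: "\<delta> \<in> module_hom A ?V Q'" "injective_module A Q'" "inj_on \<delta> (carrier ?V)"
      by blast
    note mQ' = mod[OF d(2)]
    let ?d = "\<lambda>x. \<delta> (H +>\<^bsub>Q\<^esub> x)"
    have hd: "?d \<in> module_hom A Q Q'" by (rule module_hom_comp[OF ch d(1)])
    have zV: "\<zero>\<^bsub>?V\<^esub> \<in> carrier ?V" using submodule_zero[OF submodule_carrier[OF V]] .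
    have "?d x = \<zero>\<^bsub>Q'\<^esub> \<longleftrightarrow> x \<in> H" if x: "x \<in> carrier Q" for x
    proof -
      have "?d x = \<zero>\<^bsub>Q'\<^esub> \<longleftrightarrow> \<delta> (H +>\<^bsub>Q\<^esub> x) = \<delta> \<zero>\<^bsub>?V\<^esub>" using module_hom_zero[OF V mQ' d(1)] by simp
      also have "\<dots> \<longleftrightarrow> H +>\<^bsub>Q\<^esub> x = \<zero>\<^bsub>?V\<^esub>"
        using inj_on_eq_iff[OF d(3) module_hom_closed[OF ch x] zV] .
      also have "\<dots> \<longleftrightarrow> x \<in> H" using coset_eq_self_iff[OF mQ H x] by (simp add: quotient_zero)
      finally show ?thesis .
    qed
    then have "{x \<in> carrier Q. ?d x = \<zero>\<^bsub>Q'\<^esub>} = H" using submodule_subset[OF H] by blast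
    moreover have "submodule (?d ` carrier Q) A Q'"
      by (rule submodule_image[OF mQ mQ' hd submodule_carrier[OF mQ]])
    ultimately show "\<exists>t. P (Suc n) t \<and> (\<exists>d. D s t d)"
      using d(2) hd by (intro exI[of _ "(Q', ?d ` carrier Q)"]) (auto simp: P_def D_def s intro!: exI[of _ ?d])
  qed
  then obtain f d where f: "\<And>n. P n (f n)" and d: "\<And>n. D (f n) (f (Suc n)) (d n)" by metis
  have f0: "f 0 = (Q0, \<epsilon> ` carrier L)" using f[of 0] by (simp add: P_def)
  have inj: "injective_module A (fst (f n))" for n using f[of n] by (simp add: P_def)
  have d': "d n \<in> module_hom A (fst (f n)) (fst (f (Suc n)))"
    "{x \<in> carrier (fst (f n)). d n x = \<zero>\<^bsub>fst (f (Suc n))\<^esub>} = snd (f n)"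
    "d n ` carrier (fst (f n)) = snd (f (Suc n))" for n using d[of n] by (auto simp: D_def)
  have "injective_resolution A L \<epsilon> (\<lambda>n. fst (f n)) d"
    unfolding injective_resolution_def One_nat_def d'(2,3)
    using inj d'(1) e f0 by simp
  then show ?thesis by blast
qed

text \<open>Since a resolution exists in the type at hand, the pair picked by \<open>SOME\<close> is
  one.\<close>

lemma chosen_injective_resolution:
  fixes K :: "('k, 'x) ring_scheme" and A :: "('k, 'a, 'y) module_scheme" and L :: "('a, 'm, 'z) module_scheme"
  assumes K: "field K" and A: "algebra K A" and L: "module A L"
  obtains \<epsilon> E d where "chosen_injective_resolution A L = (E, d)" "injective_resolution A L \<epsilon> E d"
proof -
  obtain E d where Ed: "chosen_injective_resolution A L = (E, d)" by (cases "chosen_injective_resolution A L")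
  have "case chosen_injective_resolution A L of (E, d) \<Rightarrow> \<exists>\<epsilon>. injective_resolution A L \<epsilon> E d"
    unfolding chosen_injective_resolution_def
    by (rule someI_ex) (use injective_resolution_exists[OF assms] in auto)
  then show ?thesis using that Ed by auto
qed

section \<open>Torsion and flabby modules\<close>

definition tor1 :: "('a, 'x) ring_scheme \<Rightarrow> ('a, 'm, 'y) module_scheme \<Rightarrow> 'a \<Rightarrow> 'm set \<Rightarrow> 'm set" where
  "tor1 R M x S = {m \<in> S. \<exists>n::nat. (x [^]\<^bsub>R\<^esub> n) \<odot>\<^bsub>M\<^esub> m = \<zero>\<^bsub>M\<^esub>}"

text \<open>Every generator may use its own exponent. On the whole module this is torsion with
  respect to the ideal generated by xs, see \<open>torsion_part_eq_tors\<close>.\<close>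

definition tors :: "('a, 'x) ring_scheme \<Rightarrow> ('a, 'm, 'y) module_scheme \<Rightarrow> 'a list \<Rightarrow> 'm set \<Rightarrow> 'm set" where
  "tors R M xs S = {m \<in> S. \<forall>x\<in>set xs. \<exists>n::nat. (x [^]\<^bsub>R\<^esub> n) \<odot>\<^bsub>M\<^esub> m = \<zero>\<^bsub>M\<^esub>}"

text \<open>The equation says that x^n kills m - x y: up to x-torsion, m is x times an element of
  S.\<close>

definition divis :: "('a, 'x) ring_scheme \<Rightarrow> ('a, 'm, 'y) module_scheme \<Rightarrow> 'a \<Rightarrow> 'm set \<Rightarrow> bool" where
  "divis R M x S \<longleftrightarrow> (\<forall>m\<in>S. \<exists>n::nat. \<exists>y\<in>S. (x [^]\<^bsub>R\<^esub> n) \<odot>\<^bsub>M\<^esub> m = (x [^]\<^bsub>R\<^esub> Suc n) \<odot>\<^bsub>M\<^esub> y)"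

text \<open>
  For \<open>xs = [x]\<close>, \<open>S\<close> is flabby iff \<open>S\<close> modulo its \<open>x\<close>-torsion is \<open>x\<close>-divisible, that is iff \<open>S \<rightarrow> S\<^sub>x\<close>
  is onto.  In general flabbiness implies that the higher local cohomology of \<open>S\<close> with support in \<open>(xs)\<close>
  vanishes.
\<close>

primrec flabby :: "('a, 'x) ring_scheme \<Rightarrow> ('a, 'm, 'y) module_scheme \<Rightarrow> 'a list \<Rightarrow> 'm set \<Rightarrow> bool" where
  "flabby R M [] S = True"
| "flabby R M (x # xs) S = (divis R M x S \<and> flabby R M xs (tor1 R M x S))"

lemma tors_Nil [simp]: "tors R M [] S = S" by (simp add: tors_def)

lemma tors_Cons: "tors R M (x # xs) S = tors R M xs (tor1 R M x S)"
  by (auto simp: tors_def tor1_def)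

lemma tors_append: "tors R M (xs @ ys) S = tors R M ys (tors R M xs S)"
  by (auto simp: tors_def)

lemma tors_subset: "tors R M xs S \<subseteq> S" by (auto simp: tors_def)

text \<open>The second block of generators is tested on the torsion left by the first. This
  separates the generators coming from A from those coming from B.\<close>

lemma flabby_append: "flabby R M (xs @ ys) S \<longleftrightarrow> flabby R M xs S \<and> flabby R M ys (tors R M xs S)"
  by (induction xs arbitrary: S) (auto simp: tors_Cons)

lemma flabby_carrier_update [simp]:
  "tor1 R (M\<lparr>carrier := Z\<rparr>) x S = tor1 R M x S"
  "tors R (M\<lparr>carrier := Z\<rparr>) xs S = tors R M xs S"
  "divis R (M\<lparr>carrier := Z\<rparr>) x S = divis R M x S"
  by (simp_all add: tor1_def tors_def divis_def)

lemma flabby_carrier_update' [simp]: "flabby R (M\<lparr>carrier := Z\<rparr>) xs S = flabby R M xs S"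
  by (induction xs arbitrary: S) simp_all

context
  fixes R :: "('a, 'x) ring_scheme" and M :: "('a, 'm, 'y) module_scheme" (structure)
  assumes M: "module R M"
begin

interpretation M: module R M by (fact M)

lemma smult_pow_add:
  assumes "x \<in> carrier R" "m \<in> carrier M"
  shows "(x [^]\<^bsub>R\<^esub> (n + k :: nat)) \<odot> m = (x [^]\<^bsub>R\<^esub> n) \<odot> ((x [^]\<^bsub>R\<^esub> k) \<odot> m)"
  using assms by (simp add: M.smult_assoc1[symmetric] M.R.nat_pow_mult)

lemma smult_commute:
  assumes "x \<in> carrier R" "y \<in> carrier R" "m \<in> carrier M"
  shows "x \<odot> (y \<odot> m) = y \<odot> (x \<odot> m)"
  using assms by (simp add: M.smult_assoc1[symmetric] M.R.m_comm)

lemma smult_pow_zero_mono: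
  assumes "x \<in> carrier R" "m \<in> carrier M" "(x [^]\<^bsub>R\<^esub> (n::nat)) \<odot> m = \<zero>" "n \<le> k"
  shows "(x [^]\<^bsub>R\<^esub> k) \<odot> m = \<zero>"
proof -
  obtain j where "k = j + n" using assms(4) by (metis le_add_diff_inverse2)
  then show ?thesis using assms by (simp add: smult_pow_add)
qed

lemma tors_submodule:
  assumes S: "submodule S R M" and xs: "set xs \<subseteq> carrier R"
  shows "submodule (tors R M xs S) R M"
proof (rule submoduleI'[OF M])
  note Sc = submodule_subset[OF S]
  show "tors R M xs S \<subseteq> carrier M" using Sc by (auto simp: tors_def)
  show "\<zero> \<in> tors R M xs S" using submodule_zero[OF S] xs by (auto simp: tors_def)
  show "m \<oplus> m' \<in> tors R M xs S" if mm: "m \<in> tors R M xs S" "m' \<in> tors R M xs S" for m m'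
  proof -
    have c: "m \<in> S" "m' \<in> S" "m \<in> carrier M" "m' \<in> carrier M" using mm Sc by (auto simp: tors_def)
    have "\<exists>n::nat. (x [^]\<^bsub>R\<^esub> n) \<odot> (m \<oplus> m') = \<zero>" if x: "x \<in> set xs" for x
    proof -
      obtain n :: nat where n: "(x [^]\<^bsub>R\<^esub> n) \<odot> m = \<zero>"
        using mm(1) x by (auto simp: tors_def)
      obtain k :: nat where k: "(x [^]\<^bsub>R\<^esub> k) \<odot> m' = \<zero>"
        using mm(2) x by (auto simp: tors_def)
      have xc: "x \<in> carrier R" using x xs by auto
      have "(x [^]\<^bsub>R\<^esub> (n + k)) \<odot> m = \<zero>" "(x [^]\<^bsub>R\<^esub> (n + k)) \<odot> m' = \<zero>"
        using smult_pow_zero_mono[OF xc] c n k by auto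
      then show ?thesis using c xc by (intro exI[of _ "n + k"]) (simp add: M.smult_r_distr)
    qed
    then show ?thesis using submodule_add[OF S c(1,2)] by (simp add: tors_def)
  qed
  show "r \<odot> m \<in> tors R M xs S" if r: "r \<in> carrier R" and m: "m \<in> tors R M xs S" for r m
  proof -
    have c: "m \<in> S" "m \<in> carrier M" using m Sc by (auto simp: tors_def)
    have "\<exists>n::nat. (x [^]\<^bsub>R\<^esub> n) \<odot> (r \<odot> m) = \<zero>" if x: "x \<in> set xs" for x
    proof -
      obtain n :: nat where n: "(x [^]\<^bsub>R\<^esub> n) \<odot> m = \<zero>" using m x by (auto simp: tors_def)
      then show ?thesis using smult_commute[of "x [^]\<^bsub>R\<^esub> n" r m] x xs r c by (intro exI[of _ n]) auto
    qed
    then show ?thesis using submodule_smult[OF S r c(1)] by (simp add: tors_def)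
  qed
qed

lemma tor1_tors: "tor1 R M x S = tors R M [x] S" by (simp add: tor1_def tors_def)

lemma tor1_submodule: "submodule S R M \<Longrightarrow> x \<in> carrier R \<Longrightarrow> submodule (tor1 R M x S) R M"
  unfolding tor1_tors by (rule tors_submodule) auto

text \<open>Applying divisibility again to the quotient y gains one more power of x, at the price of
  a larger n on both sides.\<close>

lemma divis_iterate:
  assumes S: "submodule S R M" and x: "x \<in> carrier R" and d: "divis R M x S" and m: "m \<in> S"
  shows "\<exists>n. \<exists>y\<in>S. (x [^]\<^bsub>R\<^esub> (n::nat)) \<odot> m = (x [^]\<^bsub>R\<^esub> (n + k :: nat)) \<odot> y"
proof (induction k)
  case 0 then show ?case using m by auto
next
  case (Suc k)
  then obtain n y where y: "y \<in> S" "(x [^]\<^bsub>R\<^esub> (n::nat)) \<odot> m = (x [^]\<^bsub>R\<^esub> (n + k)) \<odot> y" by blast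
  obtain a z where z: "z \<in> S" "(x [^]\<^bsub>R\<^esub> (a::nat)) \<odot> y = (x [^]\<^bsub>R\<^esub> Suc a) \<odot> z"
    using d y(1) unfolding divis_def by blast
  note c = submodule_subset[OF S m] submodule_subset[OF S y(1)] submodule_subset[OF S z(1)]
  have "(x [^]\<^bsub>R\<^esub> (a + n)) \<odot> m = (x [^]\<^bsub>R\<^esub> a) \<odot> ((x [^]\<^bsub>R\<^esub> (n + k)) \<odot> y)"
    using smult_pow_add[OF x c(1)] y by simp
  also have "\<dots> = (x [^]\<^bsub>R\<^esub> (n + k)) \<odot> ((x [^]\<^bsub>R\<^esub> a) \<odot> y)"
    using x c by (intro smult_commute) auto
  also have "\<dots> = (x [^]\<^bsub>R\<^esub> ((n + k) + Suc a)) \<odot> z"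
    unfolding z(2) by (rule smult_pow_add[OF x c(3), symmetric])
  finally have "(x [^]\<^bsub>R\<^esub> (a + n)) \<odot> m = (x [^]\<^bsub>R\<^esub> (a + n + Suc k)) \<odot> z" by (simp add: ac_simps)
  then show ?case using z(1) by blast
qed

lemma flabby_zero:
  assumes xs: "set xs \<subseteq> carrier R" shows "flabby R M xs {\<zero>}"
  using xs
proof (induction xs)
  case (Cons x xs)
  have "tor1 R M x {\<zero>} = {\<zero>}" using Cons.prems by (auto simp: tor1_def)
  moreover have "divis R M x {\<zero>}" using Cons.prems by (simp add: divis_def)
  ultimately show ?case using Cons by simp
qed simp

text \<open>Induction on the sum of the exponents with which the generators annihilate the element.\<close>

lemma torsion_part_eq_tors:
  assumes xs: "set xs \<subseteq> carrier R"
  shows "torsion_part R (Idl\<^bsub>R\<^esub> (set xs)) M = tors R M xs (carrier M)"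
proof -
  let ?a = "Idl\<^bsub>R\<^esub> (set xs)"
  let ?p = "\<lambda>n::nat. ?a [^]\<^bsub>ideals_set R\<^esub> n"
  have a: "ideal ?a R" by (rule M.R.genideal_ideal[OF xs])
  have p0: "?p 0 = carrier R" by (simp add: nat_pow_def ideals_set_def)
  have pS: "?p (Suc n) = ideal_prod R (?p n) ?a" for n by (simp add: nat_pow_def ideals_set_def)
  have pid: "ideal (?p n) R" for n
  proof (induction n)
    case 0 then show ?case unfolding p0 by (rule M.R.oneideal)
  next
    case (Suc n) then show ?case unfolding pS using a by (intro M.R.ideal_prod_is_ideal)
  qed
  define kill where "kill n = {m \<in> carrier M. \<forall>r\<in>?p n. r \<odot> m = \<zero>}" for n
  have kill_sub: "submodule (kill n) R M" for n
  proof (rule submoduleI'[OF M])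
    note pc = ideal.Icarr[OF pid[of n]]
    show "kill n \<subseteq> carrier M" "\<zero> \<in> kill n" using pc by (auto simp: kill_def)
    show "m \<oplus> m' \<in> kill n" if "m \<in> kill n" "m' \<in> kill n" for m m'
      using that pc by (auto simp: kill_def M.smult_r_distr)
    show "s \<odot> m \<in> kill n" if "s \<in> carrier R" "m \<in> kill n" for s m
      using that pc smult_commute[of _ s m] by (auto simp: kill_def)
  qed
  \<comment> \<open>The r with r m in \<open>kill n\<close> form an ideal, so testing the generators
    suffices.\<close>
  have step: "m \<in> kill (Suc n)" if m: "m \<in> carrier M" and x: "\<And>x. x \<in> set xs \<Longrightarrow> x \<odot> m \<in> kill n" for m n
  proof -
    have "ideal {r \<in> carrier R. r \<odot> m \<in> kill n} R"
      by (rule cring_idealI[OF module_cring[OF M.module_axioms]])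
        (use m kill_sub[of n] in \<open>auto simp: M.smult_l_distr M.smult_assoc1
            intro: submodule_zero submodule_add submodule_smult\<close>)
    then have 1: "?a \<subseteq> {r \<in> carrier R. r \<odot> m \<in> kill n}"
      by (rule M.R.genideal_minimal) (use xs x in auto)
    have "r \<in> carrier R \<and> r \<odot> m = \<zero>" if "r \<in> ideal_prod R (?p n) ?a" for r using that
    proof induction
      case (prod i j)
      then have "i \<in> carrier R" "j \<in> carrier R" "j \<odot> m \<in> kill n"
        using 1 ideal.Icarr[OF pid] by auto
      then show ?case using prod m by (simp add: M.smult_assoc1 kill_def)
    next
      case (sum s t) then show ?case using m by (simp add: M.smult_l_distr)
    qed
    then show ?thesis using m by (simp add: kill_def pS del: Group.nat_pow_Suc)
  qed
  \<comment> \<open>The exponent is one more than k because of the empty list: there k = 0 and the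
    ideal is zero and kills every m, but its zeroth power is the whole ring.\<close>
  have main: "m \<in> kill (Suc k)" if "m \<in> carrier M" "\<And>x. x \<in> set xs \<Longrightarrow> (x [^]\<^bsub>R\<^esub> (\<nu> x :: nat)) \<odot> m = \<zero>"
    "sum \<nu> (set xs) = k" for m \<nu> k
    using that
  proof (induction k arbitrary: m \<nu> rule: less_induct)
    case (less k)
    show ?case
    proof (cases "\<exists>x\<in>set xs. \<nu> x = 0")
      case True
      then have "m = \<zero>" using less.prems(1,2) by fastforce
      then show ?thesis using submodule_zero[OF kill_sub] by simp
    next
      case False
      show ?thesis
      proof (rule step[OF less.prems(1)])
        fix x assume x: "x \<in> set xs"
        then have pos: "\<nu> x > 0" using False by auto
        have xc: "x \<in> carrier R" using x xs by auto
        let ?\<nu> = "\<nu>(x := \<nu> x - 1)"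
        have "sum \<nu> (set xs) = \<nu> x + sum \<nu> (set xs - {x})" using x by (simp add: sum.remove)
        moreover have "sum ?\<nu> (set xs) = (\<nu> x - 1) + sum \<nu> (set xs - {x})" using x by (simp add: sum.remove)
        ultimately have s: "Suc (sum ?\<nu> (set xs)) = k" using pos less.prems(3) by simp
        have "x \<odot> m \<in> kill (Suc (sum ?\<nu> (set xs)))"
        proof (rule less.IH[of "sum ?\<nu> (set xs)" _ ?\<nu>])
          show "sum ?\<nu> (set xs) < k" using s by simp
          show "x \<odot> m \<in> carrier M" using xc less.prems(1) by simp
          fix y assume y: "y \<in> set xs"
          then have yc: "y \<in> carrier R" using xs by auto
          show "(y [^]\<^bsub>R\<^esub> ?\<nu> y) \<odot> (x \<odot> m) = \<zero>"
          proof (cases "y = x")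
            case True
            have "(x [^]\<^bsub>R\<^esub> (\<nu> x - 1)) \<otimes>\<^bsub>R\<^esub> x = x [^]\<^bsub>R\<^esub> \<nu> x"
              using pos by (cases "\<nu> x") auto
            then show ?thesis using True less.prems(1,2) x xc by (simp add: M.smult_assoc1[symmetric])
          next
            case False
            then show ?thesis using smult_commute[of "y [^]\<^bsub>R\<^esub> \<nu> y" x m] less.prems(1,2) y yc xc by simp
          qed
        qed simp
        then show "x \<odot> m \<in> kill k" using s by simp
      qed
    qed
  qed
  show ?thesis
  proof (intro equalityI subsetI)
    fix m assume "m \<in> torsion_part R ?a M"
    then obtain n where n: "m \<in> carrier M" "\<And>r. r \<in> ?p n \<Longrightarrow> r \<odot> m = \<zero>"
      by (auto simp: torsion_part_def)
    have "x [^]\<^bsub>R\<^esub> k \<in> ?p k" if "x \<in> set xs" for x k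
    proof (induction k)
      case 0 then show ?case by (simp add: ideals_set_def)
    next
      case (Suc k)
      have "x \<in> ?a" using M.R.genideal_self[OF xs] that by blast
      then show ?case using Suc unfolding pS by (auto intro: ideal_prod.prod)
    qed
    then show "m \<in> tors R M xs (carrier M)" using n by (auto simp: tors_def)
  next
    fix m assume m: "m \<in> tors R M xs (carrier M)"
    then obtain \<nu> :: "'a \<Rightarrow> nat" where "\<And>x. x \<in> set xs \<Longrightarrow> (x [^]\<^bsub>R\<^esub> \<nu> x) \<odot> m = \<zero>"
      unfolding tors_def by (auto dest!: bchoice)
    then have "m \<in> kill (Suc (sum \<nu> (set xs)))" using m by (intro main) (auto simp: tors_def)
    then show "m \<in> torsion_part R ?a M" unfolding torsion_part_def kill_def by blast
  qed
qed

end

section \<open>Torsion and flabbiness along homomorphisms\<close>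

lemma tors_hom:
  assumes M: "module R M" and N: "module R N" and f: "f \<in> module_hom R M N"
    and xs: "set xs \<subseteq> carrier R" and m: "m \<in> tors R M xs (carrier M)"
  shows "f m \<in> tors R N xs (carrier N)"
proof -
  interpret M: module R M by fact
  have mc: "m \<in> carrier M" using m by (simp add: tors_def)
  have "\<exists>n::nat. (x [^]\<^bsub>R\<^esub> n) \<odot>\<^bsub>N\<^esub> f m = \<zero>\<^bsub>N\<^esub>" if x: "x \<in> set xs" for x
  proof -
    obtain n :: nat where "(x [^]\<^bsub>R\<^esub> n) \<odot>\<^bsub>M\<^esub> m = \<zero>\<^bsub>M\<^esub>" using m x by (auto simp: tors_def)
    then have "(x [^]\<^bsub>R\<^esub> n) \<odot>\<^bsub>N\<^esub> f m = f \<zero>\<^bsub>M\<^esub>"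
      using module_hom_smult[OF f _ mc, of "x [^]\<^bsub>R\<^esub> n"] x xs by auto
    then show ?thesis using module_hom_zero[OF M N f] by auto
  qed
  then show ?thesis using module_hom_closed[OF f mc] by (simp add: tors_def)
qed

text \<open>Divisibility of the kernel lets torsion lift: if x^k kills f m, then x^k m lies in the
  kernel, so x^(n+k) m = x^(n+k) y for some y in the kernel, and m - y is torsion with the same
  image.\<close>

lemma tor1_image:
  fixes M (structure)
  assumes M: "module R M" and N: "module R N" and f: "f \<in> module_hom R M N"
    and S: "submodule S R M" and x: "x \<in> carrier R" and d: "divis R M x {m \<in> S. f m = \<zero>\<^bsub>N\<^esub>}"
  shows "f ` tor1 R M x S = tor1 R N x (f ` S)"
proof (intro equalityI subsetI)
  interpret M: module R M by fact
  interpret N: module R N by fact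
  note Sc = submodule_subset[OF S]
  note sm = module_hom_smult[OF f]
  let ?K = "{m \<in> S. f m = \<zero>\<^bsub>N\<^esub>}"
  have K: "submodule ?K R M"
  proof -
    have "?K = S \<inter> {m \<in> carrier M. f m = \<zero>\<^bsub>N\<^esub>}" using Sc by auto
    then show ?thesis using submodule_Int[OF M S submodule_kernel[OF M N f]] by simp
  qed
  { fix z assume "z \<in> f ` tor1 R M x S"
    then obtain m n where m: "m \<in> S" "z = f m" "(x [^]\<^bsub>R\<^esub> (n::nat)) \<odot> m = \<zero>" by (auto simp: tor1_def)
    have "(x [^]\<^bsub>R\<^esub> n) \<odot>\<^bsub>N\<^esub> z = \<zero>\<^bsub>N\<^esub>"
      using sm[of "x [^]\<^bsub>R\<^esub> n" m] m Sc x module_hom_zero[OF M N f] by simp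
    then show "z \<in> tor1 R N x (f ` S)" using m by (auto simp: tor1_def) }
  fix z assume "z \<in> tor1 R N x (f ` S)"
  then obtain m k where m: "m \<in> S" "z = f m" "(x [^]\<^bsub>R\<^esub> (k::nat)) \<odot>\<^bsub>N\<^esub> z = \<zero>\<^bsub>N\<^esub>" by (auto simp: tor1_def)
  have mc: "m \<in> carrier M" using Sc m by simp
  have xm: "(x [^]\<^bsub>R\<^esub> k) \<odot> m \<in> ?K"
    using sm[of "x [^]\<^bsub>R\<^esub> k" m] m mc x submodule_smult[OF S] by simp
  obtain n y where y: "y \<in> ?K" "(x [^]\<^bsub>R\<^esub> (n::nat)) \<odot> ((x [^]\<^bsub>R\<^esub> k) \<odot> m) = (x [^]\<^bsub>R\<^esub> (n + k)) \<odot> y"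
    using divis_iterate[OF M K x d xm, of k] by blast
  have yc: "y \<in> carrier M" "y \<in> S" using y Sc by auto
  have "(x [^]\<^bsub>R\<^esub> (n + k)) \<odot> (m \<ominus> y) = (x [^]\<^bsub>R\<^esub> (n + k)) \<odot> m \<ominus> (x [^]\<^bsub>R\<^esub> (n + k)) \<odot> y"
    using mc yc x by (simp add: a_minus_def M.smult_r_distr M.smult_r_minus)
  also have "\<dots> = \<zero>" using y(2) smult_pow_add[OF M x mc, of n k] yc x by (simp add: M.diff_self)
  finally have "m \<ominus> y \<in> tor1 R M x S" using submodule_diff[OF S m(1) yc(2)] by (auto simp: tor1_def)
  moreover have "f (m \<ominus> y) = z"
    using module_hom_diff[OF M N f mc yc(1)] y m module_hom_closed[OF f mc] by (simp add: a_minus_def)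
  ultimately show "z \<in> f ` tor1 R M x S" by blast
qed

text \<open>For 0 \<rightarrow> ker \<rightarrow> S \<rightarrow> f S \<rightarrow> 0 with the first
  two terms flabby, the third is flabby and taking torsion stays exact on the right. The kernel of f
  on the x-torsion of S is the x-torsion of the kernel, so the induction on xs closes.\<close>

lemma flabby_image:
  assumes M: "module R M" and N: "module R N" and f: "f \<in> module_hom R M N"
    and S: "submodule S R M" and xs: "set xs \<subseteq> carrier R"
    and "flabby R M xs {m \<in> S. f m = \<zero>\<^bsub>N\<^esub>}" "flabby R M xs S"
  shows "flabby R N xs (f ` S) \<and> f ` tors R M xs S = tors R N xs (f ` S)"
  using S xs assms(6,7)
proof (induction xs arbitrary: S)
  case (Cons x xs)
  interpret M: module R M by fact
  interpret N: module R N by fact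
  note S = Cons.prems(1)
  have x: "x \<in> carrier R" using Cons.prems by simp
  note Sc = submodule_subset[OF S]
  have im: "f ` tor1 R M x S = tor1 R N x (f ` S)"
    using tor1_image[OF M N f S x] Cons.prems by simp
  have "tor1 R M x {m \<in> S. f m = \<zero>\<^bsub>N\<^esub>} = {m \<in> tor1 R M x S. f m = \<zero>\<^bsub>N\<^esub>}" by (auto simp: tor1_def)
  then have IH: "flabby R N xs (f ` tor1 R M x S) \<and> f ` tors R M xs (tor1 R M x S) = tors R N xs (f ` tor1 R M x S)"
    using Cons.prems by (intro Cons.IH tor1_submodule[OF M S x]) auto
  have "divis R N x (f ` S)" unfolding divis_def
  proof
    fix z assume "z \<in> f ` S"
    then obtain m where m: "m \<in> S" "z = f m" by blast
    obtain n y where y: "y \<in> S" "(x [^]\<^bsub>R\<^esub> (n::nat)) \<odot>\<^bsub>M\<^esub> m = (x [^]\<^bsub>R\<^esub> Suc n) \<odot>\<^bsub>M\<^esub> y"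
      using Cons.prems(4) m(1) by (auto simp: divis_def)
    have "(x [^]\<^bsub>R\<^esub> n) \<odot>\<^bsub>N\<^esub> z = (x [^]\<^bsub>R\<^esub> Suc n) \<odot>\<^bsub>N\<^esub> f y"
      using module_hom_smult[OF f, of "x [^]\<^bsub>R\<^esub> n" m] module_hom_smult[OF f, of "x [^]\<^bsub>R\<^esub> Suc n" y] y m Sc x
      by (simp del: M.R.nat_pow_Suc)
    then show "\<exists>n. \<exists>y\<in>f ` S. (x [^]\<^bsub>R\<^esub> (n::nat)) \<odot>\<^bsub>N\<^esub> z = (x [^]\<^bsub>R\<^esub> Suc n) \<odot>\<^bsub>N\<^esub> y" using y(1) by blast
  qed
  then show ?case using IH im by (simp add: tors_Cons)
qed simp

text \<open>The cycles of an exact complex of flabby modules are flabby, by induction on the degree.\<close>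

lemma tors_exact:
  fixes C :: "nat \<Rightarrow> ('a, 'c) module"
  assumes C: "\<And>n. module R (C n)" and \<delta>: "\<And>n. \<delta> n \<in> module_hom R (C n) (C (Suc n))"
    and fl: "\<And>n. flabby R (C n) xs (carrier (C n))" and xs: "set xs \<subseteq> carrier R"
    and inj: "{c \<in> carrier (C 0). \<delta> 0 c = \<zero>\<^bsub>C (Suc 0)\<^esub>} = {\<zero>\<^bsub>C 0\<^esub>}"
    and ex: "\<And>n. {c \<in> carrier (C (Suc n)). \<delta> (Suc n) c = \<zero>\<^bsub>C (Suc (Suc n))\<^esub>} = \<delta> n ` carrier (C n)"
    and c: "c \<in> tors R (C (Suc n)) xs (carrier (C (Suc n)))" "\<delta> (Suc n) c = \<zero>\<^bsub>C (Suc (Suc n))\<^esub>"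
  shows "c \<in> \<delta> n ` tors R (C n) xs (carrier (C n))"
proof -
  let ?Z = "\<lambda>n. {c \<in> carrier (C n). \<delta> n c = \<zero>\<^bsub>C (Suc n)\<^esub>}"
  note im = flabby_image[OF C C \<delta> submodule_carrier[OF C] xs _ fl]
  have Z: "flabby R (C n) xs (?Z n)" for n
  proof (induction n)
    case 0 then show ?case unfolding inj using flabby_zero[OF C xs] .
  next
    case (Suc n) then show ?case unfolding ex using im by blast
  qed
  have "tors R (C (Suc n)) xs (?Z (Suc n)) = \<delta> n ` tors R (C n) xs (carrier (C n))"
    unfolding ex using im[OF Z] by simp
  then show ?thesis using c by (auto simp: tors_def)
qed

text \<open>If \<open>Ann (x\<^sup>n m) = Ann (x\<^sup>n\<^sup>+\<^sup>1 m)\<close>, then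
  \<open>t \<mapsto> r x\<^sup>n m\<close>, where \<open>t m = r x\<^sup>n\<^sup>+\<^sup>1 m\<close>, is well-defined on an ideal containing \<open>x\<^sup>n\<^sup>+\<^sup>1\<close> and \<open>Ann m\<close>.\<close>

lemma baer_divis:
  fixes Q (structure)
  assumes N: "noetherian_ring R" and Q: "baer_module R Q" and x: "x \<in> carrier R" and m: "m \<in> carrier Q"
  shows "\<exists>n. \<exists>y\<in>carrier Q. (x [^]\<^bsub>R\<^esub> (n::nat)) \<odot> m = (x [^]\<^bsub>R\<^esub> Suc n) \<odot> y \<and>
    (\<forall>r\<in>carrier R. r \<odot> m = \<zero> \<longrightarrow> r \<odot> y = \<zero>)"
proof -
  have mQ: "module R Q" using Q by (simp add: baer_module_def)
  interpret Q: module R Q by (rule mQ)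
  interpret N: noetherian_ring R by fact
  let ?x = "\<lambda>n::nat. (x [^]\<^bsub>R\<^esub> n) \<odot> m"
  have xc: "?x n \<in> carrier Q" for n using x m by simp
  have xS: "?x (Suc n) = x \<odot> ?x n" for n
    using x m by (simp add: Q.smult_assoc1[symmetric] Q.R.m_comm)
  define J where "J n = {r \<in> carrier R. r \<odot> ?x n = \<zero>}" for n
  have Jid: "ideal (J n) R" for n
    by (rule cring_idealI[OF module_cring[OF Q.module_axioms]])
      (use xc[of n] in \<open>auto simp: J_def Q.smult_l_distr Q.smult_assoc1\<close>)
  have Jmono: "J n \<subseteq> J (n + k)" for n k
  proof (induction k)
    case (Suc k)
    have "J (n + k) \<subseteq> J (Suc (n + k))"
      using x xc smult_commute[OF mQ _ x xc] by (auto simp: J_def xS simp del: Group.nat_pow_Suc Q.R.nat_pow_Suc)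
    then show ?case using Suc by simp
  qed simp
  have "\<Union> (range J) \<in> range J"
  proof (rule N.ideal_chain_is_trivial)
    show "subset.chain {I. ideal I R} (range J)"
      unfolding subset.chain_def
    proof (intro conjI ballI)
      show "range J \<subseteq> {I. ideal I R}" using Jid by auto
    next
      fix I I' assume "I \<in> range J" "I' \<in> range J"
      then obtain a b where ab: "I = J a" "I' = J b" by blast
      have "J a \<subseteq> J b \<or> J b \<subseteq> J a" using Jmono[of a "b - a"] Jmono[of b "a - b"] by (cases "a \<le> b") auto
      then show "(\<subset>)\<^sup>=\<^sup>= I I' \<or> (\<subset>)\<^sup>=\<^sup>= I' I" unfolding ab by blast
    qed
  qed simp
  \<comment> \<open>From here on r x^(n+1) m determines r x^n m.\<close>
  then obtain n where n: "J (Suc n) \<subseteq> J n" by blast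
  define I where "I = {t \<in> carrier R. \<exists>r\<in>carrier R. t \<odot> m = r \<odot> ?x (Suc n)}"
  define h where "h t = (SOME r. r \<in> carrier R \<and> t \<odot> m = r \<odot> ?x (Suc n)) \<odot> ?x n" for t
  have h: "t \<in> I \<and> h t = r \<odot> ?x n" if t: "t \<in> carrier R" and r: "r \<in> carrier R" "t \<odot> m = r \<odot> ?x (Suc n)" for t r
  proof -
    define s where "s = (SOME r. r \<in> carrier R \<and> t \<odot> m = r \<odot> ?x (Suc n))"
    have s: "s \<in> carrier R \<and> t \<odot> m = s \<odot> ?x (Suc n)"
      unfolding s_def by (rule someI[of _ r]) (use r in blast)
    note sr = conjunct1[OF s] r(1)
    have "(s \<ominus>\<^bsub>R\<^esub> r) \<odot> ?x (Suc n) = s \<odot> ?x (Suc n) \<ominus> r \<odot> ?x (Suc n)"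
      using sr xc[of "Suc n"] by (simp add: a_minus_def Q.smult_l_distr Q.smult_l_minus del: Q.R.nat_pow_Suc)
    also have "\<dots> = \<zero>"
    proof -
      have e: "s \<odot> ?x (Suc n) = r \<odot> ?x (Suc n)"
        by (rule trans[OF sym[OF conjunct2[OF s]] r(2)])
      show ?thesis unfolding e by (rule Q.diff_self[OF Q.smult_closed[OF r(1) xc]])
    qed
    finally have "s \<ominus>\<^bsub>R\<^esub> r \<in> J (Suc n)" using sr by (simp add: J_def del: Group.nat_pow_Suc Q.R.nat_pow_Suc)
    then have "(s \<ominus>\<^bsub>R\<^esub> r) \<odot> ?x n = \<zero>" using n by (auto simp: J_def)
    then have "s \<odot> ?x n \<ominus> r \<odot> ?x n = \<zero>"
      using sr xc[of n] by (simp add: a_minus_def Q.smult_l_distr Q.smult_l_minus)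
    then have "s \<odot> ?x n = r \<odot> ?x n"
      by (rule Q.diff_zero_imp_eq[rotated 2]) (use sr xc[of n] in auto)
    then show ?thesis using t r unfolding h_def s_def[symmetric] I_def by blast
  qed
  have Iex: "\<exists>r\<in>carrier R. t \<in> carrier R \<and> t \<odot> m = r \<odot> ?x (Suc n) \<and> h t = r \<odot> ?x n" if "t \<in> I" for t
  proof -
    from that obtain r where "r \<in> carrier R" "t \<in> carrier R" "t \<odot> m = r \<odot> ?x (Suc n)"
      unfolding I_def by blast
    then show ?thesis using h by blast
  qed
  have add: "s \<oplus>\<^bsub>R\<^esub> t \<in> I \<and> h (s \<oplus>\<^bsub>R\<^esub> t) = h s \<oplus> h t" if st: "s \<in> I" "t \<in> I" for s t
  proof -
    obtain a where a: "a \<in> carrier R" "s \<in> carrier R" "s \<odot> m = a \<odot> ?x (Suc n)" "h s = a \<odot> ?x n" using Iex[OF st(1)] by blast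
    obtain b where b: "b \<in> carrier R" "t \<in> carrier R" "t \<odot> m = b \<odot> ?x (Suc n)" "h t = b \<odot> ?x n" using Iex[OF st(2)] by blast
    have "(s \<oplus>\<^bsub>R\<^esub> t) \<odot> m = (a \<oplus>\<^bsub>R\<^esub> b) \<odot> ?x (Suc n)"
      using a b m xc[of "Suc n"] by (simp add: Q.smult_l_distr del: Q.R.nat_pow_Suc)
    then show ?thesis using h[of "s \<oplus>\<^bsub>R\<^esub> t" "a \<oplus>\<^bsub>R\<^esub> b"] a b xc[of n] by (simp add: Q.smult_l_distr)
  qed
  have mult: "c \<otimes>\<^bsub>R\<^esub> t \<in> I \<and> h (c \<otimes>\<^bsub>R\<^esub> t) = c \<odot> h t" if c: "c \<in> carrier R" and t: "t \<in> I" for c t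
  proof -
    obtain b where b: "b \<in> carrier R" "t \<in> carrier R" "t \<odot> m = b \<odot> ?x (Suc n)" "h t = b \<odot> ?x n" using Iex[OF t] by blast
    have "(c \<otimes>\<^bsub>R\<^esub> t) \<odot> m = (c \<otimes>\<^bsub>R\<^esub> b) \<odot> ?x (Suc n)"
      using b c m xc[of "Suc n"] by (simp add: Q.smult_assoc1 del: Q.R.nat_pow_Suc)
    then show ?thesis using h[of "c \<otimes>\<^bsub>R\<^esub> t" "c \<otimes>\<^bsub>R\<^esub> b"] b c xc[of n] by (simp add: Q.smult_assoc1)
  qed
  have ann: "t \<in> I \<and> h t = \<zero>" if "t \<in> carrier R" "t \<odot> m = \<zero>" for t
    using h[of t "\<zero>\<^bsub>R\<^esub>"] that xc[of n] xc[of "Suc n"] by (simp del: Q.R.nat_pow_Suc)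
  have "ideal I R"
    by (rule cring_idealI[OF module_cring[OF Q.module_axioms]]) (use add mult ann[of "\<zero>\<^bsub>R\<^esub>"] m in \<open>auto simp: I_def\<close>)
  moreover have "h t \<in> carrier Q" if "t \<in> I" for t using Iex[OF that] xc[of n] by auto
  ultimately obtain y where y: "y \<in> carrier Q" "\<And>t. t \<in> I \<Longrightarrow> h t = t \<odot> y"
    using Q[unfolded baer_module_def, THEN conjunct2, rule_format, of I h] add mult by blast
  have "x [^]\<^bsub>R\<^esub> Suc n \<in> I \<and> h (x [^]\<^bsub>R\<^esub> Suc n) = ?x n"
    using h[of "x [^]\<^bsub>R\<^esub> Suc n" "\<one>\<^bsub>R\<^esub>"] x xc[of n] xc[of "Suc n"] by (simp del: Q.R.nat_pow_Suc)
  then have "?x n = (x [^]\<^bsub>R\<^esub> Suc n) \<odot> y" using y(2) by metis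
  \<comment> \<open>The annihilator of m lies in I with coefficient 0, so h vanishes on it and y is
    killed by everything that kills m; \<open>baer_flabby\<close> depends on this.\<close>
  moreover have "r \<odot> y = \<zero>" if "r \<in> carrier R" "r \<odot> m = \<zero>" for r
    using ann[OF that] y(2) by metis
  ultimately show ?thesis using y(1) by blast
qed

text \<open>The induction runs over all subsets closed under passing from m to any y with Ann m
  \<subseteq> Ann y. \<open>baer_divis\<close> provides quotients y of that kind, and the x-torsion
  of such a subset is again closed, so injectivity of torsion submodules is never invoked.\<close>

lemma baer_flabby:
  fixes Q (structure)
  assumes N: "noetherian_ring R" and Q: "baer_module R Q" and xs: "set xs \<subseteq> carrier R"
  shows "flabby R Q xs (carrier Q)"
proof -
  have mQ: "module R Q" using Q by (simp add: baer_module_def)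
  interpret Q: module R Q by (rule mQ)
  have "flabby R Q xs S" if "S \<subseteq> carrier Q" and
    "\<And>m y. m \<in> S \<Longrightarrow> y \<in> carrier Q \<Longrightarrow> (\<And>r. r \<in> carrier R \<Longrightarrow> r \<odot> m = \<zero> \<Longrightarrow> r \<odot> y = \<zero>) \<Longrightarrow> y \<in> S" for S
    using xs that
  proof (induction xs arbitrary: S)
    case (Cons x xs)
    have x: "x \<in> carrier R" using Cons.prems by simp
    have "divis R Q x S" unfolding divis_def
    proof
      fix m assume m: "m \<in> S"
      obtain n y where y: "y \<in> carrier Q" "(x [^]\<^bsub>R\<^esub> (n::nat)) \<odot> m = (x [^]\<^bsub>R\<^esub> Suc n) \<odot> y"
        "\<And>r. r \<in> carrier R \<Longrightarrow> r \<odot> m = \<zero> \<Longrightarrow> r \<odot> y = \<zero>"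
        using baer_divis[OF N Q x, of m] Cons.prems(2) m by blast
      then show "\<exists>n. \<exists>y\<in>S. (x [^]\<^bsub>R\<^esub> (n::nat)) \<odot> m = (x [^]\<^bsub>R\<^esub> Suc n) \<odot> y"
        using Cons.prems(3)[OF m y(1,3)] by blast
    qed
    moreover have "flabby R Q xs (tor1 R Q x S)"
    proof (rule Cons.IH)
      show "set xs \<subseteq> carrier R" using Cons.prems by simp
      show "tor1 R Q x S \<subseteq> carrier Q" using Cons.prems(2) by (auto simp: tor1_def)
      fix m y assume m: "m \<in> tor1 R Q x S" and y: "y \<in> carrier Q"
        "\<And>r. r \<in> carrier R \<Longrightarrow> r \<odot> m = \<zero> \<Longrightarrow> r \<odot> y = \<zero>"
      obtain n where n: "m \<in> S" "(x [^]\<^bsub>R\<^esub> (n::nat)) \<odot> m = \<zero>" using m by (auto simp: tor1_def)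
      then have "(x [^]\<^bsub>R\<^esub> n) \<odot> y = \<zero>" using y x by auto
      then show "y \<in> tor1 R Q x S" using Cons.prems(3)[OF n(1) y] by (auto simp: tor1_def)
    qed
    ultimately show ?case by simp
  qed simp
  then show ?thesis by blast
qed

lemma cring_nat_pow_closed:
  assumes "cring A" "x \<in> carrier A" shows "x [^]\<^bsub>A\<^esub> (n::nat) \<in> carrier A"
proof -
  interpret cring A by fact
  show ?thesis using assms(2) by simp
qed

section \<open>Linear algebra over a field\<close>

text \<open>A partial inverse of f with values in S. With P a linear projection onto the kernel of f
  on S, the element x - P x depends only on f x for x in S; the resulting map on the image of S is
  then extended linearly to W.\<close>

lemma linear_section:
  fixes V (structure)
  assumes K: "field K" and V: "module K V" and W: "module K W" and S: "submodule S K V"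
    and f: "f \<in> module_hom K V W"
  shows "\<exists>s\<in>module_hom K W V. s ` carrier W \<subseteq> S \<and> (\<forall>x\<in>S. f (s (f x)) = f x)"
proof -
  interpret V: module K V by fact
  interpret W: module K W by fact
  note Sc = submodule_subset[OF S]
  define k where "k = {x \<in> S. f x = \<zero>\<^bsub>W\<^esub>}"
  have "k = S \<inter> {x \<in> carrier V. f x = \<zero>\<^bsub>W\<^esub>}" using Sc by (auto simp: k_def)
  then have ks: "submodule k K V" using submodule_Int[OF V S submodule_kernel[OF V W f]] by simp
  have Vk: "module K (V\<lparr>carrier := k\<rparr>)" by (rule submodule_module[OF V ks])
  have "(\<lambda>x. x) \<in> module_hom K (V\<lparr>carrier := k\<rparr>) (V\<lparr>carrier := k\<rparr>)" by (rule module_homI) auto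
  then obtain P where P: "P \<in> module_hom K V (V\<lparr>carrier := k\<rparr>)" "\<And>x. x \<in> k \<Longrightarrow> P x = x"
    using linear_extend[OF K Vk V ks] by blast
  have Pk: "P x \<in> k" if "x \<in> carrier V" for x using module_hom_closed[OF P(1) that] by simp
  have Pc: "P x \<in> carrier V" "f (P x) = \<zero>\<^bsub>W\<^esub>" "P x \<in> S" if "x \<in> carrier V" for x
    using Pk[OF that] Sc by (auto simp: k_def)
  have P_add: "P (x \<oplus> y) = P x \<oplus> P y" if "x \<in> carrier V" "y \<in> carrier V" for x y
    using module_hom_add[OF P(1) that] by simp
  have P_smult: "P (r \<odot> x) = r \<odot> P x" if "r \<in> carrier K" "x \<in> carrier V" for x r
    using module_hom_smult[OF P(1) that] by simp
  define g where "g w = (let x = (SOME x. x \<in> S \<and> f x = w) in x \<ominus> P x)" for w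
  have g: "g (f x) = x \<ominus> P x" if x: "x \<in> S" for x
  proof -
    define y where "y = (SOME y. y \<in> S \<and> f y = f x)"
    have y: "y \<in> S \<and> f y = f x" unfolding y_def by (rule someI[of _ x]) (use x in simp)
    have yc: "y \<in> carrier V" and xc: "x \<in> carrier V" using y x Sc by auto
    define z where "z = x \<ominus> y"
    have fz: "f z = \<zero>\<^bsub>W\<^esub>"
      using module_hom_diff[OF V W f xc yc] y module_hom_closed[OF f xc] by (simp add: z_def W.diff_self)
    have "z \<in> S" unfolding z_def using x y by (intro submodule_diff[OF S]) auto
    then have zk: "z \<in> k" using fz by (simp add: k_def)
    have zc: "z \<in> carrier V" using xc yc by (simp add: z_def)
    have xz: "x = z \<oplus> y" using xc yc by (simp add: z_def a_minus_def V.a_assoc V.l_neg)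
    have "x \<ominus> P x = (z \<oplus> y) \<ominus> (z \<oplus> P y)"
      unfolding xz P_add[OF zc yc] P(2)[OF zk] ..
    also have "\<dots> = y \<ominus> P y"
      using zc yc Pc[OF yc] by (simp add: a_minus_def V.minus_add V.a_ac V.r_neg1 V.r_neg2)
    finally show ?thesis by (simp add: g_def y_def[symmetric])
  qed
  have fS: "submodule (f ` S) K W" by (rule submodule_image[OF V W f S])
  have g_hom: "g \<in> module_hom K (W\<lparr>carrier := f ` S\<rparr>) (V\<lparr>carrier := S\<rparr>)"
  proof (rule module_homI)
    fix w assume "w \<in> carrier (W\<lparr>carrier := f ` S\<rparr>)"
    then obtain x where x: "x \<in> S" "w = f x" by auto
    then show "g w \<in> carrier (V\<lparr>carrier := S\<rparr>)"
      using g Pc Sc by (simp add: submodule_diff[OF S])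
    fix r assume r: "r \<in> carrier K"
    have "g (r \<odot>\<^bsub>W\<^esub> w) = g (f (r \<odot> x))" using x r Sc by (simp add: module_hom_smult[OF f])
    also have "\<dots> = r \<odot> x \<ominus> r \<odot> P x"
      using g[OF submodule_smult[OF S r x(1)]] P_smult r x Sc by simp
    also have "\<dots> = r \<odot> g w" using g x r Sc Pc by (simp add: a_minus_def V.smult_r_distr V.smult_r_minus)
    finally show "g (r \<odot>\<^bsub>W\<lparr>carrier := f ` S\<rparr>\<^esub> w) = r \<odot>\<^bsub>V\<lparr>carrier := S\<rparr>\<^esub> g w" by simp
  next
    fix w w' assume "w \<in> carrier (W\<lparr>carrier := f ` S\<rparr>)" "w' \<in> carrier (W\<lparr>carrier := f ` S\<rparr>)"
    then obtain x x' where x: "x \<in> S" "w = f x" "x' \<in> S" "w' = f x'" by auto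
    have c: "x \<in> carrier V" "x' \<in> carrier V" "P x \<in> carrier V" "P x' \<in> carrier V" using x Sc Pc by auto
    have "g (w \<oplus>\<^bsub>W\<^esub> w') = g (f (x \<oplus> x'))" using x c by (simp add: module_hom_add[OF f])
    also have "\<dots> = (x \<oplus> x') \<ominus> (P x \<oplus> P x')"
      using g[OF submodule_add[OF S x(1,3)]] P_add c by simp
    also have "\<dots> = g w \<oplus> g w'" using g x c by (simp add: a_minus_def V.minus_add V.a_ac)
    finally show "g (w \<oplus>\<^bsub>W\<lparr>carrier := f ` S\<rparr>\<^esub> w') = g w \<oplus>\<^bsub>V\<lparr>carrier := S\<rparr>\<^esub> g w'" by simp
  qed
  obtain s where s: "s \<in> module_hom K W (V\<lparr>carrier := S\<rparr>)" "\<And>w. w \<in> f ` S \<Longrightarrow> s w = g w"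
    using linear_extend[OF K submodule_module[OF V S] W fS g_hom] by blast
  have sS: "s w \<in> S" if "w \<in> carrier W" for w using module_hom_closed[OF s(1) that] by simp
  have "s \<in> module_hom K W V"
    using s(1) Sc by (auto simp: module_hom_def)
  moreover have "f (s (f x)) = f x" if x: "x \<in> S" for x
    using s(2)[of "f x"] g[OF x] x Sc Pc module_hom_diff[OF V W f] module_hom_closed[OF f]
    by (simp add: a_minus_def)
  ultimately show ?thesis using sS by blast
qed

section \<open>Direct sums\<close>

text \<open>Collects a graded module into one record, so that all bidegrees later sit in one tensor
  product. The ring fields are dummies.\<close>

definition dsum :: "(nat \<Rightarrow> ('a, 'e) module) \<Rightarrow> ('a, nat \<Rightarrow> 'e) module" where
  "dsum E = \<lparr>carrier = {e. (\<forall>p. e p \<in> carrier (E p)) \<and> finite {p. e p \<noteq> \<zero>\<^bsub>E p\<^esub>}},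
     monoid.mult = (\<lambda>e f. e), one = (\<lambda>p. \<zero>\<^bsub>E p\<^esub>), ring.zero = (\<lambda>p. \<zero>\<^bsub>E p\<^esub>),
     add = (\<lambda>e f p. e p \<oplus>\<^bsub>E p\<^esub> f p), smult = (\<lambda>a e p. a \<odot>\<^bsub>E p\<^esub> e p)\<rparr>"

definition single :: "(nat \<Rightarrow> ('a, 'e) module) \<Rightarrow> nat \<Rightarrow> 'e \<Rightarrow> nat \<Rightarrow> 'e" where
  "single E p x = (\<lambda>q. if q = p then x else \<zero>\<^bsub>E q\<^esub>)"

lemma dsum_sel:
  "\<zero>\<^bsub>dsum E\<^esub> = (\<lambda>p. \<zero>\<^bsub>E p\<^esub>)"
  "add (dsum E) = (\<lambda>e f p. e p \<oplus>\<^bsub>E p\<^esub> f p)"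
  "smult (dsum E) = (\<lambda>a e p. a \<odot>\<^bsub>E p\<^esub> e p)"
  "e \<in> carrier (dsum E) \<longleftrightarrow> (\<forall>p. e p \<in> carrier (E p)) \<and> finite {p. e p \<noteq> \<zero>\<^bsub>E p\<^esub>}"
  by (simp_all add: dsum_def)

context
  fixes A :: "('a, 'x) ring_scheme" and E :: "nat \<Rightarrow> ('a, 'e) module"
  assumes E: "\<And>p. module A (E p)"
begin

interpretation E: module A "E p" for p by (rule E)

lemma dsum_module: "module A (dsum E)"
proof (rule moduleI)
  show "cring A" by (rule module_cring[OF E])
  have add: "(\<lambda>p. e p \<oplus>\<^bsub>E p\<^esub> f p) \<in> carrier (dsum E)" if "e \<in> carrier (dsum E)" "f \<in> carrier (dsum E)" for e f
  proof -
    have "{p. e p \<oplus>\<^bsub>E p\<^esub> f p \<noteq> \<zero>\<^bsub>E p\<^esub>} \<subseteq> {p. e p \<noteq> \<zero>\<^bsub>E p\<^esub>} \<union> {p. f p \<noteq> \<zero>\<^bsub>E p\<^esub>}" by auto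
    then have "finite {p. e p \<oplus>\<^bsub>E p\<^esub> f p \<noteq> \<zero>\<^bsub>E p\<^esub>}"
      by (rule finite_subset) (use that in \<open>simp add: dsum_sel\<close>)
    then show ?thesis using that by (simp add: dsum_sel)
  qed
  have map: "(\<lambda>p. u p (e p)) \<in> carrier (dsum E)" if "e \<in> carrier (dsum E)"
    "\<And>p x. x \<in> carrier (E p) \<Longrightarrow> u p x \<in> carrier (E p)" "\<And>p. u p \<zero>\<^bsub>E p\<^esub> = \<zero>\<^bsub>E p\<^esub>" for e u
  proof -
    have "{p. u p (e p) \<noteq> \<zero>\<^bsub>E p\<^esub>} \<subseteq> {p. e p \<noteq> \<zero>\<^bsub>E p\<^esub>}" using that(3) by auto
    then have "finite {p. u p (e p) \<noteq> \<zero>\<^bsub>E p\<^esub>}"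
      by (rule finite_subset) (use that(1) in \<open>simp add: dsum_sel\<close>)
    then show ?thesis using that(1,2) by (simp add: dsum_sel)
  qed
  show "abelian_group (dsum E)"
  proof (rule abelian_groupI)
    show "\<zero>\<^bsub>dsum E\<^esub> \<in> carrier (dsum E)" by (simp add: dsum_sel)
    fix e assume e: "e \<in> carrier (dsum E)"
    have "(\<lambda>p. \<ominus>\<^bsub>E p\<^esub> e p) \<in> carrier (dsum E)" by (rule map[OF e]) auto
    then show "\<exists>f\<in>carrier (dsum E). f \<oplus>\<^bsub>dsum E\<^esub> e = \<zero>\<^bsub>dsum E\<^esub>"
      using e by (intro bexI[of _ "\<lambda>p. \<ominus>\<^bsub>E p\<^esub> e p"]) (auto simp: dsum_sel E.l_neg)
  qed (use add in \<open>auto simp: dsum_sel E.a_ac\<close>)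
  show "a \<odot>\<^bsub>dsum E\<^esub> e \<in> carrier (dsum E)" if "a \<in> carrier A" "e \<in> carrier (dsum E)" for a e
    using map[OF that(2), of "\<lambda>p x. a \<odot>\<^bsub>E p\<^esub> x"] that(1) by (simp add: dsum_sel(3))
qed (auto simp: dsum_sel E.smult_l_distr E.smult_r_distr E.smult_assoc1)

lemma single_hom: "single E p \<in> module_hom A (E p) (dsum E)"
proof (rule module_homI)
  fix x assume "x \<in> carrier (E p)"
  moreover have "{q. single E p x q \<noteq> \<zero>\<^bsub>E q\<^esub>} \<subseteq> {p}" by (auto simp: single_def)
  then have "finite {q. single E p x q \<noteq> \<zero>\<^bsub>E q\<^esub>}" using finite_subset by blast
  ultimately show "single E p x \<in> carrier (dsum E)" by (simp add: dsum_sel) (simp add: single_def)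
qed (auto simp: single_def dsum_sel)

lemma dsum_lift:
  fixes V (structure)
  assumes V: "module A V" and g: "\<And>p. g p \<in> module_hom A (E p) V"
  shows "\<exists>h\<in>module_hom A (dsum E) V. \<forall>p. \<forall>x\<in>carrier (E p). h (single E p x) = g p x"
proof -
  interpret V: module A V by fact
  note g0 = module_hom_zero[OF E V g]
  define h where "h e = (\<Oplus>p\<in>{p. e p \<noteq> \<zero>\<^bsub>E p\<^esub>}. g p (e p))" for e
  have h: "h e = (\<Oplus>p\<in>P. g p (e p))" if "\<forall>p. e p \<in> carrier (E p)" "finite P" "\<forall>p. p \<notin> P \<longrightarrow> e p = \<zero>\<^bsub>E p\<^esub>" for e P
    unfolding h_def
    by (rule V.add.finprod_mono_neutral_cong_left) (use that g0 module_hom_closed[OF g] in auto)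
  have gc: "g p (e p) \<in> carrier V" if "e \<in> carrier (dsum E)" for e p
    using that module_hom_closed[OF g] by (simp add: dsum_sel)
  have "h \<in> module_hom A (dsum E) V"
  proof (rule module_homI)
    fix e assume e: "e \<in> carrier (dsum E)"
    let ?P = "{p. e p \<noteq> \<zero>\<^bsub>E p\<^esub>}"
    have P: "finite ?P" "\<forall>p. e p \<in> carrier (E p)" using e by (simp_all add: dsum_sel)
    show "h e \<in> carrier V" unfolding h_def by (rule V.finsum_closed) (use gc[OF e] in auto)
    { fix a assume a: "a \<in> carrier A"
      have "h (a \<odot>\<^bsub>dsum E\<^esub> e) = (\<Oplus>p\<in>?P. g p (a \<odot>\<^bsub>E p\<^esub> e p))"
        using h[of "a \<odot>\<^bsub>dsum E\<^esub> e" ?P] P a by (simp add: dsum_sel)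
      also have "\<dots> = (\<Oplus>p\<in>?P. a \<odot> g p (e p))"
        by (rule V.finsum_cong') (use a P gc[OF e] in \<open>auto simp: module_hom_smult[OF g]\<close>)
      finally show "h (a \<odot>\<^bsub>dsum E\<^esub> e) = a \<odot> h e"
        unfolding h_def using V.finsum_smult_ldistr[OF P(1) a, of "\<lambda>p. g p (e p)"] gc[OF e] by simp }
    fix f assume f: "f \<in> carrier (dsum E)"
    let ?Q = "?P \<union> {p. f p \<noteq> \<zero>\<^bsub>E p\<^esub>}"
    have Q: "finite ?Q" "\<forall>p. f p \<in> carrier (E p)" using e f by (simp_all add: dsum_sel)
    have "h (e \<oplus>\<^bsub>dsum E\<^esub> f) = (\<Oplus>p\<in>?Q. g p (e p \<oplus>\<^bsub>E p\<^esub> f p))"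
      using h[of "e \<oplus>\<^bsub>dsum E\<^esub> f" ?Q] P Q by (simp add: dsum_sel)
    also have "\<dots> = (\<Oplus>p\<in>?Q. g p (e p) \<oplus> g p (f p))"
      by (rule V.finsum_cong') (use P Q gc[OF e] gc[OF f] in \<open>auto simp: module_hom_add[OF g]\<close>)
    also have "\<dots> = (\<Oplus>p\<in>?Q. g p (e p)) \<oplus> (\<Oplus>p\<in>?Q. g p (f p))"
      by (rule V.finsum_addf) (use gc[OF e] gc[OF f] in auto)
    also have "(\<Oplus>p\<in>?Q. g p (e p)) = h e" by (rule h[symmetric]) (use P Q in auto)
    also have "(\<Oplus>p\<in>?Q. g p (f p)) = h f" by (rule h[symmetric]) (use P Q in auto)
    finally show "h (e \<oplus>\<^bsub>dsum E\<^esub> f) = h e \<oplus> h f" .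
  qed
  moreover have "h (single E p x) = g p x" if x: "x \<in> carrier (E p)" for p x
  proof -
    have "h (single E p x) = (\<Oplus>q\<in>{p}. g q (single E p x q))"
      by (rule h) (use x in \<open>auto simp: single_def\<close>)
    then show ?thesis using x module_hom_closed[OF g] by (simp add: single_def)
  qed
  ultimately show ?thesis by blast
qed

end

lemma restrict_dsum_sel:
  "carrier (restrict_scalars A (dsum E)) = carrier (dsum (\<lambda>p. restrict_scalars A (E p)))"
  "single (\<lambda>p. restrict_scalars A (E p)) = single E"
  "module_hom K (restrict_scalars A (dsum E)) V = module_hom K (dsum (\<lambda>p. restrict_scalars A (E p))) V"
proof -
  show c: "carrier (restrict_scalars A (dsum E)) = carrier (dsum (\<lambda>p. restrict_scalars A (E p)))"
    by (auto simp: dsum_sel)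
  show "single (\<lambda>p. restrict_scalars A (E p)) = single E" by (simp add: single_def fun_eq_iff)
  have "add (restrict_scalars A (dsum E)) = add (dsum (\<lambda>p. restrict_scalars A (E p)))"
    "smult (restrict_scalars A (dsum E)) = smult (dsum (\<lambda>p. restrict_scalars A (E p)))"
    by (simp_all add: dsum_sel restrict_scalars_smult)
  then show "module_hom K (restrict_scalars A (dsum E)) V = module_hom K (dsum (\<lambda>p. restrict_scalars A (E p))) V"
    unfolding module_hom_def c[symmetric] by simp
qed

lemma dsum_lift_restrict:
  assumes A: "algebra K A" and E: "\<And>p. module A (E p)" and V: "module K V"
    and g: "\<And>p. g p \<in> module_hom K (restrict_scalars A (E p)) V"
  shows "\<exists>h\<in>module_hom K (restrict_scalars A (dsum E)) V. \<forall>p. \<forall>x\<in>carrier (E p). h (single E p x) = g p x"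
  using dsum_lift[OF restrict_scalars_module[OF A E] V g] by (simp add: restrict_dsum_sel)

section \<open>Maps of tensor products\<close>

lemma tensor_map:
  assumes K: "cring K" and M: "module K M" "module K N" "module K M2" "module K N2"
    and u: "u \<in> module_hom K M M2" and v: "v \<in> module_hom K N N2"
  shows "\<exists>h\<in>module_hom K (tensor_product K M N) (tensor_product K M2 N2).
    \<forall>m\<in>carrier M. \<forall>n\<in>carrier N. h (pure_tensor K M N m n) = pure_tensor K M2 N2 (u m) (v n)"
proof (rule tensor_lift[OF K M(1,2) tensor_is_module[OF K M(3,4)]])
  note b = pure_bilin[OF K M(3,4)]
  show "bilin K M N (tensor_product K M2 N2) (\<lambda>m n. pure_tensor K M2 N2 (u m) (v n))"
    by (rule bilinI)
      (auto intro: module_hom_comp[OF u bilin_left[OF b]] module_hom_comp[OF v bilin_right[OF b]]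
        module_hom_closed[OF u] module_hom_closed[OF v])
qed

context tensor_mod
begin

lemma cringR: "cring R" using R_alg by (simp add: algebra_def)

text \<open>Graded pieces of the tensor product and of its subcomplexes are obtained by restricting
  the set of admissible pairs.\<close>

definition tspan :: "('e \<times> 'f) set \<Rightarrow> ('e \<times> 'f \<Rightarrow> 'k) set set" where
  "tspan P = asum T {e \<star> f | e f. (e, f) \<in> P}"

lemma tspan_subset_submodule: "submodule H K T \<Longrightarrow> (\<And>e f. (e, f) \<in> P \<Longrightarrow> e \<star> f \<in> H) \<Longrightarrow> tspan P \<subseteq> H"
  unfolding tspan_def by (rule asum_subset_submodule) auto

context
  fixes P assumes P: "P \<subseteq> carrier E \<times> carrier F"
begin

lemma tspan_gen: "{e \<star> f | e f. (e, f) \<in> P} \<subseteq> carrier T"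
  using P by auto

lemma tspan_carrier: "tspan P \<subseteq> carrier T"
  unfolding tspan_def by (rule asum_carrier[OF T.abelian_group_axioms tspan_gen])

lemma tspan_incl: "(e, f) \<in> P \<Longrightarrow> e \<star> f \<in> tspan P"
  unfolding tspan_def by (rule asum_incl[OF T.abelian_group_axioms tspan_gen]) auto

lemma tspan_add: "s \<in> tspan P \<Longrightarrow> t \<in> tspan P \<Longrightarrow> s \<oplus>\<^bsub>T\<^esub> t \<in> tspan P"
  unfolding tspan_def by (rule asum_add[OF T.abelian_group_axioms tspan_gen])

lemma tspan_zero: "\<zero>\<^bsub>T\<^esub> \<in> tspan P"
  unfolding tspan_def by (rule asum.zero)

lemma tspan_induct [consumes 1, case_names zero add]:
  assumes "t \<in> tspan P" "Q \<zero>\<^bsub>T\<^esub>"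
    "\<And>e f t. (e, f) \<in> P \<Longrightarrow> t \<in> tspan P \<Longrightarrow> e \<star> f \<in> carrier T \<Longrightarrow> t \<in> carrier T \<Longrightarrow> Q t \<Longrightarrow> Q ((e \<star> f) \<oplus>\<^bsub>T\<^esub> t)"
  shows "Q t"
  using assms(1) unfolding tspan_def
proof induction
  case zero then show ?case by (rule assms(2))
next
  case (add s t)
  then have t: "t \<in> tspan P" by (simp add: tspan_def)
  from add(1) obtain e f where ef: "s = e \<star> f" "(e, f) \<in> P" by blast
  have "e \<star> f \<in> carrier T" using tspan_gen ef(2) by blast
  then show ?case unfolding ef(1) using t tspan_carrier by (intro assms(3) ef(2) add.IH) auto
qed

lemma tspan_hom_eq:
  assumes "module K V" "h \<in> module_hom K T V" "g \<in> module_hom K T V"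
    and "\<And>e f. (e, f) \<in> P \<Longrightarrow> h (e \<star> f) = g (e \<star> f)" and "t \<in> tspan P"
  shows "h t = g t"
  using asum_hom_eq[OF modT assms(1-3) tspan_gen] assms(4,5) unfolding tspan_def by blast

text \<open>A scalar can be absorbed by either factor, so it is enough that one of the two
  absorptions stays in P.\<close>

lemma tspan_submodule_K:
  assumes "\<And>c e f. c \<in> carrier K \<Longrightarrow> (e, f) \<in> P \<Longrightarrow> (c \<odot>\<^bsub>E'\<^esub> e, f) \<in> P \<or> (e, c \<odot>\<^bsub>F'\<^esub> f) \<in> P"
  shows "submodule (tspan P) K T"
  unfolding tspan_def
proof (rule asum_submodule[OF modT tspan_gen])
  fix c s assume c: "c \<in> carrier K" and "s \<in> {e \<star> f | e f. (e, f) \<in> P}"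
  then obtain e f where s: "s = e \<star> f" "(e, f) \<in> P" by auto
  have eq: "c \<odot>\<^bsub>T\<^esub> s = (c \<odot>\<^bsub>E'\<^esub> e) \<star> f" "c \<odot>\<^bsub>T\<^esub> s = e \<star> (c \<odot>\<^bsub>F'\<^esub> f)"
    using s P c bilin_smult_left[OF pX_bilin c] bilin_smult_right[OF pX_bilin c] by auto
  from assms[OF c s(2)] have "c \<odot>\<^bsub>T\<^esub> s \<in> tspan P"
  proof
    assume "(c \<odot>\<^bsub>E'\<^esub> e, f) \<in> P" then show ?thesis unfolding eq(1) by (rule tspan_incl)
  next
    assume "(e, c \<odot>\<^bsub>F'\<^esub> f) \<in> P" then show ?thesis unfolding eq(2) by (rule tspan_incl)
  qed
  then show "c \<odot>\<^bsub>T\<^esub> s \<in> asum T {e \<star> f | e f. (e, f) \<in> P}" by (simp add: tspan_def)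
qed

text \<open>Elements of R are sums of pure tensors a \<otimes> b, and each of these maps generators
  to generators.\<close>

lemma tspan_submodule:
  assumes cl: "\<And>a b e f. a \<in> carrier A \<Longrightarrow> b \<in> carrier B \<Longrightarrow> (e, f) \<in> P \<Longrightarrow> (a \<odot>\<^bsub>E\<^esub> e, b \<odot>\<^bsub>F\<^esub> f) \<in> P"
  shows "submodule (tspan P) R Xm"
  unfolding tspan_def X_asum[symmetric]
proof (rule asum_submodule[OF modX])
  show "{e \<star> f | e f. (e, f) \<in> P} \<subseteq> carrier Xm" using tspan_gen by simp
  fix r s assume r: "r \<in> carrier R" and "s \<in> {e \<star> f | e f. (e, f) \<in> P}"
  then obtain e f where s: "s = e \<star> f" "(e, f) \<in> P" by auto
  have sc: "s \<in> carrier T" using s P by auto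
  have "r \<in> asum R puresR" using r carrier_R_asum by blast
  then have "r \<odot>\<^bsub>Xm\<^esub> s \<in> tspan P"
  proof induction
    case zero then show ?case using sc Xm.smult_l_null[of s] tspan_zero by simp
  next
    case (add q r)
    then obtain a b where q: "q = pR a b" "a \<in> carrier A" "b \<in> carrier B" by (auto simp: puresR_def)
    have rc: "r \<in> carrier R" using add asum_carrier[OF R.abelian_group_axioms puresR_carrier] by blast
    have "(q \<oplus>\<^bsub>R\<^esub> r) \<odot>\<^bsub>Xm\<^esub> s = q \<odot>\<^bsub>Xm\<^esub> s \<oplus>\<^bsub>T\<^esub> r \<odot>\<^bsub>Xm\<^esub> s"
      using Xm.smult_l_distr[of q r s] rc q pR_closed sc by simp
    moreover have "q \<odot>\<^bsub>Xm\<^esub> s \<in> tspan P"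
      using smultX_pure[OF q(2,3), of e f] s P q cl[OF q(2,3) s(2)] tspan_incl by auto
    ultimately show ?case using add.IH tspan_add by simp
  qed
  then show "r \<odot>\<^bsub>Xm\<^esub> s \<in> asum Xm {e \<star> f | e f. (e, f) \<in> P}" by (simp add: tspan_def)
qed

end

lemma pX_zero: "e \<in> carrier E \<Longrightarrow> e \<star> \<zero>\<^bsub>F\<^esub> = \<zero>\<^bsub>T\<^esub>" "f \<in> carrier F \<Longrightarrow> \<zero>\<^bsub>E\<^esub> \<star> f = \<zero>\<^bsub>T\<^esub>"
  using module_hom_zero[OF modF' modT bilin_right[OF pX_bilin]]
    module_hom_zero[OF modE' modT bilin_left[OF pX_bilin]] by simp_all

lemma op_exists:
  assumes "u \<in> module_hom K E' E'" "v \<in> module_hom K F' F'"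
  shows "\<exists>h\<in>module_hom K T T. \<forall>e\<in>carrier E. \<forall>f\<in>carrier F. h (e \<star> f) = u e \<star> v f"
  using tensor_map[OF cringK modE' modF' modE' modF' assms] by simp

lemma id_hom: "(\<lambda>x. x) \<in> module_hom K V V" by (rule module_homI) auto

text \<open>The map u \<otimes> v, which is determined on T by its values on pure tensors.\<close>

definition "op u v = (SOME h. h \<in> module_hom K T T \<and> (\<forall>e\<in>carrier E. \<forall>f\<in>carrier F. h (e \<star> f) = u e \<star> v f))"

lemma op:
  assumes "u \<in> module_hom K E' E'" "v \<in> module_hom K F' F'"
  shows "op u v \<in> module_hom K T T" "\<And>e f. e \<in> carrier E \<Longrightarrow> f \<in> carrier F \<Longrightarrow> op u v (e \<star> f) = u e \<star> v f"
proof -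
  have "op u v \<in> module_hom K T T \<and> (\<forall>e\<in>carrier E. \<forall>f\<in>carrier F. op u v (e \<star> f) = u e \<star> v f)"
    unfolding op_def by (rule someI_ex[OF op_exists[OF assms, unfolded Bex_def]])
  then show "op u v \<in> module_hom K T T" "\<And>e f. e \<in> carrier E \<Longrightarrow> f \<in> carrier F \<Longrightarrow> op u v (e \<star> f) = u e \<star> v f"
    by blast+
qed

lemma smultX_pow_left:
  assumes x: "x \<in> carrier A" and "e \<in> carrier E" "f \<in> carrier F"
  shows "(pR x \<one>\<^bsub>B\<^esub> [^]\<^bsub>R\<^esub> (n::nat)) \<odot>\<^bsub>Xm\<^esub> (e \<star> f) = ((x [^]\<^bsub>A\<^esub> n) \<odot>\<^bsub>E\<^esub> e) \<star> f"
proof -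
  have "pR x \<one>\<^bsub>B\<^esub> [^]\<^bsub>R\<^esub> n = pR (x [^]\<^bsub>A\<^esub> n) \<one>\<^bsub>B\<^esub>"
    by (induction n) (use x in \<open>simp_all add: oneR multR_pure cring_nat_pow_closed[OF cringA]\<close>)
  then show ?thesis using assms by (simp add: smultX_pure)
qed

lemma smultX_pow_right:
  assumes y: "y \<in> carrier B" and "e \<in> carrier E" "f \<in> carrier F"
  shows "(pR \<one>\<^bsub>A\<^esub> y [^]\<^bsub>R\<^esub> (n::nat)) \<odot>\<^bsub>Xm\<^esub> (e \<star> f) = e \<star> ((y [^]\<^bsub>B\<^esub> n) \<odot>\<^bsub>F\<^esub> f)"
proof -
  have "pR \<one>\<^bsub>A\<^esub> y [^]\<^bsub>R\<^esub> n = pR \<one>\<^bsub>A\<^esub> (y [^]\<^bsub>B\<^esub> n)"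
    by (induction n) (use y in \<open>simp_all add: oneR multR_pure cring_nat_pow_closed[OF cringB]\<close>)
  then show ?thesis using assms by (simp add: smultX_pure)
qed

lemma smultX_hom: "r \<in> carrier R \<Longrightarrow> smult Xm r \<in> module_hom K T T"
  by (rule bilin_right[OF smultX_bilin])

end

text \<open>Both h (r t) and r (h t) are K-bilinear in r and t, so they only have to be compared on
  pure tensors.\<close>

lemma tensor_map_R:
  assumes EF: "tensor_mod K A B E F" and EF2: "tensor_mod K A B E2 F2"
    and h: "h \<in> module_hom K (tensor_product K (restrict_scalars A E) (restrict_scalars B F))
      (tensor_product K (restrict_scalars A E2) (restrict_scalars B F2))"
    and hp: "\<And>e f. e \<in> carrier E \<Longrightarrow> f \<in> carrier F \<Longrightarrow>
      h (pure_tensor K (restrict_scalars A E) (restrict_scalars B F) e f) =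
      pure_tensor K (restrict_scalars A E2) (restrict_scalars B F2) (u e) (v f)"
    and u: "u \<in> module_hom A E E2" and v: "v \<in> module_hom B F F2"
  shows "h \<in> module_hom (tensor_product K A B) (tensor_module K A B E F) (tensor_module K A B E2 F2)"
proof -
  interpret X: tensor_mod K A B E F by fact
  interpret Y: tensor_mod K A B E2 F2 by fact
  have "h (r \<odot>\<^bsub>X.Xm\<^esub> t) = r \<odot>\<^bsub>Y.Xm\<^esub> h t" if r: "r \<in> carrier X.R" and t: "t \<in> carrier X.T" for r t
  proof (rule bilinear_eq[OF Y.modT X.modR X.modT X.puresR_carrier X.puresX_carrier X.carrier_R_asum X.carrier_T_asum _ _ _ r t])
    show "bilin K X.R X.T Y.T (\<lambda>r t. h (r \<odot>\<^bsub>X.Xm\<^esub> t))"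
      by (rule bilinI) (auto intro: module_hom_comp[OF bilin_left[OF X.smultX_bilin] h]
          module_hom_comp[OF bilin_right[OF X.smultX_bilin] h])
    show "bilin K X.R X.T Y.T (\<lambda>r t. r \<odot>\<^bsub>Y.Xm\<^esub> h t)"
      by (rule bilinI) (auto intro: bilin_left[OF Y.smultX_bilin] module_hom_closed[OF h]
          module_hom_comp[OF h bilin_right[OF Y.smultX_bilin]])
    show "h (r \<odot>\<^bsub>X.Xm\<^esub> t) = r \<odot>\<^bsub>Y.Xm\<^esub> h t" if "r \<in> X.puresR" "t \<in> X.puresX" for r t
      using that module_hom_closed[OF u] module_hom_closed[OF v]
      by (auto simp: X.puresR_def X.puresX_def X.smultX_pure Y.smultX_pure hp
          module_hom_smult[OF u] module_hom_smult[OF v])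
  qed
  then show ?thesis
    by (intro module_homI) (simp_all add: module_hom_closed[OF h] module_hom_add[OF h])
qed

lemma (in abelian_group) diff_zero: "x \<in> carrier G \<Longrightarrow> x \<ominus> \<zero> = x"
proof -
  assume "x \<in> carrier G"
  moreover have "\<ominus> \<zero> = \<zero>" by (rule minus_equality) auto
  ultimately show ?thesis by (simp add: a_minus_def)
qed

text \<open>The cancellation behind \<open>DH_HD\<close>: the mixed term s occurs with both signs,
  and w is inserted and removed.\<close>

lemma (in abelian_group) homotopy_sum:
  assumes "a \<in> carrier G" "b \<in> carrier G" "s \<in> carrier G" "u \<in> carrier G" "v \<in> carrier G" "w \<in> carrier G"
  shows "((a \<oplus> s) \<oplus> u) \<oplus> (b \<oplus> (\<ominus> s \<oplus> v)) = ((w \<oplus> (u \<oplus> v)) \<oplus> (a \<oplus> b)) \<ominus> w"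
proof -
  note cl = assms a_inv_closed[OF assms(3)] a_inv_closed[OF assms(6)]
  have "((a \<oplus> s) \<oplus> u) \<oplus> (b \<oplus> (\<ominus> s \<oplus> v)) = (s \<oplus> \<ominus> s) \<oplus> ((u \<oplus> v) \<oplus> (a \<oplus> b))"
    using cl by (simp only: a_ac a_closed)
  also have "\<dots> = (w \<oplus> \<ominus> w) \<oplus> ((u \<oplus> v) \<oplus> (a \<oplus> b))" using assms by (simp add: r_neg)
  also have "\<dots> = ((w \<oplus> (u \<oplus> v)) \<oplus> (a \<oplus> b)) \<oplus> \<ominus> w"
    using cl by (simp only: a_ac a_closed)
  finally show ?thesis by (simp add: a_minus_def)
qed

lemma module_hom_sum:
  assumes N: "module R N" and f: "f \<in> module_hom R M N" and g: "g \<in> module_hom R M N"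
  shows "(\<lambda>x. f x \<oplus>\<^bsub>N\<^esub> g x) \<in> module_hom R M N"
proof -
  interpret N: module R N by fact
  show ?thesis
    by (rule module_homI)
      (simp_all add: module_hom_closed[OF f] module_hom_closed[OF g] module_hom_add[OF f] module_hom_add[OF g]
        module_hom_smult[OF f] module_hom_smult[OF g] N.smult_r_distr N.a_ac)
qed

lemma module_hom_neg:
  assumes N: "module R N" and f: "f \<in> module_hom R M N"
  shows "(\<lambda>x. \<ominus>\<^bsub>N\<^esub> f x) \<in> module_hom R M N"
proof -
  interpret N: module R N by fact
  show ?thesis
    by (rule module_homI)
      (simp_all add: module_hom_closed[OF f] module_hom_add[OF f]
        module_hom_smult[OF f] N.smult_r_minus N.minus_add)
qed

lemma module_hom_minus:
  assumes N: "module R N" and f: "f \<in> module_hom R M N" and g: "g \<in> module_hom R M N"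
  shows "(\<lambda>x. f x \<ominus>\<^bsub>N\<^esub> g x) \<in> module_hom R M N"
  unfolding a_minus_def by (rule module_hom_sum[OF N f module_hom_neg[OF N g]])

section \<open>The Kuenneth homotopy\<close>

context tensor_mod
begin

lemma pX_neg: "e \<in> carrier E \<Longrightarrow> f \<in> carrier F \<Longrightarrow> (\<ominus>\<^bsub>E\<^esub> e) \<star> f = \<ominus>\<^bsub>T\<^esub> (e \<star> f)"
  using module_hom_a_inv[OF modE' modT bilin_left[OF pX_bilin]] by simp

lemma pX_add: "e \<in> carrier E \<Longrightarrow> e' \<in> carrier E \<Longrightarrow> f \<in> carrier F \<Longrightarrow> (e \<oplus>\<^bsub>E\<^esub> e') \<star> f = e \<star> f \<oplus>\<^bsub>T\<^esub> e' \<star> f"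
  using bilin_add_left[OF pX_bilin] by simp

lemma pX_add_right: "e \<in> carrier E \<Longrightarrow> f \<in> carrier F \<Longrightarrow> f' \<in> carrier F \<Longrightarrow> e \<star> (f \<oplus>\<^bsub>F\<^esub> f') = e \<star> f \<oplus>\<^bsub>T\<^esub> e \<star> f'"
  using bilin_add_right[OF pX_bilin] by simp

end

text \<open>
  Over a field every complex splits: there is \<open>h\<close> of degree \<open>-1\<close> such that \<open>\<pi> = 1 - (d h + h d)\<close> maps into
  cycles.  A sign operator \<open>\<sigma>\<close>, equal to \<open>(-1)\<^sup>p\<close> in degree \<open>p\<close>, then makes \<open>h \<otimes> 1 + \<sigma>\<pi> \<otimes> h'\<close> a homotopy
  between the identity of the tensor product and \<open>\<pi> \<otimes> \<pi>'\<close>.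
\<close>

locale homotopy_data =
  fixes K :: "('k, 'x) ring_scheme" and E :: "('k, 'e, 'u) module_scheme" and C :: "nat \<Rightarrow> 'e set" and d h :: "'e \<Rightarrow> 'e"
  assumes KE: "module K E"
    and d: "d \<in> module_hom K E E" and h: "h \<in> module_hom K E E"
    and C: "\<And>p. submodule (C p) K E"
    and dC: "\<And>p c. c \<in> C p \<Longrightarrow> d c \<in> C (Suc p)"
    and hC: "\<And>p c. c \<in> C (Suc p) \<Longrightarrow> h c \<in> C p" and hC0: "\<And>c. c \<in> C 0 \<Longrightarrow> h c = \<zero>\<^bsub>E\<^esub>"
    and dd: "\<And>p c. c \<in> C p \<Longrightarrow> d (d c) = \<zero>\<^bsub>E\<^esub>" and dhd: "\<And>p c. c \<in> C p \<Longrightarrow> d (h (d c)) = d c"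
begin

interpretation E: module K E by (rule KE)

definition "\<pi> c = c \<ominus>\<^bsub>E\<^esub> (d (h c) \<oplus>\<^bsub>E\<^esub> h (d c))"

lemma Cc: "c \<in> C p \<Longrightarrow> c \<in> carrier E" by (rule submodule_subset[OF C])

lemma hC': "c \<in> C p \<Longrightarrow> \<exists>q. h c \<in> C q"
  using hC hC0 submodule_zero[OF C] by (cases p) auto

lemma dhC: "c \<in> C p \<Longrightarrow> d (h c) \<in> C p"
proof (cases p)
  case 0
  assume "c \<in> C p"
  then have "d (h c) = \<zero>\<^bsub>E\<^esub>" using hC0 0 module_hom_zero[OF KE KE d] by simp
  then show ?thesis using submodule_zero[OF C] by simp
qed (use hC dC in auto)

lemma Pi_hom: "\<pi> \<in> module_hom K E E"
proof -
  have "(\<lambda>c. c \<ominus>\<^bsub>E\<^esub> (d (h c) \<oplus>\<^bsub>E\<^esub> h (d c))) \<in> module_hom K E E"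
    by (intro module_hom_minus[OF KE] module_hom_sum[OF KE] module_hom_comp[OF h d] module_hom_comp[OF d h])
      (auto intro: module_homI)
  then show ?thesis by (simp add: \<pi>_def[abs_def])
qed

lemma PiC: "c \<in> C p \<Longrightarrow> \<pi> c \<in> C p"
  unfolding \<pi>_def by (intro submodule_diff[OF C] submodule_add[OF C] dhC hC dC)

text \<open>Of the two subtracted terms, d d h vanishes and d h d equals d.\<close>

lemma d_Pi:
  assumes c: "c \<in> C p" shows "d (\<pi> c) = \<zero>\<^bsub>E\<^esub>"
proof -
  note cl = Cc[OF c] Cc[OF dhC[OF c]] Cc[OF hC[OF dC[OF c]]] Cc[OF dC[OF c]]
  have "d (d (h c)) = \<zero>\<^bsub>E\<^esub>" using hC'[OF c] dd by blast
  then have "d (\<pi> c) = d c \<ominus>\<^bsub>E\<^esub> (\<zero>\<^bsub>E\<^esub> \<oplus>\<^bsub>E\<^esub> d c)"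
    unfolding \<pi>_def using cl by (simp add: module_hom_diff[OF KE KE d] module_hom_add[OF d] dhd[OF c])
  then show ?thesis using cl by (simp add: E.diff_self)
qed

lemma Pi_d:
  assumes c: "c \<in> C p" shows "\<pi> (d c) = \<zero>\<^bsub>E\<^esub>"
  unfolding \<pi>_def dd[OF c] dhd[OF c] module_hom_zero[OF KE KE h] using Cc[OF dC[OF c]] by (simp add: E.diff_self)

lemma Pi_decomp:
  assumes c: "c \<in> C p" shows "c = \<pi> c \<oplus>\<^bsub>E\<^esub> (d (h c) \<oplus>\<^bsub>E\<^esub> h (d c))"
  unfolding \<pi>_def using Cc[OF c] Cc[OF dhC[OF c]] Cc[OF hC[OF dC[OF c]]]
  by (simp add: a_minus_def E.a_assoc E.l_neg)

end

text \<open>The sign operator anticommutes with d and with h: the first makes D square to zero, the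
  second makes the mixed terms of D H + H D cancel, and both together make it commute with
  \<pi>.\<close>

locale kuenneth = tensor_mod K A B E F + dE: homotopy_data K "restrict_scalars A E" C d h +
    dF: homotopy_data K "restrict_scalars B F" C' d' h'
  for K :: "('k, 'x) ring_scheme" and A :: "('k, 'a, 'y) module_scheme" and B :: "('k, 'b, 'z) module_scheme"
    and E :: "('a, 'e, 'u) module_scheme" and F :: "('b, 'f, 'v) module_scheme"
    and C d h C' d' h' +
  fixes \<sigma>
  assumes \<sigma>: "\<sigma> \<in> module_hom K E' E'" and \<sigma>C: "\<And>p c. c \<in> C p \<Longrightarrow> \<sigma> c \<in> C p"
    and \<sigma>\<sigma>: "\<And>p c. c \<in> C p \<Longrightarrow> \<sigma> (\<sigma> c) = c"
    and \<sigma>d: "\<And>p c. c \<in> C p \<Longrightarrow> \<sigma> (d c) = \<ominus>\<^bsub>E\<^esub> d (\<sigma> c)"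
    and \<sigma>h: "\<And>p c. c \<in> C p \<Longrightarrow> \<sigma> (h c) = \<ominus>\<^bsub>E\<^esub> h (\<sigma> c)"
begin

definition "prs n = {(c, c'). \<exists>p q. c \<in> C p \<and> c' \<in> C' q \<and> p + q = n}"
definition "cprs n = {(c, c'). \<exists>p q. c \<in> C p \<and> d c = \<zero>\<^bsub>E\<^esub> \<and> c' \<in> C' q \<and> d' c' = \<zero>\<^bsub>F\<^esub> \<and> p + q = n}"
definition "D t = op d (\<lambda>f. f) t \<oplus>\<^bsub>T\<^esub> op \<sigma> d' t"
definition "H t = op h (\<lambda>f. f) t \<oplus>\<^bsub>T\<^esub> op (\<lambda>e. \<sigma> (dE.\<pi> e)) h' t"

lemma cE: "c \<in> C p \<Longrightarrow> c \<in> carrier E" using dE.Cc by simp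
lemma cF: "c \<in> C' p \<Longrightarrow> c \<in> carrier F" using dF.Cc by simp

lemma prs_carrier: "prs n \<subseteq> carrier E \<times> carrier F" by (auto simp: prs_def cE cF)

lemma prsI: "c \<in> C p \<Longrightarrow> c' \<in> C' q \<Longrightarrow> p + q = n \<Longrightarrow> c \<star> c' \<in> tspan (prs n)"
  by (rule tspan_incl[OF prs_carrier]) (auto simp: prs_def)

lemma cprs_carrier: "cprs n \<subseteq> carrier E \<times> carrier F" by (auto simp: cprs_def cE cF)

lemma cprsI: "c \<in> C p \<Longrightarrow> d c = \<zero>\<^bsub>E\<^esub> \<Longrightarrow> c' \<in> C' q \<Longrightarrow> d' c' = \<zero>\<^bsub>F\<^esub> \<Longrightarrow> p + q = n \<Longrightarrow> c \<star> c' \<in> tspan (cprs n)"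
  by (rule tspan_incl[OF cprs_carrier]) (auto simp: cprs_def)

lemma prs_submodule: "submodule (tspan (prs n)) K T"
  by (rule tspan_submodule_K[OF prs_carrier]) (auto simp: prs_def intro: submodule_smult[OF dE.C])

lemma cprs_submodule: "submodule (tspan (cprs n)) K T"
proof (rule tspan_submodule_K[OF cprs_carrier])
  fix k e f assume k: "k \<in> carrier K" and "(e, f) \<in> cprs n"
  then obtain p q where *: "e \<in> C p" "d e = \<zero>\<^bsub>E\<^esub>" "f \<in> C' q" "d' f = \<zero>\<^bsub>F\<^esub>" "p + q = n" by (auto simp: cprs_def)
  have "d (k \<odot>\<^bsub>E'\<^esub> e) = \<zero>\<^bsub>E\<^esub>"
    using module_hom_smult[OF dE.d k, of e] cE[OF *(1)] *(2) k E'.smult_r_null[of k] by simp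
  then show "(k \<odot>\<^bsub>E'\<^esub> e, f) \<in> cprs n \<or> (e, k \<odot>\<^bsub>F'\<^esub> f) \<in> cprs n"
    using * submodule_smult[OF dE.C k *(1)] by (auto simp: cprs_def)
qed

lemma sPi_hom: "(\<lambda>e. \<sigma> (dE.\<pi> e)) \<in> module_hom K E' E'"
  by (rule module_hom_comp[OF dE.Pi_hom \<sigma>])

lemma D_hom: "D \<in> module_hom K T T"
proof -
  have "(\<lambda>t. op d (\<lambda>f. f) t \<oplus>\<^bsub>T\<^esub> op \<sigma> d' t) \<in> module_hom K T T"
    by (intro module_hom_sum[OF modT] op id_hom dE.d dF.d \<sigma>)
  then show ?thesis by (simp add: D_def[abs_def])
qed

lemma H_hom: "H \<in> module_hom K T T"
proof -
  have "(\<lambda>t. op h (\<lambda>f. f) t \<oplus>\<^bsub>T\<^esub> op (\<lambda>e. \<sigma> (dE.\<pi> e)) h' t) \<in> module_hom K T T"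
    by (intro module_hom_sum[OF modT] op id_hom dE.h dF.h sPi_hom)
  then show ?thesis by (simp add: H_def[abs_def])
qed

lemma D_pure: "e \<in> carrier E \<Longrightarrow> f \<in> carrier F \<Longrightarrow> D (e \<star> f) = d e \<star> f \<oplus>\<^bsub>T\<^esub> \<sigma> e \<star> d' f"
  unfolding D_def op(2)[OF dE.d id_hom] op(2)[OF \<sigma> dF.d] ..

lemma H_pure: "e \<in> carrier E \<Longrightarrow> f \<in> carrier F \<Longrightarrow> H (e \<star> f) = h e \<star> f \<oplus>\<^bsub>T\<^esub> \<sigma> (dE.\<pi> e) \<star> h' f"
  unfolding H_def op(2)[OF dE.h id_hom] op(2)[OF sPi_hom dF.h] ..

text \<open>Anticommuting with d and h, the involution \<sigma> commutes with d h + h d and hence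
  with \<pi>.\<close>

lemma Pi_sigma:
  assumes c: "c \<in> C p" shows "\<sigma> (dE.\<pi> (\<sigma> c)) = dE.\<pi> c"
proof -
  note z = module_hom_closed[OF dE.d, simplified] module_hom_closed[OF dE.h, simplified] module_hom_closed[OF \<sigma>, simplified]
  note cc = cE[OF c]
  obtain q where q: "h c \<in> C q" using dE.hC'[OF c] by blast
  have neg: "d (\<ominus>\<^bsub>E\<^esub> e) = \<ominus>\<^bsub>E\<^esub> d e" "h (\<ominus>\<^bsub>E\<^esub> e) = \<ominus>\<^bsub>E\<^esub> h e" if "e \<in> carrier E" for e
    using module_hom_a_inv[OF modE' modE' dE.d] module_hom_a_inv[OF modE' modE' dE.h] that by simp_all
  have "h (\<sigma> c) = \<ominus>\<^bsub>E\<^esub> \<sigma> (h c)" "d (\<sigma> c) = \<ominus>\<^bsub>E\<^esub> \<sigma> (d c)" using \<sigma>h[OF c] \<sigma>d[OF c] cc z by simp_all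
  then have "d (h (\<sigma> c)) = \<ominus>\<^bsub>E\<^esub> d (\<sigma> (h c))" "h (d (\<sigma> c)) = \<ominus>\<^bsub>E\<^esub> h (\<sigma> (d c))" using cc z neg by simp_all
  then have 1: "d (h (\<sigma> c)) = \<sigma> (d (h c))" "h (d (\<sigma> c)) = \<sigma> (h (d c))"
    using \<sigma>d[OF q] \<sigma>h[OF dE.dC[OF c]] by simp_all
  have "dE.\<pi> (\<sigma> c) = \<sigma> (dE.\<pi> c)"
    unfolding dE.\<pi>_def 1 using cc z module_hom_diff[OF modE' modE' \<sigma>] module_hom_add[OF \<sigma>] by simp
  then show ?thesis using \<sigma>\<sigma>[OF dE.PiC[OF c]] by simp
qed

text \<open>Checked on c \<otimes> c' by expanding twice: the left factor as \<pi> c + (d h + h d)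
  c, and then c' in the same way in the term \<pi> c \<otimes> c'. The difference between c
  \<otimes> c' and the left side is \<pi> c \<otimes> \<pi>' c'.\<close>

lemma DH_HD:
  assumes t: "t \<in> tspan (prs n)"
  shows "D (H t) \<oplus>\<^bsub>T\<^esub> H (D t) = t \<ominus>\<^bsub>T\<^esub> op dE.\<pi> dF.\<pi> t"
proof (rule tspan_hom_eq[OF prs_carrier modT _ _ _ t])
  note op_Pi = op[OF dE.Pi_hom dF.Pi_hom]
  show "(\<lambda>t. D (H t) \<oplus>\<^bsub>T\<^esub> H (D t)) \<in> module_hom K T T"
    by (intro module_hom_sum[OF modT] module_hom_comp[OF H_hom D_hom] module_hom_comp[OF D_hom H_hom])
  show "(\<lambda>t. t \<ominus>\<^bsub>T\<^esub> op dE.\<pi> dF.\<pi> t) \<in> module_hom K T T"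
    by (intro module_hom_minus[OF modT] id_hom op_Pi)
  fix c c' assume "(c, c') \<in> prs n"
  then obtain p q where c: "c \<in> C p" and c': "c' \<in> C' q" by (auto simp: prs_def)
  note z = module_hom_closed[OF dE.d, simplified] module_hom_closed[OF dE.h, simplified] module_hom_closed[OF \<sigma>, simplified]
    module_hom_closed[OF dF.d, simplified] module_hom_closed[OF dF.h, simplified]
    module_hom_closed[OF dE.Pi_hom, simplified] module_hom_closed[OF dF.Pi_hom, simplified]
  note cc = cE[OF c] cF[OF c']
  have s0: "\<sigma> \<zero>\<^bsub>E\<^esub> = \<zero>\<^bsub>E\<^esub>" using module_hom_zero[OF modE' modE' \<sigma>] by simp
  have dPi: "d (dE.\<pi> c) = \<zero>\<^bsub>E\<^esub>" using dE.d_Pi[OF c] by simp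
  have "\<ominus>\<^bsub>E\<^esub> d (\<sigma> (dE.\<pi> c)) = \<zero>\<^bsub>E\<^esub>" using \<sigma>d[OF dE.PiC[OF c]] dPi s0 by simp
  then have dsPi: "d (\<sigma> (dE.\<pi> c)) = \<zero>\<^bsub>E\<^esub>"
    using cc z E.minus_minus[of "d (\<sigma> (dE.\<pi> c))"] by simp
  have Pid: "dE.\<pi> (d c) = \<zero>\<^bsub>E\<^esub>" using dE.Pi_d[OF c] by simp
  have hs: "h (\<sigma> c) = \<ominus>\<^bsub>E\<^esub> \<sigma> (h c)" using \<sigma>h[OF c] cc z by simp
  \<comment> \<open>The terms a and b come from splitting c; u, v and w come from splitting c' next
    to \<pi> c; s is the mixed term that appears with opposite signs.\<close>
  define a b s u v w where "a = d (h c) \<star> c'" "b = h (d c) \<star> c'" "s = \<sigma> (h c) \<star> d' c'"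
    "u = dE.\<pi> c \<star> d' (h' c')" "v = dE.\<pi> c \<star> h' (d' c')" "w = dE.\<pi> c \<star> dF.\<pi> c'"
  note defs = this
  have cl: "a \<in> carrier T" "b \<in> carrier T" "s \<in> carrier T" "u \<in> carrier T" "v \<in> carrier T" "w \<in> carrier T"
    using cc z by (auto simp: defs)
  have 1: "D (H (c \<star> c')) = (a \<oplus>\<^bsub>T\<^esub> s) \<oplus>\<^bsub>T\<^esub> u"
    using cc z cl by (simp add: H_pure module_hom_add[OF D_hom] D_pure dsPi pX_zero \<sigma>\<sigma>[OF dE.PiC[OF c]] defs(1-4)[symmetric])
  have 2: "H (D (c \<star> c')) = b \<oplus>\<^bsub>T\<^esub> (\<ominus>\<^bsub>T\<^esub> s \<oplus>\<^bsub>T\<^esub> v)"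
    using cc z cl by (simp add: D_pure module_hom_add[OF H_hom] H_pure Pid s0 pX_zero hs pX_neg Pi_sigma[OF c] defs(1-5)[symmetric])
  have "dE.\<pi> c \<star> c' = dE.\<pi> c \<star> (dF.\<pi> c' \<oplus>\<^bsub>F\<^esub> (d' (h' c') \<oplus>\<^bsub>F\<^esub> h' (d' c')))"
    using dF.Pi_decomp[OF c'] by simp
  also have "\<dots> = w \<oplus>\<^bsub>T\<^esub> (u \<oplus>\<^bsub>T\<^esub> v)" using cc z by (simp add: pX_add_right defs)
  finally have e1: "dE.\<pi> c \<star> c' = w \<oplus>\<^bsub>T\<^esub> (u \<oplus>\<^bsub>T\<^esub> v)" .
  have "c \<star> c' = (dE.\<pi> c \<oplus>\<^bsub>E\<^esub> (d (h c) \<oplus>\<^bsub>E\<^esub> h (d c))) \<star> c'" using dE.Pi_decomp[OF c] by simp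
  also have "\<dots> = dE.\<pi> c \<star> c' \<oplus>\<^bsub>T\<^esub> (a \<oplus>\<^bsub>T\<^esub> b)" using cc z by (simp add: pX_add defs)
  finally have 3: "c \<star> c' = (w \<oplus>\<^bsub>T\<^esub> (u \<oplus>\<^bsub>T\<^esub> v)) \<oplus>\<^bsub>T\<^esub> (a \<oplus>\<^bsub>T\<^esub> b)" unfolding e1 .
  have 4: "op dE.\<pi> dF.\<pi> (c \<star> c') = w" using op_Pi(2)[OF cc] by (simp add: defs)
  show "D (H (c \<star> c')) \<oplus>\<^bsub>T\<^esub> H (D (c \<star> c')) = c \<star> c' \<ominus>\<^bsub>T\<^esub> op dE.\<pi> dF.\<pi> (c \<star> c')"
    unfolding 1 2 4 unfolding 3 by (rule T.homotopy_sum[OF cl])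
qed

lemma H_zero:
  assumes "t \<in> tspan (prs 0)" shows "H t = \<zero>\<^bsub>T\<^esub>"
proof -
  have "tspan (prs 0) \<subseteq> {t \<in> carrier T. H t = \<zero>\<^bsub>T\<^esub>}"
  proof (rule tspan_subset_submodule[OF submodule_kernel[OF modT modT H_hom]])
    fix c c' assume "(c, c') \<in> prs 0"
    then have c: "c \<in> C 0" "c' \<in> C' 0" by (auto simp: prs_def)
    have "\<sigma> (dE.\<pi> c) \<in> carrier E" by (rule cE[OF \<sigma>C[OF dE.PiC[OF c(1)]]])
    then show "c \<star> c' \<in> {t \<in> carrier T. H t = \<zero>\<^bsub>T\<^esub>}"
      using c dE.hC0[OF c(1)] dF.hC0[OF c(2)] cE cF by (simp add: H_pure pX_zero)
  qed
  then show ?thesis using assms by blast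
qed

lemma H_Suc:
  assumes "t \<in> tspan (prs (Suc n))" shows "H t \<in> tspan (prs n)"
proof -
  have "tspan (prs (Suc n)) \<subseteq> {t \<in> carrier T. H t \<in> tspan (prs n)}"
  proof (rule tspan_subset_submodule[OF submodule_vimage[OF modT modT H_hom prs_submodule]])
    fix c c' assume "(c, c') \<in> prs (Suc n)"
    then obtain p q where c: "c \<in> C p" "c' \<in> C' q" "p + q = Suc n" by (auto simp: prs_def)
    have sc: "\<sigma> (dE.\<pi> c) \<in> C p" by (rule \<sigma>C[OF dE.PiC[OF c(1)]])
    have "h c \<star> c' \<in> tspan (prs n)"
    proof (cases p)
      case 0 then show ?thesis using dE.hC0 c cF tspan_zero[OF prs_carrier] by (simp add: pX_zero)
    next
      case (Suc p') then show ?thesis using dE.hC c by (intro prsI[of _ p' _ q]) auto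
    qed
    moreover have "\<sigma> (dE.\<pi> c) \<star> h' c' \<in> tspan (prs n)"
    proof (cases q)
      case 0 then show ?thesis using dF.hC0 c cE[OF sc] tspan_zero[OF prs_carrier] by (simp add: pX_zero)
    next
      case (Suc q') then show ?thesis using dF.hC c sc by (intro prsI[of _ p _ q']) auto
    qed
    ultimately show "c \<star> c' \<in> {t \<in> carrier T. H t \<in> tspan (prs n)}"
      using c cE cF tspan_add[OF prs_carrier] by (simp add: H_pure)
  qed
  then show ?thesis using assms by blast
qed

lemma op_Pi_cycle:
  assumes "t \<in> tspan (prs n)" shows "op dE.\<pi> dF.\<pi> t \<in> tspan (cprs n)"
proof -
  note op_Pi = op[OF dE.Pi_hom dF.Pi_hom]
  have "tspan (prs n) \<subseteq> {t \<in> carrier T. op dE.\<pi> dF.\<pi> t \<in> tspan (cprs n)}"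
  proof (rule tspan_subset_submodule[OF submodule_vimage[OF modT modT op_Pi(1) cprs_submodule]])
    fix c c' assume "(c, c') \<in> prs n"
    then obtain p q where c: "c \<in> C p" "c' \<in> C' q" "p + q = n" by (auto simp: prs_def)
    have "dE.\<pi> c \<star> dF.\<pi> c' \<in> tspan (cprs n)"
      by (rule cprsI[OF dE.PiC[OF c(1)] _ dF.PiC[OF c(2)] _ c(3)])
        (use dE.d_Pi[OF c(1)] dF.d_Pi[OF c(2)] in simp_all)
    then show "c \<star> c' \<in> {t \<in> carrier T. op dE.\<pi> dF.\<pi> t \<in> tspan (cprs n)}"
      using c cE cF op_Pi(2) by simp
  qed
  then show ?thesis using assms by blast
qed

text \<open>For a cycle the homotopy formula reads t - D (H t) = (\<pi> \<otimes> \<pi>') t, and the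
  right side is a sum of tensors of cycles because \<pi> and \<pi>' map into cycles. In degree 0 the
  term H t vanishes.\<close>

theorem kuenneth_cycles:
  assumes t: "t \<in> tspan (prs n)" and Dt: "D t = \<zero>\<^bsub>T\<^esub>"
  shows "n = 0 \<Longrightarrow> t \<in> tspan (cprs 0)"
    "n = Suc m \<Longrightarrow> \<exists>s\<in>tspan (prs m). t \<ominus>\<^bsub>T\<^esub> D s \<in> tspan (cprs n)"
proof -
  have tc: "t \<in> carrier T" using t tspan_carrier[OF prs_carrier] by blast
  have Hc: "H t \<in> carrier T" by (rule module_hom_closed[OF H_hom tc])
  have DHc: "D (H t) \<in> carrier T" by (rule module_hom_closed[OF D_hom Hc])
  define w where "w = op dE.\<pi> dF.\<pi> t"
  have w: "w \<in> tspan (cprs n)" unfolding w_def by (rule op_Pi_cycle[OF t])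
  have wc: "w \<in> carrier T" using w tspan_carrier[OF cprs_carrier] by blast
  have eq: "D (H t) = t \<ominus>\<^bsub>T\<^esub> w"
    using DH_HD[OF t] DHc by (simp add: Dt module_hom_zero[OF modT modT H_hom] w_def)
  have tw: "t \<ominus>\<^bsub>T\<^esub> D (H t) = w"
    unfolding eq using tc wc by (simp add: a_minus_def T.minus_add T.r_neg2)
  show "t \<in> tspan (cprs 0)" if "n = 0"
    using tw H_zero[of t] t that w tc module_hom_zero[OF modT modT D_hom] by (simp add: T.diff_zero)
  show "\<exists>s\<in>tspan (prs m). t \<ominus>\<^bsub>T\<^esub> D s \<in> tspan (cprs n)" if "n = Suc m"
    using H_Suc[of t m] t that tw w by metis
qed

end

section \<open>Tensor products of direct sums\<close>

locale dtensor =
  fixes K :: "('k, 'x) ring_scheme" and A :: "('k, 'a, 'y) module_scheme" and B :: "('k, 'b, 'z) module_scheme"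
    and Ef :: "nat \<Rightarrow> ('a, 'e) module" and Ff :: "nat \<Rightarrow> ('b, 'f) module"
  assumes fieldK: "field K" and alA: "algebra K A" and alB: "algebra K B"
    and Ef: "\<And>p. module A (Ef p)" and Ff: "\<And>q. module B (Ff q)"

sublocale dtensor \<subseteq> tensor_mod K A B "dsum Ef" "dsum Ff"
  by (intro tensor_mod.intro tensor_algebra.intro tensor_mod_axioms.intro alA alB
      dsum_module[OF Ef] dsum_module[OF Ff])

lemma restrict_submodule:
  assumes A: "algebra K A" and L: "module A L" and P: "submodule P A L"
  shows "submodule P K (restrict_scalars A L)"
proof -
  interpret A: algebra K A by fact
  show ?thesis
    by (rule submoduleI'[OF restrict_scalars_module[OF A L]])
      (use P in \<open>auto simp: restrict_scalars_smult intro: submodule_zero submodule_add submodule_smult submodule_subset\<close>)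
qed

lemma smult_restrict_hom:
  assumes A: "algebra K A" and L: "module A L" and a: "a \<in> carrier A"
  shows "smult L a \<in> module_hom K (restrict_scalars A L) (restrict_scalars A L)"
  by (rule bilin_right[OF smult_bilin[OF A L] a])

context dtensor
begin

notation pX (infixl "\<star>" 70) and actX (infixl "\<cdot>" 70)

abbreviation "sE \<equiv> single Ef"
abbreviation "sF \<equiv> single Ff"

lemma sE_hom: "sE p \<in> module_hom A (Ef p) (dsum Ef)" by (rule single_hom) (rule Ef)
lemma sF_hom: "sF q \<in> module_hom B (Ff q) (dsum Ff)" by (rule single_hom) (rule Ff)
lemmas sE_closed = module_hom_closed[OF sE_hom]
lemmas sF_closed = module_hom_closed[OF sF_hom]

lemma lift_E: "module K V \<Longrightarrow> (\<And>p. g p \<in> module_hom K (restrict_scalars A (Ef p)) V) \<Longrightarrow>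
    \<exists>h\<in>module_hom K E' V. \<forall>p. \<forall>x\<in>carrier (Ef p). h (sE p x) = g p x"
  by (rule dsum_lift_restrict) (auto intro: alA Ef)

lemma lift_F: "module K V \<Longrightarrow> (\<And>p. g p \<in> module_hom K (restrict_scalars B (Ff p)) V) \<Longrightarrow>
    \<exists>h\<in>module_hom K F' V. \<forall>p. \<forall>x\<in>carrier (Ff p). h (sF p x) = g p x"
  by (rule dsum_lift_restrict) (auto intro: alB Ff)

text \<open>P and Q select a submodule in every degree: the full modules give degree n of the total
  complex, torsion parts or cycles give the corresponding subspaces.\<close>

definition "pairs P Q n = {(sE p x, sF q y) | p q x y. x \<in> P p \<and> y \<in> Q q \<and> p + q = n}"

abbreviation "XP P Q n \<equiv> tspan (pairs P Q n)"

context
  fixes P Q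
  assumes P: "\<And>p. submodule (P p) A (Ef p)" and Q: "\<And>q. submodule (Q q) B (Ff q)"
begin

lemma pairs_carrier: "pairs P Q n \<subseteq> carrier (dsum Ef) \<times> carrier (dsum Ff)"
  using submodule_subset[OF P] submodule_subset[OF Q] sE_closed sF_closed
  unfolding pairs_def by blast

lemma pairsI: "x \<in> P p \<Longrightarrow> y \<in> Q q \<Longrightarrow> p + q = n \<Longrightarrow> sE p x \<star> sF q y \<in> XP P Q n"
  by (rule tspan_incl[OF pairs_carrier]) (auto simp: pairs_def)

lemma XP_submodule: "submodule (XP P Q n) R Xm"
proof (rule tspan_submodule[OF pairs_carrier])
  fix a b e f assume ab: "a \<in> carrier A" "b \<in> carrier B" and "(e, f) \<in> pairs P Q n"
  then obtain p q x y where *: "e = sE p x" "f = sF q y" "x \<in> P p" "y \<in> Q q" "p + q = n" by (auto simp: pairs_def)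
  have "a \<odot>\<^bsub>dsum Ef\<^esub> e = sE p (a \<odot>\<^bsub>Ef p\<^esub> x)" "b \<odot>\<^bsub>dsum Ff\<^esub> f = sF q (b \<odot>\<^bsub>Ff q\<^esub> y)"
    using module_hom_smult[OF sE_hom ab(1)] module_hom_smult[OF sF_hom ab(2)]
      submodule_subset[OF P *(3)] submodule_subset[OF Q *(4)] * by simp_all
  then show "(a \<odot>\<^bsub>dsum Ef\<^esub> e, b \<odot>\<^bsub>dsum Ff\<^esub> f) \<in> pairs P Q n"
    using * submodule_smult[OF P ab(1) *(3)] submodule_smult[OF Q ab(2) *(4)] unfolding pairs_def by blast
qed

lemma XP_submodule_K: "submodule (XP P Q n) K T"
  by (rule submodule_X_imp_T[OF XP_submodule])

end

text \<open>Over a field the kernel of x^N \<otimes> 1 is the kernel of x^N tensored with the other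
  factor. With K-linear partial inverses s of x^N on the P p, assembled to S, the map t \<mapsto> t
  - S (x^N t) sends generators into the torsion span, and it returns t itself when x^N t =
  0.\<close>

lemma XP_tor_left:
  assumes P: "\<And>p. submodule (P p) A (Ef p)" and Q: "\<And>q. submodule (Q q) B (Ff q)" and x: "x \<in> carrier A"
  shows "tor1 R Xm (pR x \<one>\<^bsub>B\<^esub>) (XP P Q n) = XP (\<lambda>p. tor1 A (Ef p) x (P p)) Q n" (is "?l = ?r")
proof (intro equalityI subsetI)
  note P' = tor1_submodule[OF Ef P x]
  have xR: "pR x \<one>\<^bsub>B\<^esub> \<in> carrier R" using x by (simp add: pR_closed)
  { have "?r \<subseteq> ?l"
    proof (rule tspan_subset_submodule[OF submodule_X_imp_T[OF tor1_submodule[OF modX XP_submodule[OF P Q] xR]]])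
      fix e f assume "(e, f) \<in> pairs (\<lambda>p. tor1 A (Ef p) x (P p)) Q n"
      then obtain p q a b N where *: "e = sE p a" "f = sF q b" "a \<in> P p" "b \<in> Q q" "p + q = n"
        "(x [^]\<^bsub>A\<^esub> (N::nat)) \<odot>\<^bsub>Ef p\<^esub> a = \<zero>\<^bsub>Ef p\<^esub>" by (auto simp: pairs_def tor1_def)
      note ac = submodule_subset[OF P *(3)] submodule_subset[OF Q *(4)]
      have ec: "e \<in> carrier (dsum Ef)" "f \<in> carrier (dsum Ff)"
        using * ac sE_closed sF_closed by auto
      have "(x [^]\<^bsub>A\<^esub> N) \<odot>\<^bsub>dsum Ef\<^esub> e = \<zero>\<^bsub>dsum Ef\<^esub>"
        using module_hom_smult[OF sE_hom cring_nat_pow_closed[OF cringA x, of N] ac(1)] *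
          module_hom_zero[OF Ef modE sE_hom] by simp
      then have "(pR x \<one>\<^bsub>B\<^esub> [^]\<^bsub>R\<^esub> N) \<cdot> (e \<star> f) = \<zero>\<^bsub>Xm\<^esub>"
        using smultX_pow_left[OF x ec] ec by (simp add: pX_zero)
      then show "e \<star> f \<in> ?l" using pairsI[OF P Q *(3-5)] * unfolding tor1_def by blast
    qed
    fix t assume "t \<in> ?r" then show "t \<in> ?l" using \<open>?r \<subseteq> ?l\<close> by blast }
  fix t assume "t \<in> ?l"
  then obtain N where t: "t \<in> XP P Q n" "(pR x \<one>\<^bsub>B\<^esub> [^]\<^bsub>R\<^esub> (N::nat)) \<cdot> t = \<zero>\<^bsub>T\<^esub>"
    by (auto simp: tor1_def)
  let ?xN = "x [^]\<^bsub>A\<^esub> N" and ?rN = "pR x \<one>\<^bsub>B\<^esub> [^]\<^bsub>R\<^esub> N"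
  have xN: "?xN \<in> carrier A" by (rule cring_nat_pow_closed[OF cringA x])
  have rN: "?rN \<in> carrier R" by (rule cring_nat_pow_closed[OF cringR xR])
  have "\<exists>s\<in>module_hom K (restrict_scalars A (Ef p)) (restrict_scalars A (Ef p)).
      s ` carrier (restrict_scalars A (Ef p)) \<subseteq> P p \<and> (\<forall>y\<in>P p. ?xN \<odot>\<^bsub>Ef p\<^esub> s (?xN \<odot>\<^bsub>Ef p\<^esub> y) = ?xN \<odot>\<^bsub>Ef p\<^esub> y)" for p
    by (rule linear_section[OF fieldK restrict_scalars_module[OF alA Ef] restrict_scalars_module[OF alA Ef]
          restrict_submodule[OF alA Ef P] smult_restrict_hom[OF alA Ef xN]])
  then obtain s where s: "\<And>p. s p \<in> module_hom K (restrict_scalars A (Ef p)) (restrict_scalars A (Ef p))"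
    "\<And>p y. y \<in> carrier (Ef p) \<Longrightarrow> s p y \<in> P p"
    "\<And>p y. y \<in> P p \<Longrightarrow> ?xN \<odot>\<^bsub>Ef p\<^esub> s p (?xN \<odot>\<^bsub>Ef p\<^esub> y) = ?xN \<odot>\<^bsub>Ef p\<^esub> y"
    by (metis (no_types, lifting) image_subset_iff restrict_scalars_sel(1))
  have "(\<lambda>y. sE p (s p y)) \<in> module_hom K (restrict_scalars A (Ef p)) E'" for p
    by (rule module_hom_comp[OF s(1) module_hom_restrict_scalars[OF alA sE_hom]])
  then obtain S where S: "S \<in> module_hom K E' E'" "\<And>p y. y \<in> carrier (Ef p) \<Longrightarrow> S (sE p y) = sE p (s p y)"
    using lift_E[OF modE', of "\<lambda>p y. sE p (s p y)"] by auto
  note oS = op[OF S(1) id_hom]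
  let ?g = "\<lambda>t. t \<ominus>\<^bsub>T\<^esub> op S (\<lambda>f. f) (?rN \<cdot> t)"
  have g: "?g \<in> module_hom K T T"
    by (intro module_hom_minus[OF modT] id_hom module_hom_comp[OF smultX_hom[OF rN] oS(1)])
  have "XP P Q n \<subseteq> {t \<in> carrier T. ?g t \<in> ?r}"
  proof (rule tspan_subset_submodule[OF submodule_vimage[OF modT modT g XP_submodule_K[OF P' Q]]])
    fix e f assume "(e, f) \<in> pairs P Q n"
    then obtain p q a b where *: "e = sE p a" "f = sF q b" "a \<in> P p" "b \<in> Q q" "p + q = n"
      by (auto simp: pairs_def)
    interpret Ep: module A "Ef p" by (rule Ef)
    note ac = submodule_subset[OF P *(3)] submodule_subset[OF Q *(4)]
    have ec: "e \<in> carrier (dsum Ef)" "f \<in> carrier (dsum Ff)"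
      using * ac sE_closed sF_closed by auto
    let ?y = "s p (?xN \<odot>\<^bsub>Ef p\<^esub> a)"
    have y: "?y \<in> P p" using s(2) ac xN by simp
    have yc: "?y \<in> carrier (Ef p)" by (rule submodule_subset[OF P y])
    have 1: "?rN \<cdot> (e \<star> f) = sE p (?xN \<odot>\<^bsub>Ef p\<^esub> a) \<star> f"
      using smultX_pow_left[OF x ec, of N] module_hom_smult[OF sE_hom xN ac(1)] *(1) by simp
    have sx: "sE p (?xN \<odot>\<^bsub>Ef p\<^esub> a) \<in> carrier (dsum Ef)" by (rule sE_closed) (use xN ac in simp)
    have 2: "op S (\<lambda>f. f) (?rN \<cdot> (e \<star> f)) = sE p ?y \<star> f"
      unfolding 1 using oS(2)[OF sx ec(2)] S(2)[of "?xN \<odot>\<^bsub>Ef p\<^esub> a" p] xN ac by simp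
    have "?g (e \<star> f) = sE p (a \<ominus>\<^bsub>Ef p\<^esub> ?y) \<star> f"
      unfolding 2 using module_hom_diff[OF modE' modT bilin_left[OF pX_bilin], of f "sE p a" "sE p ?y"]
        module_hom_diff[OF Ef modE sE_hom ac(1) yc] ec * sE_closed[OF yc] by simp
    moreover have "a \<ominus>\<^bsub>Ef p\<^esub> ?y \<in> tor1 A (Ef p) x (P p)"
    proof -
      have "?xN \<odot>\<^bsub>Ef p\<^esub> (a \<ominus>\<^bsub>Ef p\<^esub> ?y) = ?xN \<odot>\<^bsub>Ef p\<^esub> a \<ominus>\<^bsub>Ef p\<^esub> ?xN \<odot>\<^bsub>Ef p\<^esub> ?y"
        using ac yc xN by (simp add: a_minus_def Ep.smult_r_distr Ep.smult_r_minus)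
      then have "?xN \<odot>\<^bsub>Ef p\<^esub> (a \<ominus>\<^bsub>Ef p\<^esub> ?y) = \<zero>\<^bsub>Ef p\<^esub>"
        using s(3)[OF *(3)] ac xN by (simp add: Ep.diff_self)
      then show ?thesis using submodule_diff[OF P *(3) y] by (auto simp: tor1_def)
    qed
    ultimately show "e \<star> f \<in> {t \<in> carrier T. ?g t \<in> ?r}"
      using pairsI[OF P' Q _ *(4,5)] * ec by simp
  qed
  then have "?g t \<in> ?r" using t(1) by blast
  moreover have "t \<in> carrier T" using t(1) tspan_carrier[OF pairs_carrier[OF P Q]] by blast
  ultimately show "t \<in> ?r" using t(2) module_hom_zero[OF modT modT oS(1)] by (simp add: T.diff_zero)
qed

text \<open>A generator is divisible because its left component is. For a sum the exponents differ,
  and both equations are multiplied up to the common exponent N + N'.\<close>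

lemma XP_divis_left:
  assumes P: "\<And>p. submodule (P p) A (Ef p)" and Q: "\<And>q. submodule (Q q) B (Ff q)" and x: "x \<in> carrier A"
    and dv: "\<And>p. divis A (Ef p) x (P p)"
  shows "divis R Xm (pR x \<one>\<^bsub>B\<^esub>) (XP P Q n)"
  unfolding divis_def
proof
  let ?r = "pR x \<one>\<^bsub>B\<^esub>"
  have xR: "?r \<in> carrier R" using x by (simp add: pR_closed)
  note pc = pairs_carrier[OF P Q]
  fix t assume "t \<in> XP P Q n"
  then show "\<exists>N::nat. \<exists>y\<in>XP P Q n. (?r [^]\<^bsub>R\<^esub> N) \<cdot> t = (?r [^]\<^bsub>R\<^esub> Suc N) \<cdot> y"
  proof (induction rule: tspan_induct[OF pc, consumes 1, case_names zero add])
    case zero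
    have "\<zero>\<^bsub>T\<^esub> \<in> XP P Q n" by (rule tspan_zero[OF pc])
    then show ?case using Xm.smult_r_null xR by (intro exI[of _ 0] bexI[of _ "\<zero>\<^bsub>T\<^esub>"]) auto
  next
    case (add e f t)
    then obtain p q a b where *: "e = sE p a" "f = sF q b" "a \<in> P p" "b \<in> Q q" "p + q = n"
      by (auto simp: pairs_def)
    note ac = submodule_subset[OF P *(3)] submodule_subset[OF Q *(4)]
    obtain N y where y: "y \<in> P p" "(x [^]\<^bsub>A\<^esub> (N::nat)) \<odot>\<^bsub>Ef p\<^esub> a = (x [^]\<^bsub>A\<^esub> Suc N) \<odot>\<^bsub>Ef p\<^esub> y"
      using dv *(3) unfolding divis_def by blast
    note yc = submodule_subset[OF P y(1)]
    have sm: "(?r [^]\<^bsub>R\<^esub> (k::nat)) \<cdot> (sE p z \<star> f) = sE p ((x [^]\<^bsub>A\<^esub> k) \<odot>\<^bsub>Ef p\<^esub> z) \<star> f" if z: "z \<in> carrier (Ef p)" for z k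
      using smultX_pow_left[OF x sE_closed[OF z] sF_closed[OF ac(2)]] *(2)
        module_hom_smult[OF sE_hom cring_nat_pow_closed[OF cringA x] z] by simp
    have 1: "(?r [^]\<^bsub>R\<^esub> N) \<cdot> (e \<star> f) = (?r [^]\<^bsub>R\<^esub> Suc N) \<cdot> (sE p y \<star> f)"
      unfolding *(1) sm[OF ac(1)] sm[OF yc] y(2) ..
    have yP: "sE p y \<star> f \<in> XP P Q n" using pairsI[OF P Q y(1) *(4,5)] *(2) by simp
    obtain N' y' where y': "y' \<in> XP P Q n" "(?r [^]\<^bsub>R\<^esub> (N'::nat)) \<cdot> t = (?r [^]\<^bsub>R\<^esub> Suc N') \<cdot> y'"
      using add.IH by blast
    have y'c: "y' \<in> carrier T" using y'(1) tspan_carrier[OF pc] by blast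
    have yc': "sE p y \<star> f \<in> carrier T" using yP tspan_carrier[OF pc] by blast
    let ?k = "N + N'"
    have shift: "(?r [^]\<^bsub>R\<^esub> (a + b)) \<cdot> u = (?r [^]\<^bsub>R\<^esub> Suc (a + b)) \<cdot> v"
      if "u \<in> carrier T" "v \<in> carrier T" "(?r [^]\<^bsub>R\<^esub> b) \<cdot> u = (?r [^]\<^bsub>R\<^esub> Suc b) \<cdot> v" for u v and a b :: nat
      using smult_pow_add[OF modX xR, of u a b] smult_pow_add[OF modX xR, of v a "Suc b"] that by simp
    have "(?r [^]\<^bsub>R\<^esub> ?k) \<cdot> (e \<star> f) = (?r [^]\<^bsub>R\<^esub> Suc ?k) \<cdot> (sE p y \<star> f)"
      "(?r [^]\<^bsub>R\<^esub> ?k) \<cdot> t = (?r [^]\<^bsub>R\<^esub> Suc ?k) \<cdot> y'"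
      using shift[OF add(3) yc' 1, of N'] shift[OF add(4) y'c y'(2), of N] by (simp_all only: add.commute)
    note e12 = this
    note rc = cring_nat_pow_closed[OF cringR xR]
    have "(?r [^]\<^bsub>R\<^esub> ?k) \<cdot> (e \<star> f \<oplus>\<^bsub>T\<^esub> t) = (?r [^]\<^bsub>R\<^esub> ?k) \<cdot> (e \<star> f) \<oplus>\<^bsub>T\<^esub> (?r [^]\<^bsub>R\<^esub> ?k) \<cdot> t"
      using Xm.smult_r_distr[OF rc[of ?k], of "e \<star> f" t] add(3,4) by simp
    also have "\<dots> = (?r [^]\<^bsub>R\<^esub> Suc ?k) \<cdot> (sE p y \<star> f) \<oplus>\<^bsub>T\<^esub> (?r [^]\<^bsub>R\<^esub> Suc ?k) \<cdot> y'"
      unfolding e12 ..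
    also have "\<dots> = (?r [^]\<^bsub>R\<^esub> Suc ?k) \<cdot> (sE p y \<star> f \<oplus>\<^bsub>T\<^esub> y')"
      using Xm.smult_r_distr[OF rc[of "Suc ?k"], of "sE p y \<star> f" y'] yc' y'c by simp
    finally have "(?r [^]\<^bsub>R\<^esub> ?k) \<cdot> (e \<star> f \<oplus>\<^bsub>T\<^esub> t) = (?r [^]\<^bsub>R\<^esub> Suc ?k) \<cdot> (sE p y \<star> f \<oplus>\<^bsub>T\<^esub> y')" .
    then show ?case using tspan_add[OF pc yP y'(1)] by blast
  qed
qed

text \<open>The argument of \<open>XP_tor_left\<close> with the partial inverses acting on the right
  factor.\<close>

lemma XP_tor_right:
  assumes P: "\<And>p. submodule (P p) A (Ef p)" and Q: "\<And>q. submodule (Q q) B (Ff q)" and x: "x \<in> carrier B"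
  shows "tor1 R Xm (pR \<one>\<^bsub>A\<^esub> x) (XP P Q n) = XP P (\<lambda>q. tor1 B (Ff q) x (Q q)) n" (is "?l = ?r")
proof (intro equalityI subsetI)
  note P' = tor1_submodule[OF Ff Q x]
  have xR: "pR \<one>\<^bsub>A\<^esub> x \<in> carrier R" using x by (simp add: pR_closed)
  { have "?r \<subseteq> ?l"
    proof (rule tspan_subset_submodule[OF submodule_X_imp_T[OF tor1_submodule[OF modX XP_submodule[OF P Q] xR]]])
      fix e f assume "(e, f) \<in> pairs P (\<lambda>q. tor1 B (Ff q) x (Q q)) n"
      then obtain p q a b N where *: "e = sE p a" "f = sF q b" "a \<in> P p" "b \<in> Q q" "p + q = n"
        "(x [^]\<^bsub>B\<^esub> (N::nat)) \<odot>\<^bsub>Ff q\<^esub> b = \<zero>\<^bsub>Ff q\<^esub>" by (auto simp: pairs_def tor1_def)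
      note ac = submodule_subset[OF P *(3)] submodule_subset[OF Q *(4)]
      have ec: "e \<in> carrier (dsum Ef)" "f \<in> carrier (dsum Ff)"
        using * ac sE_closed sF_closed by auto
      have "(x [^]\<^bsub>B\<^esub> N) \<odot>\<^bsub>dsum Ff\<^esub> f = \<zero>\<^bsub>dsum Ff\<^esub>"
        using module_hom_smult[OF sF_hom cring_nat_pow_closed[OF cringB x, of N] ac(2)] *
          module_hom_zero[OF Ff modF sF_hom] by simp
      then have "(pR \<one>\<^bsub>A\<^esub> x [^]\<^bsub>R\<^esub> N) \<cdot> (e \<star> f) = \<zero>\<^bsub>Xm\<^esub>"
        using smultX_pow_right[OF x ec] ec by (simp add: pX_zero)
      then show "e \<star> f \<in> ?l" using pairsI[OF P Q *(3-5)] * unfolding tor1_def by blast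
    qed
    fix t assume "t \<in> ?r" then show "t \<in> ?l" using \<open>?r \<subseteq> ?l\<close> by blast }
  fix t assume "t \<in> ?l"
  then obtain N where t: "t \<in> XP P Q n" "(pR \<one>\<^bsub>A\<^esub> x [^]\<^bsub>R\<^esub> (N::nat)) \<cdot> t = \<zero>\<^bsub>T\<^esub>"
    by (auto simp: tor1_def)
  let ?xN = "x [^]\<^bsub>B\<^esub> N" and ?rN = "pR \<one>\<^bsub>A\<^esub> x [^]\<^bsub>R\<^esub> N"
  have xN: "?xN \<in> carrier B" by (rule cring_nat_pow_closed[OF cringB x])
  have rN: "?rN \<in> carrier R" by (rule cring_nat_pow_closed[OF cringR xR])
  have "\<exists>s\<in>module_hom K (restrict_scalars B (Ff p)) (restrict_scalars B (Ff p)).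
      s ` carrier (restrict_scalars B (Ff p)) \<subseteq> Q p \<and> (\<forall>y\<in>Q p. ?xN \<odot>\<^bsub>Ff p\<^esub> s (?xN \<odot>\<^bsub>Ff p\<^esub> y) = ?xN \<odot>\<^bsub>Ff p\<^esub> y)" for p
    by (rule linear_section[OF fieldK restrict_scalars_module[OF alB Ff] restrict_scalars_module[OF alB Ff]
          restrict_submodule[OF alB Ff Q] smult_restrict_hom[OF alB Ff xN]])
  then obtain s where s: "\<And>p. s p \<in> module_hom K (restrict_scalars B (Ff p)) (restrict_scalars B (Ff p))"
    "\<And>p y. y \<in> carrier (Ff p) \<Longrightarrow> s p y \<in> Q p"
    "\<And>p y. y \<in> Q p \<Longrightarrow> ?xN \<odot>\<^bsub>Ff p\<^esub> s p (?xN \<odot>\<^bsub>Ff p\<^esub> y) = ?xN \<odot>\<^bsub>Ff p\<^esub> y"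
    by (metis (no_types, lifting) image_subset_iff restrict_scalars_sel(1))
  have "(\<lambda>y. sF p (s p y)) \<in> module_hom K (restrict_scalars B (Ff p)) F'" for p
    by (rule module_hom_comp[OF s(1) module_hom_restrict_scalars[OF alB sF_hom]])
  then obtain S where S: "S \<in> module_hom K F' F'" "\<And>p y. y \<in> carrier (Ff p) \<Longrightarrow> S (sF p y) = sF p (s p y)"
    using lift_F[OF modF', of "\<lambda>p y. sF p (s p y)"] by auto
  note oS = op[OF id_hom S(1)]
  let ?g = "\<lambda>t. t \<ominus>\<^bsub>T\<^esub> op (\<lambda>f. f) S (?rN \<cdot> t)"
  have g: "?g \<in> module_hom K T T"
    by (intro module_hom_minus[OF modT] id_hom module_hom_comp[OF smultX_hom[OF rN] oS(1)])
  have "XP P Q n \<subseteq> {t \<in> carrier T. ?g t \<in> ?r}"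
  proof (rule tspan_subset_submodule[OF submodule_vimage[OF modT modT g XP_submodule_K[OF P P']]])
    fix e f assume "(e, f) \<in> pairs P Q n"
    then obtain p q a b where *: "e = sE p a" "f = sF q b" "a \<in> P p" "b \<in> Q q" "p + q = n"
      by (auto simp: pairs_def)
    interpret Fq: module B "Ff q" by (rule Ff)
    note ac = submodule_subset[OF P *(3)] submodule_subset[OF Q *(4)]
    have ec: "e \<in> carrier (dsum Ef)" "f \<in> carrier (dsum Ff)"
      using * ac sE_closed sF_closed by auto
    let ?y = "s q (?xN \<odot>\<^bsub>Ff q\<^esub> b)"
    have y: "?y \<in> Q q" using s(2) ac xN by simp
    have yc: "?y \<in> carrier (Ff q)" by (rule submodule_subset[OF Q y])
    have 1: "?rN \<cdot> (e \<star> f) = e \<star> sF q (?xN \<odot>\<^bsub>Ff q\<^esub> b)"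
      using smultX_pow_right[OF x ec, of N] module_hom_smult[OF sF_hom xN ac(2)] *(2) by simp
    have sx: "sF q (?xN \<odot>\<^bsub>Ff q\<^esub> b) \<in> carrier (dsum Ff)" by (rule sF_closed) (use xN ac in simp)
    have 2: "op (\<lambda>f. f) S (?rN \<cdot> (e \<star> f)) = e \<star> sF q ?y"
      unfolding 1 using oS(2)[OF ec(1) sx] S(2)[of "?xN \<odot>\<^bsub>Ff q\<^esub> b" q] xN ac by simp
    have "?g (e \<star> f) = e \<star> sF q (b \<ominus>\<^bsub>Ff q\<^esub> ?y)"
      unfolding 2 using module_hom_diff[OF modF' modT bilin_right[OF pX_bilin], of e "sF q b" "sF q ?y"]
        module_hom_diff[OF Ff modF sF_hom ac(2) yc] ec * sF_closed[OF yc] by simp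
    moreover have "b \<ominus>\<^bsub>Ff q\<^esub> ?y \<in> tor1 B (Ff q) x (Q q)"
    proof -
      have "?xN \<odot>\<^bsub>Ff q\<^esub> (b \<ominus>\<^bsub>Ff q\<^esub> ?y) = ?xN \<odot>\<^bsub>Ff q\<^esub> b \<ominus>\<^bsub>Ff q\<^esub> ?xN \<odot>\<^bsub>Ff q\<^esub> ?y"
        using ac yc xN by (simp add: a_minus_def Fq.smult_r_distr Fq.smult_r_minus)
      then have "?xN \<odot>\<^bsub>Ff q\<^esub> (b \<ominus>\<^bsub>Ff q\<^esub> ?y) = \<zero>\<^bsub>Ff q\<^esub>"
        using s(3)[OF *(4)] ac xN by (simp add: Fq.diff_self)
      then show ?thesis using submodule_diff[OF Q *(4) y] by (auto simp: tor1_def)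
    qed
    ultimately show "e \<star> f \<in> {t \<in> carrier T. ?g t \<in> ?r}"
      using pairsI[OF P P' *(3) _ *(5)] * ec by simp
  qed
  then have "?g t \<in> ?r" using t(1) by blast
  moreover have "t \<in> carrier T" using t(1) tspan_carrier[OF pairs_carrier[OF P Q]] by blast
  ultimately show "t \<in> ?r" using t(2) module_hom_zero[OF modT modT oS(1)] by (simp add: T.diff_zero)
qed

lemma XP_divis_right:
  assumes P: "\<And>p. submodule (P p) A (Ef p)" and Q: "\<And>q. submodule (Q q) B (Ff q)" and x: "x \<in> carrier B"
    and dv: "\<And>q. divis B (Ff q) x (Q q)"
  shows "divis R Xm (pR \<one>\<^bsub>A\<^esub> x) (XP P Q n)"
  unfolding divis_def
proof
  let ?r = "pR \<one>\<^bsub>A\<^esub> x"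
  have xR: "?r \<in> carrier R" using x by (simp add: pR_closed)
  note pc = pairs_carrier[OF P Q]
  fix t assume "t \<in> XP P Q n"
  then show "\<exists>N::nat. \<exists>y\<in>XP P Q n. (?r [^]\<^bsub>R\<^esub> N) \<cdot> t = (?r [^]\<^bsub>R\<^esub> Suc N) \<cdot> y"
  proof (induction rule: tspan_induct[OF pc, consumes 1, case_names zero add])
    case zero
    have "\<zero>\<^bsub>T\<^esub> \<in> XP P Q n" by (rule tspan_zero[OF pc])
    then show ?case using Xm.smult_r_null xR by (intro exI[of _ 0] bexI[of _ "\<zero>\<^bsub>T\<^esub>"]) auto
  next
    case (add e f t)
    then obtain p q a b where *: "e = sE p a" "f = sF q b" "a \<in> P p" "b \<in> Q q" "p + q = n"
      by (auto simp: pairs_def)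
    note ac = submodule_subset[OF P *(3)] submodule_subset[OF Q *(4)]
    obtain N y where y: "y \<in> Q q" "(x [^]\<^bsub>B\<^esub> (N::nat)) \<odot>\<^bsub>Ff q\<^esub> b = (x [^]\<^bsub>B\<^esub> Suc N) \<odot>\<^bsub>Ff q\<^esub> y"
      using dv *(4) unfolding divis_def by blast
    note yc = submodule_subset[OF Q y(1)]
    have sm: "(?r [^]\<^bsub>R\<^esub> (k::nat)) \<cdot> (e \<star> sF q z) = e \<star> sF q ((x [^]\<^bsub>B\<^esub> k) \<odot>\<^bsub>Ff q\<^esub> z)" if z: "z \<in> carrier (Ff q)" for z k
      using smultX_pow_right[OF x sE_closed[OF ac(1)] sF_closed[OF z]] *(1)
        module_hom_smult[OF sF_hom cring_nat_pow_closed[OF cringB x] z] by simp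
    have 1: "(?r [^]\<^bsub>R\<^esub> N) \<cdot> (e \<star> f) = (?r [^]\<^bsub>R\<^esub> Suc N) \<cdot> (e \<star> sF q y)"
      unfolding *(2) sm[OF ac(2)] sm[OF yc] y(2) ..
    have yP: "e \<star> sF q y \<in> XP P Q n" using pairsI[OF P Q *(3) y(1) *(5)] *(1) by simp
    obtain N' y' where y': "y' \<in> XP P Q n" "(?r [^]\<^bsub>R\<^esub> (N'::nat)) \<cdot> t = (?r [^]\<^bsub>R\<^esub> Suc N') \<cdot> y'"
      using add.IH by blast
    have y'c: "y' \<in> carrier T" using y'(1) tspan_carrier[OF pc] by blast
    have yc': "e \<star> sF q y \<in> carrier T" using yP tspan_carrier[OF pc] by blast
    let ?k = "N + N'"
    have shift: "(?r [^]\<^bsub>R\<^esub> (a + b)) \<cdot> u = (?r [^]\<^bsub>R\<^esub> Suc (a + b)) \<cdot> v"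
      if "u \<in> carrier T" "v \<in> carrier T" "(?r [^]\<^bsub>R\<^esub> b) \<cdot> u = (?r [^]\<^bsub>R\<^esub> Suc b) \<cdot> v" for u v and a b :: nat
      using smult_pow_add[OF modX xR, of u a b] smult_pow_add[OF modX xR, of v a "Suc b"] that by simp
    have "(?r [^]\<^bsub>R\<^esub> ?k) \<cdot> (e \<star> f) = (?r [^]\<^bsub>R\<^esub> Suc ?k) \<cdot> (e \<star> sF q y)"
      "(?r [^]\<^bsub>R\<^esub> ?k) \<cdot> t = (?r [^]\<^bsub>R\<^esub> Suc ?k) \<cdot> y'"
      using shift[OF add(3) yc' 1, of N'] shift[OF add(4) y'c y'(2), of N] by (simp_all only: add.commute)
    note e12 = this
    note rc = cring_nat_pow_closed[OF cringR xR]
    have "(?r [^]\<^bsub>R\<^esub> ?k) \<cdot> (e \<star> f \<oplus>\<^bsub>T\<^esub> t) = (?r [^]\<^bsub>R\<^esub> ?k) \<cdot> (e \<star> f) \<oplus>\<^bsub>T\<^esub> (?r [^]\<^bsub>R\<^esub> ?k) \<cdot> t"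
      using Xm.smult_r_distr[OF rc[of ?k], of "e \<star> f" t] add(3,4) by simp
    also have "\<dots> = (?r [^]\<^bsub>R\<^esub> Suc ?k) \<cdot> (e \<star> sF q y) \<oplus>\<^bsub>T\<^esub> (?r [^]\<^bsub>R\<^esub> Suc ?k) \<cdot> y'"
      unfolding e12 ..
    also have "\<dots> = (?r [^]\<^bsub>R\<^esub> Suc ?k) \<cdot> (e \<star> sF q y \<oplus>\<^bsub>T\<^esub> y')"
      using Xm.smult_r_distr[OF rc[of "Suc ?k"], of "e \<star> sF q y" y'] yc' y'c by simp
    finally have "(?r [^]\<^bsub>R\<^esub> ?k) \<cdot> (e \<star> f \<oplus>\<^bsub>T\<^esub> t) = (?r [^]\<^bsub>R\<^esub> Suc ?k) \<cdot> (e \<star> sF q y \<oplus>\<^bsub>T\<^esub> y')" .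
    then show ?case using tspan_add[OF pc yP y'(1)] by blast
  qed
qed

definition "leftR xs = map (\<lambda>x. pR x \<one>\<^bsub>B\<^esub>) xs"
definition "rightR ys = map (\<lambda>y. pR \<one>\<^bsub>A\<^esub> y) ys"

text \<open>Torsion and flabbiness go together, since flabbiness for the next generator refers to
  the torsion with respect to the previous ones, which must again be of the form
  \<open>XP\<close>.\<close>

lemma XP_tors_left:
  assumes "\<And>p. submodule (P p) A (Ef p)" and "\<And>q. submodule (Q q) B (Ff q)" and "set xs \<subseteq> carrier A"
  shows "tors R Xm (leftR xs) (XP P Q n) = XP (\<lambda>p. tors A (Ef p) xs (P p)) Q n \<and>
    ((\<forall>p. flabby A (Ef p) xs (P p)) \<longrightarrow> flabby R Xm (leftR xs) (XP P Q n))"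
  using assms
proof (induction xs arbitrary: P)
  case (Cons x xs)
  have x: "x \<in> carrier A" and xs: "set xs \<subseteq> carrier A" using Cons.prems by auto
  have "tors R Xm (leftR xs) (XP (\<lambda>p. tor1 A (Ef p) x (P p)) Q n)
      = XP (\<lambda>p. tors A (Ef p) xs (tor1 A (Ef p) x (P p))) Q n \<and>
    ((\<forall>p. flabby A (Ef p) xs (tor1 A (Ef p) x (P p))) \<longrightarrow>
      flabby R Xm (leftR xs) (XP (\<lambda>p. tor1 A (Ef p) x (P p)) Q n))"
    by (rule Cons.IH[OF tor1_submodule[OF Ef Cons.prems(1) x] Cons.prems(2) xs])
  then show ?case
    using XP_tor_left[OF Cons.prems(1,2) x] XP_divis_left[OF Cons.prems(1,2) x]
    by (simp add: leftR_def tors_Cons)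
qed (simp add: leftR_def)

lemma XP_tors_right:
  assumes "\<And>p. submodule (P p) A (Ef p)" and "\<And>q. submodule (Q q) B (Ff q)" and "set ys \<subseteq> carrier B"
  shows "tors R Xm (rightR ys) (XP P Q n) = XP P (\<lambda>q. tors B (Ff q) ys (Q q)) n \<and>
    ((\<forall>q. flabby B (Ff q) ys (Q q)) \<longrightarrow> flabby R Xm (rightR ys) (XP P Q n))"
  using assms
proof (induction ys arbitrary: Q)
  case (Cons x xs)
  have x: "x \<in> carrier B" and xs: "set xs \<subseteq> carrier B" using Cons.prems by auto
  have "tors R Xm (rightR xs) (XP P (\<lambda>p. tor1 B (Ff p) x (Q p)) n)
      = XP P (\<lambda>p. tors B (Ff p) xs (tor1 B (Ff p) x (Q p))) n \<and>
    ((\<forall>p. flabby B (Ff p) xs (tor1 B (Ff p) x (Q p))) \<longrightarrow>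
      flabby R Xm (rightR xs) (XP P (\<lambda>p. tor1 B (Ff p) x (Q p)) n))"
    by (rule Cons.IH[OF Cons.prems(1) tor1_submodule[OF Ff Cons.prems(2) x] xs])
  then show ?case
    using XP_tor_right[OF Cons.prems(1,2) x] XP_divis_right[OF Cons.prems(1,2) x]
    by (simp add: rightR_def tors_Cons)
qed (simp add: rightR_def)

lemma XP_tors:
  assumes P: "\<And>p. submodule (P p) A (Ef p)" and Q: "\<And>q. submodule (Q q) B (Ff q)"
    and xs: "set xs \<subseteq> carrier A" and ys: "set ys \<subseteq> carrier B"
  shows "tors R Xm (leftR xs @ rightR ys) (XP P Q n)
    = XP (\<lambda>p. tors A (Ef p) xs (P p)) (\<lambda>q. tors B (Ff q) ys (Q q)) n"
  using XP_tors_left[OF P Q xs] XP_tors_right[OF tors_submodule[OF Ef P xs] Q ys] by (simp add: tors_append)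

text \<open>After the generators from A have been processed, the torsion left is of the form
  \<open>XP\<close> with Q unchanged, so flabbiness along the generators from B comes from that of
  Q.\<close>

lemma XP_flabby:
  assumes P: "\<And>p. submodule (P p) A (Ef p)" and Q: "\<And>q. submodule (Q q) B (Ff q)"
    and xs: "set xs \<subseteq> carrier A" and ys: "set ys \<subseteq> carrier B"
    and "\<And>p. flabby A (Ef p) xs (P p)" and "\<And>q. flabby B (Ff q) ys (Q q)"
  shows "flabby R Xm (leftR xs @ rightR ys) (XP P Q n)"
  using XP_tors_left[OF P Q xs] XP_tors_right[OF tors_submodule[OF Ef P xs] Q ys] assms(5,6)
  by (simp add: flabby_append)

end

context kuenneth
begin

lemma D_prs:
  assumes "t \<in> tspan (prs n)" shows "D t \<in> tspan (prs (Suc n))"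
proof -
  have "tspan (prs n) \<subseteq> {t \<in> carrier T. D t \<in> tspan (prs (Suc n))}"
  proof (rule tspan_subset_submodule[OF submodule_vimage[OF modT modT D_hom prs_submodule]])
    fix c c' assume "(c, c') \<in> prs n"
    then obtain p q where c: "c \<in> C p" "c' \<in> C' q" "p + q = n" by (auto simp: prs_def)
    have "d c \<star> c' \<in> tspan (prs (Suc n))" using c by (intro prsI[OF dE.dC]) auto
    moreover have "\<sigma> c \<star> d' c' \<in> tspan (prs (Suc n))" using c by (intro prsI[OF \<sigma>C dF.dC]) auto
    ultimately show "c \<star> c' \<in> {t \<in> carrier T. D t \<in> tspan (prs (Suc n))}"
      using c cE cF tspan_add[OF prs_carrier] by (simp add: D_pure)
  qed
  then show ?thesis using assms by blast
qed

text \<open>The sign operator makes the two mixed terms cancel.\<close>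

lemma D_D:
  assumes "t \<in> tspan (prs n)" shows "D (D t) = \<zero>\<^bsub>T\<^esub>"
proof -
  have "tspan (prs n) \<subseteq> {t \<in> carrier T. D (D t) = \<zero>\<^bsub>T\<^esub>}"
  proof (rule tspan_subset_submodule[OF submodule_kernel[OF modT modT module_hom_comp[OF D_hom D_hom]]])
    fix c c' assume "(c, c') \<in> prs n"
    then obtain p q where c: "c \<in> C p" "c' \<in> C' q" "p + q = n" by (auto simp: prs_def)
    note cc = cE[OF c(1)] cF[OF c(2)] cE[OF dE.dC[OF c(1)]] cF[OF dF.dC[OF c(2)]] cE[OF \<sigma>C[OF c(1)]]
      cE[OF \<sigma>C[OF dE.dC[OF c(1)]]] cE[OF dE.dC[OF \<sigma>C[OF c(1)]]]
    have dd0: "d (d c) = \<zero>\<^bsub>E\<^esub>" "d' (d' c') = \<zero>\<^bsub>F\<^esub>" using dE.dd[OF c(1)] dF.dd[OF c(2)] by simp_all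
    have "D (D (c \<star> c')) = (\<ominus>\<^bsub>T\<^esub> (d (\<sigma> c) \<star> d' c')) \<oplus>\<^bsub>T\<^esub> (d (\<sigma> c) \<star> d' c')"
      using cc by (simp add: D_pure module_hom_add[OF D_hom] dd0 pX_zero \<sigma>\<sigma>[OF c(1)] \<sigma>d[OF c(1)] pX_neg)
    then show "c \<star> c' \<in> {t \<in> carrier T. D (D t) = \<zero>\<^bsub>T\<^esub>}" using cc by (simp add: T.l_neg)
  qed
  then show ?thesis using assms by blast
qed

end

text \<open>Each \<open>dE p\<close> gets a partial inverse with values in \<open>P p\<close>, and
  these together form h. The last clause records that h is homogeneous of degree -1 on the whole
  direct sum; the sign rule for h is derived from it.\<close>

lemma homotopy_data_exists:
  fixes Ef :: "nat \<Rightarrow> ('a, 'e) module"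
  assumes K: "field K" and A: "algebra K A" and Ef: "\<And>p. module A (Ef p)"
    and P: "\<And>p. submodule (P p) A (Ef p)"
    and dE: "\<And>p. dE p \<in> module_hom A (Ef p) (Ef (Suc p))" and dP: "\<And>p x. x \<in> P p \<Longrightarrow> dE p x \<in> P (Suc p)"
    and dd: "\<And>p x. x \<in> carrier (Ef p) \<Longrightarrow> dE (Suc p) (dE p x) = \<zero>\<^bsub>Ef (Suc (Suc p))\<^esub>"
    and d: "d \<in> module_hom A (dsum Ef) (dsum Ef)"
    and ds: "\<And>p x. x \<in> carrier (Ef p) \<Longrightarrow> d (single Ef p x) = single Ef (Suc p) (dE p x)"
  shows "\<exists>h. homotopy_data K (restrict_scalars A (dsum Ef)) (\<lambda>p. single Ef p ` P p) d h \<and>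
    (\<forall>p. \<forall>x\<in>carrier (Ef (Suc p)). \<exists>y\<in>carrier (Ef p). h (single Ef (Suc p) x) = single Ef p y)"
proof -
  let ?E = "restrict_scalars A (dsum Ef)"
  note rEf = restrict_scalars_module[OF A Ef]
  note Pc = submodule_subset[OF P]
  have sh: "single Ef p \<in> module_hom A (Ef p) (dsum Ef)" for p by (rule single_hom) (rule Ef)
  note sh' = module_hom_restrict_scalars[OF A sh]
  have mD: "module A (dsum Ef)" by (rule dsum_module) (rule Ef)
  have mE: "module K ?E" by (rule restrict_scalars_module[OF A mD])
  interpret D: module A "dsum Ef" by (rule mD)
  interpret D': module K ?E by (rule mE)
  have "\<exists>s\<in>module_hom K (restrict_scalars A (Ef (Suc p))) (restrict_scalars A (Ef p)).
      s ` carrier (restrict_scalars A (Ef (Suc p))) \<subseteq> P p \<and> (\<forall>y\<in>P p. dE p (s (dE p y)) = dE p y)" for p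
    by (rule linear_section[OF K rEf rEf restrict_submodule[OF A Ef P] module_hom_restrict_scalars[OF A dE]])
  then obtain s where s: "\<And>p. s p \<in> module_hom K (restrict_scalars A (Ef (Suc p))) (restrict_scalars A (Ef p))"
    "\<And>p y. y \<in> carrier (Ef (Suc p)) \<Longrightarrow> s p y \<in> P p" "\<And>p y. y \<in> P p \<Longrightarrow> dE p (s p (dE p y)) = dE p y"
    by (metis (no_types, lifting) image_subset_iff restrict_scalars_sel(1))
  \<comment> \<open>In degree 0 there is nothing below, and h is zero there.\<close>
  define g where "g p x = (case p of 0 \<Rightarrow> \<zero>\<^bsub>dsum Ef\<^esub> | Suc q \<Rightarrow> single Ef q (s q x))" for p x
  have g: "g p \<in> module_hom K (restrict_scalars A (Ef p)) ?E" for p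
  proof (cases p)
    case 0
    have "(\<lambda>x. \<zero>\<^bsub>dsum Ef\<^esub>) \<in> module_hom K (restrict_scalars A (Ef 0)) ?E"
      by (rule module_homI) (use D'.smult_r_null in auto)
    then show ?thesis using 0 by (simp add: g_def[abs_def])
  next
    case (Suc q)
    have "(\<lambda>x. single Ef q (s q x)) \<in> module_hom K (restrict_scalars A (Ef (Suc q))) ?E"
      by (rule module_hom_comp[OF s(1) sh'])
    then show ?thesis using Suc by (simp add: g_def[abs_def])
  qed
  have "\<exists>h\<in>module_hom K ?E ?E. \<forall>p. \<forall>x\<in>carrier (Ef p). h (single Ef p x) = g p x"
    by (rule dsum_lift_restrict[OF A _ mE g]) (rule Ef)
  then obtain h where h: "h \<in> module_hom K ?E ?E" "\<And>p x. x \<in> carrier (Ef p) \<Longrightarrow> h (single Ef p x) = g p x" by blast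
  have dc: "dE p x \<in> carrier (Ef (Suc p))" if "x \<in> carrier (Ef p)" for p x using module_hom_closed[OF dE that] .
  have s0: "single Ef p \<zero>\<^bsub>Ef p\<^esub> = \<zero>\<^bsub>dsum Ef\<^esub>" for p by (rule module_hom_zero[OF Ef mD sh])
  have "homotopy_data K ?E (\<lambda>p. single Ef p ` P p) d h"
  proof (rule homotopy_data.intro)
    show "d \<in> module_hom K ?E ?E" by (rule module_hom_restrict_scalars[OF A d])
    show "submodule (single Ef p ` P p) K ?E" for p
      by (rule submodule_image[OF rEf mE sh' restrict_submodule[OF A Ef P]])
    show "d c \<in> single Ef (Suc p) ` P (Suc p)" if "c \<in> single Ef p ` P p" for c p
      using that Pc ds dP by auto
    show "h c \<in> single Ef p ` P p" if "c \<in> single Ef (Suc p) ` P (Suc p)" for c p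
      using that Pc s(2) by (auto simp: h(2) g_def)
    show "h c = \<zero>\<^bsub>?E\<^esub>" if "c \<in> single Ef 0 ` P 0" for c
      using that Pc by (auto simp: h(2) g_def)
    show "d (d c) = \<zero>\<^bsub>?E\<^esub>" if "c \<in> single Ef p ` P p" for c p
      using that Pc dc by (auto simp: ds dd s0)
    show "d (h (d c)) = d c" if "c \<in> single Ef p ` P p" for c p
      using that Pc dc Pc[OF s(2)] s(3) by (auto simp: ds h(2) g_def)
  qed (rule mE h(1))+
  moreover have "\<exists>y\<in>carrier (Ef p). h (single Ef (Suc p) x) = single Ef p y" if "x \<in> carrier (Ef (Suc p))" for p x
    using that Pc[OF s(2)[OF that]] by (auto simp: h(2) g_def)
  ultimately show ?thesis by blast
qed

section \<open>The total tensor product complex\<close>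

locale dcomplex = dtensor K A B Ef Ff
  for K :: "('k, 'x) ring_scheme" and A :: "('k, 'a, 'y) module_scheme" and B :: "('k, 'b, 'z) module_scheme"
    and Ef :: "nat \<Rightarrow> ('a, 'e) module" and Ff :: "nat \<Rightarrow> ('b, 'f) module" +
  fixes dE dF
  assumes dE: "\<And>p. dE p \<in> module_hom A (Ef p) (Ef (Suc p))" and dF: "\<And>p. dF p \<in> module_hom B (Ff p) (Ff (Suc p))"
    and dEdE: "\<And>p x. x \<in> carrier (Ef p) \<Longrightarrow> dE (Suc p) (dE p x) = \<zero>\<^bsub>Ef (Suc (Suc p))\<^esub>"
    and dFdF: "\<And>p x. x \<in> carrier (Ff p) \<Longrightarrow> dF (Suc p) (dF p x) = \<zero>\<^bsub>Ff (Suc (Suc p))\<^esub>"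
begin

notation pX (infixl "\<star>" 70)

text \<open>The extension of the degreewise maps to the direct sum, whose existence is
  \<open>dsum_lift\<close>.\<close>

definition "d_E = (SOME h. h \<in> module_hom A (dsum Ef) (dsum Ef) \<and>
  (\<forall>p. \<forall>x\<in>carrier (Ef p). h (sE p x) = sE (Suc p) (dE p x)))"
definition "d_F = (SOME h. h \<in> module_hom B (dsum Ff) (dsum Ff) \<and>
  (\<forall>p. \<forall>x\<in>carrier (Ff p). h (sF p x) = sF (Suc p) (dF p x)))"
definition "sgn_E = (SOME h. h \<in> module_hom A (dsum Ef) (dsum Ef) \<and>
  (\<forall>p. \<forall>x\<in>carrier (Ef p). h (sE p x) = (if even p then sE p x else \<ominus>\<^bsub>dsum Ef\<^esub> sE p x)))"

lemma d_E: "d_E \<in> module_hom A (dsum Ef) (dsum Ef)"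
  "x \<in> carrier (Ef p) \<Longrightarrow> d_E (sE p x) = sE (Suc p) (dE p x)"
proof -
  have "\<exists>h\<in>module_hom A (dsum Ef) (dsum Ef). \<forall>p. \<forall>x\<in>carrier (Ef p). h (sE p x) = sE (Suc p) (dE p x)"
    by (rule dsum_lift) (auto intro: Ef modE module_hom_comp[OF dE sE_hom])
  from someI_ex[OF this[unfolded Bex_def]] show "d_E \<in> module_hom A (dsum Ef) (dsum Ef)"
    "x \<in> carrier (Ef p) \<Longrightarrow> d_E (sE p x) = sE (Suc p) (dE p x)" unfolding d_E_def[symmetric] by blast+
qed

lemma d_F: "d_F \<in> module_hom B (dsum Ff) (dsum Ff)"
  "y \<in> carrier (Ff p) \<Longrightarrow> d_F (sF p y) = sF (Suc p) (dF p y)"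
proof -
  have "\<exists>h\<in>module_hom B (dsum Ff) (dsum Ff). \<forall>p. \<forall>x\<in>carrier (Ff p). h (sF p x) = sF (Suc p) (dF p x)"
    by (rule dsum_lift) (auto intro: Ff modF module_hom_comp[OF dF sF_hom])
  from someI_ex[OF this[unfolded Bex_def]] show "d_F \<in> module_hom B (dsum Ff) (dsum Ff)"
    "y \<in> carrier (Ff p) \<Longrightarrow> d_F (sF p y) = sF (Suc p) (dF p y)" unfolding d_F_def[symmetric] by blast+
qed

lemma sgn_E: "sgn_E \<in> module_hom A (dsum Ef) (dsum Ef)"
  "x \<in> carrier (Ef p) \<Longrightarrow> sgn_E (sE p x) = (if even p then sE p x else \<ominus>\<^bsub>dsum Ef\<^esub> sE p x)"
proof -
  have "(\<lambda>x. if even p then sE p x else \<ominus>\<^bsub>dsum Ef\<^esub> sE p x) \<in> module_hom A (Ef p) (dsum Ef)" for p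
    using module_hom_neg[OF modE sE_hom] sE_hom by (cases "even p") auto
  then have "\<exists>h\<in>module_hom A (dsum Ef) (dsum Ef). \<forall>p. \<forall>x\<in>carrier (Ef p). h (sE p x) = (if even p then sE p x else \<ominus>\<^bsub>dsum Ef\<^esub> sE p x)"
    by (intro dsum_lift) (auto intro: Ef modE)
  from someI_ex[OF this[unfolded Bex_def]] show "sgn_E \<in> module_hom A (dsum Ef) (dsum Ef)"
    "x \<in> carrier (Ef p) \<Longrightarrow> sgn_E (sE p x) = (if even p then sE p x else \<ominus>\<^bsub>dsum Ef\<^esub> sE p x)" unfolding sgn_E_def[symmetric] by blast+
qed

lemmas d_E_K = module_hom_restrict_scalars[OF alA d_E(1)]
lemmas d_F_K = module_hom_restrict_scalars[OF alB d_F(1)]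
lemmas sgn_E_K = module_hom_restrict_scalars[OF alA sgn_E(1)]

lemma sE_inj: "sE p x = sE p y \<Longrightarrow> x = y"
  by (drule fun_cong[of _ _ p]) (simp add: single_def)
lemma sF_inj: "sF p x = sF p y \<Longrightarrow> x = y"
  by (drule fun_cong[of _ _ p]) (simp add: single_def)

lemma sE_zero: "sE p \<zero>\<^bsub>Ef p\<^esub> = \<zero>\<^bsub>dsum Ef\<^esub>" by (rule module_hom_zero[OF Ef modE sE_hom])
lemma sF_zero: "sF p \<zero>\<^bsub>Ff p\<^esub> = \<zero>\<^bsub>dsum Ff\<^esub>" by (rule module_hom_zero[OF Ff modF sF_hom])

definition "DX t = op d_E (\<lambda>f. f) t \<oplus>\<^bsub>T\<^esub> op sgn_E d_F t"

text \<open>Unlike the homotopy, which is only K-linear, the differential is R-linear, so its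
  kernels and images are R-submodules.\<close>

lemma DX_R: "DX \<in> module_hom R Xm Xm"
proof -
  note tm = tensor_mod_axioms
  have i: "(\<lambda>f. f) \<in> module_hom B (dsum Ff) (dsum Ff)" by (rule module_homI) auto
  note o1 = op[OF d_E_K id_hom] and o2 = op[OF sgn_E_K d_F_K]
  have "op d_E (\<lambda>f. f) \<in> module_hom R Xm Xm"
    by (rule tensor_map_R[OF tm tm o1 d_E(1) i])
  moreover have "op sgn_E d_F \<in> module_hom R Xm Xm"
    by (rule tensor_map_R[OF tm tm o2 sgn_E(1) d_F(1)])
  ultimately show ?thesis using module_hom_sum[OF modX] by (simp add: DX_def[abs_def])
qed

lemma DX_pure: "e \<in> carrier (dsum Ef) \<Longrightarrow> f \<in> carrier (dsum Ff) \<Longrightarrow> DX (e \<star> f) = d_E e \<star> f \<oplus>\<^bsub>T\<^esub> sgn_E e \<star> d_F f"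
  unfolding DX_def op(2)[OF d_E_K id_hom] op(2)[OF sgn_E_K d_F_K] ..

lemma DX_K: "DX \<in> module_hom K T T"
  unfolding DX_def[abs_def] by (intro module_hom_sum[OF modT] op d_E_K sgn_E_K d_F_K id_hom)

context
  fixes P Q
  assumes P: "\<And>p. submodule (P p) A (Ef p)" and Q: "\<And>q. submodule (Q q) B (Ff q)"
    and dP: "\<And>p x. x \<in> P p \<Longrightarrow> dE p x \<in> P (Suc p)" and dQ: "\<And>q y. y \<in> Q q \<Longrightarrow> dF q y \<in> Q (Suc q)"
begin

text \<open>P and Q may be any subcomplexes; below they are the full complexes and the torsion
  parts. The sign rules hold since d and h change the degree by one and so flip the parity.\<close>

lemma kuenneth_exists:
  "\<exists>h h'. kuenneth K A B (dsum Ef) (dsum Ff) (\<lambda>p. sE p ` P p) d_E h (\<lambda>q. sF q ` Q q) d_F h' sgn_E"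
proof -
  note Pc = submodule_subset[OF P] and Qc = submodule_subset[OF Q]
  have "\<exists>h. homotopy_data K E' (\<lambda>p. sE p ` P p) d_E h \<and>
      (\<forall>p. \<forall>x\<in>carrier (Ef (Suc p)). \<exists>y\<in>carrier (Ef p). h (sE (Suc p) x) = sE p y)"
    by (rule homotopy_data_exists[OF fieldK alA Ef P dE dP dEdE d_E])
  then obtain h where h: "homotopy_data K E' (\<lambda>p. sE p ` P p) d_E h"
    "\<And>p x. x \<in> carrier (Ef (Suc p)) \<Longrightarrow> \<exists>y\<in>carrier (Ef p). h (sE (Suc p) x) = sE p y" by blast
  have "\<exists>h. homotopy_data K F' (\<lambda>p. sF p ` Q p) d_F h \<and>
      (\<forall>p. \<forall>x\<in>carrier (Ff (Suc p)). \<exists>y\<in>carrier (Ff p). h (sF (Suc p) x) = sF p y)"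
    by (rule homotopy_data_exists[OF fieldK alB Ff Q dF dQ dFdF d_F])
  then obtain h' where h': "homotopy_data K F' (\<lambda>p. sF p ` Q p) d_F h'" by blast
  have hh: "h \<in> module_hom K E' E'" by (rule homotopy_data.h[OF h(1)])
  have h0: "h c = \<zero>\<^bsub>dsum Ef\<^esub>" if "c \<in> sE 0 ` P 0" for c using homotopy_data.hC0[OF h(1) that] by simp
  note tm = tensor_mod_axioms
  have sC: "c \<in> sE p ` P p \<Longrightarrow> sgn_E c \<in> sE p ` P p" for c p
  proof -
    assume c: "c \<in> sE p ` P p"
    then obtain x where x: "x \<in> P p" "c = sE p x" by blast
    have "\<ominus>\<^bsub>dsum Ef\<^esub> sE p x = sE p (\<ominus>\<^bsub>Ef p\<^esub> x)" using module_hom_a_inv[OF Ef modE sE_hom Pc[OF x(1)]] by simp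
    then show ?thesis using x c submodule_a_inv[OF P x(1)] Pc[OF x(1)] by (auto simp: sgn_E(2))
  qed
  have sc: "sgn_E e = (if even p then e else \<ominus>\<^bsub>dsum Ef\<^esub> e)" if "e = sE p x" "x \<in> carrier (Ef p)" for e p x
    using that sgn_E(2) by simp
  have neg: "d_E (\<ominus>\<^bsub>dsum Ef\<^esub> e) = \<ominus>\<^bsub>dsum Ef\<^esub> d_E e" "h (\<ominus>\<^bsub>dsum Ef\<^esub> e) = \<ominus>\<^bsub>dsum Ef\<^esub> h e"
     "sgn_E (\<ominus>\<^bsub>dsum Ef\<^esub> e) = \<ominus>\<^bsub>dsum Ef\<^esub> sgn_E e" if "e \<in> carrier (dsum Ef)" for e
    using module_hom_a_inv[OF modE' modE' d_E_K] module_hom_a_inv[OF modE' modE' hh] module_hom_a_inv[OF modE' modE' sgn_E_K] that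
    by simp_all
  have ker: "kuenneth_axioms K A (dsum Ef) (\<lambda>p. sE p ` P p) d_E h sgn_E"
  proof
    show "sgn_E \<in> module_hom K E' E'" by (rule sgn_E_K)
    fix p c assume c: "c \<in> sE p ` P p"
    show "sgn_E c \<in> sE p ` P p" by (rule sC[OF c])
    obtain x where x: "x \<in> P p" "c = sE p x" using c by blast
    note xc = Pc[OF x(1)]
    have cc: "c \<in> carrier (dsum Ef)" using sE_closed[OF xc] x by simp
    note s = sc[OF x(2) xc]
    show "sgn_E (sgn_E c) = c" using s neg[OF cc] cc by simp
    have "d_E c = sE (Suc p) (dE p x)" "dE p x \<in> carrier (Ef (Suc p))"
      using x xc d_E(2) module_hom_closed[OF dE xc] by simp_all
    then have "sgn_E (d_E c) = (if even (Suc p) then d_E c else \<ominus>\<^bsub>dsum Ef\<^esub> d_E c)" by (rule sc)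
    moreover have "d_E c \<in> carrier (dsum Ef)" by (rule module_hom_closed[OF d_E(1) cc])
    ultimately show "sgn_E (d_E c) = \<ominus>\<^bsub>dsum Ef\<^esub> d_E (sgn_E c)" using s neg[OF cc] by simp
    have hc: "h c \<in> carrier (dsum Ef)" using module_hom_closed[OF hh, of c] cc by simp
    show "sgn_E (h c) = \<ominus>\<^bsub>dsum Ef\<^esub> h (sgn_E c)"
    proof (cases p)
      case 0
      have z: "h c = \<zero>\<^bsub>dsum Ef\<^esub>" "h (sgn_E c) = \<zero>\<^bsub>dsum Ef\<^esub>" using h0 sC[OF c] c 0 by simp_all
      have m0: "\<ominus>\<^bsub>dsum Ef\<^esub> \<zero>\<^bsub>dsum Ef\<^esub> = \<zero>\<^bsub>dsum Ef\<^esub>"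
        by (rule E.minus_equality) auto
      show ?thesis unfolding z m0 by (rule module_hom_zero[OF modE modE sgn_E(1)])
    next
      case (Suc q)
      then obtain y where "y \<in> carrier (Ef q)" "h c = sE q y" using h(2)[of x q] x xc by auto
      then have "sgn_E (h c) = (if even q then h c else \<ominus>\<^bsub>dsum Ef\<^esub> h c)" using sc by blast
      then show ?thesis using s neg[OF cc] hc Suc by simp
    qed
  qed
  have "kuenneth K A B (dsum Ef) (dsum Ff) (\<lambda>p. sE p ` P p) d_E h (\<lambda>q. sF q ` Q q) d_F h' sgn_E"
    by (rule kuenneth.intro[OF tm h(1) h' ker])
  then show ?thesis by blast
qed

text \<open>Rewrites the constants of the abstract situation in terms of \<open>pairs\<close> and
  \<open>DX\<close>. The cycles match because the inclusions of the summands are injective.\<close>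

private lemma transfer:
  assumes k: "kuenneth K A B (dsum Ef) (dsum Ff) (\<lambda>p. sE p ` P p) d_E h (\<lambda>q. sF q ` Q q) d_F h' sgn_E"
  shows "kuenneth.prs (\<lambda>p. sE p ` P p) (\<lambda>q. sF q ` Q q) n = pairs P Q n"
    "kuenneth.D K A B (dsum Ef) (dsum Ff) d_E d_F sgn_E = DX"
    "kuenneth.cprs (dsum Ef) (dsum Ff) (\<lambda>p. sE p ` P p) d_E (\<lambda>q. sF q ` Q q) d_F n =
      pairs (\<lambda>p. {x \<in> P p. dE p x = \<zero>\<^bsub>Ef (Suc p)\<^esub>}) (\<lambda>q. {y \<in> Q q. dF q y = \<zero>\<^bsub>Ff (Suc q)\<^esub>}) n"
proof -
  show "kuenneth.prs (\<lambda>p. sE p ` P p) (\<lambda>q. sF q ` Q q) n = pairs P Q n"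
    unfolding kuenneth.prs_def[OF k] pairs_def by blast
  show "kuenneth.D K A B (dsum Ef) (dsum Ff) d_E d_F sgn_E = DX"
    by (rule ext) (simp add: kuenneth.D_def[OF k] DX_def)
  have zE: "d_E (sE p x) = \<zero>\<^bsub>dsum Ef\<^esub> \<longleftrightarrow> dE p x = \<zero>\<^bsub>Ef (Suc p)\<^esub>" if "x \<in> P p" for p x
    using d_E(2)[OF submodule_subset[OF P that]] sE_zero[of "Suc p"] sE_inj[of "Suc p"] by metis
  have zF: "d_F (sF p x) = \<zero>\<^bsub>dsum Ff\<^esub> \<longleftrightarrow> dF p x = \<zero>\<^bsub>Ff (Suc p)\<^esub>" if "x \<in> Q p" for p x
    using d_F(2)[OF submodule_subset[OF Q that]] sF_zero[of "Suc p"] sF_inj[of "Suc p"] by metis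
  show "kuenneth.cprs (dsum Ef) (dsum Ff) (\<lambda>p. sE p ` P p) d_E (\<lambda>q. sF q ` Q q) d_F n =
      pairs (\<lambda>p. {x \<in> P p. dE p x = \<zero>\<^bsub>Ef (Suc p)\<^esub>}) (\<lambda>q. {y \<in> Q q. dF q y = \<zero>\<^bsub>Ff (Suc q)\<^esub>}) n"
    unfolding kuenneth.cprs_def[OF k] pairs_def using zE zF by fast
qed

text \<open>With the full complexes this leads to exactness of the total complex, with the torsion
  parts to generators of its torsion cohomology.\<close>

lemma kuenneth_XP:
  assumes t: "t \<in> XP P Q n" and Dt: "DX t = \<zero>\<^bsub>T\<^esub>"
  defines "ZP \<equiv> \<lambda>p. {x \<in> P p. dE p x = \<zero>\<^bsub>Ef (Suc p)\<^esub>}" and "ZQ \<equiv> \<lambda>q. {y \<in> Q q. dF q y = \<zero>\<^bsub>Ff (Suc q)\<^esub>}"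
  shows "n = 0 \<Longrightarrow> t \<in> XP ZP ZQ 0" "n = Suc m \<Longrightarrow> \<exists>s\<in>XP P Q m. t \<ominus>\<^bsub>T\<^esub> DX s \<in> XP ZP ZQ n"
proof -
  obtain h h' where k: "kuenneth K A B (dsum Ef) (dsum Ff) (\<lambda>p. sE p ` P p) d_E h (\<lambda>q. sF q ` Q q) d_F h' sgn_E"
    using kuenneth_exists by blast
  note kc = kuenneth.kuenneth_cycles[OF k, unfolded transfer[OF k], OF t Dt]
  show "n = 0 \<Longrightarrow> t \<in> XP ZP ZQ 0" "n = Suc m \<Longrightarrow> \<exists>s\<in>XP P Q m. t \<ominus>\<^bsub>T\<^esub> DX s \<in> XP ZP ZQ n"
    unfolding ZP_def ZQ_def using kc by blast+
qed

lemma DX_XP: "t \<in> XP P Q n \<Longrightarrow> DX t \<in> XP P Q (Suc n)"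
  and DX_DX: "t \<in> XP P Q n \<Longrightarrow> DX (DX t) = \<zero>\<^bsub>T\<^esub>"
proof -
  obtain h h' where k: "kuenneth K A B (dsum Ef) (dsum Ff) (\<lambda>p. sE p ` P p) d_E h (\<lambda>q. sF q ` Q q) d_F h' sgn_E"
    using kuenneth_exists by blast
  show "t \<in> XP P Q n \<Longrightarrow> DX t \<in> XP P Q (Suc n)" "t \<in> XP P Q n \<Longrightarrow> DX (DX t) = \<zero>\<^bsub>T\<^esub>"
    using kuenneth.D_prs[OF k] kuenneth.D_D[OF k] unfolding transfer[OF k] by blast+
qed

end

lemma DX_left:
  assumes "x \<in> carrier (Ef p)" "y \<in> carrier (Ff q)" "dF q y = \<zero>\<^bsub>Ff (Suc q)\<^esub>"
  shows "DX (sE p x \<star> sF q y) = sE (Suc p) (dE p x) \<star> sF q y"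
  using assms sE_closed[OF assms(1)] sF_closed[OF assms(2)] module_hom_closed[OF sgn_E(1) sE_closed[OF assms(1)]]
    sE_closed[OF module_hom_closed[OF dE assms(1)]]
  by (simp add: DX_pure d_E d_F sF_zero pX_zero)

text \<open>The operator \<open>sgn_E\<close> is applied in advance to cancel the sign that
  \<open>DX\<close> puts in front of the second summand.\<close>

lemma DX_right:
  assumes "x \<in> carrier (Ef p)" "y \<in> carrier (Ff q)" "dE p x = \<zero>\<^bsub>Ef (Suc p)\<^esub>"
  shows "DX (sgn_E (sE p x) \<star> sF q y) = sE p x \<star> sF (Suc q) (dF q y)"
proof -
  note c = sE_closed[OF assms(1)] sF_closed[OF assms(2)] module_hom_closed[OF sgn_E(1) sE_closed[OF assms(1)]]
    sF_closed[OF module_hom_closed[OF dF assms(2)]]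
  have dd: "d_E (sE p x) = \<zero>\<^bsub>dsum Ef\<^esub>" using d_E(2)[OF assms(1)] assms(3) sE_zero by simp
  have m0: "\<ominus>\<^bsub>dsum Ef\<^esub> \<zero>\<^bsub>dsum Ef\<^esub> = \<zero>\<^bsub>dsum Ef\<^esub>" by (rule E.minus_equality) auto
  have "d_E (sgn_E (sE p x)) = \<zero>\<^bsub>dsum Ef\<^esub>" "sgn_E (sgn_E (sE p x)) = sE p x"
    using sgn_E(2)[OF assms(1)] dd c module_hom_a_inv[OF modE modE d_E(1) c(1)] module_hom_a_inv[OF modE modE sgn_E(1) c(1)] m0
    by auto
  then show ?thesis using c assms(2) by (simp add: DX_pure d_F pX_zero)
qed

lemma sgn_E_mem:
  assumes P: "submodule (P p) A (Ef p)" and x: "x \<in> P p"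
  shows "\<exists>x'\<in>P p. sgn_E (sE p x) = sE p x'"
proof -
  note xc = submodule_subset[OF P x]
  have "\<ominus>\<^bsub>dsum Ef\<^esub> sE p x = sE p (\<ominus>\<^bsub>Ef p\<^esub> x)" using module_hom_a_inv[OF Ef modE sE_hom xc] by simp
  then show ?thesis using submodule_a_inv[OF P x] x sgn_E(2)[OF xc] by auto
qed

end

section \<open>Comparison of flabby resolutions\<close>

lemma (in abelian_group) add_diff_cancel:
  assumes "x \<in> carrier G" "y \<in> carrier G" shows "(x \<oplus> y) \<ominus> x = y"
proof -
  have "(x \<oplus> y) \<ominus> x = (x \<oplus> \<ominus> x) \<oplus> y"
    using assms by (simp only: a_minus_def a_ac a_closed a_inv_closed)
  then show ?thesis using assms by (simp add: r_neg)
qed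

text \<open>An \<open>injective_resolution\<close> without injectivity, as a notion that the total
  complex satisfies too.\<close>

definition resolution :: "('a, 'x) ring_scheme \<Rightarrow> ('a, 'm, 'y) module_scheme
    \<Rightarrow> ('m \<Rightarrow> 't) \<Rightarrow> (nat \<Rightarrow> ('a, 't) module) \<Rightarrow> (nat \<Rightarrow> 't \<Rightarrow> 't) \<Rightarrow> bool" where
  "resolution R M \<eta> T D \<longleftrightarrow> (\<forall>n. module R (T n)) \<and>
     \<eta> \<in> module_hom R M (T 0) \<and> inj_on \<eta> (carrier M) \<and>
     (\<forall>n. D n \<in> module_hom R (T n) (T (Suc n))) \<and>
     \<eta> ` carrier M = {t \<in> carrier (T 0). D 0 t = \<zero>\<^bsub>T (Suc 0)\<^esub>} \<and>
     (\<forall>n. D n ` carrier (T n) = {t \<in> carrier (T (Suc n)). D (Suc n) t = \<zero>\<^bsub>T (Suc (Suc n))\<^esub>})"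

lemma injective_imp_resolution: "injective_resolution R M \<epsilon> E d \<Longrightarrow> resolution R M \<epsilon> E d"
  unfolding injective_resolution_def resolution_def by (auto simp: injective_module_def)

text \<open>On the image of f the map is forced by k (f y) = g y, and it is well defined since g
  kills the kernel of f; the Baer property of Q extends it to Z.\<close>

lemma baer_factor:
  assumes Q: "baer_module R Q" and Y: "module R Y" and Z: "module R Z"
    and f: "f \<in> module_hom R Y Z" and g: "g \<in> module_hom R Y Q"
    and k: "\<And>y. y \<in> carrier Y \<Longrightarrow> f y = \<zero>\<^bsub>Z\<^esub> \<Longrightarrow> g y = \<zero>\<^bsub>Q\<^esub>"
  shows "\<exists>k\<in>module_hom R Z Q. \<forall>y\<in>carrier Y. k (f y) = g y"
proof -
  have mQ: "module R Q" using Q by (simp add: baer_module_def)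
  interpret Y: module R Y by fact
  interpret Z: module R Z by fact
  interpret Q: module R Q by (rule mQ)
  define h where "h z = g (SOME y. y \<in> carrier Y \<and> f y = z)" for z
  have h: "h (f y) = g y" if y: "y \<in> carrier Y" for y
  proof -
    define x where "x = (SOME x. x \<in> carrier Y \<and> f x = f y)"
    have x: "x \<in> carrier Y" "f x = f y"
      using someI[of "\<lambda>x. x \<in> carrier Y \<and> f x = f y" y] y unfolding x_def[symmetric] by auto
    have "f (x \<ominus>\<^bsub>Y\<^esub> y) = \<zero>\<^bsub>Z\<^esub>"
      using module_hom_diff[OF Y Z f x(1) y] x(2) Z.diff_self[OF module_hom_closed[OF f y]] by simp
    then have "g (x \<ominus>\<^bsub>Y\<^esub> y) = \<zero>\<^bsub>Q\<^esub>" using k[of "x \<ominus>\<^bsub>Y\<^esub> y"] x(1) y by simp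
    then have "g x \<ominus>\<^bsub>Q\<^esub> g y = \<zero>\<^bsub>Q\<^esub>" using module_hom_diff[OF Y mQ g x(1) y] by simp
    then have "g x = g y"
      by (rule Q.diff_zero_imp_eq[OF module_hom_closed[OF g x(1)] module_hom_closed[OF g y]])
    then show ?thesis by (simp add: h_def x_def[symmetric])
  qed
  have S: "submodule (f ` carrier Y) R Z" by (rule submodule_image[OF Y Z f submodule_carrier[OF Y]])
  have "h \<in> module_hom R (Z\<lparr>carrier := f ` carrier Y\<rparr>) Q"
  proof (rule module_homI)
    fix z assume "z \<in> carrier (Z\<lparr>carrier := f ` carrier Y\<rparr>)"
    then obtain y where y: "y \<in> carrier Y" "z = f y" by auto
    then show "h z \<in> carrier Q" using h module_hom_closed[OF g] by simp
    show "h (r \<odot>\<^bsub>Z\<lparr>carrier := f ` carrier Y\<rparr>\<^esub> z) = r \<odot>\<^bsub>Q\<^esub> h z" if r: "r \<in> carrier R" for r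
      using h[OF Y.smult_closed[OF r y(1)]] h[OF y(1)] y(2) module_hom_smult[OF f r y(1)] module_hom_smult[OF g r y(1)]
      by simp
  next
    fix z z' assume "z \<in> carrier (Z\<lparr>carrier := f ` carrier Y\<rparr>)" "z' \<in> carrier (Z\<lparr>carrier := f ` carrier Y\<rparr>)"
    then obtain y y' where y: "y \<in> carrier Y" "z = f y" "y' \<in> carrier Y" "z' = f y'" by auto
    show "h (z \<oplus>\<^bsub>Z\<lparr>carrier := f ` carrier Y\<rparr>\<^esub> z') = h z \<oplus>\<^bsub>Q\<^esub> h z'"
      using h[OF Y.a_closed[OF y(1,3)]] h[OF y(1)] h[OF y(3)] y(2,4) module_hom_add[OF f y(1,3)] module_hom_add[OF g y(1,3)]
      by simp
  qed
  then obtain k where "k \<in> module_hom R Z Q" "\<And>z. z \<in> f ` carrier Y \<Longrightarrow> k z = h z"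
    using baer_extend[OF Q Z S] by blast
  then show ?thesis using h by (intro bexI[of _ k]) auto
qed

text \<open>The usual lifting argument, with exactness used on the source and injectivity on the
  target.\<close>

lemma comparison_map:
  fixes T :: "nat \<Rightarrow> ('a, 't) module" and Q :: "nat \<Rightarrow> ('a, 'q) module"
  assumes M: "module R M" and T: "resolution R M \<eta> T D" and Q: "resolution R M \<epsilon> Q d"
    and baer: "\<And>n. baer_module R (Q n)"
  shows "\<exists>\<phi>. (\<forall>n. \<phi> n \<in> module_hom R (T n) (Q n)) \<and> (\<forall>m\<in>carrier M. \<phi> 0 (\<eta> m) = \<epsilon> m) \<and>
    (\<forall>n. \<forall>t\<in>carrier (T n). \<phi> (Suc n) (D n t) = d n (\<phi> n t))"
proof -
  have mT: "module R (T n)" and mQ: "module R (Q n)" for n using T Q by (simp_all add: resolution_def)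
  have D: "D n \<in> module_hom R (T n) (T (Suc n))" and d: "d n \<in> module_hom R (Q n) (Q (Suc n))" for n
    using T Q by (simp_all add: resolution_def)
  have \<eta>: "\<eta> \<in> module_hom R M (T 0)" "inj_on \<eta> (carrier M)" and \<epsilon>: "\<epsilon> \<in> module_hom R M (Q 0)"
    using T Q by (simp_all add: resolution_def)
  have T0: "\<exists>m\<in>carrier M. t = \<eta> m" if "t \<in> carrier (T 0)" "D 0 t = \<zero>\<^bsub>T (Suc 0)\<^esub>" for t
    using T that unfolding resolution_def by blast
  have TS: "\<exists>s\<in>carrier (T n). t = D n s" if "t \<in> carrier (T (Suc n))" "D (Suc n) t = \<zero>\<^bsub>T (Suc (Suc n))\<^esub>" for t n
    using T that unfolding resolution_def by blast
  have d0: "d 0 (\<epsilon> m) = \<zero>\<^bsub>Q (Suc 0)\<^esub>" if "m \<in> carrier M" for m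
    using Q that unfolding resolution_def by blast
  have dd: "d (Suc n) (d n q) = \<zero>\<^bsub>Q (Suc (Suc n))\<^esub>" if "q \<in> carrier (Q n)" for n q
    using Q that unfolding resolution_def by blast
  interpret M: module R M by fact
  \<comment> \<open>The recursion carries along that cycles go to cycles, which makes the next map
    well defined on the image of D; exactness of T preserves this property.\<close>
  define P where "P n \<phi> \<longleftrightarrow> \<phi> \<in> module_hom R (T n) (Q n) \<and>
    (\<forall>t\<in>carrier (T n). D n t = \<zero>\<^bsub>T (Suc n)\<^esub> \<longrightarrow> d n (\<phi> t) = \<zero>\<^bsub>Q (Suc n)\<^esub>) \<and>
    (n = 0 \<longrightarrow> (\<forall>m\<in>carrier M. \<phi> (\<eta> m) = \<epsilon> m))" for n \<phi>
  have "\<exists>\<phi>. \<forall>n. P n (\<phi> n) \<and> (\<forall>t\<in>carrier (T n). \<phi> (Suc n) (D n t) = d n (\<phi> n t))"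
  proof (rule dependent_nat_choice)
    have "\<exists>k\<in>module_hom R (T 0) (Q 0). \<forall>m\<in>carrier M. k (\<eta> m) = \<epsilon> m"
    proof (rule baer_factor[OF baer M mT \<eta>(1) \<epsilon>])
      fix m assume m: "m \<in> carrier M" "\<eta> m = \<zero>\<^bsub>T 0\<^esub>"
      then have "m = \<zero>\<^bsub>M\<^esub>" using inj_onD[OF \<eta>(2), of m "\<zero>\<^bsub>M\<^esub>"] module_hom_zero[OF M mT \<eta>(1)] by simp
      then show "\<epsilon> m = \<zero>\<^bsub>Q 0\<^esub>" using module_hom_zero[OF M mQ \<epsilon>] by simp
    qed
    then obtain k where k: "k \<in> module_hom R (T 0) (Q 0)" "\<And>m. m \<in> carrier M \<Longrightarrow> k (\<eta> m) = \<epsilon> m" by blast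
    have "d 0 (k t) = \<zero>\<^bsub>Q (Suc 0)\<^esub>" if t: "t \<in> carrier (T 0)" "D 0 t = \<zero>\<^bsub>T (Suc 0)\<^esub>" for t
      using T0[OF t] k(2) d0 by auto
    then show "\<exists>\<phi>. P 0 \<phi>" using k unfolding P_def by blast
  next
    fix \<phi> n assume P: "P n \<phi>"
    then have \<phi>: "\<phi> \<in> module_hom R (T n) (Q n)" by (simp add: P_def)
    have "\<exists>k\<in>module_hom R (T (Suc n)) (Q (Suc n)). \<forall>t\<in>carrier (T n). k (D n t) = d n (\<phi> t)"
      by (rule baer_factor[OF baer mT mT D module_hom_comp[OF \<phi> d]]) (use P in \<open>auto simp: P_def\<close>)
    then obtain k where k: "k \<in> module_hom R (T (Suc n)) (Q (Suc n))" "\<And>t. t \<in> carrier (T n) \<Longrightarrow> k (D n t) = d n (\<phi> t)" by blast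
    have "d (Suc n) (k t) = \<zero>\<^bsub>Q (Suc (Suc n))\<^esub>" if t: "t \<in> carrier (T (Suc n))" "D (Suc n) t = \<zero>\<^bsub>T (Suc (Suc n))\<^esub>" for t
      using TS[OF t] k(2) dd module_hom_closed[OF \<phi>] by auto
    then show "\<exists>k. P (Suc n) k \<and> (\<forall>t\<in>carrier (T n). k (D n t) = d n (\<phi> t))" using k unfolding P_def by blast
  qed
  then obtain \<phi> where \<phi>: "\<And>n. P n (\<phi> n)" "\<And>n t. t \<in> carrier (T n) \<Longrightarrow> \<phi> (Suc n) (D n t) = d n (\<phi> n t)"
    by blast
  have "\<phi> 0 (\<eta> m) = \<epsilon> m" if "m \<in> carrier M" for m using \<phi>(1)[of 0] that by (simp add: P_def)
  moreover have "\<phi> n \<in> module_hom R (T n) (Q n)" for n using \<phi>(1)[of n] by (simp add: P_def)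
  ultimately show ?thesis using \<phi>(2) by (intro exI[of _ \<phi>]) simp
qed

section \<open>Products of modules and their flabbiness\<close>

definition prod_mod :: "('a, 'x, 'u) module_scheme \<Rightarrow> ('a, 'y, 'v) module_scheme \<Rightarrow> ('a, 'x \<times> 'y) module" where
  "prod_mod U Y = \<lparr>carrier = carrier U \<times> carrier Y, monoid.mult = (\<lambda>x y. x), one = (\<zero>\<^bsub>U\<^esub>, \<zero>\<^bsub>Y\<^esub>),
     ring.zero = (\<zero>\<^bsub>U\<^esub>, \<zero>\<^bsub>Y\<^esub>), add = (\<lambda>p q. (fst p \<oplus>\<^bsub>U\<^esub> fst q, snd p \<oplus>\<^bsub>Y\<^esub> snd q)),
     smult = (\<lambda>r p. (r \<odot>\<^bsub>U\<^esub> fst p, r \<odot>\<^bsub>Y\<^esub> snd p))\<rparr>"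

lemma prod_mod_sel [simp]:
  "carrier (prod_mod U Y) = carrier U \<times> carrier Y" "\<zero>\<^bsub>prod_mod U Y\<^esub> = (\<zero>\<^bsub>U\<^esub>, \<zero>\<^bsub>Y\<^esub>)"
  "add (prod_mod U Y) = (\<lambda>p q. (fst p \<oplus>\<^bsub>U\<^esub> fst q, snd p \<oplus>\<^bsub>Y\<^esub> snd q))"
  "smult (prod_mod U Y) = (\<lambda>r p. (r \<odot>\<^bsub>U\<^esub> fst p, r \<odot>\<^bsub>Y\<^esub> snd p))"
  by (simp_all add: prod_mod_def)

lemma prod_mod_module:
  assumes U: "module R U" and Y: "module R Y"
  shows "module R (prod_mod U Y)"
proof -
  interpret U: module R U by fact
  interpret Y: module R Y by fact
  show ?thesis
  proof (rule moduleI)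
    show "cring R" by (rule module_cring[OF U])
    show "abelian_group (prod_mod U Y)"
    proof (rule abelian_groupI)
      fix z assume "z \<in> carrier (prod_mod U Y)"
      then show "\<exists>w\<in>carrier (prod_mod U Y). w \<oplus>\<^bsub>prod_mod U Y\<^esub> z = \<zero>\<^bsub>prod_mod U Y\<^esub>"
        by (intro bexI[of _ "(\<ominus>\<^bsub>U\<^esub> fst z, \<ominus>\<^bsub>Y\<^esub> snd z)"]) (auto simp: U.l_neg Y.l_neg)
    qed (auto simp: U.a_ac Y.a_ac)
  qed (auto simp: U.smult_l_distr Y.smult_l_distr U.smult_r_distr Y.smult_r_distr U.smult_assoc1 Y.smult_assoc1)
qed

lemma divis_shift:
  assumes M: "module R M" and x: "x \<in> carrier R" and u: "u \<in> carrier M" and v: "v \<in> carrier M"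
    and e: "(x [^]\<^bsub>R\<^esub> (b::nat)) \<odot>\<^bsub>M\<^esub> u = (x [^]\<^bsub>R\<^esub> Suc b) \<odot>\<^bsub>M\<^esub> v"
  shows "(x [^]\<^bsub>R\<^esub> (a + b)) \<odot>\<^bsub>M\<^esub> u = (x [^]\<^bsub>R\<^esub> Suc (a + b)) \<odot>\<^bsub>M\<^esub> v"
  using smult_pow_add[OF M x u, of a b] smult_pow_add[OF M x v, of a "Suc b"] e by simp

context
  fixes R :: "('a, 'z) ring_scheme" and U :: "('a, 'x, 'u) module_scheme" and Y :: "('a, 'y, 'v) module_scheme"
  assumes U: "module R U" and Y: "module R Y"
begin

lemma tor1_prod:
  assumes "S \<subseteq> carrier U" "S' \<subseteq> carrier Y" "x \<in> carrier R"
  shows "tor1 R (prod_mod U Y) x (S \<times> S') = tor1 R U x S \<times> tor1 R Y x S'"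
proof -
  have "\<exists>n::nat. (x [^]\<^bsub>R\<^esub> n) \<odot>\<^bsub>U\<^esub> a = \<zero>\<^bsub>U\<^esub> \<and> (x [^]\<^bsub>R\<^esub> n) \<odot>\<^bsub>Y\<^esub> b = \<zero>\<^bsub>Y\<^esub>"
    if "a \<in> S" "b \<in> S'" "(x [^]\<^bsub>R\<^esub> (n::nat)) \<odot>\<^bsub>U\<^esub> a = \<zero>\<^bsub>U\<^esub>" "(x [^]\<^bsub>R\<^esub> (k::nat)) \<odot>\<^bsub>Y\<^esub> b = \<zero>\<^bsub>Y\<^esub>" for a b n k
    using smult_pow_zero_mono[OF U assms(3) _ that(3), of "n + k"] smult_pow_zero_mono[OF Y assms(3) _ that(4), of "n + k"]
      that assms by (intro exI[of _ "n + k"]) auto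
  then show ?thesis unfolding tor1_def by (auto; metis)
qed

text \<open>The two components may require different exponents n and k; both equations hold with n +
  k.\<close>

lemma flabby_prod:
  assumes "submodule S R U" "submodule S' R Y" "set xs \<subseteq> carrier R" "flabby R U xs S" "flabby R Y xs S'"
  shows "flabby R (prod_mod U Y) xs (S \<times> S') \<and>
    tors R (prod_mod U Y) xs (S \<times> S') = tors R U xs S \<times> tors R Y xs S'"
  using assms
proof (induction xs arbitrary: S S')
  case (Cons x xs)
  have x: "x \<in> carrier R" using Cons.prems by simp
  have c: "S \<subseteq> carrier U" "S' \<subseteq> carrier Y"
    using submodule_subset[OF Cons.prems(1)] submodule_subset[OF Cons.prems(2)] by auto
  note t = tor1_prod[OF c x]
  have "divis R (prod_mod U Y) x (S \<times> S')" unfolding divis_def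
  proof
    fix z assume "z \<in> S \<times> S'"
    then obtain a b where ab: "z = (a, b)" "a \<in> S" "b \<in> S'" by blast
    have dv: "divis R U x S" "divis R Y x S'" using Cons.prems by simp_all
    obtain n y where y: "y \<in> S" "(x [^]\<^bsub>R\<^esub> (n::nat)) \<odot>\<^bsub>U\<^esub> a = (x [^]\<^bsub>R\<^esub> Suc n) \<odot>\<^bsub>U\<^esub> y"
      using dv(1) ab(2) unfolding divis_def by blast
    obtain k y' where y': "y' \<in> S'" "(x [^]\<^bsub>R\<^esub> (k::nat)) \<odot>\<^bsub>Y\<^esub> b = (x [^]\<^bsub>R\<^esub> Suc k) \<odot>\<^bsub>Y\<^esub> y'"
      using dv(2) ab(3) unfolding divis_def by blast
    have "(x [^]\<^bsub>R\<^esub> (k + n)) \<odot>\<^bsub>U\<^esub> a = (x [^]\<^bsub>R\<^esub> Suc (k + n)) \<odot>\<^bsub>U\<^esub> y"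
      by (rule divis_shift[OF U x _ _ y(2)]) (use c ab y in auto)
    moreover have "(x [^]\<^bsub>R\<^esub> (n + k)) \<odot>\<^bsub>Y\<^esub> b = (x [^]\<^bsub>R\<^esub> Suc (n + k)) \<odot>\<^bsub>Y\<^esub> y'"
      by (rule divis_shift[OF Y x _ _ y'(2)]) (use c ab y' in auto)
    ultimately have "(x [^]\<^bsub>R\<^esub> (n + k)) \<odot>\<^bsub>prod_mod U Y\<^esub> z = (x [^]\<^bsub>R\<^esub> Suc (n + k)) \<odot>\<^bsub>prod_mod U Y\<^esub> (y, y')"
      by (simp add: ab(1) add.commute[of k n] del: Group.nat_pow_Suc)
    then show "\<exists>n. \<exists>y\<in>S \<times> S'. (x [^]\<^bsub>R\<^esub> (n::nat)) \<odot>\<^bsub>prod_mod U Y\<^esub> z = (x [^]\<^bsub>R\<^esub> Suc n) \<odot>\<^bsub>prod_mod U Y\<^esub> y"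
      using y(1) y'(1) by blast
  qed
  then show ?case
    using Cons.IH[OF tor1_submodule[OF U Cons.prems(1) x] tor1_submodule[OF Y Cons.prems(2) x]] Cons.prems
    by (simp add: t tors_Cons)
qed simp

end

text \<open>The boundaries of the torsion subcomplex, zero in degree 0. This is the submodule
  divided out in \<open>torsion_cohomology\<close>, with the ideal replaced by generators.\<close>

definition bdry :: "('a, 'x) ring_scheme \<Rightarrow> (nat \<Rightarrow> ('a, 'q) module) \<Rightarrow> (nat \<Rightarrow> 'q \<Rightarrow> 'q) \<Rightarrow> 'a list \<Rightarrow> nat \<Rightarrow> 'q set" where
  "bdry R Q d xs n = (case n of 0 \<Rightarrow> {\<zero>\<^bsub>Q 0\<^esub>} | Suc m \<Rightarrow> d m ` tors R (Q m) xs (carrier (Q m)))"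

text \<open>The mapping cone of the comparison map is an exact complex of flabby modules, so it stays exact after
  taking torsion.\<close>

lemma comparison_torsion:
  fixes T :: "nat \<Rightarrow> ('a, 't) module" and Q :: "nat \<Rightarrow> ('a, 'q) module"
  assumes M: "module R M" and T: "resolution R M \<eta> T D" and Q: "resolution R M \<epsilon> Q d"
    and xs: "set xs \<subseteq> carrier R"
    and flT: "\<And>n. flabby R (T n) xs (carrier (T n))" and flQ: "\<And>n. flabby R (Q n) xs (carrier (Q n))"
    and \<phi>: "\<And>n. \<phi> n \<in> module_hom R (T n) (Q n)" and \<phi>0: "\<And>m. m \<in> carrier M \<Longrightarrow> \<phi> 0 (\<eta> m) = \<epsilon> m"
    and \<phi>D: "\<And>n t. t \<in> carrier (T n) \<Longrightarrow> \<phi> (Suc n) (D n t) = d n (\<phi> n t)"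
  shows "q \<in> tors R (Q n) xs (carrier (Q n)) \<Longrightarrow> d n q = \<zero>\<^bsub>Q (Suc n)\<^esub> \<Longrightarrow>
      \<exists>t\<in>tors R (T n) xs (carrier (T n)). D n t = \<zero>\<^bsub>T (Suc n)\<^esub> \<and> q \<ominus>\<^bsub>Q n\<^esub> \<phi> n t \<in> bdry R Q d xs n"
    and "t \<in> tors R (T n) xs (carrier (T n)) \<Longrightarrow> D n t = \<zero>\<^bsub>T (Suc n)\<^esub> \<Longrightarrow> \<phi> n t \<in> bdry R Q d xs n \<Longrightarrow>
      t \<in> bdry R T D xs n"
proof -
  have mT: "module R (T n)" and mQ: "module R (Q n)" for n using T Q by (simp_all add: resolution_def)
  have D: "D n \<in> module_hom R (T n) (T (Suc n))" and d: "d n \<in> module_hom R (Q n) (Q (Suc n))" for n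
    using T Q by (simp_all add: resolution_def)
  have \<eta>: "\<eta> \<in> module_hom R M (T 0)" "inj_on \<eta> (carrier M)" and \<epsilon>: "\<epsilon> \<in> module_hom R M (Q 0)" "inj_on \<epsilon> (carrier M)"
    using T Q by (simp_all add: resolution_def)
  have T0: "\<exists>m\<in>carrier M. t = \<eta> m" if "t \<in> carrier (T 0)" "D 0 t = \<zero>\<^bsub>T (Suc 0)\<^esub>" for t
    using T that unfolding resolution_def by blast
  have TS: "\<exists>s\<in>carrier (T n). t = D n s" if "t \<in> carrier (T (Suc n))" "D (Suc n) t = \<zero>\<^bsub>T (Suc (Suc n))\<^esub>" for t n
    using T that unfolding resolution_def by blast
  have Q0: "\<exists>m\<in>carrier M. t = \<epsilon> m" if "t \<in> carrier (Q 0)" "d 0 t = \<zero>\<^bsub>Q (Suc 0)\<^esub>" for t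
    using Q that unfolding resolution_def by blast
  have QS: "\<exists>s\<in>carrier (Q n). t = d n s" if "t \<in> carrier (Q (Suc n))" "d (Suc n) t = \<zero>\<^bsub>Q (Suc (Suc n))\<^esub>" for t n
    using Q that unfolding resolution_def by blast
  have dd: "d (Suc n) (d n q) = \<zero>\<^bsub>Q (Suc (Suc n))\<^esub>" if "q \<in> carrier (Q n)" for n q
    using Q that unfolding resolution_def by blast
  have DD: "D (Suc n) (D n q) = \<zero>\<^bsub>T (Suc (Suc n))\<^esub>" if "q \<in> carrier (T n)" for n q
    using T that unfolding resolution_def by blast
  have D\<eta>: "D 0 (\<eta> m) = \<zero>\<^bsub>T (Suc 0)\<^esub>" if "m \<in> carrier M" for m
    using T that unfolding resolution_def by blast
  interpret M: module R M by fact
  interpret T: module R "T n" for n by (rule mT)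
  interpret Q: module R "Q n" for n by (rule mQ)
  note Tc = module_hom_closed[OF D] and Qc = module_hom_closed[OF d] and \<phi>c = module_hom_closed[OF \<phi>]
  note Dz = module_hom_zero[OF mT mT D] and dz = module_hom_zero[OF mQ mQ d] and \<phi>z = module_hom_zero[OF mT mQ \<phi>]
  have T_neg0: "a = \<zero>\<^bsub>T n\<^esub>" if "a \<in> carrier (T n)" "\<ominus>\<^bsub>T n\<^esub> a = \<zero>\<^bsub>T n\<^esub>" for a n
    using T.diff_self[OF that(1)] that by (simp add: a_minus_def)
  have T_m0: "\<ominus>\<^bsub>T n\<^esub> \<zero>\<^bsub>T n\<^esub> = \<zero>\<^bsub>T n\<^esub>" for n by (rule T.minus_equality) auto
  \<comment> \<open>Q shifted by one, with the zero module in degree 0: in degree n the cone is the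
    product of T n and Q (n - 1).\<close>
  define Qs where "Qs n = (case n of 0 \<Rightarrow> (Q 0)\<lparr>carrier := {\<zero>\<^bsub>Q 0\<^esub>}\<rparr> | Suc m \<Rightarrow> Q m)" for n
  define dS where "dS n q = (case n of 0 \<Rightarrow> \<zero>\<^bsub>Q 0\<^esub> | Suc m \<Rightarrow> d m q)" for n q
  have mQs: "module R (Qs n)" for n
    by (cases n) (simp_all add: Qs_def mQ submodule_module[OF mQ submodule_singleton_zero[OF mQ]])
  have dS: "dS n \<in> module_hom R (Qs n) (Q n)" for n
  proof (cases n)
    case 0
    have "(\<lambda>q. \<zero>\<^bsub>Q 0\<^esub>) \<in> module_hom R ((Q 0)\<lparr>carrier := {\<zero>\<^bsub>Q 0\<^esub>}\<rparr>) (Q 0)" by (rule module_homI) auto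
    then show ?thesis by (simp add: 0 Qs_def dS_def[abs_def])
  next
    case (Suc m) then show ?thesis using d by (simp add: Qs_def dS_def[abs_def])
  qed
  note dSc = module_hom_closed[OF dS]
  have flQs: "flabby R (Qs n) xs (carrier (Qs n))" for n
    by (cases n) (simp_all add: Qs_def flQ flabby_zero[OF mQ xs])
  define C where "C n = prod_mod (T n) (Qs n)" for n
  \<comment> \<open>The minus sign on D makes \<delta> square to zero, as \<phi> commutes with the
    differentials.\<close>
  define \<delta> where "\<delta> n c = (\<ominus>\<^bsub>T (Suc n)\<^esub> D n (fst c), \<phi> n (fst c) \<oplus>\<^bsub>Q n\<^esub> dS n (snd c))" for n c
  have QsS: "Qs (Suc n) = Q n" for n by (simp add: Qs_def)
  have mC: "module R (C n)" for n unfolding C_def by (rule prod_mod_module[OF mT mQs])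
  have \<delta>: "\<delta> n \<in> module_hom R (C n) (C (Suc n))" for n
  proof (rule module_homI)
    fix c assume "c \<in> carrier (C n)"
    then have c: "fst c \<in> carrier (T n)" "snd c \<in> carrier (Qs n)" by (auto simp: C_def)
    show "\<delta> n c \<in> carrier (C (Suc n))" using c Tc \<phi>c dSc by (simp add: C_def QsS \<delta>_def)
    show "\<delta> n (r \<odot>\<^bsub>C n\<^esub> c) = r \<odot>\<^bsub>C (Suc n)\<^esub> \<delta> n c" if "r \<in> carrier R" for r
      using c that Tc \<phi>c dSc
      by (simp add: C_def QsS \<delta>_def module_hom_smult[OF D] module_hom_smult[OF \<phi>] module_hom_smult[OF dS]
          Q.smult_r_distr T.smult_r_minus)
    fix c' assume "c' \<in> carrier (C n)"
    then have c': "fst c' \<in> carrier (T n)" "snd c' \<in> carrier (Qs n)" by (auto simp: C_def)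
    show "\<delta> n (c \<oplus>\<^bsub>C n\<^esub> c') = \<delta> n c \<oplus>\<^bsub>C (Suc n)\<^esub> \<delta> n c'"
      using c c' Tc \<phi>c dSc
      by (simp add: C_def QsS \<delta>_def module_hom_add[OF D] module_hom_add[OF \<phi>] module_hom_add[OF dS]
          Q.a_ac T.minus_add)
  qed
  have C0: "\<delta> n c = \<zero>\<^bsub>C (Suc n)\<^esub> \<longleftrightarrow> D n (fst c) = \<zero>\<^bsub>T (Suc n)\<^esub> \<and> \<phi> n (fst c) \<oplus>\<^bsub>Q n\<^esub> dS n (snd c) = \<zero>\<^bsub>Q n\<^esub>"
    if "c \<in> carrier (C n)" for n c
    using that T_neg0[OF Tc, of "fst c" n] T_m0 by (auto simp: C_def QsS \<delta>_def)
  have tC: "flabby R (C n) xs (carrier (C n))"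
    "tors R (C n) xs (carrier (C n)) = tors R (T n) xs (carrier (T n)) \<times> tors R (Qs n) xs (carrier (Qs n))" for n
    using flabby_prod[OF mT mQs submodule_carrier[OF mT] submodule_carrier[OF mQs] xs flT flQs, of n n]
    by (simp_all add: C_def)
  \<comment> \<open>The cycles of T 0 are the image of \<eta>, and there \<phi> 0 is given by
    \<epsilon> and hence injective.\<close>
  have inj0: "t = \<zero>\<^bsub>T 0\<^esub>" if t: "t \<in> carrier (T 0)" "D 0 t = \<zero>\<^bsub>T (Suc 0)\<^esub>" "\<phi> 0 t = \<zero>\<^bsub>Q 0\<^esub>" for t
  proof -
    obtain m where m: "m \<in> carrier M" "t = \<eta> m" using T0[OF t(1,2)] by blast
    then have "\<epsilon> m = \<epsilon> \<zero>\<^bsub>M\<^esub>" using \<phi>0 t(3) module_hom_zero[OF M mQ \<epsilon>(1)] by simp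
    then have "m = \<zero>\<^bsub>M\<^esub>" using inj_onD[OF \<epsilon>(2)] m by blast
    then show ?thesis using m module_hom_zero[OF M mT \<eta>(1)] by simp
  qed
  have inj: "{c \<in> carrier (C 0). \<delta> 0 c = \<zero>\<^bsub>C (Suc 0)\<^esub>} = {\<zero>\<^bsub>C 0\<^esub>}"
  proof (intro equalityI subsetI)
    fix c assume c: "c \<in> {c \<in> carrier (C 0). \<delta> 0 c = \<zero>\<^bsub>C (Suc 0)\<^esub>}"
    then have "fst c \<in> carrier (T 0)" "snd c = \<zero>\<^bsub>Q 0\<^esub>" by (auto simp: C_def Qs_def)
    moreover have "D 0 (fst c) = \<zero>\<^bsub>T (Suc 0)\<^esub>" "\<phi> 0 (fst c) = \<zero>\<^bsub>Q 0\<^esub>"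
      using c C0[of c 0] calculation \<phi>c by (auto simp: dS_def)
    ultimately show "c \<in> {\<zero>\<^bsub>C 0\<^esub>}" using inj0 by (simp add: C_def Qs_def prod_eq_iff)
  next
    fix c assume "c \<in> {\<zero>\<^bsub>C 0\<^esub>}"
    then show "c \<in> {c \<in> carrier (C 0). \<delta> 0 c = \<zero>\<^bsub>C (Suc 0)\<^esub>}"
      using module_hom_zero[OF mC mC \<delta>] submodule_zero[OF submodule_carrier[OF mC]] by auto
  qed
  have ex: "{c \<in> carrier (C (Suc n)). \<delta> (Suc n) c = \<zero>\<^bsub>C (Suc (Suc n))\<^esub>} = \<delta> n ` carrier (C n)" for n
  proof (intro equalityI subsetI)
    fix c assume c: "c \<in> {c \<in> carrier (C (Suc n)). \<delta> (Suc n) c = \<zero>\<^bsub>C (Suc (Suc n))\<^esub>}"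
    obtain t q where tq: "c = (t, q)" by (cases c)
    then have tqc: "t \<in> carrier (T (Suc n))" "q \<in> carrier (Q n)" using c by (auto simp: C_def QsS)
    have e: "D (Suc n) t = \<zero>\<^bsub>T (Suc (Suc n))\<^esub>" "\<phi> (Suc n) t \<oplus>\<^bsub>Q (Suc n)\<^esub> d n q = \<zero>\<^bsub>Q (Suc n)\<^esub>"
      using c C0[of c "Suc n"] tq by (auto simp: dS_def)
    obtain u' where u': "u' \<in> carrier (T n)" "t = D n u'" using TS[OF tqc(1) e(1)] by blast
    \<comment> \<open>A preimage of t under -D. The second component q is then off by a cycle of Q
      n, namely q - \<phi> u.\<close>
    define u where "u = \<ominus>\<^bsub>T n\<^esub> u'"
    have u: "u \<in> carrier (T n)" using u' by (simp add: u_def)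
    have Du: "D n u = \<ominus>\<^bsub>T (Suc n)\<^esub> t" using module_hom_a_inv[OF mT mT D u'(1)] u'(2) by (simp add: u_def)
    have "\<phi> (Suc n) (D n u) = \<ominus>\<^bsub>Q (Suc n)\<^esub> \<phi> (Suc n) t"
      unfolding Du by (rule module_hom_a_inv[OF mT mQ \<phi> tqc(1)])
    moreover have "\<ominus>\<^bsub>Q (Suc n)\<^esub> \<phi> (Suc n) t = d n q"
      by (rule Q.minus_equality) (use e(2) tqc \<phi>c Qc in \<open>simp_all add: Q.a_comm\<close>)
    ultimately have du: "d n (\<phi> n u) = d n q" using \<phi>D[OF u] by simp
    have kq: "q \<ominus>\<^bsub>Q n\<^esub> \<phi> n u \<in> carrier (Q n)" "d n (q \<ominus>\<^bsub>Q n\<^esub> \<phi> n u) = \<zero>\<^bsub>Q (Suc n)\<^esub>"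
      using tqc \<phi>c[OF u] Qc by (simp_all add: module_hom_diff[OF mQ mQ d] du Q.diff_self)
    have t': "t = \<ominus>\<^bsub>T (Suc n)\<^esub> D n u" using Du tqc(1) by simp
    have phi_q: "\<phi> n u \<oplus>\<^bsub>Q n\<^esub> (q \<ominus>\<^bsub>Q n\<^esub> \<phi> n u) = q"
      using tqc \<phi>c[OF u] by (simp add: a_minus_def Q.a_ac Q.r_neg Q.r_neg2 Q.r_neg1)
    show "c \<in> \<delta> n ` carrier (C n)"
    proof (cases n)
      case 0
      \<comment> \<open>In degree 0 the shifted Q is zero and cannot absorb the difference; it comes
        from M instead, and adding \<eta> m to u accounts for it.\<close>
      then obtain m where m: "m \<in> carrier M" "q \<ominus>\<^bsub>Q n\<^esub> \<phi> n u = \<epsilon> m" using Q0 kq by blast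
      let ?u = "u \<oplus>\<^bsub>T n\<^esub> \<eta> m"
      have \<eta>m: "\<eta> m \<in> carrier (T n)" using module_hom_closed[OF \<eta>(1) m(1)] 0 by simp
      have "D n ?u = D n u" using D\<eta>[OF m(1)] u \<eta>m 0 Tc[OF u] by (simp add: module_hom_add[OF D])
      moreover have "\<phi> n ?u = q" using u \<eta>m phi_q m \<phi>0[OF m(1)] 0 by (simp add: module_hom_add[OF \<phi>])
      ultimately have "\<delta> n (?u, \<zero>\<^bsub>Q 0\<^esub>) = c" using tq t' tqc 0 by (simp add: \<delta>_def dS_def)
      moreover have "(?u, \<zero>\<^bsub>Q 0\<^esub>) \<in> carrier (C n)" using u \<eta>m 0 by (simp add: C_def Qs_def)
      ultimately show ?thesis by blast
    next
      case (Suc m)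
      then obtain v where v: "v \<in> carrier (Q m)" "q \<ominus>\<^bsub>Q n\<^esub> \<phi> n u = d m v" using QS kq by blast
      have "\<delta> n (u, v) = c" using tq t' phi_q v Suc by (simp add: \<delta>_def dS_def)
      moreover have "(u, v) \<in> carrier (C n)" using u v Suc by (simp add: C_def Qs_def)
      ultimately show ?thesis by blast
    qed
  next
    fix c assume "c \<in> \<delta> n ` carrier (C n)"
    then obtain b where b: "b \<in> carrier (C n)" "c = \<delta> n b" by blast
    then have bc: "fst b \<in> carrier (T n)" "snd b \<in> carrier (Qs n)" by (auto simp: C_def)
    have cc: "c \<in> carrier (C (Suc n))" using b module_hom_closed[OF \<delta>] by simp
    have "d n (dS n (snd b)) = \<zero>\<^bsub>Q (Suc n)\<^esub>"
      using bc dz dd by (cases n) (simp_all add: dS_def Qs_def)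
    then have "d n (\<phi> n (fst b) \<oplus>\<^bsub>Q n\<^esub> dS n (snd b)) = d n (\<phi> n (fst b))"
      using bc \<phi>c dSc Qc by (simp add: module_hom_add[OF d])
    moreover have "\<phi> (Suc n) (\<ominus>\<^bsub>T (Suc n)\<^esub> D n (fst b)) = \<ominus>\<^bsub>Q (Suc n)\<^esub> d n (\<phi> n (fst b))"
      using module_hom_a_inv[OF mT mQ \<phi> Tc[OF bc(1)]] \<phi>D[OF bc(1)] by simp
    moreover have "D (Suc n) (\<ominus>\<^bsub>T (Suc n)\<^esub> D n (fst b)) = \<zero>\<^bsub>T (Suc (Suc n))\<^esub>"
      using module_hom_a_inv[OF mT mT D Tc[OF bc(1)]] DD[OF bc(1)] T_m0 by simp
    ultimately have "\<delta> (Suc n) c = \<zero>\<^bsub>C (Suc (Suc n))\<^esub>"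
      using C0[OF cc] b(2) bc \<phi>c Qc by (simp add: \<delta>_def dS_def Q.l_neg)
    then show "c \<in> {c \<in> carrier (C (Suc n)). \<delta> (Suc n) c = \<zero>\<^bsub>C (Suc (Suc n))\<^esub>}" using cc by simp
  qed
  note cone_exact = tors_exact[where C = C and \<delta> = \<delta>, OF mC \<delta> tC(1) xs inj ex]
  have tz: "\<zero>\<^bsub>T n\<^esub> \<in> tors R (T n) xs (carrier (T n))" for n
    by (rule submodule_zero[OF tors_submodule[OF mT submodule_carrier[OF mT] xs]])
  \<comment> \<open>Surjectivity on cohomology: q gives the torsion cycle (0, q) of the cone, and a
    torsion preimage (t, v) satisfies D t = 0 and q = \<phi> t + d v.\<close>
  { assume q: "q \<in> tors R (Q n) xs (carrier (Q n))" "d n q = \<zero>\<^bsub>Q (Suc n)\<^esub>"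
    have qc: "q \<in> carrier (Q n)" using q(1) by (simp add: tors_def)
    have "(\<zero>\<^bsub>T (Suc n)\<^esub>, q) \<in> tors R (C (Suc n)) xs (carrier (C (Suc n)))"
      unfolding tC(2) QsS using q tz by simp
    moreover have "\<delta> (Suc n) (\<zero>\<^bsub>T (Suc n)\<^esub>, q) = \<zero>\<^bsub>C (Suc (Suc n))\<^esub>"
      using C0[of "(\<zero>\<^bsub>T (Suc n)\<^esub>, q)" "Suc n"] qc q(2) Dz \<phi>z by (simp add: C_def QsS dS_def)
    ultimately have "(\<zero>\<^bsub>T (Suc n)\<^esub>, q) \<in> \<delta> n ` tors R (C n) xs (carrier (C n))" by (rule cone_exact)
    then obtain t v where tv: "t \<in> tors R (T n) xs (carrier (T n))" "v \<in> tors R (Qs n) xs (carrier (Qs n))"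
      "\<delta> n (t, v) = (\<zero>\<^bsub>T (Suc n)\<^esub>, q)" unfolding tC(2) by force
    have c: "t \<in> carrier (T n)" "v \<in> carrier (Qs n)" using tv by (auto simp: tors_def)
    have "D n t = \<zero>\<^bsub>T (Suc n)\<^esub>" using T_neg0[OF Tc[OF c(1)]] tv(3) by (simp add: \<delta>_def)
    moreover have "q = \<phi> n t \<oplus>\<^bsub>Q n\<^esub> dS n v" using tv(3) by (simp add: \<delta>_def)
    then have "q \<ominus>\<^bsub>Q n\<^esub> \<phi> n t = dS n v"
      using \<phi>c[OF c(1)] dSc[OF c(2)] by (simp add: Q.add_diff_cancel)
    moreover have "dS n v \<in> bdry R Q d xs n"
      using tv(2) by (cases n) (auto simp: dS_def bdry_def Qs_def)
    ultimately show "\<exists>t\<in>tors R (T n) xs (carrier (T n)). D n t = \<zero>\<^bsub>T (Suc n)\<^esub> \<and> q \<ominus>\<^bsub>Q n\<^esub> \<phi> n t \<in> bdry R Q d xs n"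
      using tv(1) by auto }
  \<comment> \<open>Injectivity on cohomology: in positive degree, if \<phi> t = d v, then (t, -v)
    is a torsion cycle of the cone, and a torsion preimage exhibits t as a boundary.\<close>
  assume t: "t \<in> tors R (T n) xs (carrier (T n))" "D n t = \<zero>\<^bsub>T (Suc n)\<^esub>" "\<phi> n t \<in> bdry R Q d xs n"
  have tc: "t \<in> carrier (T n)" using t(1) by (simp add: tors_def)
  show "t \<in> bdry R T D xs n"
  proof (cases n)
    case 0 then show ?thesis using inj0[of t] t tc by (simp add: bdry_def)
  next
    case (Suc m)
    then obtain v where v: "v \<in> tors R (Q m) xs (carrier (Q m))" "\<phi> n t = d m v" using t(3) by (auto simp: bdry_def)
    have vc: "v \<in> carrier (Q m)" using v(1) by (simp add: tors_def)
    have nv: "\<ominus>\<^bsub>Q m\<^esub> v \<in> tors R (Q m) xs (carrier (Q m))"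
      by (rule submodule_a_inv[OF tors_submodule[OF mQ submodule_carrier[OF mQ] xs] v(1)])
    have "(t, \<ominus>\<^bsub>Q m\<^esub> v) \<in> tors R (C (Suc m)) xs (carrier (C (Suc m)))"
      unfolding tC(2) QsS using t nv Suc by simp
    moreover have "\<delta> (Suc m) (t, \<ominus>\<^bsub>Q m\<^esub> v) = \<zero>\<^bsub>C (Suc (Suc m))\<^esub>"
      using C0[of "(t, \<ominus>\<^bsub>Q m\<^esub> v)" "Suc m"] tc vc t(2) Suc v(2) Qc[OF vc] module_hom_a_inv[OF mQ mQ d vc]
      by (simp add: C_def QsS dS_def Q.r_neg)
    ultimately have "(t, \<ominus>\<^bsub>Q m\<^esub> v) \<in> \<delta> m ` tors R (C m) xs (carrier (C m))" by (rule cone_exact)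
    then obtain u where u: "u \<in> tors R (T m) xs (carrier (T m))" "t = \<ominus>\<^bsub>T (Suc m)\<^esub> D m u"
      unfolding tC(2) \<delta>_def by auto
    have uc: "u \<in> carrier (T m)" using u(1) by (simp add: tors_def)
    have "t = D m (\<ominus>\<^bsub>T m\<^esub> u)" using u(2) module_hom_a_inv[OF mT mT D uc] by simp
    moreover have "\<ominus>\<^bsub>T m\<^esub> u \<in> tors R (T m) xs (carrier (T m))"
      by (rule submodule_a_inv[OF tors_submodule[OF mT submodule_carrier[OF mT] xs] u(1)])
    ultimately show ?thesis using Suc by (auto simp: bdry_def)
  qed
qed

section \<open>Finite generation\<close>

text \<open>Finite generation of \<open>Z / H\<close>, without forming the quotient.\<close>

definition fg_mod :: "('a, 'x) ring_scheme \<Rightarrow> ('a, 'm, 'y) module_scheme \<Rightarrow> 'm set \<Rightarrow> 'm set \<Rightarrow> bool" where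
  "fg_mod R M Z H \<longleftrightarrow> (\<exists>S. finite S \<and> S \<subseteq> Z \<and>
     (\<forall>W. submodule W R M \<longrightarrow> S \<subseteq> W \<longrightarrow> H \<subseteq> W \<longrightarrow> Z \<subseteq> W))"

lemma submodule_restrictD:
  assumes M: "module R M" and Z: "submodule Z R M" and W: "submodule W R (M\<lparr>carrier := Z\<rparr>)"
  shows "submodule W R M" "W \<subseteq> Z"
proof -
  show WZ: "W \<subseteq> Z" using submodule_subset[OF W] by auto
  show "submodule W R M"
  proof (rule submoduleI'[OF M])
    show "W \<subseteq> carrier M" using WZ submodule_subset[OF Z] by blast
    show "\<zero>\<^bsub>M\<^esub> \<in> W" using submodule_zero[OF W] by simp
    show "x \<oplus>\<^bsub>M\<^esub> y \<in> W" if "x \<in> W" "y \<in> W" for x y using submodule_add[OF W that] by simp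
    show "r \<odot>\<^bsub>M\<^esub> x \<in> W" if "r \<in> carrier R" "x \<in> W" for r x using submodule_smult[OF W that] by simp
  qed
qed

lemma restrict_diff:
  assumes M: "module R M" and Z: "submodule Z R M" and "x \<in> Z" "y \<in> Z"
  shows "x \<ominus>\<^bsub>M\<lparr>carrier := Z\<rparr>\<^esub> y = x \<ominus>\<^bsub>M\<^esub> y"
proof -
  have "(\<lambda>x. x) \<in> module_hom R (M\<lparr>carrier := Z\<rparr>) M"
    by (rule module_homI) (use submodule_subset[OF Z] in auto)
  from module_hom_diff[OF submodule_module[OF M Z] M this] show ?thesis using assms by simp
qed

context
  fixes R :: "('a, 'x) ring_scheme" and M :: "('a, 'm, 'y) module_scheme" and Z H
  assumes M: "module R M" and Z: "submodule Z R M" and H: "submodule H R M" and HZ: "H \<subseteq> Z"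
begin

private abbreviation "N \<equiv> M\<lparr>carrier := Z\<rparr>"

private lemma N: "module R N" by (rule submodule_module[OF M Z])
private lemma HN: "submodule H R N" by (rule submodule_of_submodule[OF M Z H HZ])

lemma nonzero_quotient_iff: "nonzero_module (quotient_module (M\<lparr>carrier := Z\<rparr>) H) \<longleftrightarrow> \<not> Z \<subseteq> H"
proof -
  have "carrier (quotient_module N H) = {H} \<longleftrightarrow> (\<forall>z\<in>Z. H +>\<^bsub>N\<^esub> z = H)"
    unfolding quotient_carrier using submodule_zero[OF Z] by auto
  also have "\<dots> \<longleftrightarrow> Z \<subseteq> H" using coset_eq_self_iff[OF N HN] by auto
  finally show ?thesis by (simp add: nonzero_module_def quotient_zero)
qed

text \<open>Generators of Z / H correspond to representatives in Z taken together with H. A test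
  submodule W of M may leave Z, so it is intersected with Z before passing to the quotient.\<close>

lemma fg_quotient_iff: "fg_module R (quotient_module (M\<lparr>carrier := Z\<rparr>) H) \<longleftrightarrow> fg_mod R M Z H"
proof
  let ?Q = "quotient_module N H"
  note mQ = quotient_is_module[OF N HN]
  note ch = coset_hom[OF N HN]
  note Zc = submodule_subset[OF Z]
  interpret M: module R M by (rule M)
  {
    assume "fg_module R ?Q"
    then obtain S' where S': "finite S'" "S' \<subseteq> carrier ?Q" "submodule_gen R ?Q S' = carrier ?Q"
      by (auto simp: fg_module_def)
    then have "\<forall>C\<in>S'. \<exists>z. z \<in> Z \<and> C = H +>\<^bsub>N\<^esub> z" by (auto simp: quotient_carrier)
    then obtain f where f: "\<And>C. C \<in> S' \<Longrightarrow> f C \<in> Z \<and> C = H +>\<^bsub>N\<^esub> f C" by metis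
    have "Z \<subseteq> W" if W: "submodule W R M" "f ` S' \<subseteq> W" "H \<subseteq> W" for W
    proof
      fix z assume z: "z \<in> Z"
      have WZ: "submodule (W \<inter> Z) R N"
        by (rule submodule_of_submodule[OF M Z submodule_Int[OF M W(1) Z]]) simp
      have "submodule ((\<lambda>x. H +>\<^bsub>N\<^esub> x) ` (W \<inter> Z)) R ?Q" by (rule submodule_image[OF N mQ ch WZ])
      moreover have "S' \<subseteq> (\<lambda>x. H +>\<^bsub>N\<^esub> x) ` (W \<inter> Z)" using f W(2) by blast
      ultimately have "carrier ?Q \<subseteq> (\<lambda>x. H +>\<^bsub>N\<^esub> x) ` (W \<inter> Z)"
        using submodule_gen_least S'(3) by metis
      moreover have "H +>\<^bsub>N\<^esub> z \<in> carrier ?Q" using z by (simp add: quotient_carrier)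
      ultimately obtain w where w: "w \<in> W" "w \<in> Z" "H +>\<^bsub>N\<^esub> z = H +>\<^bsub>N\<^esub> w" by blast
      then have "z \<ominus>\<^bsub>N\<^esub> w \<in> H" using coset_eq_iff[OF N HN, of z w] z by simp
      then have "z \<ominus>\<^bsub>M\<^esub> w \<in> W" using restrict_diff[OF M Z z w(2)] W(3) by auto
      then have "(z \<ominus>\<^bsub>M\<^esub> w) \<oplus>\<^bsub>M\<^esub> w \<in> W" using submodule_add[OF W(1)] w(1) by simp
      then show "z \<in> W" using Zc[OF z] Zc[OF w(2)] by (simp add: a_minus_def M.a_assoc M.l_neg)
    qed
    then show "fg_mod R M Z H" unfolding fg_mod_def using S'(1) f by (intro exI[of _ "f ` S'"]) blast
  next
    assume "fg_mod R M Z H"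
    then obtain S where S: "finite S" "S \<subseteq> Z" "\<And>W. submodule W R M \<Longrightarrow> S \<subseteq> W \<Longrightarrow> H \<subseteq> W \<Longrightarrow> Z \<subseteq> W"
      unfolding fg_mod_def by blast
    let ?S = "(\<lambda>x. H +>\<^bsub>N\<^esub> x) ` S"
    have Sc: "?S \<subseteq> carrier ?Q" using S(2) by (auto simp: quotient_carrier)
    have "carrier ?Q \<subseteq> submodule_gen R ?Q ?S"
    proof -
      let ?G = "submodule_gen R ?Q ?S"
      have G: "submodule ?G R ?Q" by (rule submodule_gen_submodule[OF mQ Sc])
      let ?W = "{z \<in> carrier N. H +>\<^bsub>N\<^esub> z \<in> ?G}"
      have "submodule ?W R M" by (rule submodule_restrictD(1)[OF M Z submodule_vimage[OF N mQ ch G]])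
      moreover have "S \<subseteq> ?W" using S(2) submodule_gen_incl[of ?S R ?Q] by auto
      moreover have "H \<subseteq> ?W"
      proof
        fix x assume x: "x \<in> H"
        then have "H +>\<^bsub>N\<^esub> x = \<zero>\<^bsub>?Q\<^esub>" using coset_eq_self_iff[OF N HN, of x] HZ by (auto simp: quotient_zero)
        then show "x \<in> ?W" using submodule_zero[OF G] x HZ by auto
      qed
      ultimately have "Z \<subseteq> ?W" by (rule S(3))
      then show ?thesis by (auto simp: quotient_carrier)
    qed
    moreover have "submodule_gen R ?Q ?S \<subseteq> carrier ?Q"
      by (rule submodule_gen_least[OF submodule_carrier[OF mQ] Sc])
    ultimately show "fg_module R ?Q" unfolding fg_module_def using S(1) Sc by blast
  }
qed

end

text \<open>The hypotheses say that \<phi> induces an isomorphism from Z / H onto Z' / H'.\<close>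

lemma fg_mod_hom_iff:
  fixes M' (structure)
  assumes M: "module R M" and M': "module R M'" and \<phi>: "\<phi> \<in> module_hom R M M'"
    and Z: "submodule Z R M" and Z': "submodule Z' R M'" and H': "submodule H' R M'"
    and HM: "H \<subseteq> carrier M"
    and ZZ: "\<And>z. z \<in> Z \<Longrightarrow> \<phi> z \<in> Z'" and surj: "\<And>z'. z' \<in> Z' \<Longrightarrow> \<exists>z\<in>Z. z' \<ominus> \<phi> z \<in> H'"
    and HH: "\<And>z. z \<in> H \<Longrightarrow> \<phi> z \<in> H'" and inj: "\<And>z. z \<in> Z \<Longrightarrow> \<phi> z \<in> H' \<Longrightarrow> z \<in> H"
  shows "fg_mod R M Z H \<longleftrightarrow> fg_mod R M' Z' H'"
proof
  interpret M: module R M by fact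
  interpret M': module R M' by fact
  note Zc = submodule_subset[OF Z] and Zc' = submodule_subset[OF Z'] and Hc' = submodule_subset[OF H']
  note \<phi>c = module_hom_closed[OF \<phi>]
  { assume "fg_mod R M Z H"
    then obtain S where S: "finite S" "S \<subseteq> Z" "\<And>W. submodule W R M \<Longrightarrow> S \<subseteq> W \<Longrightarrow> H \<subseteq> W \<Longrightarrow> Z \<subseteq> W"
      unfolding fg_mod_def by blast
    have "Z' \<subseteq> W" if W: "submodule W R M'" "\<phi> ` S \<subseteq> W" "H' \<subseteq> W" for W
    proof
      fix z' assume z': "z' \<in> Z'"
      have "submodule {x \<in> carrier M. \<phi> x \<in> W} R M" by (rule submodule_vimage[OF M M' \<phi> W(1)])
      moreover have "S \<subseteq> {x \<in> carrier M. \<phi> x \<in> W}" using S(2) Zc W(2) by auto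
      moreover have "H \<subseteq> {x \<in> carrier M. \<phi> x \<in> W}" using HM HH W(3) by auto
      ultimately have ZW: "Z \<subseteq> {x \<in> carrier M. \<phi> x \<in> W}" by (rule S(3))
      obtain z where z: "z \<in> Z" "z' \<ominus> \<phi> z \<in> H'" using surj[OF z'] by blast
      then have "(z' \<ominus> \<phi> z) \<oplus> \<phi> z \<in> W" using ZW W submodule_add[OF W(1)] by blast
      then show "z' \<in> W" using Zc'[OF z'] \<phi>c[OF Zc[OF z(1)]] by (simp add: a_minus_def M'.a_assoc M'.l_neg)
    qed
    then show "fg_mod R M' Z' H'" unfolding fg_mod_def using S(1,2) ZZ by (intro exI[of _ "\<phi> ` S"]) blast
  next
    assume "fg_mod R M' Z' H'"
    then obtain S' where S': "finite S'" "S' \<subseteq> Z'" "\<And>W. submodule W R M' \<Longrightarrow> S' \<subseteq> W \<Longrightarrow> H' \<subseteq> W \<Longrightarrow> Z' \<subseteq> W"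
      unfolding fg_mod_def by blast
    have "\<forall>s\<in>S'. \<exists>z. z \<in> Z \<and> s \<ominus> \<phi> z \<in> H'" using surj S'(2) by blast
    then obtain f where f: "\<And>s. s \<in> S' \<Longrightarrow> f s \<in> Z \<and> s \<ominus> \<phi> (f s) \<in> H'" by metis
    have "Z \<subseteq> W" if W: "submodule W R M" "f ` S' \<subseteq> W" "H \<subseteq> W" for W
    proof
      fix x assume x: "x \<in> Z"
      \<comment> \<open>Everything congruent modulo H' to some \<phi> w with w in both W and
        Z.\<close>
      let ?W = "{y \<in> carrier M'. \<exists>w\<in>W \<inter> Z. y \<ominus> \<phi> w \<in> H'}"
      have WZ: "submodule (W \<inter> Z) R M" by (rule submodule_Int[OF M W(1) Z])
      have "submodule ?W R M'"
      proof (rule submoduleI'[OF M'])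
        show "\<zero> \<in> ?W"
          using submodule_zero[OF WZ] module_hom_zero[OF M M' \<phi>] submodule_zero[OF H']
          by (auto intro!: bexI[of _ "\<zero>\<^bsub>M\<^esub>"] simp: M'.diff_self)
        show "a \<oplus> b \<in> ?W" if ab: "a \<in> ?W" "b \<in> ?W" for a b
        proof -
          obtain u where u: "u \<in> W \<inter> Z" "a \<ominus> \<phi> u \<in> H'" using ab(1) by blast
          obtain v where v: "v \<in> W \<inter> Z" "b \<ominus> \<phi> v \<in> H'" using ab(2) by blast
          have c: "a \<in> carrier M'" "b \<in> carrier M'" "u \<in> carrier M" "v \<in> carrier M" using ab u v Zc by auto
          have "(a \<oplus> b) \<ominus> \<phi> (u \<oplus>\<^bsub>M\<^esub> v) = (a \<ominus> \<phi> u) \<oplus> (b \<ominus> \<phi> v)"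
            using c \<phi>c by (simp add: module_hom_add[OF \<phi>] a_minus_def M'.minus_add M'.a_ac)
          then have "(a \<oplus> b) \<ominus> \<phi> (u \<oplus>\<^bsub>M\<^esub> v) \<in> H'" using submodule_add[OF H' u(2) v(2)] by simp
          then show ?thesis using c by (intro CollectI conjI bexI[OF _ submodule_add[OF WZ u(1) v(1)]]) simp_all
        qed
        show "r \<odot> a \<in> ?W" if r: "r \<in> carrier R" and a: "a \<in> ?W" for r a
        proof -
          obtain u where u: "u \<in> W \<inter> Z" "a \<ominus> \<phi> u \<in> H'" using a by blast
          have c: "a \<in> carrier M'" "u \<in> carrier M" using a u Zc by auto
          have "(r \<odot> a) \<ominus> \<phi> (r \<odot>\<^bsub>M\<^esub> u) = r \<odot> (a \<ominus> \<phi> u)"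
            using c \<phi>c r by (simp add: module_hom_smult[OF \<phi>] a_minus_def M'.smult_r_distr M'.smult_r_minus)
          then have "(r \<odot> a) \<ominus> \<phi> (r \<odot>\<^bsub>M\<^esub> u) \<in> H'" using submodule_smult[OF H' r u(2)] by simp
          then show ?thesis using c r by (intro CollectI conjI bexI[OF _ submodule_smult[OF WZ r u(1)]]) simp_all
        qed
      qed auto
      moreover have "S' \<subseteq> ?W" using S'(2) Zc' f W(2) by blast
      moreover have "H' \<subseteq> ?W"
        using Hc' submodule_zero[OF WZ] module_hom_zero[OF M M' \<phi>]
        by (auto intro!: bexI[of _ "\<zero>\<^bsub>M\<^esub>"] simp: M'.diff_zero)
      ultimately have "Z' \<subseteq> ?W" by (rule S'(3))
      then obtain w where w: "w \<in> W" "w \<in> Z" "\<phi> x \<ominus> \<phi> w \<in> H'" using ZZ[OF x] by blast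
      then have "\<phi> (x \<ominus>\<^bsub>M\<^esub> w) \<in> H'" using x Zc by (simp add: module_hom_diff[OF M M' \<phi>])
      then have "x \<ominus>\<^bsub>M\<^esub> w \<in> W" using inj submodule_diff[OF Z x w(2)] W(3) by blast
      then have "(x \<ominus>\<^bsub>M\<^esub> w) \<oplus>\<^bsub>M\<^esub> w \<in> W" using submodule_add[OF W(1)] w(1) by simp
      then show "x \<in> W" using Zc[OF x] Zc[OF w(2)] by (simp add: a_minus_def M.a_assoc M.l_neg)
    qed
    then show "fg_mod R M Z H" unfolding fg_mod_def using S'(1) f by (intro exI[of _ "f ` S'"]) blast
  }
qed

text \<open>Induction on the number of generators; the coefficients of the last generator form an ideal.\<close>

lemma noetherian_submodule_fg:
  fixes M (structure)
  assumes N: "noetherian_ring R" and M: "module R M" and H: "submodule H R M"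
    and S: "finite S" "S \<subseteq> carrier M" and Y: "submodule Y R M" "H \<subseteq> Y" "Y \<subseteq> submodule_gen R M (S \<union> H)"
  shows "\<exists>U. finite U \<and> U \<subseteq> Y \<and> Y \<subseteq> submodule_gen R M (U \<union> H)"
  using S Y
proof (induction S arbitrary: Y rule: finite_induct)
  case empty then show ?case by (intro exI[of _ "{}"]) auto
next
  case (insert s S)
  interpret M: module R M by fact
  interpret N: noetherian_ring R by fact
  note Hc = submodule_subset[OF H]
  let ?G = "\<lambda>S. submodule_gen R M (S \<union> H)"
  have G: "submodule (?G S) R M" if "S \<subseteq> carrier M" for S
    by (rule submodule_gen_submodule[OF M]) (use that Hc in auto)
  have s: "s \<in> carrier M" and S: "S \<subseteq> carrier M" using insert.prems(1) by auto
  note GS = G[OF S]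
  note GSc = submodule_subset[OF GS]
  have Gin: "\<exists>a\<in>?G S. \<exists>r\<in>carrier R. y = a \<oplus> r \<odot> s" if y: "y \<in> ?G (insert s S)" for y
  proof -
    let ?W = "{y \<in> carrier M. \<exists>a\<in>?G S. \<exists>r\<in>carrier R. y = a \<oplus> r \<odot> s}"
    have "submodule ?W R M"
    proof (rule submoduleI'[OF M])
      show "\<zero> \<in> ?W" using submodule_zero[OF GS] s
        by (auto intro!: bexI[of _ "\<zero>"] bexI[of _ "\<zero>\<^bsub>R\<^esub>"])
      show "x \<oplus> y \<in> ?W" if xy: "x \<in> ?W" "y \<in> ?W" for x y
      proof -
        obtain a r where a: "a \<in> ?G S" "r \<in> carrier R" "x = a \<oplus> r \<odot> s" using xy(1) by blast
        obtain b q where b: "b \<in> ?G S" "q \<in> carrier R" "y = b \<oplus> q \<odot> s" using xy(2) by blast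
        have "x \<oplus> y = (a \<oplus> b) \<oplus> (r \<oplus>\<^bsub>R\<^esub> q) \<odot> s"
          using a b s GSc by (simp add: M.smult_l_distr M.a_ac)
        moreover have "x \<oplus> y \<in> carrier M" using xy by auto
        ultimately show ?thesis
          by (intro CollectI conjI bexI[OF bexI[OF _ M.R.a_closed[OF a(2) b(2)]] submodule_add[OF GS a(1) b(1)]])
      qed
      show "c \<odot> x \<in> ?W" if c: "c \<in> carrier R" and x: "x \<in> ?W" for c x
      proof -
        obtain a r where a: "a \<in> ?G S" "r \<in> carrier R" "x = a \<oplus> r \<odot> s" using x by blast
        have "c \<odot> x = c \<odot> a \<oplus> (c \<otimes>\<^bsub>R\<^esub> r) \<odot> s"
          using a c s GSc by (simp add: M.smult_r_distr M.smult_assoc1)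
        moreover have "c \<odot> x \<in> carrier M" using c x by auto
        ultimately show ?thesis
          by (intro CollectI conjI bexI[OF bexI[OF _ M.R.m_closed[OF c a(2)]] submodule_smult[OF GS c a(1)]])
      qed
    qed auto
    moreover have "insert s S \<union> H \<subseteq> ?W"
    proof -
      have "x \<in> ?W" if "x \<in> S \<union> H" for x
      proof -
        have x: "x \<in> ?G S" by (rule subsetD[OF submodule_gen_incl that])
        have "x = x \<oplus> \<zero>\<^bsub>R\<^esub> \<odot> s" using GSc[OF x] s by simp
        then show ?thesis using GSc[OF x] by (intro CollectI conjI bexI[OF bexI[OF _ M.R.zero_closed] x])
      qed
      moreover have "s = \<zero> \<oplus> \<one>\<^bsub>R\<^esub> \<odot> s" using s by simp
      then have "s \<in> ?W"
        by (intro CollectI conjI s bexI[OF bexI[OF _ M.R.one_closed] submodule_zero[OF GS]])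
      ultimately show ?thesis unfolding Un_insert_left insert_subset by (intro conjI subsetI)
    qed
    ultimately have "?G (insert s S) \<subseteq> ?W" by (rule submodule_gen_least)
    then show ?thesis using y by blast
  qed
  \<comment> \<open>The coefficients at s that occur in elements of Y, modulo the span of S and
    H.\<close>
  define J where "J Y = {r \<in> carrier R. \<exists>a\<in>?G S. a \<oplus> r \<odot> s \<in> Y}" for Y
  have J: "ideal (J Y) R" if Y: "submodule Y R M" for Y
  proof (rule cring_idealI[OF module_cring[OF M]])
    show "\<zero>\<^bsub>R\<^esub> \<in> J Y"
      using s submodule_zero[OF GS] submodule_zero[OF Y] by (auto simp: J_def intro!: bexI[of _ "\<zero>"])
    show "r \<oplus>\<^bsub>R\<^esub> q \<in> J Y" if rq: "r \<in> J Y" "q \<in> J Y" for r q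
    proof -
      obtain a where a: "a \<in> ?G S" "r \<in> carrier R" "a \<oplus> r \<odot> s \<in> Y" using rq(1) by (auto simp: J_def)
      obtain b where b: "b \<in> ?G S" "q \<in> carrier R" "b \<oplus> q \<odot> s \<in> Y" using rq(2) by (auto simp: J_def)
      have "(a \<oplus> r \<odot> s) \<oplus> (b \<oplus> q \<odot> s) = (a \<oplus> b) \<oplus> (r \<oplus>\<^bsub>R\<^esub> q) \<odot> s"
        using a b s GSc by (simp add: M.smult_l_distr M.a_ac)
      then have "(a \<oplus> b) \<oplus> (r \<oplus>\<^bsub>R\<^esub> q) \<odot> s \<in> Y" using submodule_add[OF Y a(3) b(3)] by simp
      then show ?thesis using submodule_add[OF GS a(1) b(1)] a(2) b(2) unfolding J_def by blast
    qed
    show "c \<otimes>\<^bsub>R\<^esub> r \<in> J Y" if c: "c \<in> carrier R" and r: "r \<in> J Y" for c r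
    proof -
      obtain a where a: "a \<in> ?G S" "r \<in> carrier R" "a \<oplus> r \<odot> s \<in> Y" using r by (auto simp: J_def)
      have "c \<odot> (a \<oplus> r \<odot> s) = c \<odot> a \<oplus> (c \<otimes>\<^bsub>R\<^esub> r) \<odot> s"
        using a c s GSc by (simp add: M.smult_r_distr M.smult_assoc1)
      then have "c \<odot> a \<oplus> (c \<otimes>\<^bsub>R\<^esub> r) \<odot> s \<in> Y" using submodule_smult[OF Y c a(3)] by simp
      then show ?thesis using submodule_smult[OF GS c a(1)] a(2) c unfolding J_def by blast
    qed
  qed (auto simp: J_def)
  note Y = insert.prems(2) and HY = insert.prems(3)
  note Yc = submodule_subset[OF Y]
  obtain A where A: "A \<subseteq> carrier R" "finite A" "J Y = Idl\<^bsub>R\<^esub> A" using N.finetely_gen[OF J[OF Y]] by blast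
  have "A \<subseteq> J Y" using M.R.genideal_self[OF A(1)] A(3) by simp
  then have "\<forall>r\<in>A. \<exists>a. a \<in> ?G S \<and> a \<oplus> r \<odot> s \<in> Y" unfolding J_def by blast
  then obtain f where f: "\<And>r. r \<in> A \<Longrightarrow> f r \<in> ?G S \<and> f r \<oplus> r \<odot> s \<in> Y" by metis
  have "\<exists>U. finite U \<and> U \<subseteq> Y \<inter> ?G S \<and> Y \<inter> ?G S \<subseteq> ?G U"
  proof (rule insert.IH[OF S submodule_Int[OF M Y GS]])
    show "H \<subseteq> Y \<inter> ?G S" using HY submodule_gen_incl[of "S \<union> H" R M] by auto
  qed simp
  then obtain U0 where U0: "finite U0" "U0 \<subseteq> Y \<inter> ?G S" "Y \<inter> ?G S \<subseteq> ?G U0" by blast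
  \<comment> \<open>Generators of the part of Y inside the span of S and H, and for each generator
    of the coefficient ideal one element of Y having it as coefficient.\<close>
  define U where "U = U0 \<union> (\<lambda>r. f r \<oplus> r \<odot> s) ` A"
  have U: "finite U" "U \<subseteq> Y" using U0 A(2) f by (auto simp: U_def)
  have Uc: "U \<subseteq> carrier M" using U(2) Yc by blast
  note GU = G[OF Uc]
  have GUY: "?G U \<subseteq> Y" by (rule submodule_gen_least[OF Y]) (use U(2) HY in blast)
  have UG: "U \<subseteq> ?G U" by (rule subset_trans[OF Un_upper1 submodule_gen_incl])
  have "A \<subseteq> J (?G U)"
  proof
    fix r assume r: "r \<in> A"
    then have "f r \<oplus> r \<odot> s \<in> ?G U" using UG by (auto simp: U_def)
    then show "r \<in> J (?G U)" unfolding J_def using f[OF r] r A(1) by blast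
  qed
  then have JJ: "J Y \<subseteq> J (?G U)" unfolding A(3) by (rule M.R.genideal_minimal[OF J[OF GU]])
  have "?G U0 \<subseteq> ?G U"
    by (rule submodule_gen_least[OF GU]) (use submodule_gen_incl[of "U \<union> H" R M] in \<open>auto simp: U_def\<close>)
  then have U0U: "Y \<inter> ?G S \<subseteq> ?G U" using U0(3) by blast
  have "Y \<subseteq> ?G U"
  proof
    fix y assume y: "y \<in> Y"
    then obtain a r where a: "a \<in> ?G S" "r \<in> carrier R" "y = a \<oplus> r \<odot> s"
      using Gin insert.prems(4) by blast
    then have "r \<in> J Y" using y by (auto simp: J_def)
    then obtain b where b: "b \<in> ?G S" "b \<oplus> r \<odot> s \<in> ?G U" using JJ by (auto simp: J_def)
    have c: "a \<in> carrier M" "b \<in> carrier M" "r \<odot> s \<in> carrier M" using a b s GSc by auto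
    \<comment> \<open>Subtracting an element of the span of U with the same coefficient at s leaves
      an element of Y in the span of S and H.\<close>
    have ab: "a \<ominus> b = y \<ominus> (b \<oplus> r \<odot> s)"
      unfolding a(3) using c by (simp add: a_minus_def M.minus_add M.a_ac M.r_neg M.r_neg1 M.r_neg2)
    have "a \<ominus> b \<in> Y" unfolding ab using submodule_diff[OF Y y] b(2) GUY by blast
    then have "a \<ominus> b \<in> ?G U" using submodule_diff[OF GS a(1) b(1)] U0U by blast
    then have "(a \<ominus> b) \<oplus> (b \<oplus> r \<odot> s) \<in> ?G U" using submodule_add[OF GU] b(2) by simp
    moreover have "(a \<ominus> b) \<oplus> (b \<oplus> r \<odot> s) = y"
      unfolding a(3) using c by (simp add: a_minus_def M.a_assoc M.r_neg1)
    ultimately show "y \<in> ?G U" by simp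
  qed
  then show ?case using U by blast
qed

text \<open>The finite generating set can be taken from X0 itself: the span of X0 is finitely
  generated by noetherianity, and each generator involves only finitely many elements of X0. Applied
  to tensors with one factor fixed, this keeps their shape.\<close>

lemma noetherian_fg_subset:
  assumes N: "noetherian_ring R" and M: "module R M" and Z: "submodule Z R M" and H: "submodule H R M"
    and fg: "fg_mod R M Z H" and X0: "X0 \<subseteq> Z" and HZ: "H \<subseteq> Z"
  shows "\<exists>U. finite U \<and> U \<subseteq> X0 \<and> X0 \<subseteq> submodule_gen R M (U \<union> H)"
proof -
  interpret M: module R M by fact
  note Zc = submodule_subset[OF Z] and Hc = submodule_subset[OF H]
  let ?G = "\<lambda>S. submodule_gen R M (S \<union> H)"
  have G: "submodule (?G S) R M" if "S \<subseteq> carrier M" for S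
    by (rule submodule_gen_submodule[OF M]) (use that Hc in auto)
  obtain S where S: "finite S" "S \<subseteq> Z" "\<And>W. submodule W R M \<Longrightarrow> S \<subseteq> W \<Longrightarrow> H \<subseteq> W \<Longrightarrow> Z \<subseteq> W"
    using fg unfolding fg_mod_def by blast
  have Sc: "S \<subseteq> carrier M" using S(2) Zc by blast
  have ZG: "Z \<subseteq> ?G S" using S(3)[OF G[OF Sc]] submodule_gen_incl[of "S \<union> H" R M] by blast
  have X0c: "X0 \<subseteq> carrier M" using X0 Zc by blast
  have "\<exists>U. finite U \<and> U \<subseteq> ?G X0 \<and> ?G X0 \<subseteq> ?G U"
  proof (rule noetherian_submodule_fg[OF N M H S(1) Sc G[OF X0c]])
    show "H \<subseteq> ?G X0" using submodule_gen_incl[of "X0 \<union> H" R M] by blast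
    have "?G X0 \<subseteq> Z" by (rule submodule_gen_least[OF Z]) (use X0 HZ in blast)
    then show "?G X0 \<subseteq> ?G S" using ZG by blast
  qed
  then obtain U where U: "finite U" "U \<subseteq> ?G X0" "?G X0 \<subseteq> ?G U" by blast
  have Gmono: "?G F \<subseteq> ?G F'" if "F \<subseteq> F'" "F' \<subseteq> carrier M" for F F'
    by (rule submodule_gen_least[OF G[OF that(2)]]) (use submodule_gen_incl[of "F' \<union> H" R M] that in auto)
  let ?W = "{y \<in> carrier M. \<exists>F. finite F \<and> F \<subseteq> X0 \<and> y \<in> ?G F}"
  have "submodule ?W R M"
  proof (rule submoduleI'[OF M])
    show "\<zero>\<^bsub>M\<^esub> \<in> ?W" using submodule_zero[OF G[of "{}"]] by (auto intro!: exI[of _ "{}"])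
    show "x \<oplus>\<^bsub>M\<^esub> y \<in> ?W" if xy: "x \<in> ?W" "y \<in> ?W" for x y
    proof -
      obtain F where F: "finite F" "F \<subseteq> X0" "x \<in> ?G F" using xy(1) by blast
      obtain F' where F': "finite F'" "F' \<subseteq> X0" "y \<in> ?G F'" using xy(2) by blast
      have c: "F \<union> F' \<subseteq> carrier M" using F F' X0c by blast
      have "x \<in> ?G (F \<union> F')" "y \<in> ?G (F \<union> F')" using Gmono[OF _ c] F(3) F'(3) by blast+
      then have "x \<oplus>\<^bsub>M\<^esub> y \<in> ?G (F \<union> F')" by (rule submodule_add[OF G[OF c]])
      moreover have "finite (F \<union> F')" "F \<union> F' \<subseteq> X0" using F F' by auto
      ultimately show ?thesis using xy by blast
    qed
    show "r \<odot>\<^bsub>M\<^esub> x \<in> ?W" if r: "r \<in> carrier R" and x: "x \<in> ?W" for r x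
    proof -
      obtain F where F: "finite F" "F \<subseteq> X0" "x \<in> ?G F" using x by blast
      then have "r \<odot>\<^bsub>M\<^esub> x \<in> ?G F" using submodule_smult[OF G r] X0c by blast
      then show ?thesis using F x r by blast
    qed
  qed auto
  moreover have "X0 \<union> H \<subseteq> ?W"
  proof
    fix x assume x: "x \<in> X0 \<union> H"
    show "x \<in> ?W"
    proof (cases "x \<in> X0")
      case True
      have "x \<in> ?G {x}" using submodule_gen_incl[of "{x} \<union> H" R M] by blast
      then show ?thesis using True X0c by (intro CollectI conjI exI[of _ "{x}"]) auto
    next
      case False
      then have "x \<in> ?G {}" using x submodule_gen_incl[of "{} \<union> H" R M] by blast
      then show ?thesis using False x Hc by (intro CollectI conjI exI[of _ "{}"]) auto
    qed
  qed
  ultimately have GW: "?G X0 \<subseteq> ?W" by (rule submodule_gen_least)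
  have "\<forall>u\<in>U. \<exists>F. finite F \<and> F \<subseteq> X0 \<and> u \<in> ?G F" using U(2) GW by blast
  then obtain F where F: "\<And>u. u \<in> U \<Longrightarrow> finite (F u) \<and> F u \<subseteq> X0 \<and> u \<in> ?G (F u)" by metis
  define V where "V = \<Union> (F ` U)"
  have V: "finite V" "V \<subseteq> X0" using F U(1) by (auto simp: V_def)
  have Vc: "V \<subseteq> carrier M" using V X0c by blast
  have "U \<subseteq> ?G V"
  proof
    fix u assume u: "u \<in> U"
    then have "F u \<subseteq> V" by (auto simp: V_def)
    then show "u \<in> ?G V" using F[OF u] Gmono[OF _ Vc] by blast
  qed
  then have "?G U \<subseteq> ?G V"
    by (intro submodule_gen_least[OF G[OF Vc]]) (use submodule_gen_incl[of "V \<union> H" R M] in auto)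
  then have "X0 \<subseteq> ?G V" using U(3) submodule_gen_incl[of "X0 \<union> H" R M] by blast
  then show ?thesis using V by blast
qed

section \<open>Cohomology of the torsion part of the total complex\<close>

text \<open>The line spanned by the class c' of c in V / B is a copy of K, and a partial inverse of
  k \<mapsto> k c' is the required functional. Its value at c' is 1 because a nonzero scalar cannot
  kill a nonzero vector.\<close>

lemma regular_field_functional:
  assumes K: "field K" and V: "module K V" and B: "submodule B K V" and c: "c \<in> carrier V" "c \<notin> B"
  shows "\<exists>\<mu>\<in>module_hom K V (regular_module K). (\<forall>b\<in>B. \<mu> b = \<zero>\<^bsub>K\<^esub>) \<and> \<mu> c = \<one>\<^bsub>K\<^esub>"
proof -
  interpret K: field K by fact
  let ?K = "regular_module K"
  let ?Q = "quotient_module V B"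
  have mK: "module K ?K" by (rule regular_is_module[OF K.is_cring])
  note mQ = quotient_is_module[OF V B]
  interpret Q: module K ?Q by (rule mQ)
  note ch = coset_hom[OF V B]
  define c' where "c' = B +>\<^bsub>V\<^esub> c"
  have c': "c' \<in> carrier ?Q" using module_hom_closed[OF ch c(1)] by (simp add: c'_def)
  have c'0: "c' \<noteq> \<zero>\<^bsub>?Q\<^esub>" using coset_eq_self_iff[OF V B c(1)] c(2) by (simp add: c'_def quotient_zero)
  have g: "(\<lambda>k. k \<odot>\<^bsub>?Q\<^esub> c') \<in> module_hom K ?K ?Q"
    by (rule module_homI) (use c' in \<open>auto simp: Q.smult_l_distr Q.smult_assoc1\<close>)
  obtain s where s: "s \<in> module_hom K ?Q ?K"
    "\<And>k. k \<in> carrier K \<Longrightarrow> s (k \<odot>\<^bsub>?Q\<^esub> c') \<odot>\<^bsub>?Q\<^esub> c' = k \<odot>\<^bsub>?Q\<^esub> c'"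
    using linear_section[OF K mK mQ submodule_carrier[OF mK] g] by auto
  have "s c' \<in> carrier K" using module_hom_closed[OF s(1) c'] by simp
  moreover have "s c' \<odot>\<^bsub>?Q\<^esub> c' = c'" using s(2)[OF K.one_closed] c' by simp
  ultimately have sc: "s c' = \<one>\<^bsub>K\<^esub>"
  proof -
    assume sK: "s c' \<in> carrier K" and e: "s c' \<odot>\<^bsub>?Q\<^esub> c' = c'"
    let ?u = "s c' \<ominus>\<^bsub>K\<^esub> \<one>\<^bsub>K\<^esub>"
    have uK: "?u \<in> carrier K" using sK by simp
    have "?u \<odot>\<^bsub>?Q\<^esub> c' = s c' \<odot>\<^bsub>?Q\<^esub> c' \<ominus>\<^bsub>?Q\<^esub> c'"
      using sK c' by (simp add: a_minus_def Q.smult_l_distr Q.smult_l_minus)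
    then have u0: "?u \<odot>\<^bsub>?Q\<^esub> c' = \<zero>\<^bsub>?Q\<^esub>" unfolding e using c' by (simp add: Q.diff_self)
    have "?u = \<zero>\<^bsub>K\<^esub>"
    proof (rule ccontr)
      assume "?u \<noteq> \<zero>\<^bsub>K\<^esub>"
      then have u: "?u \<in> Units K" using uK K.field_Units by auto
      have "c' = (inv\<^bsub>K\<^esub> ?u \<otimes>\<^bsub>K\<^esub> ?u) \<odot>\<^bsub>?Q\<^esub> c'" using u c' by simp
      also have "\<dots> = inv\<^bsub>K\<^esub> ?u \<odot>\<^bsub>?Q\<^esub> (?u \<odot>\<^bsub>?Q\<^esub> c')" using u uK c' by (intro Q.smult_assoc1) auto
      also have "\<dots> = \<zero>\<^bsub>?Q\<^esub>" unfolding u0 using u Q.smult_r_null by simp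
      finally show False using c'0 by simp
    qed
    then show ?thesis by (rule K.diff_zero_imp_eq[OF sK K.one_closed])
  qed
  have "(\<lambda>v. s (B +>\<^bsub>V\<^esub> v)) \<in> module_hom K V ?K" by (rule module_hom_comp[OF ch s(1)])
  moreover have "s (B +>\<^bsub>V\<^esub> b) = \<zero>\<^bsub>K\<^esub>" if "b \<in> B" for b
    using coset_eq_self_iff[OF V B submodule_subset[OF B that]] that module_hom_zero[OF mQ mK s(1)]
    by (simp add: quotient_zero)
  ultimately show ?thesis using sc unfolding c'_def by (intro bexI[of _ "\<lambda>v. s (B +>\<^bsub>V\<^esub> v)"]) auto
qed

text \<open>Contraction of one tensor factor by a linear functional, for either side.\<close>

lemma tensor_functional:
  assumes K: "cring K" and M: "module K M" and N: "module K N" and V: "module K V"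
    and \<Lambda>: "\<Lambda> \<in> module_hom K M (regular_module K)" and g: "g \<in> module_hom K N V"
  shows "\<exists>G\<in>module_hom K (tensor_product K M N) V.
      \<forall>m\<in>carrier M. \<forall>n\<in>carrier N. G (pure_tensor K M N m n) = \<Lambda> m \<odot>\<^bsub>V\<^esub> g n"
    and "\<exists>G\<in>module_hom K (tensor_product K N M) V.
      \<forall>n\<in>carrier N. \<forall>m\<in>carrier M. G (pure_tensor K N M n m) = \<Lambda> m \<odot>\<^bsub>V\<^esub> g n"
proof -
  interpret V: module K V by (rule V)
  interpret K: cring K by (rule K)
  have \<Lambda>K: "\<Lambda> m \<in> carrier K" if "m \<in> carrier M" for m using module_hom_closed[OF \<Lambda> that] by simp
  note gc = module_hom_closed[OF g]
  have swap: "a \<odot>\<^bsub>V\<^esub> (c \<odot>\<^bsub>V\<^esub> v) = c \<odot>\<^bsub>V\<^esub> (a \<odot>\<^bsub>V\<^esub> v)"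
    if "a \<in> carrier K" "c \<in> carrier K" "v \<in> carrier V" for a c v
    using that by (simp add: V.smult_assoc1[symmetric] V.R.m_comm)
  have 1: "(\<lambda>m. \<Lambda> m \<odot>\<^bsub>V\<^esub> g n) \<in> module_hom K M V" if "n \<in> carrier N" for n
    by (rule module_homI)
      (use \<Lambda>K gc[OF that] in \<open>simp_all add: module_hom_add[OF \<Lambda>] module_hom_smult[OF \<Lambda>] V.smult_l_distr V.smult_assoc1\<close>)
  have 2: "(\<lambda>n. \<Lambda> m \<odot>\<^bsub>V\<^esub> g n) \<in> module_hom K N V" if "m \<in> carrier M" for m
  proof (rule module_homI)
    show "\<Lambda> m \<odot>\<^bsub>V\<^esub> g (c \<odot>\<^bsub>N\<^esub> n) = c \<odot>\<^bsub>V\<^esub> (\<Lambda> m \<odot>\<^bsub>V\<^esub> g n)" if c: "c \<in> carrier K" and n: "n \<in> carrier N" for c n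
      using swap[OF \<Lambda>K[OF \<open>m \<in> carrier M\<close>] c gc[OF n]] module_hom_smult[OF g c n] by simp
  qed (use \<Lambda>K[OF that] gc module_hom_add[OF g] in \<open>simp_all add: V.smult_r_distr\<close>)
  show "\<exists>G\<in>module_hom K (tensor_product K M N) V.
      \<forall>m\<in>carrier M. \<forall>n\<in>carrier N. G (pure_tensor K M N m n) = \<Lambda> m \<odot>\<^bsub>V\<^esub> g n"
    by (rule tensor_lift[OF K M N V]) (rule bilinI; use 1 2 in blast)
  show "\<exists>G\<in>module_hom K (tensor_product K N M) V.
      \<forall>n\<in>carrier N. \<forall>m\<in>carrier M. G (pure_tensor K N M n m) = \<Lambda> m \<odot>\<^bsub>V\<^esub> g n"
    by (rule tensor_lift[OF K N M V]) (rule bilinI; use 1 2 in blast)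
qed

text \<open>Brings finite generation from Z over R down to Z' over S along a map G that is additive
  but in general not R-linear. In place of linearity, G (r \<iota> v) is always a multiple of v.
  Finitely many of the \<iota> v generate all of them modulo H, and the corresponding v generate Z'
  modulo H'.\<close>

lemma fg_mod_retract:
  fixes M (structure)
  assumes N: "noetherian_ring R" and M: "module R M" and Z: "submodule Z R M" and H: "submodule H R M"
    and HZ: "H \<subseteq> Z" and fg: "fg_mod R M Z H"
    and Y: "module S Y" and G: "\<And>x y. x \<in> carrier M \<Longrightarrow> y \<in> carrier M \<Longrightarrow> G (x \<oplus> y) = G x \<oplus>\<^bsub>Y\<^esub> G y"
    and G0: "G \<zero> = \<zero>\<^bsub>Y\<^esub>" and GH: "\<And>t. t \<in> H \<Longrightarrow> G t \<in> H'"
    and \<iota>: "\<And>v. v \<in> Z' \<Longrightarrow> \<iota> v \<in> Z" "\<And>v. v \<in> Z' \<Longrightarrow> G (\<iota> v) = v"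
    and P: "P \<subseteq> carrier R" "carrier R \<subseteq> asum R P" and Zc: "Z' \<subseteq> carrier Y"
    and p: "\<And>r v. r \<in> P \<Longrightarrow> v \<in> Z' \<Longrightarrow> \<exists>b\<in>carrier S. G (r \<odot> \<iota> v) = b \<odot>\<^bsub>Y\<^esub> v"
  shows "fg_mod S Y Z' H'"
proof -
  interpret M: module R M by (rule M)
  interpret Y: module S Y by (rule Y)
  have r: "\<exists>b\<in>carrier S. G (r \<odot> \<iota> v) = b \<odot>\<^bsub>Y\<^esub> v" if r: "r \<in> carrier R" and v: "v \<in> Z'" for r v
  proof -
    note c = submodule_subset[OF Z \<iota>(1)[OF v]] subsetD[OF Zc v]
    have "r \<in> asum R P" using r P(2) by blast
    then show ?thesis
    proof induction
      case zero
      have "G (\<zero>\<^bsub>R\<^esub> \<odot> \<iota> v) = \<zero>\<^bsub>S\<^esub> \<odot>\<^bsub>Y\<^esub> v" using c G0 by simp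
      then show ?case by (rule bexI) simp
    next
      case (add s r)
      obtain b where b: "b \<in> carrier S" "G (s \<odot> \<iota> v) = b \<odot>\<^bsub>Y\<^esub> v" using p[OF add.hyps(1) v] by blast
      obtain b' where b': "b' \<in> carrier S" "G (r \<odot> \<iota> v) = b' \<odot>\<^bsub>Y\<^esub> v" using add.IH by blast
      have rs: "r \<in> carrier R" "s \<in> carrier R"
        using add.hyps asum_carrier[OF M.R.abelian_group_axioms P(1)] P(1) by blast+
      have "G ((s \<oplus>\<^bsub>R\<^esub> r) \<odot> \<iota> v) = (b \<oplus>\<^bsub>S\<^esub> b') \<odot>\<^bsub>Y\<^esub> v"
        using rs c b b' by (simp add: M.smult_l_distr Y.smult_l_distr G)
      then show ?case by (rule bexI) (simp add: b b')
    qed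
  qed
  have X0: "\<iota> ` Z' \<subseteq> Z" using \<iota> by blast
  obtain U where U: "finite U" "U \<subseteq> \<iota> ` Z'" "\<iota> ` Z' \<subseteq> submodule_gen R M (U \<union> H)"
    using noetherian_fg_subset[OF N M Z H fg X0 HZ] by blast
  obtain V where V: "V \<subseteq> Z'" "finite V" "U = \<iota> ` V" using finite_subset_image[OF U(1,2)] by blast
  have "Z' \<subseteq> W" if W: "submodule W S Y" "V \<subseteq> W" "H' \<subseteq> W" for W
  proof
    fix v assume v: "v \<in> Z'"
    \<comment> \<open>The largest R-submodule on which G takes values in W; the preimage of W under
      G need not be one.\<close>
    let ?P = "{t \<in> carrier M. \<forall>r\<in>carrier R. G (r \<odot> t) \<in> W}"
    have "submodule ?P R M"
    proof (rule submoduleI'[OF M])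
      show "\<zero> \<in> ?P" using M.smult_r_null G0 submodule_zero[OF W(1)] by simp
      show "x \<oplus> y \<in> ?P" if "x \<in> ?P" "y \<in> ?P" for x y
        using that submodule_add[OF W(1)] by (simp add: M.smult_r_distr G)
      show "s \<odot> x \<in> ?P" if "s \<in> carrier R" "x \<in> ?P" for s x
        using that by (simp add: M.smult_assoc1[symmetric])
    qed simp
    moreover have "U \<union> H \<subseteq> ?P"
    proof (rule Un_least)
      show "U \<subseteq> ?P"
      proof
        fix t assume "t \<in> U"
        then obtain w where w: "w \<in> V" "t = \<iota> w" using V(3) by blast
        have wZ: "w \<in> Z'" using w V(1) by blast
        have "G (r \<odot> t) \<in> W" if rr: "r \<in> carrier R" for r
        proof -
          obtain b where "b \<in> carrier S" "G (r \<odot> t) = b \<odot>\<^bsub>Y\<^esub> w" using r[OF rr wZ] w(2) by blast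
          then show ?thesis using submodule_smult[OF W(1)] w(1) W(2) by auto
        qed
        then show "t \<in> ?P" using submodule_subset[OF Z \<iota>(1)[OF wZ]] w(2) by simp
      qed
      show "H \<subseteq> ?P"
      proof
        fix t assume t: "t \<in> H"
        show "t \<in> ?P" using submodule_subset[OF H t] GH[OF submodule_smult[OF H _ t]] W(3) by blast
      qed
    qed
    ultimately have "submodule_gen R M (U \<union> H) \<subseteq> ?P" by (rule submodule_gen_least)
    then have "\<iota> v \<in> ?P" using U(3) v by blast
    then have "G (\<one>\<^bsub>R\<^esub> \<odot> \<iota> v) \<in> W" by blast
    then show "v \<in> W" using \<iota>(2)[OF v] submodule_subset[OF Z \<iota>(1)[OF v]] by simp
  qed
  then show ?thesis unfolding fg_mod_def using V(1,2) by blast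
qed

text \<open>One choice of finite sets for all degrees at once; the generating property is claimed
  only in the degrees where finite generation holds.\<close>

lemma fg_mod_generators:
  "\<exists>U. \<forall>p::nat. finite (U p) \<and> U p \<subseteq> Z p \<and> (fg_mod R (M p) (Z p) (H p) \<longrightarrow>
      (\<forall>W. submodule W R (M p) \<longrightarrow> U p \<subseteq> W \<longrightarrow> H p \<subseteq> W \<longrightarrow> Z p \<subseteq> W))"
proof (rule choice, rule allI)
  fix p
  show "\<exists>S. finite S \<and> S \<subseteq> Z p \<and> (fg_mod R (M p) (Z p) (H p) \<longrightarrow>
      (\<forall>W. submodule W R (M p) \<longrightarrow> S \<subseteq> W \<longrightarrow> H p \<subseteq> W \<longrightarrow> Z p \<subseteq> W))"
  proof (cases "fg_mod R (M p) (Z p) (H p)")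
    case True
    then obtain S where S: "finite S \<and> S \<subseteq> Z p \<and> (\<forall>W. submodule W R (M p) \<longrightarrow> S \<subseteq> W \<longrightarrow> H p \<subseteq> W \<longrightarrow> Z p \<subseteq> W)"
      unfolding fg_mod_def by (rule exE)
    show ?thesis by (rule exI[of _ S], intro conjI impI S[THEN conjunct1] S[THEN conjunct2, THEN conjunct1] S[THEN conjunct2, THEN conjunct2])
  next
    case False then show ?thesis by (intro exI[of _ "{}"]) simp
  qed
qed

lemma torsion_cycles:
  assumes C: "\<And>p. module A (C p)" and d: "\<And>p. d p \<in> module_hom A (C p) (C (Suc p))"
    and dd: "\<And>p x. x \<in> carrier (C p) \<Longrightarrow> d (Suc p) (d p x) = \<zero>\<^bsub>C (Suc (Suc p))\<^esub>" and xs: "set xs \<subseteq> carrier A"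
  shows "submodule {x \<in> tors A (C p) xs (carrier (C p)). d p x = \<zero>\<^bsub>C (Suc p)\<^esub>} A (C p)"
    and "submodule (bdry A C d xs p) A (C p)"
    and "bdry A C d xs p \<subseteq> {x \<in> tors A (C p) xs (carrier (C p)). d p x = \<zero>\<^bsub>C (Suc p)\<^esub>}"
proof -
  have G: "submodule (tors A (C p) xs (carrier (C p))) A (C p)" for p
    by (rule tors_submodule[OF C submodule_carrier[OF C] xs])
  have "{x \<in> tors A (C p) xs (carrier (C p)). d p x = \<zero>\<^bsub>C (Suc p)\<^esub>}
      = tors A (C p) xs (carrier (C p)) \<inter> {x \<in> carrier (C p). d p x = \<zero>\<^bsub>C (Suc p)\<^esub>}"
    using submodule_subset[OF G] by auto
  then show 1: "submodule {x \<in> tors A (C p) xs (carrier (C p)). d p x = \<zero>\<^bsub>C (Suc p)\<^esub>} A (C p)"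
    using submodule_Int[OF C G submodule_kernel[OF C C d]] by simp
  show "submodule (bdry A C d xs p) A (C p)"
    by (cases p) (auto simp: bdry_def submodule_singleton_zero[OF C] submodule_image[OF C C d G])
  show "bdry A C d xs p \<subseteq> {x \<in> tors A (C p) xs (carrier (C p)). d p x = \<zero>\<^bsub>C (Suc p)\<^esub>}"
  proof (cases p)
    case 0 then show ?thesis using submodule_zero[OF 1] by (auto simp: bdry_def)
  next
    case (Suc q) then show ?thesis using tors_hom[OF C C d xs] dd submodule_subset[OF G] by (auto simp: bdry_def)
  qed
qed

context dcomplex
begin

lemma lift_E_single:
  assumes V: "module K V" and g: "g \<in> module_hom K (restrict_scalars A (Ef p)) V"
  shows "\<exists>h\<in>module_hom K E' V. \<forall>i. \<forall>x\<in>carrier (Ef i). h (sE i x) = (if i = p then g x else \<zero>\<^bsub>V\<^esub>)"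
proof (rule lift_E[OF V])
  interpret V: module K V by (rule V)
  show "(\<lambda>x. if i = p then g x else \<zero>\<^bsub>V\<^esub>) \<in> module_hom K (restrict_scalars A (Ef i)) V" for i
    using g V.smult_r_null by (cases "i = p") (auto simp: module_hom_def)
qed

lemma lift_F_single:
  assumes V: "module K V" and g: "g \<in> module_hom K (restrict_scalars B (Ff q)) V"
  shows "\<exists>h\<in>module_hom K F' V. \<forall>j. \<forall>y\<in>carrier (Ff j). h (sF j y) = (if j = q then g y else \<zero>\<^bsub>V\<^esub>)"
proof (rule lift_F[OF V])
  interpret V: module K V by (rule V)
  show "(\<lambda>x. if j = q then g x else \<zero>\<^bsub>V\<^esub>) \<in> module_hom K (restrict_scalars B (Ff j)) V" for j
    using g V.smult_r_null by (cases "j = q") (auto simp: module_hom_def)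
qed

end

locale torsion_complex = dcomplex K A B Ef Ff dE dF
  for K :: "('k, 'x) ring_scheme" and A :: "('k, 'a, 'y) module_scheme" and B :: "('k, 'b, 'z) module_scheme"
    and Ef :: "nat \<Rightarrow> ('a, 'e) module" and Ff :: "nat \<Rightarrow> ('b, 'f) module" and dE dF +
  fixes xs ys
  assumes xs: "set xs \<subseteq> carrier A" and ys: "set ys \<subseteq> carrier B"
begin

notation pX (infixl "\<star>" 70) and actX (infixl "\<cdot>" 70)

text \<open>In these names G stands for torsion parts, Z for their cycles and B for their
  boundaries, while E, F and X denote the two factors and the total complex.\<close>

definition "GE p = tors A (Ef p) xs (carrier (Ef p))"
definition "GF q = tors B (Ff q) ys (carrier (Ff q))"
definition "ZE p = {x \<in> GE p. dE p x = \<zero>\<^bsub>Ef (Suc p)\<^esub>}"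
definition "ZF q = {y \<in> GF q. dF q y = \<zero>\<^bsub>Ff (Suc q)\<^esub>}"
abbreviation "BE \<equiv> bdry A Ef dE xs"
abbreviation "BF \<equiv> bdry B Ff dF ys"
definition "GX n = XP GE GF n"
definition "ZX n = {t \<in> GX n. DX t = \<zero>\<^bsub>T\<^esub>}"
definition "BX n = (case n of 0 \<Rightarrow> {\<zero>\<^bsub>T\<^esub>} | Suc m \<Rightarrow> DX ` GX m)"

lemma GE: "submodule (GE p) A (Ef p)" unfolding GE_def by (rule tors_submodule[OF Ef submodule_carrier[OF Ef] xs])
lemma GF: "submodule (GF p) B (Ff p)" unfolding GF_def by (rule tors_submodule[OF Ff submodule_carrier[OF Ff] ys])
lemma dGE: "x \<in> GE p \<Longrightarrow> dE p x \<in> GE (Suc p)" unfolding GE_def by (rule tors_hom[OF Ef Ef dE xs])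
lemma dGF: "x \<in> GF p \<Longrightarrow> dF p x \<in> GF (Suc p)" unfolding GF_def by (rule tors_hom[OF Ff Ff dF ys])

lemma BE_Suc: "BE (Suc p) = dE p ` GE p" by (simp add: bdry_def GE_def)
lemma BF_Suc: "BF (Suc p) = dF p ` GF p" by (simp add: bdry_def GF_def)
lemma BE_0: "BE 0 = {\<zero>\<^bsub>Ef 0\<^esub>}" by (simp add: bdry_def)
lemma BF_0: "BF 0 = {\<zero>\<^bsub>Ff 0\<^esub>}" by (simp add: bdry_def)

lemma ZE: "submodule (ZE p) A (Ef p)" and BE: "submodule (BE p) A (Ef p)" and BE_ZE: "BE p \<subseteq> ZE p"
  using torsion_cycles[where C = Ef and d = dE and p = p, OF Ef dE _ xs] dEdE by (simp_all add: ZE_def GE_def)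

lemma ZF: "submodule (ZF p) B (Ff p)" and BF: "submodule (BF p) B (Ff p)" and BF_ZF: "BF p \<subseteq> ZF p"
  using torsion_cycles[where C = Ff and d = dF and p = p, OF Ff dF _ ys] dFdF by (simp_all add: ZF_def GF_def)

lemma GX: "submodule (GX n) R Xm" unfolding GX_def by (rule XP_submodule[OF GE GF])
lemma DX_GX: "t \<in> GX n \<Longrightarrow> DX t \<in> GX (Suc n)" unfolding GX_def by (rule DX_XP[OF GE GF dGE dGF])
lemma DX_DX_GX: "t \<in> GX n \<Longrightarrow> DX (DX t) = \<zero>\<^bsub>T\<^esub>" unfolding GX_def by (rule DX_DX[OF GE GF dGE dGF])

lemma ZX: "submodule (ZX n) R Xm"
proof -
  have "ZX n = GX n \<inter> {t \<in> carrier Xm. DX t = \<zero>\<^bsub>Xm\<^esub>}"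
    using submodule_subset[OF GX] by (auto simp: ZX_def)
  then show ?thesis using submodule_Int[OF modX GX submodule_kernel[OF modX modX DX_R]] by simp
qed

lemma BX: "submodule (BX n) R Xm"
  by (cases n) (use submodule_singleton_zero[OF modX] submodule_image[OF modX modX DX_R GX] in \<open>auto simp: BX_def\<close>)

lemma BX_ZX: "BX n \<subseteq> ZX n"
proof (cases n)
  case 0 then show ?thesis using submodule_zero[OF ZX] by (auto simp: BX_def)
next
  case (Suc q) then show ?thesis using DX_GX DX_DX_GX by (auto simp: BX_def ZX_def)
qed

lemma GXI: "x \<in> GE p \<Longrightarrow> y \<in> GF q \<Longrightarrow> p + q = n \<Longrightarrow> sE p x \<star> sF q y \<in> GX n"
  unfolding GX_def by (rule pairsI[OF GE GF])

lemma ZXI: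
  assumes "x \<in> ZE p" "y \<in> ZF q" "p + q = n" shows "sE p x \<star> sF q y \<in> ZX n"
proof -
  have x: "x \<in> GE p" "dE p x = \<zero>\<^bsub>Ef (Suc p)\<^esub>" and y: "y \<in> GF q" "dF q y = \<zero>\<^bsub>Ff (Suc q)\<^esub>"
    using assms by (auto simp: ZE_def ZF_def)
  note c = submodule_subset[OF GE x(1)] submodule_subset[OF GF y(1)]
  have "DX (sE p x \<star> sF q y) = \<zero>\<^bsub>T\<^esub>"
    unfolding DX_left[OF c y(2)] x(2) sE_zero by (rule pX_zero(2)[OF sF_closed[OF c(2)]])
  then show ?thesis using GXI[OF x(1) y(1) assms(3)] by (simp add: ZX_def)
qed

lemma BXI_left:
  assumes x: "x \<in> BE p" and y: "y \<in> ZF q" and n: "p + q = n" shows "sE p x \<star> sF q y \<in> BX n"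
proof (cases p)
  case 0
  then have "sE p x \<star> sF q y = \<zero>\<^bsub>T\<^esub>"
    using x pX_zero(2)[OF sF_closed[OF submodule_subset[OF ZF y]]] by (simp add: BE_0 sE_zero)
  then show ?thesis using submodule_zero[OF BX] by simp
next
  case (Suc m)
  then obtain u where u: "u \<in> GE m" "x = dE m u" using x by (auto simp: BE_Suc)
  have y': "y \<in> GF q" "dF q y = \<zero>\<^bsub>Ff (Suc q)\<^esub>" using y by (auto simp: ZF_def)
  have "sE p x \<star> sF q y = DX (sE m u \<star> sF q y)"
    using DX_left[OF submodule_subset[OF GE u(1)] submodule_subset[OF GF y'(1)] y'(2)] Suc u by simp
  moreover have "n = Suc (m + q)" using n Suc by simp
  ultimately show ?thesis using GXI[OF u(1) y'(1) refl] by (auto simp: BX_def)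
qed

text \<open>The sign in front of the second differential is absorbed into the left factor, which
  stays in \<open>GE p\<close>.\<close>

lemma BXI_right:
  assumes x: "x \<in> ZE p" and y: "y \<in> BF q" and n: "p + q = n" shows "sE p x \<star> sF q y \<in> BX n"
proof (cases q)
  case 0
  then have "sE p x \<star> sF q y = \<zero>\<^bsub>T\<^esub>"
    using y pX_zero(1)[OF sE_closed[OF submodule_subset[OF ZE x]]] by (simp add: BF_0 sF_zero)
  then show ?thesis using submodule_zero[OF BX] by simp
next
  case (Suc m)
  then obtain u where u: "u \<in> GF m" "y = dF m u" using y by (auto simp: BF_Suc)
  have x': "x \<in> GE p" "dE p x = \<zero>\<^bsub>Ef (Suc p)\<^esub>" using x by (auto simp: ZE_def)
  obtain x'' where x'': "x'' \<in> GE p" "sgn_E (sE p x) = sE p x''" using sgn_E_mem[where P = GE, OF GE x'(1)] by blast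
  have "sE p x \<star> sF q y = DX (sE p x'' \<star> sF m u)"
    using DX_right[OF submodule_subset[OF GE x'(1)] submodule_subset[OF GF u(1)] x'(2)] Suc u x'' by simp
  moreover have "n = Suc (p + m)" using n Suc by simp
  ultimately show ?thesis using GXI[OF x''(1) u(1) refl] by (auto simp: BX_def)
qed

lemma smult_left: "a \<in> carrier A \<Longrightarrow> x \<in> carrier (Ef p) \<Longrightarrow> f \<in> carrier (dsum Ff) \<Longrightarrow>
    pR a \<one>\<^bsub>B\<^esub> \<cdot> (sE p x \<star> f) = sE p (a \<odot>\<^bsub>Ef p\<^esub> x) \<star> f"
  using smultX_pure[of a "\<one>\<^bsub>B\<^esub>" "sE p x" f] sE_closed module_hom_smult[OF sE_hom] by simp

lemma smult_right: "b \<in> carrier B \<Longrightarrow> y \<in> carrier (Ff q) \<Longrightarrow> e \<in> carrier (dsum Ef) \<Longrightarrow>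
    pR \<one>\<^bsub>A\<^esub> b \<cdot> (e \<star> sF q y) = e \<star> sF q (b \<odot>\<^bsub>Ff q\<^esub> y)"
  using smultX_pure[of "\<one>\<^bsub>A\<^esub>" b e "sF q y"] sF_closed module_hom_smult[OF sF_hom] by simp

text \<open>A acts on the left factor through the elements a \<otimes> 1 of R, under which W is
  stable.\<close>

lemma slice_left:
  assumes W: "submodule W R Xm" and f: "f \<in> carrier (dsum Ff)"
  shows "submodule {x \<in> carrier (Ef p). sE p x \<star> f \<in> W} A (Ef p)"
proof (rule submoduleI'[OF Ef])
  interpret Ep: module A "Ef p" by (rule Ef)
  show "\<zero>\<^bsub>Ef p\<^esub> \<in> {x \<in> carrier (Ef p). sE p x \<star> f \<in> W}"
    using submodule_zero[OF W] pX_zero(2)[OF f] by (simp add: sE_zero)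
  show "x \<oplus>\<^bsub>Ef p\<^esub> y \<in> {x \<in> carrier (Ef p). sE p x \<star> f \<in> W}"
    if "x \<in> {x \<in> carrier (Ef p). sE p x \<star> f \<in> W}" "y \<in> {x \<in> carrier (Ef p). sE p x \<star> f \<in> W}" for x y
    using that submodule_add[OF W] f by (simp add: module_hom_add[OF sE_hom] pX_add sE_closed)
  show "a \<odot>\<^bsub>Ef p\<^esub> x \<in> {x \<in> carrier (Ef p). sE p x \<star> f \<in> W}"
    if "a \<in> carrier A" "x \<in> {x \<in> carrier (Ef p). sE p x \<star> f \<in> W}" for a x
    using that submodule_smult[OF W pR_closed[of a "\<one>\<^bsub>B\<^esub>"], of "sE p x \<star> f"] smult_left[OF that(1) _ f] by simp
qed auto

lemma slice_right:
  assumes W: "submodule W R Xm" and e: "e \<in> carrier (dsum Ef)"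
  shows "submodule {y \<in> carrier (Ff q). e \<star> sF q y \<in> W} B (Ff q)"
proof (rule submoduleI'[OF Ff])
  interpret Fq: module B "Ff q" by (rule Ff)
  show "\<zero>\<^bsub>Ff q\<^esub> \<in> {y \<in> carrier (Ff q). e \<star> sF q y \<in> W}"
    using submodule_zero[OF W] pX_zero(1)[OF e] by (simp add: sF_zero)
  show "x \<oplus>\<^bsub>Ff q\<^esub> y \<in> {y \<in> carrier (Ff q). e \<star> sF q y \<in> W}"
    if "x \<in> {y \<in> carrier (Ff q). e \<star> sF q y \<in> W}" "y \<in> {y \<in> carrier (Ff q). e \<star> sF q y \<in> W}" for x y
    using that submodule_add[OF W] e by (simp add: module_hom_add[OF sF_hom] pX_add_right sF_closed)
  show "b \<odot>\<^bsub>Ff q\<^esub> y \<in> {y \<in> carrier (Ff q). e \<star> sF q y \<in> W}"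
    if "b \<in> carrier B" "y \<in> {y \<in> carrier (Ff q). e \<star> sF q y \<in> W}" for b y
    using that submodule_smult[OF W pR_closed[of "\<one>\<^bsub>A\<^esub>" b], of "e \<star> sF q y"] smult_right[OF that(1) _ e] by simp
qed auto

text \<open>Products of generators with p + q = n generate: a submodule W containing them and the
  boundaries contains all tensors of cycles, and then by \<open>kuenneth_XP\<close> every
  cycle.\<close>

lemma fg_total:
  assumes fg: "\<And>p q. p + q = n \<Longrightarrow> ZE p \<subseteq> BE p \<or> ZF q \<subseteq> BF q \<or>
    fg_mod A (Ef p) (ZE p) (BE p) \<and> fg_mod B (Ff q) (ZF q) (BF q)"
  shows "fg_mod R Xm (ZX n) (BX n)"
proof -
  obtain U where U0: "\<forall>p. finite (U p) \<and> U p \<subseteq> ZE p \<and> (fg_mod A (Ef p) (ZE p) (BE p) \<longrightarrow>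
      (\<forall>W. submodule W A (Ef p) \<longrightarrow> U p \<subseteq> W \<longrightarrow> BE p \<subseteq> W \<longrightarrow> ZE p \<subseteq> W))"
    using fg_mod_generators[of ZE A Ef BE] by (rule exE)
  note U = U0[THEN spec, THEN conjunct1] U0[THEN spec, THEN conjunct2, THEN conjunct1] U0[THEN spec, THEN conjunct2, THEN conjunct2, THEN mp, THEN spec, THEN mp, THEN mp, THEN mp]
  obtain V where V0: "\<forall>p. finite (V p) \<and> V p \<subseteq> ZF p \<and> (fg_mod B (Ff p) (ZF p) (BF p) \<longrightarrow>
      (\<forall>W. submodule W B (Ff p) \<longrightarrow> V p \<subseteq> W \<longrightarrow> BF p \<subseteq> W \<longrightarrow> ZF p \<subseteq> W))"
    using fg_mod_generators[of ZF B Ff BF] by (rule exE)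
  note V = V0[THEN spec, THEN conjunct1] V0[THEN spec, THEN conjunct2, THEN conjunct1] V0[THEN spec, THEN conjunct2, THEN conjunct2, THEN mp, THEN spec, THEN mp, THEN mp, THEN mp]
  define S where "S = (\<Union>p\<in>{..n}. (\<lambda>(u, v). sE p u \<star> sF (n - p) v) ` (U p \<times> V (n - p)))"
  have Sfin: "finite S" unfolding S_def using U(1) V(1) by blast
  have SI: "sE p u \<star> sF q v \<in> S" if "u \<in> U p" "v \<in> V q" "p + q = n" for p q u v
    unfolding S_def using that by (intro UN_I[of p] image_eqI[of _ _ "(u, v)"]) auto
  have SZ: "S \<subseteq> ZX n" unfolding S_def using U(2) V(2) ZXI by fastforce
  have "ZX n \<subseteq> W" if W: "submodule W R Xm" "S \<subseteq> W" "BX n \<subseteq> W" for W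
  proof
    have gen: "sE p x \<star> sF q y \<in> W" if x: "x \<in> ZE p" and y: "y \<in> ZF q" and n: "p + q = n" for p q x y
    proof -
      consider "ZE p \<subseteq> BE p" | "ZF q \<subseteq> BF q" | "fg_mod A (Ef p) (ZE p) (BE p)" "fg_mod B (Ff q) (ZF q) (BF q)"
        using fg[OF n] by blast
      then show ?thesis
      proof cases
        \<comment> \<open>If one cohomology vanishes, its cycles are boundaries and the tensor is
          already a boundary.\<close>
        case 1 then show ?thesis using BXI_left[of x p y q n] x y n W(3) by blast
      next
        case 2 then show ?thesis using BXI_right[of x p y q n] x y n W(3) by blast
      next
        case 3
        \<comment> \<open>One variable at a time: with v fixed, the slice of W contains
          \<open>U p\<close> and the boundaries, hence all of \<open>ZE p\<close>; afterwards x is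
          fixed and the same is done on the right.\<close>
        have A1: "sE p x \<star> sF q v \<in> W" if v: "v \<in> V q" for v
        proof -
          have vZ: "v \<in> ZF q" using V(2) v by blast
          note fc = sF_closed[OF submodule_subset[OF ZF vZ]]
          have "ZE p \<subseteq> {x \<in> carrier (Ef p). sE p x \<star> sF q v \<in> W}"
          proof (rule U(3)[OF 3(1) slice_left[OF W(1) fc]])
            show "U p \<subseteq> {x \<in> carrier (Ef p). sE p x \<star> sF q v \<in> W}"
              using SI[OF _ v n] W(2) U(2) submodule_subset[OF ZE] by blast
            show "BE p \<subseteq> {x \<in> carrier (Ef p). sE p x \<star> sF q v \<in> W}"
              using BXI_left[OF _ vZ n] W(3) submodule_subset[OF BE] by blast
          qed
          then show ?thesis using x by blast
        qed
        note ec = sE_closed[OF submodule_subset[OF ZE x]]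
        have "ZF q \<subseteq> {y \<in> carrier (Ff q). sE p x \<star> sF q y \<in> W}"
        proof (rule V(3)[OF 3(2) slice_right[OF W(1) ec]])
          show "V q \<subseteq> {y \<in> carrier (Ff q). sE p x \<star> sF q y \<in> W}"
            using A1 V(2) submodule_subset[OF ZF] by blast
          show "BF q \<subseteq> {y \<in> carrier (Ff q). sE p x \<star> sF q y \<in> W}"
            using BXI_right[OF x _ n] W(3) submodule_subset[OF BF] by blast
        qed
        then show ?thesis using y by blast
      qed
    qed
    have XW: "XP ZE ZF n \<subseteq> W"
      by (rule tspan_subset_submodule[OF submodule_X_imp_T[OF W(1)]]) (use gen in \<open>auto simp: pairs_def\<close>)
    fix t assume t: "t \<in> ZX n"
    then have tG: "t \<in> XP GE GF n" "DX t = \<zero>\<^bsub>T\<^esub>" by (auto simp: ZX_def GX_def)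
    note k = kuenneth_XP[OF GE GF dGE dGF tG, folded ZE_def ZF_def]
    show "t \<in> W"
    proof (cases n)
      case 0 then show ?thesis using k(1) XW by auto
    next
      case (Suc m)
      then obtain s where s: "s \<in> GX m" "t \<ominus>\<^bsub>T\<^esub> DX s \<in> W" using k(2) XW by (auto simp: GX_def)
      have "DX s \<in> W" using s(1) W(3) Suc by (auto simp: BX_def)
      then have "(t \<ominus>\<^bsub>T\<^esub> DX s) \<oplus>\<^bsub>T\<^esub> DX s \<in> W" using submodule_add[OF W(1) s(2)] by simp
      moreover have "t \<in> carrier T" "DX s \<in> carrier T"
        using submodule_subset[OF W(1) \<open>DX s \<in> W\<close>] submodule_subset[OF ZX t] by simp_all
      ultimately show ?thesis by (simp add: a_minus_def T.a_assoc T.l_neg)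
    qed
  qed
  then show ?thesis unfolding fg_mod_def using Sfin SZ by blast
qed

text \<open>The sign is hidden in x', of which only the degree matters later.\<close>

lemma DX_single:
  assumes x: "x \<in> carrier (Ef i)" and y: "y \<in> carrier (Ff j)"
  shows "\<exists>x'\<in>carrier (Ef i). DX (sE i x \<star> sF j y) = sE (Suc i) (dE i x) \<star> sF j y \<oplus>\<^bsub>T\<^esub> sE i x' \<star> sF (Suc j) (dF j y)"
proof -
  obtain x' where x': "x' \<in> carrier (Ef i)" "sgn_E (sE i x) = sE i x'"
    using sgn_E_mem[of "\<lambda>i. carrier (Ef i)", OF submodule_carrier[OF Ef] x] by blast
  then show ?thesis using DX_pure[OF sE_closed[OF x] sF_closed[OF y]] by (auto simp: d_E(2)[OF x] d_F(2)[OF y])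
qed

lemma smult_single: "a \<in> carrier A \<Longrightarrow> b \<in> carrier B \<Longrightarrow> x \<in> carrier (Ef p) \<Longrightarrow> y \<in> carrier (Ff q) \<Longrightarrow>
    pR a b \<cdot> (sE p x \<star> sF q y) = sE p (a \<odot>\<^bsub>Ef p\<^esub> x) \<star> sF q (b \<odot>\<^bsub>Ff q\<^esub> y)"
  using smultX_pure[of a b "sE p x" "sF q y"] sE_closed sF_closed module_hom_smult[OF sE_hom] module_hom_smult[OF sF_hom]
  by simp

text \<open>If the left factor has a nonzero class \<open>c\<close>, a functional \<open>\<mu>\<close> with \<open>\<mu> c = 1\<close> that kills boundaries
  turns generators of the cohomology of the tensor product into generators of the cohomology of the right
  factor.\<close>

lemma fg_total_imp_right:
  assumes N: "noetherian_ring R" and c: "c \<in> ZE p" "c \<notin> BE p" and n: "p + q = n"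
    and fg: "fg_mod R Xm (ZX n) (BX n)"
  shows "fg_mod B (Ff q) (ZF q) (BF q)"
proof -
  let ?V = "restrict_scalars B (Ff q)"
  note mK = regular_is_module[OF cringK] and mV = restrict_scalars_module[OF alB Ff]
  interpret V: module K ?V by (rule mV)
  interpret Y: module B "Ff q" by (rule Ff)
  interpret Ep: module A "Ef p" by (rule Ef)
  note Zc = submodule_subset[OF ZE] submodule_subset[OF ZF]
  note cc = Zc(1)[OF c(1)]
  have "\<exists>\<mu>\<in>module_hom K (restrict_scalars A (Ef p)) (regular_module K). (\<forall>b\<in>BE p. \<mu> b = \<zero>\<^bsub>K\<^esub>) \<and> \<mu> c = \<one>\<^bsub>K\<^esub>"
    by (rule regular_field_functional[OF fieldK restrict_scalars_module[OF alA Ef] restrict_submodule[OF alA Ef BE]])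
      (use cc c in simp_all)
  then obtain \<mu> where \<mu>: "\<mu> \<in> module_hom K (restrict_scalars A (Ef p)) (regular_module K)"
    "\<And>b. b \<in> BE p \<Longrightarrow> \<mu> b = \<zero>\<^bsub>K\<^esub>" "\<mu> c = \<one>\<^bsub>K\<^esub>" by blast
  \<comment> \<open>The functional \<mu> and the identity are extended by zero to the other degrees,
    so that their contraction G sees only bidegree (p, q).\<close>
  obtain \<Lambda> where \<Lambda>: "\<Lambda> \<in> module_hom K E' (regular_module K)"
    "\<And>i x. x \<in> carrier (Ef i) \<Longrightarrow> \<Lambda> (sE i x) = (if i = p then \<mu> x else \<zero>\<^bsub>K\<^esub>)"
    using lift_E_single[OF mK \<mu>(1)] by auto
  obtain g where g: "g \<in> module_hom K F' ?V"
    "\<And>j y. y \<in> carrier (Ff j) \<Longrightarrow> g (sF j y) = (if j = q then y else \<zero>\<^bsub>Ff q\<^esub>)"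
    using lift_F_single[OF mV id_hom, of q] by auto
  obtain G where G: "G \<in> module_hom K T ?V"
    "\<And>e f. e \<in> carrier (dsum Ef) \<Longrightarrow> f \<in> carrier (dsum Ff) \<Longrightarrow> G (e \<star> f) = \<Lambda> e \<odot>\<^bsub>?V\<^esub> g f"
    using tensor_functional(1)[OF cringK modE' modF' mV \<Lambda>(1) g(1)] by auto
  have Gs: "G (sE i x \<star> sF j y) = (if i = p then \<mu> x else \<zero>\<^bsub>K\<^esub>) \<odot>\<^bsub>?V\<^esub> (if j = q then y else \<zero>\<^bsub>Ff q\<^esub>)"
    if "x \<in> carrier (Ef i)" "y \<in> carrier (Ff j)" for i x j y
    using G(2)[OF sE_closed[OF that(1)] sF_closed[OF that(2)]] \<Lambda>(2)[OF that(1)] g(2)[OF that(2)] by simp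
  have BV: "submodule (BF q) K ?V" by (rule restrict_submodule[OF alB Ff BF])
  have \<mu>K: "\<mu> x \<in> carrier K" if "x \<in> carrier (Ef p)" for x using module_hom_closed[OF \<mu>(1), of x] that by simp
  \<comment> \<open>G maps boundaries into \<open>BF q\<close>: the term with dE x vanishes because
    \<mu> kills boundaries, and the term with dF y is a scalar multiple of a boundary or
    zero.\<close>
  have GD: "G (DX s) \<in> BF q" if s: "s \<in> GX m" for s m
  proof -
    have "GX m \<subseteq> {t \<in> carrier T. G (DX t) \<in> BF q}"
      unfolding GX_def
    proof (rule tspan_subset_submodule[OF submodule_vimage[OF modT mV module_hom_comp[OF DX_K G(1)] BV]])
      fix e f assume "(e, f) \<in> pairs GE GF m"
      then obtain i j x y where *: "e = sE i x" "f = sF j y" "x \<in> GE i" "y \<in> GF j" by (auto simp: pairs_def)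
      note xc = submodule_subset[OF GE *(3)] and yc = submodule_subset[OF GF *(4)]
      note dxc = module_hom_closed[OF dE xc] and dyc = module_hom_closed[OF dF yc]
      obtain x' where x': "x' \<in> carrier (Ef i)"
        "DX (sE i x \<star> sF j y) = sE (Suc i) (dE i x) \<star> sF j y \<oplus>\<^bsub>T\<^esub> sE i x' \<star> sF (Suc j) (dF j y)"
        using DX_single[OF xc yc] by blast
      have a: "(if Suc i = p then \<mu> (dE i x) else \<zero>\<^bsub>K\<^esub>) = \<zero>\<^bsub>K\<^esub>" using \<mu>(2)[of "dE i x"] *(3) by (auto simp: BE_Suc)
      have b: "(if Suc j = q then dF j y else \<zero>\<^bsub>Ff q\<^esub>) \<in> BF q" using *(4) submodule_zero[OF BF] by (auto simp: BF_Suc)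
      have k: "(if i = p then \<mu> x' else \<zero>\<^bsub>K\<^esub>) \<in> carrier K" using \<mu>K[of x'] x'(1) by (cases "i = p") auto
      have "G (DX (e \<star> f)) = \<zero>\<^bsub>K\<^esub> \<odot>\<^bsub>?V\<^esub> (if j = q then y else \<zero>\<^bsub>Ff q\<^esub>) \<oplus>\<^bsub>?V\<^esub>
          (if i = p then \<mu> x' else \<zero>\<^bsub>K\<^esub>) \<odot>\<^bsub>?V\<^esub> (if Suc j = q then dF j y else \<zero>\<^bsub>Ff q\<^esub>)"
        unfolding *(1,2) x'(2)
          module_hom_add[OF G(1) pX_closed[OF sE_closed[OF dxc] sF_closed[OF yc]] pX_closed[OF sE_closed[OF x'(1)] sF_closed[OF dyc]]]
          Gs[OF dxc yc] Gs[OF x'(1) dyc] a ..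
      moreover have "\<zero>\<^bsub>K\<^esub> \<odot>\<^bsub>?V\<^esub> (if j = q then y else \<zero>\<^bsub>Ff q\<^esub>) = \<zero>\<^bsub>?V\<^esub>"
        by (rule V.smult_l_null) (use yc in auto)
      ultimately have "G (DX (e \<star> f)) \<in> BF q"
        using submodule_add[OF BV submodule_zero[OF BV] submodule_smult[OF BV k b]] by simp
      then show "e \<star> f \<in> {t \<in> carrier T. G (DX t) \<in> BF q}" using * sE_closed[OF xc] sF_closed[OF yc] by simp
    qed
    then show ?thesis using s by blast
  qed
  show ?thesis
  proof (rule fg_mod_retract[OF N modX ZX BX BX_ZX fg Ff _ _ _ _ _ puresR_carrier carrier_R_asum,
        where G = G and \<iota> = "\<lambda>v. sE p c \<star> sF q v"])
    show "ZF q \<subseteq> carrier (Ff q)" using Zc(2) by blast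
    show "G (x \<oplus>\<^bsub>Xm\<^esub> y) = G x \<oplus>\<^bsub>Ff q\<^esub> G y" if "x \<in> carrier Xm" "y \<in> carrier Xm" for x y
      using module_hom_add[OF G(1), of x y] that by simp
    show G0: "G \<zero>\<^bsub>Xm\<^esub> = \<zero>\<^bsub>Ff q\<^esub>" using module_hom_zero[OF modT mV G(1)] by simp
    show "G t \<in> BF q" if "t \<in> BX n" for t
      using that GD submodule_zero[OF BF] G0 by (auto simp: BX_def split: nat.splits)
    fix v assume v: "v \<in> ZF q"
    note vc = Zc(2)[OF v]
    show "sE p c \<star> sF q v \<in> ZX n" by (rule ZXI[OF c(1) v n])
    show "G (sE p c \<star> sF q v) = v" using Gs[OF cc vc] \<mu>(3) V.smult_one[of v] vc by simp
    fix s assume "s \<in> puresR"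
    then obtain a b where s: "s = pR a b" "a \<in> carrier A" "b \<in> carrier B" by (auto simp: puresR_def)
    have k: "\<mu> (a \<odot>\<^bsub>Ef p\<^esub> c) \<in> carrier K" using \<mu>K s cc by simp
    \<comment> \<open>After contraction, the action of a \<otimes> b on c \<otimes> v becomes
      multiplication of v by the element \<mu>(a c) b of B.\<close>
    have "G (s \<cdot> (sE p c \<star> sF q v)) = (\<mu> (a \<odot>\<^bsub>Ef p\<^esub> c) \<odot>\<^bsub>B\<^esub> b) \<odot>\<^bsub>Ff q\<^esub> v"
      using Gs[of "a \<odot>\<^bsub>Ef p\<^esub> c" p "b \<odot>\<^bsub>Ff q\<^esub> v" q] s cc vc algebra_smult_smult(1)[OF alB Ff k s(3) vc]
      by (simp add: smult_single)
    then show "\<exists>b\<in>carrier B. G (s \<cdot> (sE p c \<star> sF q v)) = b \<odot>\<^bsub>Ff q\<^esub> v"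
      by (rule bexI) (rule B.smult_closed[OF k s(3)])
  qed
qed

text \<open>The same contraction, with the functional on the right factor.\<close>

lemma fg_total_imp_left:
  assumes N: "noetherian_ring R" and c: "c \<in> ZF q" "c \<notin> BF q" and n: "p + q = n"
    and fg: "fg_mod R Xm (ZX n) (BX n)"
  shows "fg_mod A (Ef p) (ZE p) (BE p)"
proof -
  let ?V = "restrict_scalars A (Ef p)"
  note mK = regular_is_module[OF cringK] and mV = restrict_scalars_module[OF alA Ef]
  interpret V: module K ?V by (rule mV)
  interpret Y: module B "Ff q" by (rule Ff)
  interpret Ep: module A "Ef p" by (rule Ef)
  note Zc = submodule_subset[OF ZE] submodule_subset[OF ZF]
  note cc = Zc(2)[OF c(1)]
  have "\<exists>\<mu>\<in>module_hom K (restrict_scalars B (Ff q)) (regular_module K). (\<forall>b\<in>BF q. \<mu> b = \<zero>\<^bsub>K\<^esub>) \<and> \<mu> c = \<one>\<^bsub>K\<^esub>"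
    by (rule regular_field_functional[OF fieldK restrict_scalars_module[OF alB Ff] restrict_submodule[OF alB Ff BF]])
      (use cc c in simp_all)
  then obtain \<mu> where \<mu>: "\<mu> \<in> module_hom K (restrict_scalars B (Ff q)) (regular_module K)"
    "\<And>b. b \<in> BF q \<Longrightarrow> \<mu> b = \<zero>\<^bsub>K\<^esub>" "\<mu> c = \<one>\<^bsub>K\<^esub>" by blast
  obtain \<Lambda> where \<Lambda>: "\<Lambda> \<in> module_hom K F' (regular_module K)"
    "\<And>j y. y \<in> carrier (Ff j) \<Longrightarrow> \<Lambda> (sF j y) = (if j = q then \<mu> y else \<zero>\<^bsub>K\<^esub>)"
    using lift_F_single[OF mK \<mu>(1)] by auto
  obtain g where g: "g \<in> module_hom K E' ?V"
    "\<And>i x. x \<in> carrier (Ef i) \<Longrightarrow> g (sE i x) = (if i = p then x else \<zero>\<^bsub>Ef p\<^esub>)"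
    using lift_E_single[OF mV id_hom, of p] by auto
  obtain G where G: "G \<in> module_hom K T ?V"
    "\<And>e f. e \<in> carrier (dsum Ef) \<Longrightarrow> f \<in> carrier (dsum Ff) \<Longrightarrow> G (e \<star> f) = \<Lambda> f \<odot>\<^bsub>?V\<^esub> g e"
    using tensor_functional(2)[OF cringK modF' modE' mV \<Lambda>(1) g(1)] by auto
  have Gs: "G (sE i x \<star> sF j y) = (if j = q then \<mu> y else \<zero>\<^bsub>K\<^esub>) \<odot>\<^bsub>?V\<^esub> (if i = p then x else \<zero>\<^bsub>Ef p\<^esub>)"
    if "x \<in> carrier (Ef i)" "y \<in> carrier (Ff j)" for i x j y
    using G(2)[OF sE_closed[OF that(1)] sF_closed[OF that(2)]] \<Lambda>(2)[OF that(2)] g(2)[OF that(1)] by simp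
  have BV: "submodule (BE p) K ?V" by (rule restrict_submodule[OF alA Ef BE])
  have \<mu>K: "\<mu> y \<in> carrier K" if "y \<in> carrier (Ff q)" for y using module_hom_closed[OF \<mu>(1), of y] that by simp
  have GD: "G (DX s) \<in> BE p" if s: "s \<in> GX m" for s m
  proof -
    have "GX m \<subseteq> {t \<in> carrier T. G (DX t) \<in> BE p}"
      unfolding GX_def
    proof (rule tspan_subset_submodule[OF submodule_vimage[OF modT mV module_hom_comp[OF DX_K G(1)] BV]])
      fix e f assume "(e, f) \<in> pairs GE GF m"
      then obtain i j x y where *: "e = sE i x" "f = sF j y" "x \<in> GE i" "y \<in> GF j" by (auto simp: pairs_def)
      note xc = submodule_subset[OF GE *(3)] and yc = submodule_subset[OF GF *(4)]
      note dxc = module_hom_closed[OF dE xc] and dyc = module_hom_closed[OF dF yc]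
      obtain x' where x': "x' \<in> carrier (Ef i)"
        "DX (sE i x \<star> sF j y) = sE (Suc i) (dE i x) \<star> sF j y \<oplus>\<^bsub>T\<^esub> sE i x' \<star> sF (Suc j) (dF j y)"
        using DX_single[OF xc yc] by blast
      have a: "(if Suc j = q then \<mu> (dF j y) else \<zero>\<^bsub>K\<^esub>) = \<zero>\<^bsub>K\<^esub>" using \<mu>(2)[of "dF j y"] *(4) by (auto simp: BF_Suc)
      have b: "(if Suc i = p then dE i x else \<zero>\<^bsub>Ef p\<^esub>) \<in> BE p" using *(3) submodule_zero[OF BE] by (auto simp: BE_Suc)
      have k: "(if j = q then \<mu> y else \<zero>\<^bsub>K\<^esub>) \<in> carrier K" using \<mu>K[of y] yc by (cases "j = q") auto
      have "G (DX (e \<star> f)) = (if j = q then \<mu> y else \<zero>\<^bsub>K\<^esub>) \<odot>\<^bsub>?V\<^esub> (if Suc i = p then dE i x else \<zero>\<^bsub>Ef p\<^esub>) \<oplus>\<^bsub>?V\<^esub>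
          \<zero>\<^bsub>K\<^esub> \<odot>\<^bsub>?V\<^esub> (if i = p then x' else \<zero>\<^bsub>Ef p\<^esub>)"
        unfolding *(1,2) x'(2)
          module_hom_add[OF G(1) pX_closed[OF sE_closed[OF dxc] sF_closed[OF yc]] pX_closed[OF sE_closed[OF x'(1)] sF_closed[OF dyc]]]
          Gs[OF dxc yc] Gs[OF x'(1) dyc] a ..
      moreover have "\<zero>\<^bsub>K\<^esub> \<odot>\<^bsub>?V\<^esub> (if i = p then x' else \<zero>\<^bsub>Ef p\<^esub>) = \<zero>\<^bsub>?V\<^esub>"
        by (rule V.smult_l_null) (use x'(1) in auto)
      ultimately have "G (DX (e \<star> f)) \<in> BE p"
        using submodule_add[OF BV submodule_smult[OF BV k b] submodule_zero[OF BV]] by simp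
      then show "e \<star> f \<in> {t \<in> carrier T. G (DX t) \<in> BE p}" using * sE_closed[OF xc] sF_closed[OF yc] by simp
    qed
    then show ?thesis using s by blast
  qed
  show ?thesis
  proof (rule fg_mod_retract[OF N modX ZX BX BX_ZX fg Ef _ _ _ _ _ puresR_carrier carrier_R_asum,
        where G = G and \<iota> = "\<lambda>v. sE p v \<star> sF q c"])
    show "ZE p \<subseteq> carrier (Ef p)" using Zc(1) by blast
    show "G (x \<oplus>\<^bsub>Xm\<^esub> y) = G x \<oplus>\<^bsub>Ef p\<^esub> G y" if "x \<in> carrier Xm" "y \<in> carrier Xm" for x y
      using module_hom_add[OF G(1), of x y] that by simp
    show G0: "G \<zero>\<^bsub>Xm\<^esub> = \<zero>\<^bsub>Ef p\<^esub>" using module_hom_zero[OF modT mV G(1)] by simp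
    show "G t \<in> BE p" if "t \<in> BX n" for t
      using that GD submodule_zero[OF BE] G0 by (auto simp: BX_def split: nat.splits)
    fix v assume v: "v \<in> ZE p"
    note vc = Zc(1)[OF v]
    show "sE p v \<star> sF q c \<in> ZX n" by (rule ZXI[OF v c(1) n])
    show "G (sE p v \<star> sF q c) = v" using Gs[OF vc cc] \<mu>(3) V.smult_one[of v] vc by simp
    fix s assume "s \<in> puresR"
    then obtain a b where s: "s = pR a b" "a \<in> carrier A" "b \<in> carrier B" by (auto simp: puresR_def)
    have k: "\<mu> (b \<odot>\<^bsub>Ff q\<^esub> c) \<in> carrier K" using \<mu>K s cc by simp
    have "G (s \<cdot> (sE p v \<star> sF q c)) = (\<mu> (b \<odot>\<^bsub>Ff q\<^esub> c) \<odot>\<^bsub>A\<^esub> a) \<odot>\<^bsub>Ef p\<^esub> v"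
      using Gs[of "a \<odot>\<^bsub>Ef p\<^esub> v" p "b \<odot>\<^bsub>Ff q\<^esub> c" q] s cc vc algebra_smult_smult(1)[OF alA Ef k s(2) vc]
      by (simp add: smult_single)
    then show "\<exists>b\<in>carrier A. G (s \<cdot> (sE p v \<star> sF q c)) = b \<odot>\<^bsub>Ef p\<^esub> v"
      by (rule bexI) (rule A.smult_closed[OF k s(2)])
  qed
qed

end

section \<open>The total complex as a resolution\<close>

context dcomplex
begin

notation pX (infixl "\<star>" 70)

abbreviation "XT n \<equiv> XP (\<lambda>p. carrier (Ef p)) (\<lambda>q. carrier (Ff q)) n"

lemma XT_submodule: "submodule (XT n) R Xm" and XT_submodule_K: "submodule (XT n) K T"
  by (rule XP_submodule XP_submodule_K; rule submodule_carrier[OF Ef] submodule_carrier[OF Ff])+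

lemma XTI: "x \<in> carrier (Ef p) \<Longrightarrow> y \<in> carrier (Ff q) \<Longrightarrow> p + q = n \<Longrightarrow> sE p x \<star> sF q y \<in> XT n"
  by (rule pairsI[OF submodule_carrier[OF Ef] submodule_carrier[OF Ff]])

lemma DX_XT: "t \<in> XT n \<Longrightarrow> DX t \<in> XT (Suc n)"
  by (rule DX_XP[OF submodule_carrier[OF Ef] submodule_carrier[OF Ff] module_hom_closed[OF dE] module_hom_closed[OF dF]])

lemma DX_DX_XT: "t \<in> XT n \<Longrightarrow> DX (DX t) = \<zero>\<^bsub>T\<^esub>"
  by (rule DX_DX[OF submodule_carrier[OF Ef] submodule_carrier[OF Ff] module_hom_closed[OF dE] module_hom_closed[OF dF]])

abbreviation "cyc_E \<equiv> \<lambda>p. {x \<in> carrier (Ef p). dE p x = \<zero>\<^bsub>Ef (Suc p)\<^esub>}"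
abbreviation "cyc_F \<equiv> \<lambda>q. {y \<in> carrier (Ff q). dF q y = \<zero>\<^bsub>Ff (Suc q)\<^esub>}"

lemma kuenneth_XT:
  assumes "t \<in> XT n" "DX t = \<zero>\<^bsub>T\<^esub>"
  shows "n = 0 \<Longrightarrow> t \<in> XP cyc_E cyc_F 0" "n = Suc m \<Longrightarrow> \<exists>s\<in>XT m. t \<ominus>\<^bsub>T\<^esub> DX s \<in> XP cyc_E cyc_F n"
proof -
  have c: "\<And>p x. x \<in> carrier (Ef p) \<Longrightarrow> dE p x \<in> carrier (Ef (Suc p))" by (rule module_hom_closed[OF dE])
  have c': "\<And>q y. y \<in> carrier (Ff q) \<Longrightarrow> dF q y \<in> carrier (Ff (Suc q))" by (rule module_hom_closed[OF dF])
  have P: "\<And>p. submodule (carrier (Ef p)) A (Ef p)" and Q: "\<And>q. submodule (carrier (Ff q)) B (Ff q)"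
    by (rule submodule_carrier[OF Ef], rule submodule_carrier[OF Ff])
  note k = kuenneth_XP[where P = "\<lambda>p. carrier (Ef p)" and Q = "\<lambda>q. carrier (Ff q)" and n = n and t = t]
  show "n = 0 \<Longrightarrow> t \<in> XP cyc_E cyc_F 0"
    using k(1)[OF P Q _ _ assms(1,2)] c c' by simp
  show "n = Suc m \<Longrightarrow> \<exists>s\<in>XT m. t \<ominus>\<^bsub>T\<^esub> DX s \<in> XP cyc_E cyc_F n"
    using k(2)[where m = m, OF P Q _ _ assms(1,2)] c c' by simp
qed

text \<open>The augmentation is \<epsilon> \<otimes> \<epsilon>'. Cycles are reduced to tensors of
  cycles: in positive total degree one factor sits in positive degree and is a boundary, in degree 0
  both factors come from L and N.\<close>

lemma total_resolution:
  assumes L: "module A L" and N: "module B N"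
    and rE: "resolution A L \<epsilon> Ef dE" and rF: "resolution B N \<epsilon>' Ff dF"
  shows "\<exists>\<eta>. resolution R (tensor_module K A B L N) \<eta> (\<lambda>n. Xm\<lparr>carrier := XT n\<rparr>) (\<lambda>_. DX)"
proof -
  have TM: "tensor_mod K A B L N" by (rule tensor_mod.intro[OF tensor_algebra_axioms tensor_mod_axioms.intro[OF L N]])
  interpret LN: tensor_mod K A B L N by (rule TM)
  have eps: "\<epsilon> \<in> module_hom A L (Ef 0)" "inj_on \<epsilon> (carrier L)"
      "\<epsilon> ` carrier L = {x \<in> carrier (Ef 0). dE 0 x = \<zero>\<^bsub>Ef (Suc 0)\<^esub>}"
      "\<And>p. dE p ` carrier (Ef p) = {x \<in> carrier (Ef (Suc p)). dE (Suc p) x = \<zero>\<^bsub>Ef (Suc (Suc p))\<^esub>}"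
    using rE by (simp_all add: resolution_def)
  have eps': "\<epsilon>' \<in> module_hom B N (Ff 0)" "inj_on \<epsilon>' (carrier N)"
      "\<epsilon>' ` carrier N = {x \<in> carrier (Ff 0). dF 0 x = \<zero>\<^bsub>Ff (Suc 0)\<^esub>}"
      "\<And>p. dF p ` carrier (Ff p) = {x \<in> carrier (Ff (Suc p)). dF (Suc p) x = \<zero>\<^bsub>Ff (Suc (Suc p))\<^esub>}"
    using rF by (simp_all add: resolution_def)
  note ec = module_hom_closed[OF eps(1)] and ec' = module_hom_closed[OF eps'(1)]
  note u = module_hom_comp[OF eps(1) sE_hom] and v = module_hom_comp[OF eps'(1) sF_hom]
  have uK: "(\<lambda>x. sE 0 (\<epsilon> x)) \<in> module_hom K LN.E' E'" by (rule module_hom_restrict_scalars[OF alA u])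
  have vK: "(\<lambda>x. sF 0 (\<epsilon>' x)) \<in> module_hom K LN.F' F'" by (rule module_hom_restrict_scalars[OF alB v])
  obtain h where h: "h \<in> module_hom K LN.T T"
    "\<And>l m. l \<in> carrier L \<Longrightarrow> m \<in> carrier N \<Longrightarrow> h (LN.pX l m) = sE 0 (\<epsilon> l) \<star> sF 0 (\<epsilon>' m)"
    using tensor_map[OF cringK LN.modE' LN.modF' modE' modF' uK vK] by auto
  have hR: "h \<in> module_hom R LN.Xm Xm"
    by (rule tensor_map_R[OF LN.tensor_mod_axioms tensor_mod_axioms h u v])
  have h_in: "h t \<in> H" if H: "submodule H K T" and t: "t \<in> carrier LN.T"
      and p: "\<And>l m. l \<in> carrier L \<Longrightarrow> m \<in> carrier N \<Longrightarrow> sE 0 (\<epsilon> l) \<star> sF 0 (\<epsilon>' m) \<in> H" for t H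
  proof -
    have "LN.puresX \<subseteq> {t \<in> carrier LN.T. h t \<in> H}" using p h(2) by (auto simp: LN.puresX_def)
    then have "asum LN.T LN.puresX \<subseteq> {t \<in> carrier LN.T. h t \<in> H}"
      by (rule asum_subset_submodule[OF submodule_vimage[OF LN.modT modT h(1) H]])
    then show ?thesis using t LN.carrier_T_asum by blast
  qed
  have h_XT: "h t \<in> XT 0" if "t \<in> carrier LN.T" for t
    by (rule h_in[OF XT_submodule_K that]) (rule XTI[OF ec ec'], auto)
  have h_ker: "DX (h t) = \<zero>\<^bsub>T\<^esub>" if t: "t \<in> carrier LN.T" for t
  proof -
    have "h t \<in> {t \<in> carrier T. DX t = \<zero>\<^bsub>T\<^esub>}"
    proof (rule h_in[OF submodule_kernel[OF modT modT DX_K] t])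
      fix l m assume lm: "l \<in> carrier L" "m \<in> carrier N"
      have z: "dE 0 (\<epsilon> l) = \<zero>\<^bsub>Ef (Suc 0)\<^esub>" "dF 0 (\<epsilon>' m) = \<zero>\<^bsub>Ff (Suc 0)\<^esub>"
        using eps(3) eps'(3) lm by blast+
      have "DX (sE 0 (\<epsilon> l) \<star> sF 0 (\<epsilon>' m)) = \<zero>\<^bsub>T\<^esub>"
        unfolding DX_left[OF ec[OF lm(1)] ec'[OF lm(2)] z(2)] z(1) sE_zero
        by (rule pX_zero(2)[OF sF_closed[OF ec'[OF lm(2)]]])
      then show "sE 0 (\<epsilon> l) \<star> sF 0 (\<epsilon>' m) \<in> {t \<in> carrier T. DX t = \<zero>\<^bsub>T\<^esub>}"
        using sE_closed[OF ec[OF lm(1)]] sF_closed[OF ec'[OF lm(2)]] by simp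
    qed
    then show ?thesis by simp
  qed
  \<comment> \<open>Over a field \<epsilon> and \<epsilon>' have linear left inverses, and their
    tensor product is a left inverse of h.\<close>
  have h_inj: "inj_on h (carrier LN.T)"
  proof -
    have "\<exists>s\<in>module_hom K (restrict_scalars A (Ef 0)) LN.E'. s ` carrier (restrict_scalars A (Ef 0)) \<subseteq> carrier LN.E' \<and>
        (\<forall>x\<in>carrier LN.E'. \<epsilon> (s (\<epsilon> x)) = \<epsilon> x)"
      by (rule linear_section[OF fieldK LN.modE' restrict_scalars_module[OF alA Ef] submodule_carrier[OF LN.modE']
            module_hom_restrict_scalars[OF alA eps(1)]])
    then obtain s where s: "s \<in> module_hom K (restrict_scalars A (Ef 0)) LN.E'" "\<And>x. x \<in> carrier L \<Longrightarrow> \<epsilon> (s (\<epsilon> x)) = \<epsilon> x"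
      by auto
    have "\<exists>s\<in>module_hom K (restrict_scalars B (Ff 0)) LN.F'. s ` carrier (restrict_scalars B (Ff 0)) \<subseteq> carrier LN.F' \<and>
        (\<forall>x\<in>carrier LN.F'. \<epsilon>' (s (\<epsilon>' x)) = \<epsilon>' x)"
      by (rule linear_section[OF fieldK LN.modF' restrict_scalars_module[OF alB Ff] submodule_carrier[OF LN.modF']
            module_hom_restrict_scalars[OF alB eps'(1)]])
    then obtain s' where s': "s' \<in> module_hom K (restrict_scalars B (Ff 0)) LN.F'"
        "\<And>x. x \<in> carrier N \<Longrightarrow> \<epsilon>' (s' (\<epsilon>' x)) = \<epsilon>' x" by auto
    have se: "s (\<epsilon> l) = l" if "l \<in> carrier L" for l
      using inj_onD[OF eps(2) s(2)[OF that]] module_hom_closed[OF s(1), of "\<epsilon> l"] ec[OF that] that by simp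
    have se': "s' (\<epsilon>' l) = l" if "l \<in> carrier N" for l
      using inj_onD[OF eps'(2) s'(2)[OF that]] module_hom_closed[OF s'(1), of "\<epsilon>' l"] ec'[OF that] that by simp
    obtain r where r: "r \<in> module_hom K E' LN.E'" "\<And>x. x \<in> carrier (Ef 0) \<Longrightarrow> r (sE 0 x) = s x"
      using lift_E_single[OF LN.modE' s(1)] by auto
    obtain r' where r': "r' \<in> module_hom K F' LN.F'" "\<And>x. x \<in> carrier (Ff 0) \<Longrightarrow> r' (sF 0 x) = s' x"
      using lift_F_single[OF LN.modF' s'(1)] by auto
    obtain k where k: "k \<in> module_hom K T LN.T"
      "\<And>e f. e \<in> carrier (dsum Ef) \<Longrightarrow> f \<in> carrier (dsum Ff) \<Longrightarrow> k (e \<star> f) = LN.pX (r e) (r' f)"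
      using tensor_map[OF cringK modE' modF' LN.modE' LN.modF' r(1) r'(1)] by auto
    have "k (h t) = t" if t: "t \<in> carrier LN.T" for t
    proof (rule tensor_hom_eq[OF cringK LN.modE' LN.modF' LN.modT module_hom_comp[OF h(1) k(1)] id_hom _ t])
      fix l m assume "l \<in> carrier LN.E'" "m \<in> carrier LN.F'"
      then show "k (h (LN.pX l m)) = LN.pX l m"
        using h(2)[of l m] k(2)[of "sE 0 (\<epsilon> l)" "sF 0 (\<epsilon>' m)"] sE_closed[OF ec, of l] sF_closed[OF ec', of m]
          r(2)[OF ec, of l] r'(2)[OF ec', of m] se se' by simp
    qed
    then show ?thesis by (rule inj_on_inverseI)
  qed
  have ker0: "t \<in> h ` carrier LN.T" if t: "t \<in> XT 0" "DX t = \<zero>\<^bsub>T\<^esub>" for t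
  proof -
    have hS: "submodule (h ` carrier LN.T) K T" by (rule submodule_image[OF LN.modT modT h(1) submodule_carrier[OF LN.modT]])
    have "XP cyc_E cyc_F 0
        \<subseteq> h ` carrier LN.T"
    proof (rule tspan_subset_submodule[OF hS])
      fix e f
      assume "(e, f) \<in> pairs cyc_E cyc_F 0"
      then obtain x y where *: "e = sE 0 x" "f = sF 0 y" "x \<in> \<epsilon> ` carrier L" "y \<in> \<epsilon>' ` carrier N"
        unfolding eps(3) eps'(3) by (auto simp: pairs_def)
      then obtain l m where lm: "l \<in> carrier L" "m \<in> carrier N" "x = \<epsilon> l" "y = \<epsilon>' m" by blast
      have "e \<star> f = h (LN.pX l m)" using * lm h(2) by simp
      then show "e \<star> f \<in> h ` carrier LN.T" by (rule image_eqI) (use lm in simp)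
    qed
    then show ?thesis using kuenneth_XT(1)[OF t refl] by blast
  qed
  have exact: "t \<in> DX ` XT n" if t: "t \<in> XT (Suc n)" "DX t = \<zero>\<^bsub>T\<^esub>" for t n
  proof -
    have dS: "submodule (DX ` XT n) K T" by (rule submodule_image[OF modT modT DX_K XT_submodule_K])
    have sub: "XP cyc_E cyc_F (Suc n)
        \<subseteq> DX ` XT n"
    proof (rule tspan_subset_submodule[OF dS])
      fix e f
      assume "(e, f) \<in> pairs cyc_E cyc_F (Suc n)"
      then obtain p q x y where *: "e = sE p x" "f = sF q y" "p + q = Suc n" and x: "x \<in> carrier (Ef p)" "dE p x = \<zero>\<^bsub>Ef (Suc p)\<^esub>"
          and y: "y \<in> carrier (Ff q)" "dF q y = \<zero>\<^bsub>Ff (Suc q)\<^esub>" by (auto simp: pairs_def)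
      show "e \<star> f \<in> DX ` XT n"
      proof (cases p)
        case (Suc p')
        then have "x \<in> dE p' ` carrier (Ef p')" unfolding eps(4) using x by simp
        then obtain w where w: "w \<in> carrier (Ef p')" "x = dE p' w" by blast
        have "e \<star> f = DX (sE p' w \<star> sF q y)" using DX_left[OF w(1) y] * w(2) Suc by simp
        then show ?thesis by (rule image_eqI) (rule XTI[OF w(1) y(1)], use * Suc in simp)
      next
        \<comment> \<open>Here q is positive, and exactness of F takes the place of exactness of
          E.\<close>
        case 0
        then have q: "q = Suc n" using * by simp
        have "y \<in> dF n ` carrier (Ff n)" unfolding eps'(4) using y q by simp
        then obtain w where w: "w \<in> carrier (Ff n)" "y = dF n w" by blast
        obtain x' where x': "x' \<in> carrier (Ef p)" "sgn_E (sE p x) = sE p x'"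
          using sgn_E_mem[where P = "\<lambda>p. carrier (Ef p)", OF submodule_carrier[OF Ef] x(1)] by blast
        have "e \<star> f = DX (sE p x' \<star> sF n w)" using DX_right[OF x(1) w(1) x(2)] * w(2) q x'(2) by simp
        then show ?thesis by (rule image_eqI) (rule XTI[OF x'(1) w(1)], use 0 in simp)
      qed
    qed
    obtain s where s: "s \<in> XT n" "t \<ominus>\<^bsub>T\<^esub> DX s \<in> DX ` XT n" using kuenneth_XT(2)[OF t refl] sub by blast
    have c: "t \<in> carrier T" "DX s \<in> carrier T"
      using submodule_subset[OF XT_submodule_K t(1)] submodule_subset[OF XT_submodule_K DX_XT[OF s(1)]] by simp_all
    have "(t \<ominus>\<^bsub>T\<^esub> DX s) \<oplus>\<^bsub>T\<^esub> DX s \<in> DX ` XT n" using submodule_add[OF dS s(2)] s(1) by blast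
    moreover have "(t \<ominus>\<^bsub>T\<^esub> DX s) \<oplus>\<^bsub>T\<^esub> DX s = t" using c by (simp add: a_minus_def T.a_assoc T.l_neg)
    ultimately show ?thesis by simp
  qed
  have "resolution R LN.Xm h (\<lambda>n. Xm\<lparr>carrier := XT n\<rparr>) (\<lambda>_. DX)"
    unfolding resolution_def
  proof (intro conjI allI)
    show "module R (Xm\<lparr>carrier := XT n\<rparr>)" for n by (rule submodule_module[OF modX XT_submodule])
    show "h \<in> module_hom R LN.Xm (Xm\<lparr>carrier := XT 0\<rparr>)"
      by (rule module_homI) (use h_XT module_hom_add[OF hR] module_hom_smult[OF hR] in simp_all)
    show "inj_on h (carrier LN.Xm)" using h_inj by simp
    show "DX \<in> module_hom R (Xm\<lparr>carrier := XT n\<rparr>) (Xm\<lparr>carrier := XT (Suc n)\<rparr>)" for n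
      by (rule module_homI)
        (use DX_XT module_hom_add[OF DX_R] module_hom_smult[OF DX_R] submodule_subset[OF XT_submodule] in simp_all)
    show "h ` carrier LN.Xm = {t \<in> carrier (Xm\<lparr>carrier := XT 0\<rparr>). DX t = \<zero>\<^bsub>Xm\<lparr>carrier := XT (Suc 0)\<rparr>\<^esub>}"
      using h_XT h_ker ker0 by (intro equalityI subsetI) auto
    show "DX ` carrier (Xm\<lparr>carrier := XT n\<rparr>) =
        {t \<in> carrier (Xm\<lparr>carrier := XT (Suc n)\<rparr>). DX t = \<zero>\<^bsub>Xm\<lparr>carrier := XT (Suc (Suc n))\<rparr>\<^esub>}" for n
      using DX_XT DX_DX_XT exact by (intro equalityI subsetI) auto
  qed
  then show ?thesis by blast
qed

end

section \<open>Local cohomology of a tensor product\<close>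

text \<open>From here on local cohomology enters only through cycles and boundaries of the torsion
  part of the chosen resolution, with the ideal given by a list of generators.\<close>

lemma local_cohomology_iff:
  assumes xs: "set xs \<subseteq> carrier A" and Ed: "chosen_injective_resolution A L = (E, d)" "injective_resolution A L \<epsilon> E d"
  defines "Z \<equiv> \<lambda>i. {x \<in> tors A (E i) xs (carrier (E i)). d i x = \<zero>\<^bsub>E (Suc i)\<^esub>}"
  shows "nonzero_module (local_cohomology A (Idl\<^bsub>A\<^esub> (set xs)) L i) \<longleftrightarrow> \<not> Z i \<subseteq> bdry A E d xs i"
    and "fg_module A (local_cohomology A (Idl\<^bsub>A\<^esub> (set xs)) L i) \<longleftrightarrow> fg_mod A (E i) (Z i) (bdry A E d xs i)"
proof -
  have mE: "module A (E i)" and dE: "d i \<in> module_hom A (E i) (E (Suc i))"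
    and ex: "d i ` carrier (E i) = {x \<in> carrier (E (Suc i)). d (Suc i) x = \<zero>\<^bsub>E (Suc (Suc i))\<^esub>}" for i
    using Ed(2) by (simp_all add: injective_resolution_def injective_module_def)
  have dd: "d (Suc i) (d i x) = \<zero>\<^bsub>E (Suc (Suc i))\<^esub>" if "x \<in> carrier (E i)" for i x using ex[of i] that by blast
  note tc = torsion_cycles[where C = E and d = d and p = i, OF mE dE _ xs]
  have Z: "submodule (Z i) A (E i)" and H: "submodule (bdry A E d xs i) A (E i)" and HZ: "bdry A E d xs i \<subseteq> Z i"
    using tc dd by (simp_all add: Z_def)
  have "local_cohomology A (Idl\<^bsub>A\<^esub> (set xs)) L i = quotient_module ((E i)\<lparr>carrier := Z i\<rparr>) (bdry A E d xs i)"
    unfolding local_cohomology_def Ed(1) torsion_cohomology_def Z_def bdry_def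
    by (cases i) (simp_all add: torsion_part_eq_tors[OF mE xs])
  then show "nonzero_module (local_cohomology A (Idl\<^bsub>A\<^esub> (set xs)) L i) \<longleftrightarrow> \<not> Z i \<subseteq> bdry A E d xs i"
    and "fg_module A (local_cohomology A (Idl\<^bsub>A\<^esub> (set xs)) L i) \<longleftrightarrow> fg_mod A (E i) (Z i) (bdry A E d xs i)"
    using nonzero_quotient_iff[OF mE Z H HZ] fg_quotient_iff[OF mE Z H HZ] by simp_all
qed

context tensor_algebra
begin

lemma ideal_submodule:
  assumes I: "ideal I R" shows "submodule I K R"
proof -
  interpret R: algebra K R by (rule R_alg)
  interpret I: ideal I R by (rule I)
  show ?thesis
  proof (rule submoduleI'[OF modR])
    fix c r assume c: "c \<in> carrier K" and r: "r \<in> I"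
    have "(c \<odot>\<^bsub>R\<^esub> \<one>\<^bsub>R\<^esub>) \<otimes>\<^bsub>R\<^esub> r \<in> I" using c r by (intro I.I_l_closed) simp_all
    then show "c \<odot>\<^bsub>R\<^esub> r \<in> I" using c r I.a_subset R.smult_assoc2[of c "\<one>\<^bsub>R\<^esub>" r] by auto
  qed (use I.a_subset in auto)
qed

text \<open>The set \<open>tensor_image\<close> is generated only over K; closure of S and S' under
  multiplication makes the span stable under pure tensors and hence an ideal.\<close>

lemma pure_span_ideal:
  assumes S: "S \<subseteq> carrier A" "S' \<subseteq> carrier B"
    and cl: "\<And>a s. a \<in> carrier A \<Longrightarrow> s \<in> S \<Longrightarrow> a \<otimes>\<^bsub>A\<^esub> s \<in> S" "\<And>b s. b \<in> carrier B \<Longrightarrow> s \<in> S' \<Longrightarrow> b \<otimes>\<^bsub>B\<^esub> s \<in> S'"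
  shows "ideal (tensor_image K A B S S') R"
proof -
  interpret R: algebra K R by (rule R_alg)
  have cR: "cring R" using R_alg by (simp add: algebra_def)
  let ?G = "{pR s t | s t. s \<in> S \<and> t \<in> S'}"
  let ?P = "tensor_image K A B S S'"
  have G: "?G \<subseteq> carrier R" using S pR_closed by blast
  have P: "submodule ?P K R" unfolding tensor_image_def by (rule submodule_gen_submodule[OF modR G])
  have GP: "?G \<subseteq> ?P" unfolding tensor_image_def by (rule submodule_gen_incl)
  note Pc = submodule_subset[OF P]
  have pure: "pR a b \<otimes>\<^bsub>R\<^esub> x \<in> ?P" if a: "a \<in> carrier A" and b: "b \<in> carrier B" and x: "x \<in> ?P" for a b x
  proof -
    have "?G \<subseteq> {x \<in> carrier R. pR a b \<otimes>\<^bsub>R\<^esub> x \<in> ?P}"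
    proof
      fix x assume "x \<in> ?G"
      then obtain s t where st: "x = pR s t" "s \<in> S" "t \<in> S'" by blast
      have "pR a b \<otimes>\<^bsub>R\<^esub> x = pR (a \<otimes>\<^bsub>A\<^esub> s) (b \<otimes>\<^bsub>B\<^esub> t)" unfolding st(1) by (rule multR_pure) (use a b st S in auto)
      also have "\<dots> \<in> ?P" using GP cl(1)[OF a st(2)] cl(2)[OF b st(3)] by blast
      finally show "x \<in> {x \<in> carrier R. pR a b \<otimes>\<^bsub>R\<^esub> x \<in> ?P}" using st S pR_closed by auto
    qed
    then have "?P \<subseteq> {x \<in> carrier R. pR a b \<otimes>\<^bsub>R\<^esub> x \<in> ?P}"
      using submodule_gen_least[OF submodule_vimage[OF modR modR bilin_right[OF multR_bilin pR_closed[OF a b]] P]]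
      unfolding tensor_image_def by blast
    then show ?thesis using x by blast
  qed
  show ?thesis
  proof (rule cring_idealI[OF cR _ submodule_zero[OF P] submodule_add[OF P]])
    show "?P \<subseteq> carrier R" using Pc by blast
    fix r x assume r: "r \<in> carrier R" and x: "x \<in> ?P"
    have "r \<in> asum R puresR" using r carrier_R_asum by blast
    then show "r \<otimes>\<^bsub>R\<^esub> x \<in> ?P"
    proof induction
      case zero then show ?case using Pc[OF x] submodule_zero[OF P] by simp
    next
      case (add s r)
      then obtain a b where s: "s = pR a b" "a \<in> carrier A" "b \<in> carrier B" by (auto simp: puresR_def)
      have "r \<in> carrier R" "s \<in> carrier R"
        using add.hyps asum_carrier[OF R.abelian_group_axioms puresR_carrier] puresR_carrier by blast+
      then have "(s \<oplus>\<^bsub>R\<^esub> r) \<otimes>\<^bsub>R\<^esub> x = s \<otimes>\<^bsub>R\<^esub> x \<oplus>\<^bsub>R\<^esub> r \<otimes>\<^bsub>R\<^esub> x" using Pc[OF x] by (simp add: R.l_distr)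
      then show ?case using submodule_add[OF P pure[OF s(2,3) x] add.IH] s(1) by simp
    qed
  qed
qed

text \<open>The a with a \<otimes> 1 in the right-hand ideal form an ideal of A containing xs, hence
  containing the ideal generated by xs, and likewise for B; then a \<otimes> b = (a \<otimes> 1)(1
  \<otimes> b) gives one inclusion. Conversely each generator lies in one of the two
  summands.\<close>

lemma tensor_ideal_eq:
  assumes xs: "set xs \<subseteq> carrier A" and ys: "set ys \<subseteq> carrier B"
  defines "zs \<equiv> map (\<lambda>x. pR x \<one>\<^bsub>B\<^esub>) xs @ map (\<lambda>y. pR \<one>\<^bsub>A\<^esub> y) ys"
  shows "tensor_image K A B (Idl\<^bsub>A\<^esub> (set xs)) (carrier B) <+>\<^bsub>R\<^esub> tensor_image K A B (carrier A) (Idl\<^bsub>B\<^esub> (set ys))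
    = Idl\<^bsub>R\<^esub> (set zs)" (is "?P <+>\<^bsub>R\<^esub> ?Q = _")
proof -
  interpret R: algebra K R by (rule R_alg)
  interpret I: ideal "Idl\<^bsub>A\<^esub> (set xs)" A by (rule A.genideal_ideal[OF xs])
  interpret J: ideal "Idl\<^bsub>B\<^esub> (set ys)" B by (rule B.genideal_ideal[OF ys])
  have zs: "set zs \<subseteq> carrier R" using xs ys pR_closed by (auto simp: zs_def)
  interpret Z: ideal "Idl\<^bsub>R\<^esub> (set zs)" R by (rule R.genideal_ideal[OF zs])
  note zZ = R.genideal_self[OF zs]
  have P: "ideal ?P R" by (rule pure_span_ideal) (use I.a_subset I.I_l_closed in auto)
  have Q: "ideal ?Q R" by (rule pure_span_ideal) (use J.a_subset J.I_l_closed in auto)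
  have PG: "pR a b \<in> ?P" if "a \<in> Idl\<^bsub>A\<^esub> (set xs)" "b \<in> carrier B" for a b
    unfolding tensor_image_def by (rule subsetD[OF submodule_gen_incl]) (use that in blast)
  have QG: "pR a b \<in> ?Q" if "a \<in> carrier A" "b \<in> Idl\<^bsub>B\<^esub> (set ys)" for a b
    unfolding tensor_image_def by (rule subsetD[OF submodule_gen_incl]) (use that in blast)
  have mult: "pR a b = pR \<one>\<^bsub>A\<^esub> b \<otimes>\<^bsub>R\<^esub> pR a \<one>\<^bsub>B\<^esub>" "pR a b = pR a \<one>\<^bsub>B\<^esub> \<otimes>\<^bsub>R\<^esub> pR \<one>\<^bsub>A\<^esub> b"
    if "a \<in> carrier A" "b \<in> carrier B" for a b using that by (simp_all add: multR_pure)
  have pl: "(\<lambda>a. pR a \<one>\<^bsub>B\<^esub>) \<in> module_hom K A R" and pr: "pR \<one>\<^bsub>A\<^esub> \<in> module_hom K B R"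
    using bilin_left[OF pure_bilin[OF cringK modA modB]] bilin_right[OF pure_bilin[OF cringK modA modB]] by auto
  have IA: "Idl\<^bsub>A\<^esub> (set xs) \<subseteq> {a \<in> carrier A. pR a \<one>\<^bsub>B\<^esub> \<in> Idl\<^bsub>R\<^esub> (set zs)}"
  proof (rule A.genideal_minimal[OF cring_idealI[OF cringA]])
    show "\<zero>\<^bsub>A\<^esub> \<in> {a \<in> carrier A. pR a \<one>\<^bsub>B\<^esub> \<in> Idl\<^bsub>R\<^esub> (set zs)}"
      using module_hom_zero[OF modA modR pl] by simp
    show "r \<otimes>\<^bsub>A\<^esub> x \<in> {a \<in> carrier A. pR a \<one>\<^bsub>B\<^esub> \<in> Idl\<^bsub>R\<^esub> (set zs)}"
      if r: "r \<in> carrier A" and x: "x \<in> {a \<in> carrier A. pR a \<one>\<^bsub>B\<^esub> \<in> Idl\<^bsub>R\<^esub> (set zs)}" for r x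
    proof -
      have "pR (r \<otimes>\<^bsub>A\<^esub> x) \<one>\<^bsub>B\<^esub> = pR r \<one>\<^bsub>B\<^esub> \<otimes>\<^bsub>R\<^esub> pR x \<one>\<^bsub>B\<^esub>" using r x by (simp add: multR_pure)
      then show ?thesis using Z.I_l_closed[OF _ pR_closed[OF r B.one_closed]] r x by auto
    qed
    show "set xs \<subseteq> {a \<in> carrier A. pR a \<one>\<^bsub>B\<^esub> \<in> Idl\<^bsub>R\<^esub> (set zs)}" using xs zZ by (auto simp: zs_def)
  qed (use module_hom_add[OF pl] in auto)
  have JB: "Idl\<^bsub>B\<^esub> (set ys) \<subseteq> {b \<in> carrier B. pR \<one>\<^bsub>A\<^esub> b \<in> Idl\<^bsub>R\<^esub> (set zs)}"
  proof (rule B.genideal_minimal[OF cring_idealI[OF cringB]])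
    show "\<zero>\<^bsub>B\<^esub> \<in> {b \<in> carrier B. pR \<one>\<^bsub>A\<^esub> b \<in> Idl\<^bsub>R\<^esub> (set zs)}"
      using module_hom_zero[OF modB modR pr] by simp
    show "r \<otimes>\<^bsub>B\<^esub> x \<in> {b \<in> carrier B. pR \<one>\<^bsub>A\<^esub> b \<in> Idl\<^bsub>R\<^esub> (set zs)}"
      if r: "r \<in> carrier B" and x: "x \<in> {b \<in> carrier B. pR \<one>\<^bsub>A\<^esub> b \<in> Idl\<^bsub>R\<^esub> (set zs)}" for r x
    proof -
      have "pR \<one>\<^bsub>A\<^esub> (r \<otimes>\<^bsub>B\<^esub> x) = pR \<one>\<^bsub>A\<^esub> r \<otimes>\<^bsub>R\<^esub> pR \<one>\<^bsub>A\<^esub> x" using r x by (simp add: multR_pure)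
      then show ?thesis using Z.I_l_closed[OF _ pR_closed[OF A.one_closed r]] r x by auto
    qed
    show "set ys \<subseteq> {b \<in> carrier B. pR \<one>\<^bsub>A\<^esub> b \<in> Idl\<^bsub>R\<^esub> (set zs)}" using ys zZ by (auto simp: zs_def)
  qed (use module_hom_add[OF pr] in auto)
  note ZK = ideal_submodule[OF Z.ideal_axioms]
  have PZ: "?P \<subseteq> Idl\<^bsub>R\<^esub> (set zs)"
    unfolding tensor_image_def
  proof (rule submodule_gen_least[OF ZK], safe)
    fix a b assume a: "a \<in> Idl\<^bsub>A\<^esub> (set xs)" and b: "b \<in> carrier B"
    have aZ: "a \<in> carrier A \<and> pR a \<one>\<^bsub>B\<^esub> \<in> Idl\<^bsub>R\<^esub> (set zs)" using subsetD[OF IA a] by simp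
    show "pR a b \<in> Idl\<^bsub>R\<^esub> (set zs)"
      by (subst mult(1)[OF aZ[THEN conjunct1] b]) (rule Z.I_l_closed[OF aZ[THEN conjunct2] pR_closed[OF A.one_closed b]])
  qed
  have QZ: "?Q \<subseteq> Idl\<^bsub>R\<^esub> (set zs)"
    unfolding tensor_image_def
  proof (rule submodule_gen_least[OF ZK], safe)
    fix a b assume a: "a \<in> carrier A" and b: "b \<in> Idl\<^bsub>B\<^esub> (set ys)"
    have bZ: "b \<in> carrier B \<and> pR \<one>\<^bsub>A\<^esub> b \<in> Idl\<^bsub>R\<^esub> (set zs)" using subsetD[OF JB b] by simp
    show "pR a b \<in> Idl\<^bsub>R\<^esub> (set zs)"
      by (subst mult(2)[OF a bZ[THEN conjunct1]]) (rule Z.I_l_closed[OF bZ[THEN conjunct2] pR_closed[OF a B.one_closed]])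
  qed
  have "set zs \<subseteq> ?P <+>\<^bsub>R\<^esub> ?Q"
  proof
    have P0: "\<zero>\<^bsub>R\<^esub> \<in> ?P" and Q0: "\<zero>\<^bsub>R\<^esub> \<in> ?Q"
      using submodule_zero[OF ideal_submodule[OF P]] submodule_zero[OF ideal_submodule[OF Q]] by auto
    fix z assume "z \<in> set zs"
    then consider x where "x \<in> set xs" "z = pR x \<one>\<^bsub>B\<^esub>" | y where "y \<in> set ys" "z = pR \<one>\<^bsub>A\<^esub> y" by (auto simp: zs_def)
    then show "z \<in> ?P <+>\<^bsub>R\<^esub> ?Q"
    proof cases
      case 1
      have z: "z \<in> ?P" unfolding 1(2) by (rule PG[OF subsetD[OF A.genideal_self[OF xs] 1(1)] B.one_closed])
      have "z \<oplus>\<^bsub>R\<^esub> \<zero>\<^bsub>R\<^esub> = z" by (rule R.r_zero[OF submodule_subset[OF ideal_submodule[OF P] z]])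
      then show ?thesis unfolding set_add_def' by (intro UN_I[OF z] UN_I[OF Q0]) simp
    next
      case 2
      have z: "z \<in> ?Q" unfolding 2(2) by (rule QG[OF A.one_closed subsetD[OF B.genideal_self[OF ys] 2(1)]])
      have "\<zero>\<^bsub>R\<^esub> \<oplus>\<^bsub>R\<^esub> z = z" by (rule R.l_zero[OF submodule_subset[OF ideal_submodule[OF Q] z]])
      then show ?thesis unfolding set_add_def' by (intro UN_I[OF P0] UN_I[OF z]) simp
    qed
  qed
  then have "Idl\<^bsub>R\<^esub> (set zs) \<subseteq> ?P <+>\<^bsub>R\<^esub> ?Q" by (rule R.genideal_minimal[OF R.add_ideals[OF P Q]])
  moreover have "?P <+>\<^bsub>R\<^esub> ?Q \<subseteq> Idl\<^bsub>R\<^esub> (set zs)"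
    unfolding set_add_def' by (intro UN_least) (use PZ QZ Z.a_closed in auto)
  ultimately show ?thesis by blast
qed

end

text \<open>Finite generation of Z / H does not depend on the ambient module. This matters because
  each degree of the total complex is a submodule of one big module.\<close>

lemma submodule_fg_mod_restrict:
  assumes M: "module R M" and S: "submodule S R M" and Z: "submodule Z R M" "Z \<subseteq> S" and H: "submodule H R M" "H \<subseteq> Z"
  shows "fg_mod R (M\<lparr>carrier := S\<rparr>) Z H \<longleftrightarrow> fg_mod R M Z H"
proof (rule fg_mod_hom_iff[OF submodule_module[OF M S] M _ submodule_of_submodule[OF M S Z] Z(1) H(1), where \<phi> = "\<lambda>x. x"])
  interpret M: module R M by (rule M)
  show "(\<lambda>x. x) \<in> module_hom R (M\<lparr>carrier := S\<rparr>) M" by (rule module_homI) (use submodule_subset[OF S] in simp_all)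
  show "H \<subseteq> carrier (M\<lparr>carrier := S\<rparr>)" using H Z by auto
  show "\<exists>z\<in>Z. z' \<ominus>\<^bsub>M\<^esub> z \<in> H" if "z' \<in> Z" for z'
    using M.diff_self[OF submodule_subset[OF Z(1) that]] submodule_zero[OF H(1)] that by (intro bexI[of _ z']) simp_all
qed simp_all

context torsion_complex
begin

notation pX (infixl "\<star>" 70)

abbreviation "zs \<equiv> leftR xs @ rightR ys"

lemma zs: "set zs \<subseteq> carrier R"
  using xs ys pR_closed by (auto simp: leftR_def rightR_def)

lemma tors_XT: "tors R Xm zs (XT n) = GX n"
  unfolding GX_def GE_def GF_def
  by (rule XP_tors[OF submodule_carrier[OF Ef] submodule_carrier[OF Ff] xs ys])

text \<open>The total complex consists of flabby modules, and the chosen resolution of injective,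
  hence flabby ones. So the comparison map induces an isomorphism on torsion cohomology, along which
  finite generation is transported.\<close>

lemma fg_total_iff_resolution:
  fixes Q :: "nat \<Rightarrow> (('a \<times> 'b \<Rightarrow> 'k) set, 'q) module"
  assumes N: "noetherian_ring R" and NA: "noetherian_ring A" and NB: "noetherian_ring B"
    and L: "module A L" and N': "module B N"
    and rE: "injective_resolution A L \<epsilon> Ef dE" and rF: "injective_resolution B N \<epsilon>' Ff dF"
    and rQ: "injective_resolution R (tensor_module K A B L N) \<epsilon>'' Q dQ"
  shows "fg_mod R Xm (ZX n) (BX n) \<longleftrightarrow>
    fg_mod R (Q n) {x \<in> tors R (Q n) zs (carrier (Q n)). dQ n x = \<zero>\<^bsub>Q (Suc n)\<^esub>} (bdry R Q dQ zs n)"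
proof -
  let ?T = "\<lambda>n. Xm\<lparr>carrier := XT n\<rparr>"
  have M: "module R (tensor_module K A B L N)"
    by (rule tensor_mod.modX[OF tensor_mod.intro[OF tensor_algebra_axioms tensor_mod_axioms.intro[OF L N']]])
  obtain \<eta> where rT: "resolution R (tensor_module K A B L N) \<eta> ?T (\<lambda>_. DX)"
    using total_resolution[OF L N' injective_imp_resolution[OF rE] injective_imp_resolution[OF rF]] by blast
  note rQ' = injective_imp_resolution[OF rQ]
  have bQ: "baer_module R (Q n)" for n using rQ by (simp add: injective_resolution_def injective_imp_baer)
  have bE: "baer_module A (Ef n)" for n using rE by (simp add: injective_resolution_def injective_imp_baer)
  have bF: "baer_module B (Ff n)" for n using rF by (simp add: injective_resolution_def injective_imp_baer)
  have mQ: "module R (Q n)" and dQ: "dQ n \<in> module_hom R (Q n) (Q (Suc n))"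
    and exQ: "dQ n ` carrier (Q n) = {x \<in> carrier (Q (Suc n)). dQ (Suc n) x = \<zero>\<^bsub>Q (Suc (Suc n))\<^esub>}" for n
    using rQ' by (simp_all add: resolution_def)
  have ddQ: "dQ (Suc n) (dQ n x) = \<zero>\<^bsub>Q (Suc (Suc n))\<^esub>" if "x \<in> carrier (Q n)" for n x using exQ[of n] that by blast
  have flT: "flabby R (?T n) zs (carrier (?T n))" for n
    using XP_flabby[OF submodule_carrier[OF Ef] submodule_carrier[OF Ff] xs ys
      baer_flabby[OF NA bE xs] baer_flabby[OF NB bF ys], of n] by simp
  have flQ: "flabby R (Q n) zs (carrier (Q n))" for n by (rule baer_flabby[OF N bQ zs])
  obtain \<phi> where \<phi>: "\<And>n. \<phi> n \<in> module_hom R (?T n) (Q n)"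
      "\<And>m. m \<in> carrier (tensor_module K A B L N) \<Longrightarrow> \<phi> 0 (\<eta> m) = \<epsilon>'' m"
      "\<And>n t. t \<in> carrier (?T n) \<Longrightarrow> \<phi> (Suc n) (DX t) = dQ n (\<phi> n t)"
    using comparison_map[OF M rT rQ' bQ] by blast
  note cmp = comparison_torsion[where T = ?T and D = "\<lambda>_. DX" and Q = Q and d = dQ and \<phi> = \<phi>,
      OF M rT rQ' zs flT flQ \<phi>(1) \<phi>(2) \<phi>(3)]
  have tT: "tors R (?T n) zs (carrier (?T n)) = GX n" for n using tors_XT by simp
  have bT: "bdry R ?T (\<lambda>_. DX) zs n = BX n" using tors_XT by (simp add: bdry_def BX_def split: nat.split)
  have mT: "module R (?T n)" for n by (rule submodule_module[OF modX XT_submodule])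
  have ZT: "ZX n \<subseteq> XT n" "BX n \<subseteq> XT n" using tors_XT[of n] tors_subset[of R Xm zs "XT n"] BX_ZX[of n] by (auto simp: ZX_def)
  note cQ = torsion_cycles[where C = Q and d = dQ and p = n, OF mQ dQ _ zs]
  let ?Z = "{x \<in> tors R (Q n) zs (carrier (Q n)). dQ n x = \<zero>\<^bsub>Q (Suc n)\<^esub>}"
  have Z': "submodule ?Z R (Q n)" and H': "submodule (bdry R Q dQ zs n) R (Q n)" using cQ ddQ by simp_all
  have Zin: "\<phi> n z \<in> ?Z" if z: "z \<in> ZX n" for z
  proof -
    have c: "z \<in> XT n" "DX z = \<zero>\<^bsub>T\<^esub>" "z \<in> GX n" using z ZT by (auto simp: ZX_def)
    have "\<phi> n z \<in> tors R (Q n) zs (carrier (Q n))" using tors_hom[OF mT mQ \<phi>(1) zs, of z n] c tors_XT by simp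
    moreover have "dQ n (\<phi> n z) = \<zero>\<^bsub>Q (Suc n)\<^esub>"
      using \<phi>(3)[of z n] c module_hom_zero[OF mT mQ \<phi>(1), of "Suc n"] by simp
    ultimately show ?thesis by simp
  qed
  have Bin: "\<phi> n z \<in> bdry R Q dQ zs n" if z: "z \<in> BX n" for z
  proof (cases n)
    case 0 then show ?thesis using z module_hom_zero[OF mT mQ \<phi>(1), of 0] by (simp add: BX_def bdry_def)
  next
    case (Suc m)
    then obtain s where s: "s \<in> GX m" "z = DX s" using z by (auto simp: BX_def)
    have sX: "s \<in> XT m" using s(1) tors_subset[of R Xm zs "XT m"] unfolding tors_XT by blast
    have "\<phi> m s \<in> tors R (Q m) zs (carrier (Q m))" using tors_hom[OF mT mQ \<phi>(1) zs, of s m] s(1) tors_XT by simp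
    moreover have "\<phi> n z = dQ m (\<phi> m s)" using \<phi>(3)[of s m] sX s(2) Suc by simp
    ultimately show ?thesis using Suc by (simp add: bdry_def)
  qed
  have "fg_mod R (?T n) (ZX n) (BX n) \<longleftrightarrow> fg_mod R (Q n) ?Z (bdry R Q dQ zs n)"
  proof (rule fg_mod_hom_iff[OF mT mQ \<phi>(1) submodule_of_submodule[OF modX XT_submodule ZX ZT(1)] Z' H' _ Zin _ Bin])
    show "BX n \<subseteq> carrier (?T n)" using ZT by simp
    show "\<exists>z\<in>ZX n. q \<ominus>\<^bsub>Q n\<^esub> \<phi> n z \<in> bdry R Q dQ zs n" if q: "q \<in> ?Z" for q
    proof -
      have "\<exists>t\<in>GX n. DX t = \<zero>\<^bsub>T\<^esub> \<and> q \<ominus>\<^bsub>Q n\<^esub> \<phi> n t \<in> bdry R Q dQ zs n"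
        using cmp(1)[of q n] q unfolding tT by simp
      then show ?thesis unfolding ZX_def by blast
    qed
    show "z \<in> BX n" if z: "z \<in> ZX n" "\<phi> n z \<in> bdry R Q dQ zs n" for z
      using cmp(2)[of z n] z unfolding tT bT ZX_def by simp
  qed
  then show ?thesis using submodule_fg_mod_restrict[OF modX XT_submodule ZX ZT(1) BX BX_ZX] by simp
qed

lemma fg_total_iff:
  assumes N: "noetherian_ring R"
  shows "fg_mod R Xm (ZX n) (BX n) \<longleftrightarrow> (\<forall>p q. p + q = n \<longrightarrow>
    (ZE p \<subseteq> BE p \<or> fg_mod B (Ff q) (ZF q) (BF q)) \<and> (fg_mod A (Ef p) (ZE p) (BE p) \<or> ZF q \<subseteq> BF q))"
proof (intro iffI allI impI conjI)
  fix p q assume fg: "fg_mod R Xm (ZX n) (BX n)" and n: "p + q = n"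
  show "ZE p \<subseteq> BE p \<or> fg_mod B (Ff q) (ZF q) (BF q)" using fg_total_imp_right[OF N _ _ n fg] by blast
  show "fg_mod A (Ef p) (ZE p) (BE p) \<or> ZF q \<subseteq> BF q" using fg_total_imp_left[OF N _ _ n fg] by blast
next
  assume *: "\<forall>p q. p + q = n \<longrightarrow> (ZE p \<subseteq> BE p \<or> fg_mod B (Ff q) (ZF q) (BF q)) \<and>
    (fg_mod A (Ef p) (ZE p) (BE p) \<or> ZF q \<subseteq> BF q)"
  show "fg_mod R Xm (ZX n) (BX n)"
  proof (rule fg_total)
    fix p q assume n: "p + q = n"
    \<comment> \<open>If neither cohomology vanishes, the two disjunctions force both to be finitely
      generated.\<close>
    show "ZE p \<subseteq> BE p \<or> ZF q \<subseteq> BF q \<or> fg_mod A (Ef p) (ZE p) (BE p) \<and> fg_mod B (Ff q) (ZF q) (BF q)"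
      using *[THEN spec, THEN spec, THEN mp, OF n] by argo
  qed
qed

end

section \<open>The formula\<close>

lemma Inf_enat_mem: "S \<noteq> {} \<Longrightarrow> Inf S \<in> (S :: enat set)"
  by (auto simp: Inf_enat_def intro: LeastI)

text \<open>Infima of nonempty sets of naturals are attained, so they add up; if one family is
  empty, both sides are infinite.\<close>

lemma Inf_enat_plus:
  fixes P Q :: "nat \<Rightarrow> bool"
  shows "Inf {enat (p + q) | p q. P p \<and> Q q} = Inf {enat p | p. P p} + Inf {enat q | q. Q q}"
proof (cases "(\<exists>p. P p) \<and> (\<exists>q. Q q)")
  case True
  have mem: "\<exists>p. Inf {enat p | p. P p} = enat p \<and> P p" if "\<exists>p. P p" for P :: "nat \<Rightarrow> bool"
    using Inf_enat_mem[of "{enat p | p. P p}"] that by blast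
  obtain p q where pq: "Inf {enat p | p. P p} = enat p" "P p" "Inf {enat q | q. Q q} = enat q" "Q q"
    using mem[of P] mem[of Q] True by blast
  show ?thesis
  proof (rule antisym)
    show "Inf {enat (p + q) | p q. P p \<and> Q q} \<le> Inf {enat p | p. P p} + Inf {enat q | q. Q q}"
      unfolding pq plus_enat_simps by (rule Inf_lower) (use pq in blast)
    show "Inf {enat p | p. P p} + Inf {enat q | q. Q q} \<le> Inf {enat (p + q) | p q. P p \<and> Q q}"
    proof (rule Inf_greatest)
      fix x assume "x \<in> {enat (p + q) | p q. P p \<and> Q q}"
      then obtain i j where ij: "x = enat i + enat j" "P i" "Q j" by auto
      show "Inf {enat p | p. P p} + Inf {enat q | q. Q q} \<le> x"
        unfolding ij(1) by (intro add_mono Inf_lower) (use ij in auto)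
    qed
  qed
next
  case False
  then consider "\<And>p. \<not> P p" | "\<And>q. \<not> Q q" by blast
  then show ?thesis by cases (simp_all add: top_enat_def)
qed

theorem theorem3p2:
  fixes K :: "'k ring"
    and A :: "('k, 'a) module" and B :: "('k, 'b) module"
    and L :: "('a, 'l) module" and N :: "('b, 'n) module"
    and I :: "'a set" and J :: "'b set"
  assumes "field K"
    and "algebra K A" and "noetherian_ring A" and "local_ring A"
    and "algebra K B" and "noetherian_ring B" and "local_ring B"
    and "noetherian_ring (tensor_product K A B)"
    and "ideal I A" and "ideal J B"
    and "module A L" and "fg_module A L" and "nonzero_module L"
    and "module B N" and "fg_module B N" and "nonzero_module N"
  shows "finiteness_dim (tensor_product K A B)
           (tensor_image K A B I (carrier B) <+>\<^bsub>tensor_product K A B\<^esub> tensor_image K A B (carrier A) J)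
           (tensor_module K A B L N)
         = min (grade A I L + finiteness_dim B J N) (finiteness_dim A I L + grade B J N)"
proof -
  note K = assms(1) and A = assms(2) and NA = assms(3) and B = assms(5) and NB = assms(6) and NR = assms(8)
    and I = assms(9) and J = assms(10) and L = assms(11) and N = assms(14)
  \<comment> \<open>Noetherianity replaces both ideals by finite lists of generators, in terms of
    which torsion and flabbiness are formulated.\<close>
  obtain S where "S \<subseteq> carrier A" "finite S" "I = Idl\<^bsub>A\<^esub> S" using noetherian_ring.finetely_gen[OF NA I] by blast
  then obtain xs where xs: "set xs \<subseteq> carrier A" and Ixs: "I = Idl\<^bsub>A\<^esub> (set xs)" using finite_list by metis
  obtain S' where "S' \<subseteq> carrier B" "finite S'" "J = Idl\<^bsub>B\<^esub> S'" using noetherian_ring.finetely_gen[OF NB J] by blast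
  then obtain ys where ys: "set ys \<subseteq> carrier B" and Jys: "J = Idl\<^bsub>B\<^esub> (set ys)" using finite_list by metis
  let ?R = "tensor_product K A B"
  have TA: "tensor_algebra K A B" by (rule tensor_algebra.intro[OF A B])
  have TM: "tensor_mod K A B L N" by (rule tensor_mod.intro[OF TA tensor_mod_axioms.intro[OF L N]])
  obtain \<epsilon> E d where E: "chosen_injective_resolution A L = (E, d)" "injective_resolution A L \<epsilon> E d"
    by (rule chosen_injective_resolution[OF K A L])
  obtain \<epsilon>' F d' where F: "chosen_injective_resolution B N = (F, d')" "injective_resolution B N \<epsilon>' F d'"
    by (rule chosen_injective_resolution[OF K B N])
  \<comment> \<open>The tensor product is a K-algebra too, so the same existence result covers L
    \<otimes> N; nothing relates Q to E and F yet.\<close>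
  obtain \<epsilon>'' Q dQ where Q: "chosen_injective_resolution ?R (tensor_module K A B L N) = (Q, dQ)"
      "injective_resolution ?R (tensor_module K A B L N) \<epsilon>'' Q dQ"
    by (rule chosen_injective_resolution[OF K tensor_algebra.R_alg[OF TA] tensor_mod.modX[OF TM]])
  have rE: "resolution A L \<epsilon> E d" and rF: "resolution B N \<epsilon>' F d'"
    using injective_imp_resolution[OF E(2)] injective_imp_resolution[OF F(2)] .
  have mE: "module A (E p)" and dE: "d p \<in> module_hom A (E p) (E (Suc p))" for p
    using rE by (simp_all add: resolution_def)
  have mF: "module B (F p)" and dF: "d' p \<in> module_hom B (F p) (F (Suc p))" for p
    using rF by (simp_all add: resolution_def)
  have dd: "d (Suc p) (d p x) = \<zero>\<^bsub>E (Suc (Suc p))\<^esub>" if "x \<in> carrier (E p)" for p x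
    using rE that unfolding resolution_def by blast
  have dd': "d' (Suc p) (d' p x) = \<zero>\<^bsub>F (Suc (Suc p))\<^esub>" if "x \<in> carrier (F p)" for p x
    using rF that unfolding resolution_def by blast
  interpret torsion_complex K A B E F d d' xs ys
    by (intro torsion_complex.intro dcomplex.intro dtensor.intro dcomplex_axioms.intro torsion_complex_axioms.intro)
      (rule K A B mE mF dE dF xs ys | erule dd dd')+
  have IJ: "tensor_image K A B I (carrier B) <+>\<^bsub>?R\<^esub> tensor_image K A B (carrier A) J = Idl\<^bsub>?R\<^esub> (set zs)"
    using tensor_ideal_eq[OF xs ys] by (simp add: Ixs Jys leftR_def rightR_def)
  let ?nA = "\<lambda>p. nonzero_module (local_cohomology A I L p)" and ?fA = "\<lambda>p. fg_module A (local_cohomology A I L p)"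
  let ?nB = "\<lambda>q. nonzero_module (local_cohomology B J N q)" and ?fB = "\<lambda>q. fg_module B (local_cohomology B J N q)"
  have HA: "?nA p \<longleftrightarrow> \<not> ZE p \<subseteq> BE p" "?fA p \<longleftrightarrow> fg_mod A (E p) (ZE p) (BE p)" for p
    using local_cohomology_iff[OF xs E, of p] by (simp_all add: Ixs ZE_def GE_def)
  have HB: "?nB q \<longleftrightarrow> \<not> ZF q \<subseteq> BF q" "?fB q \<longleftrightarrow> fg_mod B (F q) (ZF q) (BF q)" for q
    using local_cohomology_iff[OF ys F, of q] by (simp_all add: Jys ZF_def GF_def)
  have "fg_module ?R (local_cohomology ?R (Idl\<^bsub>?R\<^esub> (set zs)) (tensor_module K A B L N) n) \<longleftrightarrow>
      (\<forall>p q. p + q = n \<longrightarrow> (\<not> ?nA p \<or> ?fB q) \<and> (?fA p \<or> \<not> ?nB q))" for n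
    unfolding local_cohomology_iff(2)[OF zs Q] fg_total_iff_resolution[OF NR NA NB L N E(2) F(2) Q(2), symmetric]
      fg_total_iff[OF NR] HA HB by simp
  \<comment> \<open>The degrees of failure form a union of two sets of sums; the infimum of a union
    is a minimum, and each set of sums splits by \<open>Inf_enat_plus\<close>.\<close>
  then have "{enat n | n. \<not> fg_module ?R (local_cohomology ?R (Idl\<^bsub>?R\<^esub> (set zs)) (tensor_module K A B L N) n)}
      = {enat (p + q) | p q. ?nA p \<and> \<not> ?fB q} \<union> {enat (p + q) | p q. \<not> ?fA p \<and> ?nB q}" by auto
  then show ?thesis
    unfolding finiteness_dim_def grade_def IJ by (simp only: Inf_union_distrib Inf_enat_plus inf_min)
qed

end
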